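(* Let $\frac32<\nu<2$ and $m>2\nu+\frac12$. Let $r_0,K_0$ be the constants fixed in the context (for $\mu=1$ and this $m$). Then there exists $K_5>0$ such that, for every $\mathbf w_0\in\mathbb L^2(m)$ with $\|\mathbf w_0\|_m\le r_0$, there exist real constants $b_i$, $c_i$ ($i=1,2,3$) and $d_{ij}$ ($(ij)\in S$) such that the solution $\mathbf w\in C^0([0,\infty),\mathbb L^2(m))$ of the rescaled vorticity equation with $\mathbf w(0)=\mathbf w_0$ satisfies $$\|\mathbf w(\tau)-\mathbf w_{app}(\tau)\|_m\le K_5\,e^{-\nu\tau}\|\mathbf w_0\|_m\qquad\text{for all }\tau\ge 0,$$ where $$\mathbf w_{app}(\xi,\tau)=\sum_{i=1}^3 b_ie^{-\tau}\mathbf f_i(\xi)+\sum_{i=1}^3c_ie^{-\frac32\tau}\mathbf g_i(\xi)+\sum_{(ij)\in S}d_{ij}e^{-\frac32\tau}\mathbf h_{ij}(\xi).$$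
   Context: Notation: $\rho(\xi)=1+|\xi|$ on $\mathbb R^3$; $|\cdot|_p$ is the norm of $L^p(\mathbb R^3)$ (for a vector field, the $L^p$ norm of its Euclidean length). For $m\ge 0$, $\|f\|_m=|\rho^m f|_2$, $L^2(m)=\{f\in L^2(\mathbb R^3): \|f\|_m<\infty\}$, and $\mathbb L^2(m)=\{\mathbf f\in L^2(m)^3:\operatorname{div}\mathbf f=0\}$ (distributional divergence), with norm $\|\mathbf f\|_m=|\rho^m|\mathbf f||_2$. Biot-Savart law: the velocity field $\mathbf v$ obtained from $\mathbf w$ is $\mathbf v(\xi)=-\frac1{4\pi}\int_{\mathbb R^3}\frac{(\xi-\eta)\wedge\mathbf w(\eta)}{|\xi-\eta|^3}\,d\eta$ ($\wedge$ is the cross product). Rescaled vorticity equation: $\partial_\tau\mathbf w=\Lambda\mathbf w-(\mathbf v\cdot\nabla)\mathbf w+(\mathbf w\cdot\nabla)\mathbf v$, $\operatorname{div}\mathbf w=0$, with $\Lambda=\Delta_\xi+\frac12\xi\cdot\nabla_\xi+1$. A solution in $\mathbb L^2(m)$ means a mild solution: a continuous function of $\tau$ with values in $\mathbb L^2(m)$ such that, for $i=1,2,3$, $$w_i(\tau)=e^{\tau\Lambda}w_i(0)+\sum_{j=1}^3\int_0^\tau \partial_j e^{(\tau-s)(\Lambda-\frac12)}\bigl(w_j(s)v_i(s)-v_j(s)w_i(s)\bigr)ds,$$ where $(e^{\tau\Lambda}f)(\xi)=\frac{e^{\tau}}{(4\pi(1-e^{-\tau}))^{3/2}}\int_{\mathbb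 R^3}e^{-\frac{|\xi-\eta|^2}{4(1-e^{-\tau})}}f(\eta e^{\tau/2})\,d\eta$ for $\tau>0$ and $e^{\tau(\Lambda-\frac12)}=e^{-\tau/2}e^{\tau\Lambda}$. Constants: for $m>\frac52$, fix $r_0>0$ and $K_0\ge1$ such that for every $\mathbf w_0\in\mathbb L^2(m)$ with $\|\mathbf w_0\|_m\le r_0$ there is a unique global solution $\mathbf w\in C^0([0,\infty),\mathbb L^2(m))$ with $\mathbf w(0)=\mathbf w_0$, and it satisfies $\|\mathbf w(\tau)\|_m\le K_0e^{-\tau}\|\mathbf w_0\|_m$ for all $\tau\ge0$ (such constants exist; this is the global existence theorem with decay exponent $\mu=1$). With $\mathbf e_1,\mathbf e_2,\mathbf e_3$ the canonical basis of $\mathbb R^3$: $G(\xi)=(4\pi)^{-3/2}e^{-|\xi|^2/4}$, $\mathbf p_i(\xi)=\frac12\,\mathbf e_i\wedge\xi$, $\mathbf f_i=\operatorname{rot}(G\mathbf e_i)=\mathbf p_iG$, $\mathbf g_i=\operatorname{rot}\mathbf f_i=\frac G4\bigl((4-|\xi|^2)\mathbf e_i+\xi_i\xi\bigr)$ for $i=1,2,3$; $S=\{(11),(12),(13),(22),(23)\}$ and $\mathbf h_{ij}=\partial_i\mathbf f_j+\partial_j\mathbf f_i$ for $(ij)\in S$. *)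

theory Defs
  imports "HOL-Analysis.Analysis"
begin

text \<open>
  Elements of the function spaces are represented by Borel functions on \<open>real^3\<close>; equality of
  two elements is equality almost everywhere with respect to \<open>lborel\<close>.
\<close>

definition pderiv3 :: "3 \<Rightarrow> (real^3 \<Rightarrow> 'b::real_normed_vector) \<Rightarrow> real^3 \<Rightarrow> 'b"
  where "pderiv3 j f \<xi> = vector_derivative (\<lambda>t. f (\<xi> + t *\<^sub>R axis j 1)) (at 0)"

definition grad :: "(real^3 \<Rightarrow> real) \<Rightarrow> real^3 \<Rightarrow> real^3"
  where "grad f \<xi> = (\<chi> j. pderiv3 j f \<xi>)"

definition rot :: "(real^3 \<Rightarrow> real^3) \<Rightarrow> real^3 \<Rightarrow> real^3"
  where "rot f \<xi> = vector
    [pderiv3 2 (\<lambda>x. f x $ 3) \<xi> - pderiv3 3 (\<lambda>x. f x $ 2) \<xi>,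
     pderiv3 3 (\<lambda>x. f x $ 1) \<xi> - pderiv3 1 (\<lambda>x. f x $ 3) \<xi>,
     pderiv3 1 (\<lambda>x. f x $ 2) \<xi> - pderiv3 2 (\<lambda>x. f x $ 1) \<xi>]"

primrec C_times :: "nat \<Rightarrow> (real^3 \<Rightarrow> real) \<Rightarrow> bool"
  where
    "C_times 0 f \<longleftrightarrow> continuous_on UNIV f"
  | "C_times (Suc k) f \<longleftrightarrow> f differentiable_on UNIV \<and> (\<forall>j. C_times k (pderiv3 j f))"

definition test_function :: "(real^3 \<Rightarrow> real) \<Rightarrow> bool"
  where "test_function \<phi> \<longleftrightarrow> (\<forall>k. C_times k \<phi>) \<and> compact (closure {\<xi>. \<phi> \<xi> \<noteq> 0})"

definition div_free :: "(real^3 \<Rightarrow> real^3) \<Rightarrow> bool"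
  where "div_free f \<longleftrightarrow> (\<forall>\<phi>. test_function \<phi> \<longrightarrow> (LINT \<xi>|lborel. f \<xi> \<bullet> grad \<phi> \<xi>) = 0)"

definition \<rho> :: "real^3 \<Rightarrow> real"
  where "\<rho> \<xi> = 1 + norm \<xi>"

definition L2_space :: "(real^3 \<Rightarrow> 'b::euclidean_space) set"
  where "L2_space = {f. f \<in> borel_measurable lborel \<and> integrable lborel (\<lambda>\<xi>. (norm (f \<xi>))\<^sup>2)}"

definition norm2 :: "(real^3 \<Rightarrow> 'b::euclidean_space) \<Rightarrow> real"
  where "norm2 f = sqrt (LINT \<xi>|lborel. (norm (f \<xi>))\<^sup>2)"

definition wnorm :: "real \<Rightarrow> (real^3 \<Rightarrow> 'b::euclidean_space) \<Rightarrow> real"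
  where "wnorm m f = norm2 (\<lambda>\<xi>. \<rho> \<xi> powr m *\<^sub>R f \<xi>)"

text \<open>As \<open>\<rho> \<ge> 1\<close>, for \<open>m \<ge> 0\<close> the condition \<open>f \<in> L2_space\<close> only contributes measurability.\<close>

definition L2w :: "real \<Rightarrow> (real^3 \<Rightarrow> 'b::euclidean_space) set"
  where "L2w m = {f \<in> L2_space. (\<lambda>\<xi>. \<rho> \<xi> powr m *\<^sub>R f \<xi>) \<in> L2_space}"

definition L2w_sol :: "real \<Rightarrow> (real^3 \<Rightarrow> real^3) set"
  where "L2w_sol m = {f \<in> L2w m. div_free f}"

definition biot_savart :: "(real^3 \<Rightarrow> real^3) \<Rightarrow> real^3 \<Rightarrow> real^3"
  where "biot_savart w \<xi> =
    - (1 / (4 * pi)) *\<^sub>R (LINT \<eta>|lborel. (1 / norm (\<xi> - \<eta>) ^ 3) *\<^sub>R cross3 (\<xi> - \<eta>) (w \<eta>))"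

text \<open>
  The semigroup generated by \<open>\<Lambda>\<close> and the one generated by \<open>\<Lambda> - 1/2\<close>, used for \<open>\<tau> \<ge> 0\<close> only;
  at \<open>\<tau> = 0\<close>, where the kernel formula makes no sense, they are the identity.
\<close>

definition exp_Lambda :: "real \<Rightarrow> (real^3 \<Rightarrow> real) \<Rightarrow> real^3 \<Rightarrow> real"
  where "exp_Lambda \<tau> f \<xi> =
    (if \<tau> = 0 then f \<xi>
     else exp \<tau> / (4 * pi * (1 - exp (- \<tau>))) powr (3/2) *
       (LINT \<eta>|lborel. exp (- (norm (\<xi> - \<eta>))\<^sup>2 / (4 * (1 - exp (- \<tau>)))) * f (exp (\<tau>/2) *\<^sub>R \<eta>)))"

definition exp_Lambda_half :: "real \<Rightarrow> (real^3 \<Rightarrow> real) \<Rightarrow> real^3 \<Rightarrow> real"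
  where "exp_Lambda_half \<tau> f \<xi> = exp (- \<tau>/2) * exp_Lambda \<tau> f \<xi>"

definition duhamel :: "(real \<Rightarrow> real^3 \<Rightarrow> real^3) \<Rightarrow> 3 \<Rightarrow> 3 \<Rightarrow> real \<Rightarrow> real^3 \<Rightarrow> real \<Rightarrow> real"
  where "duhamel w i j \<tau> \<xi> s =
    pderiv3 j (exp_Lambda_half (\<tau> - s)
      (\<lambda>\<eta>. w s \<eta> $ j * biot_savart (w s) \<eta> $ i - biot_savart (w s) \<eta> $ j * w s \<eta> $ i)) \<xi>"

text \<open>
  The values of \<open>w\<close> at negative times are irrelevant.  The time integral is taken pointwise in
  \<open>\<xi>\<close>; its absolute convergence for almost every \<open>\<xi>\<close> is demanded explicitly, since a
  divergent integral would be \<open>0\<close> by convention.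
\<close>

definition mild_solution :: "real \<Rightarrow> (real \<Rightarrow> real^3 \<Rightarrow> real^3) \<Rightarrow> bool"
  where "mild_solution m w \<longleftrightarrow>
    (\<forall>\<tau>\<ge>0. w \<tau> \<in> L2w_sol m) \<and>
    (\<forall>\<tau>\<ge>0. ((\<lambda>\<sigma>. wnorm m (\<lambda>\<xi>. w \<sigma> \<xi> - w \<tau> \<xi>)) \<longlongrightarrow> 0) (at \<tau> within {0..})) \<and>
    (\<forall>\<tau>\<ge>0. \<forall>i. AE \<xi> in lborel.
       (\<forall>j. set_integrable lborel {0..\<tau>} (duhamel w i j \<tau> \<xi>)) \<and>
       w \<tau> \<xi> $ i = exp_Lambda \<tau> (\<lambda>\<eta>. w 0 \<eta> $ i) \<xi> +
         (\<Sum>j\<in>UNIV. LBINT s:{0..\<tau>}. duhamel w i j \<tau> \<xi> s))"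

definition solution_from :: "real \<Rightarrow> (real^3 \<Rightarrow> real^3) \<Rightarrow> (real \<Rightarrow> real^3 \<Rightarrow> real^3) \<Rightarrow> bool"
  where "solution_from m w0 w \<longleftrightarrow> mild_solution m w \<and> (AE \<xi> in lborel. w 0 \<xi> = w0 \<xi>)"

text \<open>
  The property by which \<open>r0\<close> and \<open>K0\<close> are chosen in the global existence theorem with decay
  exponent 1.
\<close>

definition global_constants :: "real \<Rightarrow> real \<Rightarrow> real \<Rightarrow> bool"
  where "global_constants m r0 K0 \<longleftrightarrow> r0 > 0 \<and> K0 \<ge> 1 \<and>
    (\<forall>w0 \<in> L2w_sol m. wnorm m w0 \<le> r0 \<longrightarrow>
       (\<exists>w. solution_from m w0 w \<and>
          (\<forall>w'. solution_from m w0 w' \<longrightarrow> (\<forall>\<tau>\<ge>0. AE \<xi> in lborel. w' \<tau> \<xi> = w \<tau> \<xi>)) \<and>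
          (\<forall>\<tau>\<ge>0. wnorm m (w \<tau>) \<le> K0 * exp (- \<tau>) * wnorm m w0)))"

definition G :: "real^3 \<Rightarrow> real"
  where "G \<xi> = (4 * pi) powr (- (3/2)) * exp (- (norm \<xi>)\<^sup>2 / 4)"

definition pfield :: "3 \<Rightarrow> real^3 \<Rightarrow> real^3"
  where "pfield i \<xi> = (1/2) *\<^sub>R cross3 (axis i 1) \<xi>"

definition ffield :: "3 \<Rightarrow> real^3 \<Rightarrow> real^3"
  where "ffield i = rot (\<lambda>\<xi>. G \<xi> *\<^sub>R axis i 1)"

definition gfield :: "3 \<Rightarrow> real^3 \<Rightarrow> real^3"
  where "gfield i = rot (ffield i)"

definition hfield :: "3 \<Rightarrow> 3 \<Rightarrow> real^3 \<Rightarrow> real^3"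
  where "hfield i j \<xi> = pderiv3 i (ffield j) \<xi> + pderiv3 j (ffield i) \<xi>"

definition S :: "(3 \<times> 3) set"
  where "S = {(1,1), (1,2), (1,3), (2,2), (2,3)}"

definition w_app ::
    "(3 \<Rightarrow> real) \<Rightarrow> (3 \<Rightarrow> real) \<Rightarrow> (3 \<Rightarrow> 3 \<Rightarrow> real) \<Rightarrow> real \<Rightarrow> real^3 \<Rightarrow> real^3"
  where "w_app b c d \<tau> \<xi> =
    (\<Sum>i\<in>UNIV. (b i * exp (- \<tau>)) *\<^sub>R ffield i \<xi>) +
    (\<Sum>i\<in>UNIV. (c i * exp (- (3/2) * \<tau>)) *\<^sub>R gfield i \<xi>) +
    (\<Sum>(i, j)\<in>S. (d i j * exp (- (3/2) * \<tau>)) *\<^sub>R hfield i j \<xi>)"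

lemma pderiv3_eqI:
  assumes "((\<lambda>t. f (\<xi> + t *\<^sub>R axis j 1)) has_vector_derivative D) (at 0)"
  shows "pderiv3 j f \<xi> = D"
  unfolding pderiv3_def using assms by (rule vector_derivative_at)

lemma has_deriv_G_line:
  "((\<lambda>t. G (\<xi> + t *\<^sub>R axis j 1)) has_real_derivative - (\<xi> $ j / 2) * G \<xi>) (at 0)"
proof -
  have n: "(norm (\<xi> + t *\<^sub>R axis j 1))\<^sup>2 = (norm \<xi>)\<^sup>2 + 2 * t * \<xi> $ j + t\<^sup>2" for t :: real
    unfolding power2_norm_eq_inner
    by (simp add: inner_add_left inner_add_right inner_axis inner_axis' power2_eq_square algebra_simps)
  show ?thesis
    unfolding G_def n by (auto intro!: derivative_eq_intros simp: field_simps)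
qed

lemma pderiv3_G_times:
  assumes "((\<lambda>t. q (\<xi> + t *\<^sub>R axis j 1)) has_real_derivative D) (at 0)"
  shows "pderiv3 j (\<lambda>x. q x * G x) \<xi> = (D - \<xi> $ j / 2 * q \<xi>) * G \<xi>"
proof (rule pderiv3_eqI)
  show "((\<lambda>t. q (\<xi> + t *\<^sub>R axis j 1) * G (\<xi> + t *\<^sub>R axis j 1)) has_vector_derivative
      (D - \<xi> $ j / 2 * q \<xi>) * G \<xi>) (at 0)"
    using DERIV_mult[OF assms has_deriv_G_line]
    unfolding has_real_derivative_iff_has_vector_derivative[symmetric]
    by (simp add: algebra_simps)
qed

lemma ffield_eq: "ffield i \<xi> = G \<xi> *\<^sub>R pfield i \<xi>"
proof -
  have *: "pderiv3 j (\<lambda>x. G x * c) \<xi> = - (\<xi> $ j / 2) * c * G \<xi>" for j and c :: real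
    using pderiv3_G_times[where q="\<lambda>_. c" and D=0 and j=j and \<xi>=\<xi>] by (simp add: mult.commute)
  show ?thesis
    using exhaust_3[of i]
    by (auto simp: ffield_def rot_def pfield_def cross3_def vec_eq_iff forall_3 * axis_def)
qed

lemma gfield_eq:
  "gfield i \<xi> = (G \<xi> / 4) *\<^sub>R ((4 - (norm \<xi>)\<^sup>2) *\<^sub>R axis i 1 + \<xi> $ i *\<^sub>R \<xi>)"
proof -
  have *: "pderiv3 j (\<lambda>x. G x * (x $ k * c)) \<xi> =
      ((if j = k then c else 0) - \<xi> $ j / 2 * (\<xi> $ k * c)) * G \<xi>" for j k and c :: real
  proof -
    have "((\<lambda>t. (\<xi> + t *\<^sub>R axis j 1) $ k * c) has_real_derivative (if j = k then c else 0)) (at 0)"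
      by (auto intro!: derivative_eq_intros simp: axis_def)
    from pderiv3_G_times[where q="\<lambda>x. x $ k * c", OF this] show ?thesis
      by (simp add: mult.commute)
  qed
  have n: "(norm \<xi>)\<^sup>2 = (\<xi> $ 1)\<^sup>2 + (\<xi> $ 2)\<^sup>2 + (\<xi> $ 3)\<^sup>2"
    unfolding power2_norm_eq_inner by (simp add: inner_vec_def sum_3 power2_eq_square)
  have f: "ffield i = (\<lambda>x. G x *\<^sub>R pfield i x)"
    by (rule ext) (rule ffield_eq)
  have z: "pderiv3 j (\<lambda>x. 0) \<xi> = (0::real)" for j
    by (rule pderiv3_eqI) auto
  have 1: "pderiv3 j (\<lambda>x. G x * x $ k / 2) \<xi> =
      ((if j = k then 1 else 0) - \<xi> $ j / 2 * \<xi> $ k) / 2 * G \<xi>" for j k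
    using *[of j k "1/2"] by (simp add: field_simps)
  have 2: "pderiv3 j (\<lambda>x. - (G x * x $ k / 2)) \<xi> =
      - (((if j = k then 1 else 0) - \<xi> $ j / 2 * \<xi> $ k) / 2 * G \<xi>)" for j k
    using *[of j k "-1/2"] by (simp add: field_simps)
  show ?thesis
    using exhaust_3[of i]
    by (auto simp: gfield_def f rot_def pfield_def cross3_def vec_eq_iff forall_3 axis_def n z 1 2)
      (auto simp: power2_eq_square field_simps)
qed

end

theory Submission
  imports Defs
begin

text \<open>
  In the rescaled variables the semigroup generated by \<open>\<Lambda>\<close> is an explicit Gaussian convolution: with \<open>\<epsilon> = exp (- \<tau> / 2)\<close> and
  \<open>a = 1 - \<epsilon>\<^sup>2\<close>, its value at \<open>\<xi>\<close> is \<open>\<epsilon>\<close> times the integral of \<open>heat a (\<xi> - \<epsilon> \<eta>) * f \<eta>\<close> over \<open>\<eta>\<close>.  The kernel depends on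
  \<open>\<eta>\<close> only through \<open>\<epsilon> \<eta>\<close>, so a Taylor expansion in \<open>\<epsilon> \<eta>\<close> is an expansion in powers of \<open>exp (- \<tau> / 2)\<close> whose coefficients
  are moments of \<open>f\<close> and whose profiles are derivatives of \<open>G\<close>.  The whole theorem is this expansion, made twice and with
  remainders controlled in the weighted norm.

  \<^emph>\<open>Linear part.\<close>  The initial vorticity is divergence free, so it is orthogonal to gradients of polynomials.  This
  kills its mass, the symmetric part of its first moments and the totally symmetric part of its second moments
  (\<open>div_free_moments\<close>).  The orders one and two of the expansion therefore carry \<open>exp (- \<tau>)\<close> and
  \<open>exp (- (3/2) * \<tau>)\<close>.  The remainder would be of order three, but the weight only allows moments of order less than
  \<open>m - 3/2\<close>; interpolating the remainder to the power \<open>(\<epsilon> \<rho> \<eta>) powr (2 * \<nu> - 1)\<close> needs exactly \<open>m > 2 * \<nu> + 1/2\<close> and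
  leaves \<open>\<epsilon> powr (2 * \<nu>) = exp (- \<nu> * \<tau>)\<close>.  Where \<open>\<epsilon> \<eta>\<close> is not small, Taylor expansion is useless, but the
  weight can be moved from \<open>\<xi>\<close> to \<open>\<epsilon> \<eta>\<close>, which gains \<open>\<epsilon> powr m\<close> (\<open>heat_expansion_weighted\<close>, \<open>linear_rem_bound\<close>).

  \<^emph>\<open>Nonlinear part.\<close>  The mild formulation has the nonlinearity \<open>F = w\<^sub>j v\<^sub>i - v\<^sub>j w\<^sub>i\<close> under a derivative of the
  semigroup, which is one more power of \<open>\<epsilon>\<close>; one order of expansion less is enough.  The quadratic \<open>F\<close> decays like
  \<open>exp (- 2 * s)\<close>, so its mass and first moments, multiplied by \<open>exp s\<close> and \<open>exp (3/2 * s)\<close>, are integrable over all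
  times: the full integrals are the coefficients and the tails are \<open>O (exp (- 2 * \<tau>))\<close> (\<open>coeff_tails\<close>).  The
  remainder is a time integral of \<open>exp (- \<nu> * (\<tau> - s)) * exp (- 2 * s)\<close> with the singularity of the
  differentiated kernel at \<open>s = \<tau>\<close>, and \<open>\<nu> < 2\<close> makes it \<open>O (exp (- \<nu> * \<tau>))\<close>.  The bilinear estimate
  \<open>gaussian_bilinear_bound\<close>, which uses only the Cauchy-Schwarz inequality and Fubini's theorem, keeps the singularity at
  \<open>(\<tau> - s) powr (- 7/8)\<close>, hence integrable.

  \<^emph>\<open>Identification of the profiles.\<close>  \<open>F\<close> is antisymmetric in \<open>i\<close> and \<open>j\<close>, so the nonlinear coefficients satisfy the
  same linear relations as the moments of a divergence-free field.  Fields with such coefficients are exactly the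
  combinations of the \<open>f\<^sub>i\<close>, \<open>g\<^sub>i\<close> and \<open>h\<^sub>i\<^sub>j\<close> (\<open>w_app_coefficients_exist\<close>).
\<close>

section \<open>Power singularities and power decay in Euclidean space\<close>

lemma ennreal_le_suminf: "f n \<le> (\<Sum>n. f n :: ennreal)"
  using sum_le_suminf[of f "{n}"] by simp

lemma nn_integral_suminf_cmult_indicator:
  assumes [measurable]: "\<And>n. A n \<in> sets M"
  shows "(\<integral>\<^sup>+x. (\<Sum>n. c n * indicator (A n) x) \<partial>M) = (\<Sum>n. c n * emeasure M (A n))"
  by (simp only: nn_integral_suminf borel_measurable_times_ennreal borel_measurable_const borel_measurable_indicator assms nn_integral_cmult_indicator)

lemma nat_floor_bounds: "real (nat \<lfloor>L\<rfloor>) \<le> L \<and> L < real (nat \<lfloor>L\<rfloor>) + 1" if "0 \<le> L" for L :: real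
  using that by linarith

lemma log_2_one_plus_norm: "log 2 (1 + norm x) \<ge> 0"
  using add_increasing2[of "norm x" 1 1] by (subst zero_le_log_cancel_iff) (simp_all add: add_pos_nonneg)

text \<open>On the shell where \<open>1 + norm x\<close> lies between \<open>2 ^ n\<close> and \<open>2 ^ Suc n\<close> the integrand is at most \<open>2 powr (- q * n)\<close>, and the
  shell sits in a ball of volume proportional to \<open>2 ^ (n * d)\<close>; the resulting geometric series converges for \<open>q > d\<close>.\<close>
lemma nn_integral_inverse_power_decay_finite:
  fixes q :: real
  assumes q: "q > DIM('a::euclidean_space)"
  shows "(\<integral>\<^sup>+x. ennreal ((1 + norm (x::'a)) powr (-q)) \<partial>lborel) < \<infinity>"
proof -
  let ?d = "DIM('a)"
  let ?V = "unit_ball_vol (real ?d)"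
  let ?r = "2 powr (?d - q)"
  have pt: "ennreal ((1 + norm x) powr (-q))
     \<le> (\<Sum>n. ennreal (2 powr (- q * n)) * indicator (ball 0 (2 ^ Suc n)) x)" for x :: 'a
  proof -
    define n where "n = nat \<lfloor>log 2 (1 + norm x)\<rfloor>"
    have l0: "log 2 (1 + norm x) \<ge> 0" by (rule log_2_one_plus_norm)
    have n1: "real n \<le> log 2 (1 + norm x)" "log 2 (1 + norm x) < real n + 1"
      using nat_floor_bounds[OF l0] by (simp_all add: n_def)
    have "2 powr real n \<le> 1 + norm x"
      using n1(1) by (subst (asm) le_log_iff) (auto simp: add_pos_nonneg)
    then have a: "(1 + norm x) powr (-q) \<le> (2 powr real n) powr (-q)"
      using q by (intro powr_mono2') (auto)
    have "1 + norm x < 2 powr (real n + 1)"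
      using n1(2) by (subst (asm) log_less_iff) (auto simp: add_pos_nonneg)
    then have b: "x \<in> ball 0 (2 ^ Suc n)"
      by (simp add: powr_add powr_realpow)
    have "ennreal ((1 + norm x) powr (-q)) \<le> ennreal (2 powr (- q * n)) * indicator (ball 0 (2 ^ Suc n)) x"
      using a b by (simp add: powr_powr mult.commute)
    also have "\<dots> \<le> (\<Sum>n. ennreal (2 powr (- q * n)) * indicator (ball 0 (2 ^ Suc n)) x)"
      by (rule ennreal_le_suminf)
    finally show ?thesis .
  qed
  have "(\<integral>\<^sup>+x. ennreal ((1 + norm (x::'a)) powr (-q)) \<partial>lborel)
    \<le> (\<integral>\<^sup>+x. (\<Sum>n. ennreal (2 powr (- q * n)) * indicator (ball 0 (2 ^ Suc n)) (x::'a)) \<partial>lborel)"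
    by (intro nn_integral_mono pt)
  also have "\<dots> = (\<Sum>n. ennreal (2 powr (- q * n)) * emeasure lborel (ball (0::'a) (2 ^ Suc n)))"
    by (rule nn_integral_suminf_cmult_indicator) simp
  also have "\<dots> = (\<Sum>n. ennreal (?V * 2 ^ ?d * ?r ^ n))"
  proof (intro suminf_cong)
    fix n
    have "(2::real) ^ (n * ?d) = 2 powr (real ?d * n)"
      by (simp add: mult.commute flip: powr_realpow)
    then have "2 powr (- q * n) * (2::real) ^ (n * ?d) = ?r powr n"
      by (simp add: powr_powr algebra_simps flip: powr_add)
    then have u: "2 powr (- q * n) * (2::real) ^ (n * ?d) = ?r ^ n"
      by (simp add: powr_realpow)
    have v: "((2::real) ^ Suc n) ^ ?d = 2 ^ ?d * 2 ^ (n * ?d)"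
      by (simp add: power_mult power_mult_distrib)
    have "2 powr (- q * n) * (?V * (2 ^ Suc n) ^ ?d) = ?V * 2 ^ ?d * ?r ^ n"
      unfolding v u[symmetric] by (simp only: mult_ac)
    then show "ennreal (2 powr (- q * n)) * emeasure lborel (ball (0::'a) (2 ^ Suc n))
        = ennreal (?V * 2 ^ ?d * ?r ^ n)"
      by (subst emeasure_ball) (auto simp flip: ennreal_mult')
  qed
  also have "\<dots> = ennreal (\<Sum>n. ?V * 2 ^ ?d * ?r ^ n)"
  proof (rule suminf_ennreal2)
    have "?r < 2 powr 0" using q by (intro powr_less_mono) auto
    then show "summable (\<lambda>n. ?V * 2 ^ ?d * ?r ^ n)"
      by (intro summable_mult summable_geometric) auto
  qed auto
  finally show ?thesis by (auto simp: less_top[symmetric] top_unique)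
qed

text \<open>The same dyadic argument with shells shrinking to the origin.\<close>
lemma nn_integral_singularity_finite:
  fixes p :: real
  assumes p0: "0 \<le> p" and p: "p < DIM('a::euclidean_space)"
  shows "(\<integral>\<^sup>+x. ennreal (norm (x::'a) powr (-p)) * indicator (ball 0 1) x \<partial>lborel) < \<infinity>"
proof -
  let ?d = "DIM('a)"
  let ?V = "unit_ball_vol (real ?d)"
  let ?r = "2 powr (p - ?d)"
  have half: "(1/2::real) ^ n = 2 powr (- real n)" for n :: nat
    by (simp add: powr_minus powr_realpow power_one_over inverse_eq_divide)
  have pt: "ennreal (norm x powr (-p)) * indicator (ball 0 1) x
     \<le> (\<Sum>n. ennreal (2 powr (p * (n + 1))) * indicator (ball 0 ((1/2) ^ n)) x)" for x :: 'a
  proof (cases "x \<noteq> 0 \<and> norm x < 1")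
    case True
    then have x0: "norm x > 0" "norm x < 1" by auto
    define n where "n = nat (\<lceil>- log 2 (norm x)\<rceil> - 1)"
    have l0: "- log 2 (norm x) > 0" using x0 by simp
    have n1: "real n < - log 2 (norm x)" "- log 2 (norm x) \<le> real n + 1"
      unfolding n_def using l0 by linarith+
    have "- (real n + 1) \<le> log 2 (norm x)" using n1 by simp
    then have "2 powr (- (real n + 1)) \<le> norm x"
      using x0 by (subst (asm) le_log_iff) auto
    then have a: "norm x powr (-p) \<le> (2 powr (- (real n + 1))) powr (-p)"
      using p0 by (intro powr_mono2') (auto)
    have "log 2 (norm x) < - real n" using n1 by simp
    then have "norm x < 2 powr (- real n)"
      using x0 by (subst (asm) log_less_iff) auto
    then have b: "x \<in> ball 0 ((1/2) ^ n)"
      by (simp add: half)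
    have "ennreal (norm x powr (-p)) * indicator (ball 0 1) x
      \<le> ennreal (2 powr (p * (n + 1))) * indicator (ball 0 ((1/2) ^ n)) x"
      using a b x0 by (simp add: powr_powr algebra_simps)
    also have "\<dots> \<le> (\<Sum>n. ennreal (2 powr (p * (n + 1))) * indicator (ball 0 ((1/2) ^ n)) x)"
      by (rule ennreal_le_suminf)
    finally show ?thesis .
  next
    case False
    then have z: "ennreal (norm x powr (-p)) * indicator (ball 0 1) x = 0"
      by (auto simp: indicator_def)
    show ?thesis unfolding z by (rule zero_le)
  qed
  have "(\<integral>\<^sup>+x. ennreal (norm (x::'a) powr (-p)) * indicator (ball 0 1) x \<partial>lborel)
    \<le> (\<integral>\<^sup>+x. (\<Sum>n. ennreal (2 powr (p * (n + 1))) * indicator (ball 0 ((1/2) ^ n)) (x::'a)) \<partial>lborel)"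
    by (intro nn_integral_mono pt)
  also have "\<dots> = (\<Sum>n. ennreal (2 powr (p * (n + 1))) * emeasure lborel (ball (0::'a) ((1/2) ^ n)))"
    by (rule nn_integral_suminf_cmult_indicator) simp
  also have "\<dots> = (\<Sum>n. ennreal (?V * 2 powr p * ?r ^ n))"
  proof (intro suminf_cong)
    fix n
    have "((1/2::real) ^ n) ^ ?d = 2 powr (- (real ?d * n))"
      using half[of "n * ?d"] by (simp add: power_mult mult.commute)
    then have "2 powr (p * n) * ((1/2::real) ^ n) ^ ?d = ?r powr n"
      by (simp add: powr_powr algebra_simps flip: powr_add)
    then have u: "2 powr (p * n) * ((1/2::real) ^ n) ^ ?d = ?r ^ n"
      by (simp add: powr_realpow)
    have v: "2 powr (p * (n + 1)) = 2 powr p * 2 powr (p * n)"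
      by (simp add: distrib_left powr_add)
    have "2 powr (p * (n + 1)) * (?V * ((1/2) ^ n) ^ ?d) = ?V * 2 powr p * ?r ^ n"
      unfolding v u[symmetric] by (simp only: mult_ac)
    then show "ennreal (2 powr (p * (n + 1))) * emeasure lborel (ball (0::'a) ((1/2) ^ n))
        = ennreal (?V * 2 powr p * ?r ^ n)"
      by (subst emeasure_ball) (auto simp flip: ennreal_mult')
  qed
  also have "\<dots> = ennreal (\<Sum>n. ?V * 2 powr p * ?r ^ n)"
  proof (rule suminf_ennreal2)
    have "?r < 2 powr 0" using p by (intro powr_less_mono) auto
    then show "summable (\<lambda>n. ?V * 2 powr p * ?r ^ n)"
      by (intro summable_mult summable_geometric) auto
  qed auto
  finally show ?thesis by (auto simp: less_top[symmetric] top_unique)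
qed

lemma nn_integral_lborel_affine:
  fixes f :: "'a::euclidean_space \<Rightarrow> ennreal" and c :: real
  assumes [measurable]: "f \<in> borel_measurable borel" and c: "c \<noteq> 0"
  shows "(\<integral>\<^sup>+x. f x \<partial>lborel) = ennreal (\<bar>c\<bar> ^ DIM('a)) * (\<integral>\<^sup>+x. f (t + c *\<^sub>R x) \<partial>lborel)"
  by (subst lborel_affine[OF c, of t])
     (simp add: nn_integral_density nn_integral_distr nn_integral_cmult)

lemma lborel_integral_affine:
  fixes f :: "'a::euclidean_space \<Rightarrow> real" and c :: real
  assumes [measurable]: "f \<in> borel_measurable borel" and c: "c \<noteq> 0"
  shows "(LINT x|lborel. f x) = \<bar>c\<bar> ^ DIM('a) * (LINT x|lborel. f (t + c *\<^sub>R x))"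
  by (subst lborel_affine[OF c, of t])
     (simp add: integral_density integral_distr)

lemma nn_integral_reflect_translate:
  fixes f :: "'a::euclidean_space \<Rightarrow> ennreal"
  assumes "f \<in> borel_measurable borel"
  shows "(\<integral>\<^sup>+x. f (t - x) \<partial>lborel) = (\<integral>\<^sup>+x. f x \<partial>lborel)"
  using nn_integral_lborel_affine[OF assms, of "-1" t] by simp

lemma nn_integral_singular_kernel_le:
  fixes \<phi> :: "'a::euclidean_space \<Rightarrow> ennreal" and p :: real
  assumes p0: "0 \<le> p" and [measurable]: "\<phi> \<in> borel_measurable borel" and b: "\<And>x. \<phi> x \<le> M"
  shows "(\<integral>\<^sup>+x. \<phi> x * ennreal (norm (t - x) powr (-p)) \<partial>lborel)
     \<le> M * (\<integral>\<^sup>+x. ennreal (norm (x::'a) powr (-p)) * indicator (ball 0 1) x \<partial>lborel) + (\<integral>\<^sup>+x. \<phi> x \<partial>lborel)"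
proof -
  have ind [measurable]: "(indicator (ball 0 1) :: 'a \<Rightarrow> ennreal) \<in> borel_measurable borel"
    by (rule borel_measurable_indicator) (rule borel_open, rule open_ball)
  then have [measurable]: "(\<lambda>x. indicator (ball 0 1) (t - x) :: ennreal) \<in> borel_measurable borel"
    by (rule measurable_compose[of "\<lambda>x. t - x" borel borel, rotated]) simp
  have "\<phi> x * ennreal (norm (t - x) powr (-p))
     \<le> M * (ennreal (norm (t - x) powr (-p)) * indicator (ball 0 1) (t - x)) + \<phi> x" for x
  proof (cases "norm (t - x) < 1")
    case True
    then show ?thesis using b[of x]
      by (simp add: add_increasing2 mult_right_mono)
  next
    case False
    then have "norm (t - x) powr (-p) \<le> 1 powr (-p)"
      using p0 by (intro powr_mono2') auto
    then have "\<phi> x * ennreal (norm (t - x) powr (-p)) \<le> \<phi> x * 1"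
      by (intro mult_left_mono) auto
    then show ?thesis by (simp add: add_increasing)
  qed
  then have "(\<integral>\<^sup>+x. \<phi> x * ennreal (norm (t - x) powr (-p)) \<partial>lborel)
     \<le> (\<integral>\<^sup>+x. M * (ennreal (norm (t - x) powr (-p)) * indicator (ball 0 1) (t - x)) + \<phi> x \<partial>lborel)"
    by (intro nn_integral_mono)
  also have "\<dots> = M * (\<integral>\<^sup>+x. ennreal (norm (t - x) powr (-p)) * indicator (ball 0 1) (t - x) \<partial>lborel)
       + (\<integral>\<^sup>+x. \<phi> x \<partial>lborel)"
    by (simp add: nn_integral_add nn_integral_cmult)
  also have "(\<integral>\<^sup>+x. ennreal (norm (t - x) powr (-p)) * indicator (ball 0 1) (t - x) \<partial>lborel)
     = (\<integral>\<^sup>+x. ennreal (norm (x::'a) powr (-p)) * indicator (ball 0 1) x \<partial>lborel)"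
    by (rule nn_integral_reflect_translate) (intro borel_measurable_times_ennreal ind, measurable)
  finally show ?thesis .
qed

section \<open>The heat kernel and its Taylor expansion\<close>

definition heat :: "real \<Rightarrow> real^3 \<Rightarrow> real"
  where "heat a x = (4 * pi * a) powr (- (3/2)) * exp (- (norm x)\<^sup>2 / (4 * a))"

text \<open>The \<open>j\<close>-th partial derivative of \<open>heat a\<close>.\<close>
definition dheat :: "3 \<Rightarrow> real \<Rightarrow> real^3 \<Rightarrow> real"
  where "dheat j a x = - (x $ j / (2 * a)) * heat a x"

text \<open>\<open>dG\<close> and \<open>ddG\<close> are the first and second partial derivatives of \<open>G\<close>, the profiles of the expansion before they are recombined
  into rotational fields.\<close>
definition dG :: "3 \<Rightarrow> real^3 \<Rightarrow> real"
  where "dG j x = - (x $ j / 2) * G x"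

definition ddG :: "3 \<Rightarrow> 3 \<Rightarrow> real^3 \<Rightarrow> real"
  where "ddG j k x = (x $ j * x $ k / 4 - (if j = k then 1/2 else 0)) * G x"

lemma rho_ge_1: "\<rho> x \<ge> 1" and rho_pos: "\<rho> x > 0"
  by (simp_all add: \<rho>_def add_pos_nonneg)

text \<open>Submultiplicativity is what lets a weight at \<open>\<xi>\<close> be paid for by weights at \<open>\<xi> - h\<close> and \<open>h\<close>.\<close>
lemma rho_add_le: "\<rho> (x + y) \<le> \<rho> x * \<rho> y"
proof -
  have "norm (x + y) \<le> norm x + norm y" by (rule norm_triangle_ineq)
  moreover have "0 \<le> norm x * norm y" by simp
  ultimately show ?thesis unfolding \<rho>_def by (simp only: distrib_left distrib_right mult_1 mult_1_right)
qed

text \<open>Any power of the weight is absorbed by a small part of a Gaussian exponent; the constant comes from completing the square.\<close>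
lemma rho_powr_le_exp:
  assumes "0 \<le> m" "0 < \<delta>"
  shows "\<rho> x powr m \<le> exp (m\<^sup>2 / (4 * \<delta>)) * exp (\<delta> * (norm x)\<^sup>2)"
proof -
  have "\<rho> x \<le> exp (norm x)" unfolding \<rho>_def by (rule exp_ge_add_one_self)
  then have "\<rho> x powr m \<le> exp (norm x) powr m"
    using assms rho_pos[of x] by (intro powr_mono2) auto
  also have "\<dots> = exp (m * norm x)" by (simp add: powr_def)
  also have "\<dots> \<le> exp (m\<^sup>2 / (4 * \<delta>) + \<delta> * (norm x)\<^sup>2)"
  proof -
    have "0 \<le> (m - 2 * \<delta> * norm x)\<^sup>2 / (4 * \<delta>)" using assms by simp
    also have "\<dots> = m\<^sup>2 / (4 * \<delta>) - m * norm x + \<delta> * (norm x)\<^sup>2"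
      using assms by (simp add: power2_eq_square field_simps)
    finally show ?thesis by simp
  qed
  finally show ?thesis by (simp add: exp_add)
qed

lemma heat_nonneg: "0 \<le> heat a x" unfolding heat_def by simp

lemma heat_le:
  assumes "0 < a" shows "heat a x \<le> a powr (-(3/2)) * exp (- (norm x)\<^sup>2 / (4 * a))"
proof -
  have "(4 * pi * a) powr (-(3/2)) \<le> a powr (-(3/2))"
    using assms pi_gt3 by (intro powr_mono2') (auto simp: mult_ge1_I)
  then show ?thesis unfolding heat_def by (intro mult_right_mono) auto
qed

text \<open>The factor \<open>norm x / sqrt a\<close> is absorbed by half of the Gaussian exponent, which costs only the power of \<open>a\<close> that scaling dictates.\<close>
lemma dheat_le:
  assumes a: "0 < a"
  shows "\<bar>dheat j a x\<bar> \<le> a powr (-2) * exp (- (norm x)\<^sup>2 / (8 * a))"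
proof -
  define t where "t = norm x / sqrt a"
  have t0: "t \<ge> 0" using a by (simp add: t_def)
  have t2: "t\<^sup>2 = (norm x)\<^sup>2 / a" using a by (simp add: t_def power_divide)
  have "t / 2 \<le> 1 + t\<^sup>2 / 8"
  proof -
    have "0 \<le> (t - 2)\<^sup>2" by simp
    also have "\<dots> = t\<^sup>2 - 4 * t + 4" by (simp add: power2_eq_square algebra_simps)
    finally show ?thesis by simp
  qed
  also have "\<dots> \<le> exp (t\<^sup>2 / 8)" by (rule exp_ge_add_one_self)
  finally have te: "t / 2 \<le> exp (t\<^sup>2 / 8)" .
  have "\<bar>dheat j a x\<bar> = \<bar>x $ j\<bar> / (2 * a) * heat a x"
    using a by (simp add: dheat_def abs_mult heat_nonneg abs_of_nonneg)
  also have "\<dots> \<le> norm x / (2 * a) * (a powr (-(3/2)) * exp (- (norm x)\<^sup>2 / (4 * a)))"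
    using a component_le_norm_cart[of x j] by (intro mult_mono heat_le divide_right_mono) (auto simp: heat_nonneg)
  also have "\<dots> = (t / 2) * (a powr (-2)) * exp (- (norm x)\<^sup>2 / (4 * a))"
  proof -
    have "a powr (-2) = a powr (-(3/2)) * a powr (-(1/2))" by (simp flip: powr_add)
    moreover have "a powr (-(1/2)) = 1 / sqrt a" using a by (simp add: powr_minus powr_half_sqrt inverse_eq_divide)
    ultimately have "a powr (-(3/2)) / a = a powr (-2) / sqrt a"
      using a by (simp add: field_simps) (metis mult.assoc mult.left_commute real_sqrt_mult_self abs_of_pos mult.commute)
    then have "norm x / 2 * exp (- (norm x)\<^sup>2 / (4 * a)) * (a powr (-(3/2)) / a)
        = norm x / 2 * exp (- (norm x)\<^sup>2 / (4 * a)) * (a powr (-2) / sqrt a)"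
      by (rule arg_cong)
    then show ?thesis by (simp add: t_def mult_ac)
  qed
  also have "\<dots> \<le> exp (t\<^sup>2 / 8) * (a powr (-2)) * exp (- (norm x)\<^sup>2 / (4 * a))"
    using te by (intro mult_right_mono) auto
  also have "\<dots> = a powr (-2) * exp (- (norm x)\<^sup>2 / (8 * a))"
    using a by (simp add: t2 field_simps flip: exp_add)
  finally show ?thesis .
qed

lemma norm_diff_scale_sq_ge:
  fixes x h :: "real^3"
  assumes "norm h \<le> 1" "0 \<le> s" "s \<le> 1"
  shows "(norm (x - s *\<^sub>R h))\<^sup>2 \<ge> (norm x)\<^sup>2 / 2 - 1"
proof -
  have sh: "norm (s *\<^sub>R h) \<le> 1" using assms by (simp add: mult_le_one)
  have "norm x \<le> norm (x - s *\<^sub>R h) + norm (s *\<^sub>R h)"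
    using norm_triangle_ineq[of "x - s *\<^sub>R h" "s *\<^sub>R h"] by simp
  then have n: "norm x \<le> norm (x - s *\<^sub>R h) + 1" using sh by linarith
  have "(norm x)\<^sup>2 \<le> (norm (x - s *\<^sub>R h) + 1)\<^sup>2" using n by (intro power_mono) auto
  also have "\<dots> \<le> 2 * (norm (x - s *\<^sub>R h))\<^sup>2 + 2"
    using zero_le_power2[of "norm (x - s *\<^sub>R h) - 1"] by (simp add: power2_eq_square algebra_simps)
  finally show ?thesis by simp
qed

text \<open>Restricted to a segment, the kernel is the exponential of a quadratic polynomial.  These bounds for its derivatives, uniform
  in the width \<open>a\<close>, are the input of both Taylor expansions below.\<close>
lemma heat_exponent_bounds:
  fixes x h :: "real^3"
  assumes a: "1/2 \<le> a" "a \<le> 1" and h: "norm h \<le> 1" and s: "0 \<le> s" "s \<le> 1"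
  shows "((\<lambda>s. exp (- (norm (x - s *\<^sub>R h))\<^sup>2 / (4 * a))) has_real_derivative
            (x \<bullet> h - s * (norm h)\<^sup>2) / (2 * a) * exp (- (norm (x - s *\<^sub>R h))\<^sup>2 / (4 * a))) (at s)"
    and "\<bar>(x \<bullet> h - s * (norm h)\<^sup>2) / (2 * a)\<bar> \<le> norm h * \<rho> x"
    and "(norm h)\<^sup>2 / (2 * a) \<le> (norm h)\<^sup>2"
    and "exp (- (norm (x - s *\<^sub>R h))\<^sup>2 / (4 * a)) \<le> 2 * exp (- (norm x)\<^sup>2 / 8)"
    and "(4 * pi * a) powr (-(3/2)) \<le> 1"
proof -
  have n: "(norm (x - s *\<^sub>R h))\<^sup>2 = (norm x)\<^sup>2 - 2 * s * (x \<bullet> h) + s\<^sup>2 * (norm h)\<^sup>2" for s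
    unfolding power2_norm_eq_inner
    by (simp add: inner_diff_left inner_diff_right power2_eq_square algebra_simps inner_commute)
  show "((\<lambda>s. exp (- (norm (x - s *\<^sub>R h))\<^sup>2 / (4 * a))) has_real_derivative
            (x \<bullet> h - s * (norm h)\<^sup>2) / (2 * a) * exp (- (norm (x - s *\<^sub>R h))\<^sup>2 / (4 * a))) (at s)"
    unfolding n using a by (auto intro!: derivative_eq_intros simp: field_simps)
  have "\<bar>x \<bullet> h - s * (norm h)\<^sup>2\<bar> \<le> \<bar>x \<bullet> h\<bar> + \<bar>s * (norm h)\<^sup>2\<bar>" by (rule abs_triangle_ineq4)
  also have "\<dots> \<le> norm x * norm h + 1 * norm h"
  proof (intro add_mono Cauchy_Schwarz_ineq2)
    have "s * (norm h * norm h) \<le> 1 * (1 * norm h)"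
      using s h by (intro mult_mono) auto
    then show "\<bar>s * (norm h)\<^sup>2\<bar> \<le> 1 * norm h" using s by (simp add: power2_eq_square abs_of_nonneg)
  qed
  finally have "\<bar>x \<bullet> h - s * (norm h)\<^sup>2\<bar> \<le> norm h * \<rho> x" by (simp add: \<rho>_def algebra_simps)
  moreover have "\<bar>(x \<bullet> h - s * (norm h)\<^sup>2) / (2 * a)\<bar> \<le> \<bar>x \<bullet> h - s * (norm h)\<^sup>2\<bar>"
    using a by (simp add: abs_div divide_le_eq mult_le_cancel_left1)
  ultimately show "\<bar>(x \<bullet> h - s * (norm h)\<^sup>2) / (2 * a)\<bar> \<le> norm h * \<rho> x" by linarith
  show "(norm h)\<^sup>2 / (2 * a) \<le> (norm h)\<^sup>2"
    using a by (simp add: divide_le_eq mult_le_cancel_left1)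
  have "- (norm (x - s *\<^sub>R h))\<^sup>2 / (4 * a) \<le> - ((norm x)\<^sup>2 / 2 - 1) / 4"
  proof -
    have "(norm (x - s *\<^sub>R h))\<^sup>2 / 4 \<le> (norm (x - s *\<^sub>R h))\<^sup>2 / (4 * a)"
      using a by (intro divide_left_mono) auto
    then show ?thesis using norm_diff_scale_sq_ge[OF h s, of x] by simp
  qed
  then have "exp (- (norm (x - s *\<^sub>R h))\<^sup>2 / (4 * a)) \<le> exp (- ((norm x)\<^sup>2 / 2 - 1) / 4)"
    by simp
  also have "\<dots> = exp (1/4) * exp (- (norm x)\<^sup>2 / 8)"
    by (simp flip: exp_add add: field_simps)
  also have "exp (1/4::real) \<le> 2"
  proof -
    have "exp (1/4::real) \<le> exp (1/2)" by simp
    also have "\<dots> \<le> 2" using exp_bound_half[of "1/2::real"] by simp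
    finally show ?thesis .
  qed
  then have "exp (1/4) * exp (- (norm x)\<^sup>2 / 8) \<le> 2 * exp (- (norm x)\<^sup>2 / 8)" by (intro mult_right_mono) auto
  finally show "exp (- (norm (x - s *\<^sub>R h))\<^sup>2 / (4 * a)) \<le> 2 * exp (- (norm x)\<^sup>2 / 8)" .
  have "4 * pi * a \<ge> 4 * 3 * (1/2)" using pi_gt3 a by (intro mult_mono) auto
  then show "(4 * pi * a) powr (-(3/2)) \<le> 1"
    using powr_mono2'[of "-(3/2)" 1 "4 * pi * a"] by simp
qed

text \<open>Taylor's formula along the segment from \<open>x\<close> to \<open>x - h\<close>, with the remainder of order two estimated by the bounds on the exponent.
  Half of the Gaussian survives because a shift by at most one changes \<open>(norm x)\<^sup>2\<close> by a bounded factor up to a constant.\<close>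
lemma dheat_taylor:
  fixes x h :: "real^3"
  assumes a: "1/2 \<le> a" "a \<le> 1" and h: "norm h \<le> 1"
  shows "\<bar>dheat j a (x - h) - dheat j a x - (h $ j / (2 * a) - x $ j * (x \<bullet> h) / (4 * a\<^sup>2)) * heat a x\<bar>
    \<le> 6 * (norm h)\<^sup>2 * \<rho> x ^ 3 * exp (- (norm x)\<^sup>2 / 8)"
proof -
  define c where "c = (4 * pi * a) powr (-(3/2))"
  define e where "e s = exp (- (norm (x - s *\<^sub>R h))\<^sup>2 / (4 * a))" for s :: real
  define q where "q s = (x \<bullet> h - s * (norm h)\<^sup>2) / (2 * a)" for s
  define L where "L s = x $ j - s * h $ j" for s
  let ?b = "(norm h)\<^sup>2 / (2 * a)"
  have a0: "a > 0" using a by simp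
  have dq: "(q has_real_derivative - ?b) (at s)" for s
    unfolding q_def using a0 by (auto intro!: derivative_eq_intros simp: field_simps)
  have dL: "(L has_real_derivative - h $ j) (at s)" for s
    unfolding L_def by (auto intro!: derivative_eq_intros)
  have de: "(e has_real_derivative q s * e s) (at s)" if "0 \<le> s" "s \<le> 1" for s
    unfolding e_def q_def using heat_exponent_bounds(1)[OF a h that] .
  define D where "D n s = (if n = 0 then L s * e s else if n = 1 then (- h $ j + L s * q s) * e s
     else (- 2 * h $ j * q s - L s * ?b + L s * (q s)\<^sup>2) * e s)" for n :: nat and s
  have "\<exists>t. 0 < t \<and> t < 1 \<and> D 0 1 = (\<Sum>m<2. D m 0 / fact m * 1 ^ m) + D 2 t / fact 2 * 1 ^ 2"
  proof (rule Maclaurin)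
    show "\<forall>m t. m < 2 \<and> 0 \<le> t \<and> t \<le> 1 \<longrightarrow> (D m has_real_derivative D (Suc m) t) (at t)"
    proof (intro allI impI, elim conjE)
      fix m :: nat and t :: real assume m: "m < 2" and t: "0 \<le> t" "t \<le> 1"
      note d = de[OF t] dq[of t] dL[of t]
      consider "m = 0" | "m = 1" using m by linarith
      then show "(D m has_real_derivative D (Suc m) t) (at t)"
      proof cases
        case 1
        have "((\<lambda>s. L s * e s) has_real_derivative (- h $ j + L t * q t) * e t) (at t)"
          by (rule derivative_eq_intros d refl)+ (simp add: algebra_simps)
        then show ?thesis using 1 by (simp add: D_def[abs_def])
      next
        case 2
        have "((\<lambda>s. (- h $ j + L s * q s) * e s) has_real_derivative
          (- 2 * h $ j * q t - L t * ?b + L t * (q t)\<^sup>2) * e t) (at t)"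
          by (rule derivative_eq_intros d refl)+ (simp add: algebra_simps power2_eq_square)
        then show ?thesis using 2 by (simp add: D_def[abs_def])
      qed
    qed
  qed auto
  then obtain t where t: "0 < t" "t < 1" and T: "D 0 1 = D 0 0 + D 1 0 + D 2 t / 2"
    by (auto simp: lessThan_nat_numeral lessThan_Suc eval_nat_numeral)
  have t': "0 \<le> t" "t \<le> 1" using t by auto
  note B = heat_exponent_bounds(2)[OF a h t', of x, folded q_def] heat_exponent_bounds(3)[OF a h t']
    heat_exponent_bounds(4)[OF a h t', of x, folded e_def] heat_exponent_bounds(5)[OF a h t', folded c_def]
  have L: "\<bar>L t\<bar> \<le> \<rho> x"
  proof -
    have "\<bar>L t\<bar> \<le> \<bar>x $ j\<bar> + \<bar>t * h $ j\<bar>" unfolding L_def by (rule abs_triangle_ineq4)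
    also have "\<bar>t * h $ j\<bar> \<le> 1 * norm h"
      unfolding abs_mult using t component_le_norm_cart[of h j] by (intro mult_mono) auto
    finally show ?thesis using h component_le_norm_cart[of x j] by (simp add: \<rho>_def)
  qed
  have r1: "\<rho> x \<ge> 1" by (rule rho_ge_1)
  have n0: "norm h \<ge> 0" by simp
  have "\<bar>- 2 * h $ j * q t - L t * ?b + L t * (q t)\<^sup>2\<bar>
     \<le> 2 * (\<bar>h $ j\<bar> * \<bar>q t\<bar>) + \<bar>L t\<bar> * ?b + \<bar>L t\<bar> * \<bar>q t\<bar>\<^sup>2"
  proof -
    have "\<bar>L t * ?b\<bar> = \<bar>L t\<bar> * ?b" using a0 by (simp add: abs_mult)
    moreover have "\<bar>L t * (q t)\<^sup>2\<bar> = \<bar>L t\<bar> * \<bar>q t\<bar>\<^sup>2" by (simp add: abs_mult)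
    moreover have "\<bar>2 * h $ j * q t\<bar> = 2 * (\<bar>h $ j\<bar> * \<bar>q t\<bar>)" by (simp add: abs_mult)
    ultimately show ?thesis by linarith
  qed
  also have "\<dots> \<le> 2 * (norm h * (norm h * \<rho> x)) + \<rho> x * (norm h)\<^sup>2 + \<rho> x * (norm h * \<rho> x)\<^sup>2"
    using B(1,2) L component_le_norm_cart[of h j] r1 a0
    by (intro add_mono mult_mono mult_left_mono power_mono order_refl) auto
  also have "\<dots> = (norm h)\<^sup>2 * (3 * \<rho> x + \<rho> x ^ 3)"
    by (simp add: power2_eq_square power3_eq_cube algebra_simps)
  also have "\<dots> \<le> (norm h)\<^sup>2 * (4 * \<rho> x ^ 3)"
    using self_le_power[OF r1, of 3] by (intro mult_left_mono) auto
  finally have P: "\<bar>- 2 * h $ j * q t - L t * ?b + L t * (q t)\<^sup>2\<bar> \<le> (norm h)\<^sup>2 * (4 * \<rho> x ^ 3)" .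
  have "\<bar>D 2 t\<bar> = \<bar>- 2 * h $ j * q t - L t * ?b + L t * (q t)\<^sup>2\<bar> * e t"
    by (simp add: D_def abs_mult e_def)
  also have "\<dots> \<le> (norm h)\<^sup>2 * (4 * \<rho> x ^ 3) * (2 * exp (- (norm x)\<^sup>2 / 8))"
    using P B(3) r1 by (intro mult_mono) (auto simp: e_def)
  finally have "\<bar>D 2 t\<bar> \<le> (norm h)\<^sup>2 * (4 * \<rho> x ^ 3) * (2 * exp (- (norm x)\<^sup>2 / 8))" .
  then have D2: "\<bar>D 2 t / 2\<bar> \<le> 4 * (norm h)\<^sup>2 * \<rho> x ^ 3 * exp (- (norm x)\<^sup>2 / 8)" by simp
  have "dheat j a (x - h) = - (c / (2 * a)) * D 0 1" "dheat j a x = - (c / (2 * a)) * D 0 0"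
    by (simp_all add: dheat_def heat_def D_def L_def e_def c_def)
  moreover have "(h $ j / (2 * a) - x $ j * (x \<bullet> h) / (4 * a\<^sup>2)) * heat a x = - (c / (2 * a)) * D 1 0"
    using a0 by (simp add: heat_def D_def L_def e_def c_def q_def field_simps power2_eq_square)
  ultimately have "dheat j a (x - h) - dheat j a x - (h $ j / (2 * a) - x $ j * (x \<bullet> h) / (4 * a\<^sup>2)) * heat a x
      = - (c / (2 * a)) * (D 2 t / 2)" using T by (simp add: algebra_simps)
  moreover have "c / (2 * a) \<le> 1" "c / (2 * a) \<ge> 0"
    using B(4) a by (simp_all add: c_def divide_le_eq)
  ultimately have "\<bar>dheat j a (x - h) - dheat j a x - (h $ j / (2 * a) - x $ j * (x \<bullet> h) / (4 * a\<^sup>2)) * heat a x\<bar>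
      \<le> 1 * \<bar>D 2 t / 2\<bar>" by (simp only: abs_mult abs_minus_cancel) (intro mult_right_mono, auto)
  then show ?thesis using D2 r1
    by (smt (verit) mult_right_mono exp_ge_zero zero_le_power zero_le_power2 mult_nonneg_nonneg)
qed

text \<open>The same argument one order further, as the undifferentiated kernel is expanded to order two.\<close>
lemma heat_taylor:
  fixes x h :: "real^3"
  assumes a: "1/2 \<le> a" "a \<le> 1" and h: "norm h \<le> 1"
  shows "\<bar>heat a (x - h) - heat a x - (x \<bullet> h) / (2 * a) * heat a x
      - ((x \<bullet> h)\<^sup>2 / (4 * a\<^sup>2) - (norm h)\<^sup>2 / (2 * a)) / 2 * heat a x\<bar>
    \<le> 2 * (norm h) ^ 3 * \<rho> x ^ 3 * exp (- (norm x)\<^sup>2 / 8)"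
proof -
  define c where "c = (4 * pi * a) powr (-(3/2))"
  define e where "e s = exp (- (norm (x - s *\<^sub>R h))\<^sup>2 / (4 * a))" for s :: real
  define q where "q s = (x \<bullet> h - s * (norm h)\<^sup>2) / (2 * a)" for s
  let ?b = "(norm h)\<^sup>2 / (2 * a)"
  have a0: "a > 0" using a by simp
  have dq: "(q has_real_derivative - ?b) (at s)" for s
    unfolding q_def using a0 by (auto intro!: derivative_eq_intros simp: field_simps)
  have de: "(e has_real_derivative q s * e s) (at s)" if "0 \<le> s" "s \<le> 1" for s
    unfolding e_def q_def using heat_exponent_bounds(1)[OF a h that] .
  define D where "D n s = (if n = 0 then e s else if n = 1 then q s * e s
     else if n = 2 then ((q s)\<^sup>2 - ?b) * e s else ((q s)^3 - 3 * ?b * q s) * e s)" for n :: nat and s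
  have "\<exists>t. 0 < t \<and> t < 1 \<and> D 0 1 = (\<Sum>m<3. D m 0 / fact m * 1 ^ m) + D 3 t / fact 3 * 1 ^ 3"
  proof (rule Maclaurin)
    show "\<forall>m t. m < 3 \<and> 0 \<le> t \<and> t \<le> 1 \<longrightarrow> (D m has_real_derivative D (Suc m) t) (at t)"
    proof (intro allI impI, elim conjE)
      fix m :: nat and t :: real assume m: "m < 3" and t: "0 \<le> t" "t \<le> 1"
      note d = de[OF t] dq[of t]
      consider "m = 0" | "m = 1" | "m = 2" using m by linarith
      then show "(D m has_real_derivative D (Suc m) t) (at t)"
      proof cases
        case 1
        then show ?thesis using d(1) by (simp add: D_def[abs_def])
      next
        case 2
        have "((\<lambda>s. q s * e s) has_real_derivative ((q t)\<^sup>2 - ?b) * e t) (at t)"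
          by (rule derivative_eq_intros d refl)+ (simp add: algebra_simps power2_eq_square)
        then show ?thesis using 2 by (simp add: D_def[abs_def])
      next
        case 3
        have "((\<lambda>s. ((q s)\<^sup>2 - ?b) * e s) has_real_derivative ((q t)^3 - 3 * ?b * q t) * e t) (at t)"
          by (rule derivative_eq_intros d refl)+ (simp add: algebra_simps power2_eq_square power3_eq_cube)
        then show ?thesis using 3 by (simp add: D_def[abs_def])
      qed
    qed
  qed auto
  then obtain t where t: "0 < t" "t < 1" and T: "D 0 1 = D 0 0 + D 1 0 + D 2 0 / 2 + D 3 t / 6"
    by (auto simp: lessThan_nat_numeral lessThan_Suc eval_nat_numeral)
  have t': "0 \<le> t" "t \<le> 1" using t by auto
  note B = heat_exponent_bounds(2)[OF a h t', of x, folded q_def] heat_exponent_bounds(3)[OF a h t']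
    heat_exponent_bounds(4)[OF a h t', of x, folded e_def] heat_exponent_bounds(5)[OF a h t', folded c_def]
  have r1: "\<rho> x \<ge> 1" by (rule rho_ge_1)
  have "\<bar>(q t)^3 - 3 * ?b * q t\<bar> \<le> \<bar>q t\<bar> ^ 3 + 3 * (?b * \<bar>q t\<bar>)"
  proof -
    have "\<bar>3 * ?b * q t\<bar> = 3 * (?b * \<bar>q t\<bar>)" using a0 by (simp add: abs_mult)
    moreover have "\<bar>(q t)^3\<bar> = \<bar>q t\<bar> ^ 3" by (simp add: power_abs)
    ultimately show ?thesis by linarith
  qed
  also have "\<dots> \<le> (norm h * \<rho> x) ^ 3 + 3 * ((norm h)\<^sup>2 * (norm h * \<rho> x))"
    using B(1,2) r1 a0 by (intro add_mono mult_mono mult_left_mono power_mono) auto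
  also have "\<dots> = (norm h)^3 * (\<rho> x ^ 3 + 3 * \<rho> x)"
    by (simp add: power2_eq_square power3_eq_cube algebra_simps)
  also have "\<dots> \<le> (norm h)^3 * (4 * \<rho> x ^ 3)"
    using self_le_power[OF r1, of 3] by (intro mult_left_mono) auto
  finally have P: "\<bar>(q t)^3 - 3 * ?b * q t\<bar> \<le> (norm h)^3 * (4 * \<rho> x ^ 3)" .
  have "\<bar>D 3 t\<bar> = \<bar>(q t)^3 - 3 * ?b * q t\<bar> * e t"
    by (simp add: D_def abs_mult e_def)
  also have "\<dots> \<le> (norm h)^3 * (4 * \<rho> x ^ 3) * (2 * exp (- (norm x)\<^sup>2 / 8))"
    using P B(3) r1 by (intro mult_mono) (auto simp: e_def)
  finally have "\<bar>D 3 t\<bar> \<le> (norm h)^3 * (4 * \<rho> x ^ 3) * (2 * exp (- (norm x)\<^sup>2 / 8))" .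
  then have D2: "\<bar>D 3 t / 6\<bar> \<le> 2 * (norm h)^3 * \<rho> x ^ 3 * exp (- (norm x)\<^sup>2 / 8)"
    using mult_nonneg_nonneg[of "norm h ^ 3 * \<rho> x ^ 3" "exp (- (norm x)\<^sup>2 / 8)"] r1 by simp
  have "heat a (x - h) = c * D 0 1" "heat a x = c * D 0 0"
    by (simp_all add: heat_def D_def e_def c_def)
  moreover have "(x \<bullet> h) / (2 * a) * heat a x = c * D 1 0"
    by (simp add: heat_def D_def e_def c_def q_def)
  moreover have "((x \<bullet> h)\<^sup>2 / (4 * a\<^sup>2) - (norm h)\<^sup>2 / (2 * a)) / 2 * heat a x = c * (D 2 0 / 2)"
    by (simp add: heat_def D_def e_def c_def q_def power_divide power_mult_distrib)
  ultimately have "heat a (x - h) - heat a x - (x \<bullet> h) / (2 * a) * heat a x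
      - ((x \<bullet> h)\<^sup>2 / (4 * a\<^sup>2) - (norm h)\<^sup>2 / (2 * a)) / 2 * heat a x = c * (D 3 t / 6)"
    using T by (simp add: algebra_simps)
  moreover have "c \<le> 1" "c \<ge> 0" using B(4) by (simp_all add: c_def)
  ultimately have "\<bar>heat a (x - h) - heat a x - (x \<bullet> h) / (2 * a) * heat a x
      - ((x \<bullet> h)\<^sup>2 / (4 * a\<^sup>2) - (norm h)\<^sup>2 / (2 * a)) / 2 * heat a x\<bar> \<le> 1 * \<bar>D 3 t / 6\<bar>"
    by (simp only: abs_mult) (intro mult_right_mono, auto)
  then show ?thesis using D2 by linarith
qed

text \<open>The profiles of the expansion have width \<open>1\<close> and the kernel has width \<open>a\<close>.  The difference is \<open>O (1 - a)\<close>, which is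
  \<open>O (\<epsilon>\<^sup>2)\<close> for the kernel at time \<open>\<tau>\<close> and therefore belongs to the remainder.  The power \<open>n\<close> accounts for the factors
  \<open>1 / a\<close> produced by differentiation.\<close>
lemma heat_width_difference:
  assumes a: "1/2 \<le> a" "a \<le> 1" and n: "n \<le> 2"
  shows "\<bar>heat a x / a ^ n - G x\<bar> \<le> 80 * (1 - a) * \<rho> x ^ 2 * exp (- (norm x)\<^sup>2 / 4)"
proof -
  define r where "r = (norm x)\<^sup>2"
  define k where "k = (4 * pi) powr (-(3/2))"
  have a0: "a > 0" using a by simp
  have k: "0 \<le> k" "k \<le> 1"
  proof -
    have "1 \<le> 4 * pi" using pi_gt3 by simp
    then show "k \<le> 1" using powr_mono2'[of "-(3/2)" 1 "4 * pi"] by (simp add: k_def)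
  qed (simp add: k_def)
  define P where "P = a powr (-(3/2)) / a ^ n"
  have "P = a powr (-(3/2) - n)" using a0 by (simp add: P_def powr_diff powr_realpow)
  then have P: "1 \<le> P" "P \<le> a powr (-4)"
    using a n powr_mono'[of "-(3/2) - n" 0 a] powr_mono'[of "-4" "-(3/2) - n" a] by auto
  have P4: "a powr (-4) = 1 / a ^ 4" using a0 by (simp add: powr_minus inverse_eq_divide flip: powr_numeral)
  have "1 / a ^ 4 - 1 = (1 - a) * (1 + a + a^2 + a^3) / a ^ 4"
    using a0 by (simp add: field_simps power2_eq_square power3_eq_cube power4_eq_xxxx)
  also have "\<dots> \<le> (1 - a) * 4 / (1/2) ^ 4"
  proof (intro frac_le mult_left_mono power_mono)
    show "1 + a + a^2 + a^3 \<le> 4" using a power_le_one[of a 2] power_le_one[of a 3] by simp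
  qed (use a in auto)
  finally have P1: "P - 1 \<le> 64 * (1 - a)" using P P4 by (simp add: field_simps)
  have e1: "exp (- r / (4 * a)) \<le> exp (- r / 4)"
  proof -
    have "r / 4 \<le> r / (4 * a)" using a by (intro divide_left_mono) (auto simp: r_def)
    then show ?thesis by simp
  qed
  have e2: "exp (- r / 4) - exp (- r / (4 * a)) \<le> (1 - a) * r * exp (- r / 4)"
  proof -
    have "exp (- r / (4 * a)) = exp (- r / 4) * exp (- (r * (1 - a) / (4 * a)))"
      using a0 by (simp add: field_simps flip: exp_add)
    moreover have "1 + - (r * (1 - a) / (4 * a)) \<le> exp (- (r * (1 - a) / (4 * a)))"
      by (rule exp_ge_add_one_self)
    moreover have "r * (1 - a) / (4 * a) \<le> r * (1 - a) / 1"
      using a by (intro divide_left_mono) (auto simp: r_def)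
    ultimately have "exp (- r / 4) * (1 - (1 - a) * r) \<le> exp (- r / (4 * a))"
      by (simp add: mult.commute)
    then show ?thesis by (simp add: algebra_simps)
  qed
  have eq: "heat a x / a ^ n - G x = k * ((P - 1) * exp (- r / (4 * a)) - (exp (- r / 4) - exp (- r / (4 * a))))"
    using a0 by (simp add: heat_def G_def k_def P_def r_def powr_mult algebra_simps)
  have "\<bar>(P - 1) * exp (- r / (4 * a)) - (exp (- r / 4) - exp (- r / (4 * a)))\<bar>
     \<le> (P - 1) * exp (- r / (4 * a)) + (exp (- r / 4) - exp (- r / (4 * a)))"
    using P e1 by (smt (verit) mult_nonneg_nonneg exp_ge_zero)
  also have "\<dots> \<le> 64 * (1 - a) * exp (- r / 4) + (1 - a) * r * exp (- r / 4)"
    using P P1 e1 e2 a by (intro add_mono mult_mono) auto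
  also have "\<dots> = (1 - a) * (64 + r) * exp (- r / 4)" by (simp add: algebra_simps)
  also have "\<dots> \<le> (1 - a) * (80 * \<rho> x ^ 2) * exp (- r / 4)"
  proof (intro mult_right_mono mult_left_mono)
    show "64 + r \<le> 80 * \<rho> x ^ 2" by (simp add: r_def \<rho>_def power2_eq_square algebra_simps)
  qed (use a in auto)
  finally have "k * \<bar>(P - 1) * exp (- r / (4 * a)) - (exp (- r / 4) - exp (- r / (4 * a)))\<bar>
     \<le> 1 * ((1 - a) * (80 * \<rho> x ^ 2) * exp (- r / 4))"
    using k by (intro mult_mono) auto
  then show ?thesis unfolding eq abs_mult using k by (simp add: r_def algebra_simps)
qed

section \<open>Expansions in the weighted norm\<close>

text \<open>The weight at \<open>\<xi>\<close> is split into a weight at \<open>\<xi> - h\<close>, eaten by half of the Gaussian, and one at \<open>h\<close>, bounded by \<open>R\<close>.\<close>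
lemma kernel_far_weight:
  assumes "0 < a" "a \<le> 1" "\<rho> h \<le> R" "0 \<le> m"
  shows "\<rho> \<xi> powr m * exp (- (norm (\<xi> - h))\<^sup>2 / (8 * a))
    \<le> exp (4 * m\<^sup>2) * R powr m * exp (- (norm (\<xi> - h))\<^sup>2 / (16 * a))"
proof -
  let ?r = "(norm (\<xi> - h))\<^sup>2"
  have "\<rho> \<xi> \<le> \<rho> (\<xi> - h) * \<rho> h" using rho_add_le[of "\<xi> - h" h] by simp
  also have "\<dots> \<le> \<rho> (\<xi> - h) * R"
    using assms rho_pos[of "\<xi> - h"] by (intro mult_left_mono) auto
  finally have "\<rho> \<xi> powr m \<le> (\<rho> (\<xi> - h) * R) powr m"
    using assms rho_pos[of \<xi>] by (intro powr_mono2) auto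
  also have "\<dots> = \<rho> (\<xi> - h) powr m * R powr m"
    by (rule powr_mult)
  also have "\<dots> \<le> (exp (m\<^sup>2 / (4 * (1/16))) * exp (1/16 * ?r)) * R powr m"
    using assms by (intro mult_right_mono rho_powr_le_exp) auto
  finally have "\<rho> \<xi> powr m * exp (- ?r / (8 * a))
    \<le> exp (4 * m\<^sup>2) * exp (1/16 * ?r) * R powr m * exp (- ?r / (8 * a))"
    by (intro mult_right_mono) (auto simp: mult_ac)
  also have "\<dots> = exp (4 * m\<^sup>2) * R powr m * exp (1/16 * ?r - ?r / (8 * a))"
  proof -
    have "exp (1/16 * ?r - ?r / (8 * a)) = exp (1/16 * ?r) * exp (- ?r / (8 * a))"
      by (simp flip: exp_add)
    then show ?thesis by (simp add: mult_ac)
  qed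
  also have "\<dots> \<le> exp (4 * m\<^sup>2) * R powr m * exp (- ?r / (16 * a))"
  proof -
    have "?r / 16 \<le> ?r / (16 * a)" using assms by (intro divide_left_mono) auto
    then have "1/16 * ?r - ?r / (8 * a) \<le> - ?r / (16 * a)" using assms by (simp add: field_simps)
    then show ?thesis by (intro mult_left_mono) auto
  qed
  finally show ?thesis .
qed

lemma kernel_near_weight:
  assumes "0 \<le> m"
  shows "\<rho> \<xi> powr m * (\<rho> \<xi> ^ 4 * exp (- (norm \<xi>)\<^sup>2 / 8)) \<le> exp (4 * (m + 4)\<^sup>2) * exp (- (norm \<xi>)\<^sup>2 / 16)"
proof -
  have "\<rho> \<xi> powr m * \<rho> \<xi> ^ 4 = \<rho> \<xi> powr (m + 4)"
    using rho_pos[of \<xi>] by (simp add: powr_add)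
  also have "\<dots> \<le> exp ((m + 4)\<^sup>2 / (4 * (1/16))) * exp (1/16 * (norm \<xi>)\<^sup>2)"
    using assms by (intro rho_powr_le_exp) auto
  finally have "\<rho> \<xi> powr m * \<rho> \<xi> ^ 4 * exp (- (norm \<xi>)\<^sup>2 / 8)
      \<le> exp (4 * (m + 4)\<^sup>2) * exp (1/16 * (norm \<xi>)\<^sup>2) * exp (- (norm \<xi>)\<^sup>2 / 8)"
    by (intro mult_right_mono) (auto simp: mult_ac)
  also have "\<dots> = exp (4 * (m + 4)\<^sup>2) * exp (- (norm \<xi>)\<^sup>2 / 16)"
    by (simp flip: exp_add add: field_simps)
  finally show ?thesis by (simp add: mult_ac)
qed

lemma G_le: "G x \<le> exp (- (norm x)\<^sup>2 / 4)" and G_nonneg: "0 \<le> G x"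
proof -
  have "1 \<le> 4 * pi" using pi_gt3 by simp
  then have "(4 * pi) powr (-(3/2)) \<le> 1" using powr_mono2'[of "-(3/2)" 1 "4 * pi"] by simp
  then have "(4 * pi) powr (-(3/2)) * exp (- (norm x)\<^sup>2 / 4) \<le> 1 * exp (- (norm x)\<^sup>2 / 4)"
    by (intro mult_right_mono) auto
  then show "G x \<le> exp (- (norm x)\<^sup>2 / 4)" by (simp add: G_def)
qed (simp add: G_def)

text \<open>Outside the range of the Taylor expansion either \<open>\<epsilon> \<eta>\<close> is large or \<open>\<epsilon>\<close> is close to one; in both cases \<open>1\<close> is dominated by
  \<open>\<epsilon> * \<rho> \<eta>\<close>, so lower powers of this quantity may be raised to higher ones.\<close>
lemma rho_scale_cases:
  assumes e: "0 < \<epsilon>" "\<epsilon> < 1" and far: "\<not> (norm (\<epsilon> *\<^sub>R \<eta>) \<le> 1 \<and> \<epsilon>\<^sup>2 \<le> 1/2)"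
  shows "\<rho> (\<epsilon> *\<^sub>R \<eta>) \<le> 2 * (\<epsilon> * \<rho> \<eta>)"
proof (cases "norm (\<epsilon> *\<^sub>R \<eta>) \<le> 1")
  case True
  then have "\<epsilon>\<^sup>2 > (1/2)\<^sup>2" using far by (simp add: power2_eq_square)
  then have "\<epsilon> > 1/2" using e by (intro power_less_imp_less_base[of "1/2" 2 \<epsilon>]) auto
  moreover have "0 \<le> \<epsilon> * norm \<eta>" using e by simp
  ultimately show ?thesis unfolding \<rho>_def norm_scaleR distrib_left using e by linarith
next
  case False
  then show ?thesis using e by (simp add: \<rho>_def distrib_left)
qed

lemma sum_ddG: "(\<Sum>k\<in>UNIV. h $ k * ddG j k \<xi>) = (\<xi> $ j * (\<xi> \<bullet> h) / 4 - h $ j / 2) * G \<xi>"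
proof -
  have "j = 1 \<or> j = 2 \<or> j = 3" by (rule exhaust_3)
  then show ?thesis
    by (elim disjE) (simp_all add: ddG_def sum_3 inner_vec_def algebra_simps)
qed

lemma sum_dG: "(\<Sum>k\<in>UNIV. h $ k * dG k \<xi>) = - ((\<xi> \<bullet> h) / 2 * G \<xi>)"
  by (simp add: dG_def sum_3 inner_vec_def algebra_simps)

lemma norm_sq_vec3: "(norm h)\<^sup>2 = (\<Sum>k\<in>UNIV. h $ k * (h $ k :: real))"
  by (simp add: power2_norm_eq_inner inner_vec_def)

lemma sum_sum_ddG:
  "(\<Sum>k\<in>UNIV. \<Sum>l\<in>UNIV. h $ k * h $ l * ddG k l \<xi>) = ((\<xi> \<bullet> h)\<^sup>2 / 4 - (norm h)\<^sup>2 / 2) * G \<xi>"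
proof -
  have "(\<Sum>k\<in>UNIV. \<Sum>l\<in>UNIV. h $ k * h $ l * ddG k l \<xi>) = (\<Sum>k\<in>UNIV. h $ k * (\<Sum>l\<in>UNIV. h $ l * ddG k l \<xi>))"
    by (simp add: sum_distrib_left mult_ac)
  also have "\<dots> = ((\<xi> \<bullet> h)\<^sup>2 / 4 - (norm h)\<^sup>2 / 2) * G \<xi>"
    unfolding sum_ddG norm_sq_vec3 by (simp add: sum_3 inner_vec_def field_simps power2_eq_square)
  finally show ?thesis .
qed

lemma scaled_norm_le: "0 < \<epsilon> \<Longrightarrow> norm (\<epsilon> *\<^sub>R \<eta>) \<le> \<epsilon> * \<rho> \<eta>" "0 < \<epsilon> \<Longrightarrow> \<epsilon> \<le> \<epsilon> * \<rho> \<eta>"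
  by (simp_all add: \<rho>_def)

text \<open>Taylor expansion in \<open>h = \<epsilon> \<eta>\<close>, followed by the replacement of the width \<open>1 - \<epsilon>\<^sup>2\<close> by \<open>1\<close> in each term.\<close>
lemma dheat_expansion_near:
  assumes e: "0 < \<epsilon>" "\<epsilon> < 1" and near: "norm (\<epsilon> *\<^sub>R \<eta>) \<le> 1" "\<epsilon>\<^sup>2 \<le> 1/2"
  shows "\<bar>dheat j (1 - \<epsilon>\<^sup>2) (\<xi> - \<epsilon> *\<^sub>R \<eta>) - dG j \<xi> + \<epsilon> * (\<Sum>k\<in>UNIV. \<eta> $ k * ddG j k \<xi>)\<bar>
     \<le> 110 * (\<epsilon> * \<rho> \<eta>)\<^sup>2 * (\<rho> \<xi> ^ 4 * exp (- (norm \<xi>)\<^sup>2 / 8))"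
proof -
  define h where "h = \<epsilon> *\<^sub>R \<eta>"
  define a where "a = 1 - \<epsilon>\<^sup>2"
  define E where "E = exp (- (norm \<xi>)\<^sup>2 / 8)"
  define N where "N = \<epsilon> * \<rho> \<eta>"
  have a: "1/2 \<le> a" "a \<le> 1" "0 < a" using near by (auto simp: a_def)
  have h: "norm h \<le> 1" using near by (simp add: h_def)
  have hN: "norm h \<le> N" "\<epsilon> \<le> N" using scaled_norm_le e by (auto simp: h_def N_def)
  have r: "\<rho> \<xi> \<ge> 1" by (rule rho_ge_1)
  have x: "\<bar>\<xi> $ j\<bar> \<le> \<rho> \<xi>" "norm \<xi> \<le> \<rho> \<xi>" "\<bar>h $ j\<bar> \<le> norm h"
    using component_le_norm_cart[of \<xi> j] component_le_norm_cart[of h j] by (auto simp: \<rho>_def)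
  have xh: "\<bar>\<xi> \<bullet> h\<bar> \<le> \<rho> \<xi>"
    using Cauchy_Schwarz_ineq2[of \<xi> h] mult_mono[OF x(2) h] r by simp
  have W: "\<bar>heat a \<xi> / a ^ n - G \<xi>\<bar> \<le> 80 * N\<^sup>2 * \<rho> \<xi> ^ 2 * E" if "n \<le> 2" for n
  proof -
    have "\<bar>heat a \<xi> / a ^ n - G \<xi>\<bar> \<le> 80 * (1 - a) * \<rho> \<xi> ^ 2 * exp (- (norm \<xi>)\<^sup>2 / 4)"
      by (rule heat_width_difference[OF a(1,2) that])
    also have "\<dots> \<le> 80 * N\<^sup>2 * \<rho> \<xi> ^ 2 * E"
      using hN e by (intro mult_mono mult_left_mono) (auto simp: a_def E_def intro: power_mono)
    finally show ?thesis .
  qed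
  define T where "T = dheat j a (\<xi> - h) - dheat j a \<xi> - (h $ j / (2 * a) - \<xi> $ j * (\<xi> \<bullet> h) / (4 * a\<^sup>2)) * heat a \<xi>"
  have T: "\<bar>T\<bar> \<le> 6 * (norm h)\<^sup>2 * \<rho> \<xi> ^ 3 * E"
    unfolding T_def E_def by (rule dheat_taylor[OF a(1,2) h])
  also have "\<dots> \<le> 6 * N\<^sup>2 * \<rho> \<xi> ^ 4 * E"
    using hN r by (intro mult_mono mult_left_mono power_mono power_increasing) (auto simp: E_def)
  finally have T: "\<bar>T\<bar> \<le> 6 * N\<^sup>2 * \<rho> \<xi> ^ 4 * E" .
  have "\<epsilon> * (\<Sum>k\<in>UNIV. \<eta> $ k * ddG j k \<xi>) = (\<Sum>k\<in>UNIV. h $ k * ddG j k \<xi>)"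
    by (simp add: h_def sum_distrib_left mult_ac)
  also have "\<dots> = (\<xi> $ j * (\<xi> \<bullet> h) / 4 - h $ j / 2) * G \<xi>" by (rule sum_ddG)
  finally have s1: "\<epsilon> * (\<Sum>k\<in>UNIV. \<eta> $ k * ddG j k \<xi>) = (\<xi> $ j * (\<xi> \<bullet> h) / 4 - h $ j / 2) * G \<xi>" .
  have eq: "dheat j a (\<xi> - h) - dG j \<xi> + \<epsilon> * (\<Sum>k\<in>UNIV. \<eta> $ k * ddG j k \<xi>)
     = T + (- (\<xi> $ j / 2)) * (heat a \<xi> / a ^ 1 - G \<xi>) + (h $ j / 2) * (heat a \<xi> / a ^ 1 - G \<xi>)
        + (- (\<xi> $ j * (\<xi> \<bullet> h) / 4)) * (heat a \<xi> / a ^ 2 - G \<xi>)"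
    unfolding s1 using a by (simp add: T_def dheat_def dG_def field_simps power2_eq_square)
  have b1: "\<bar>(- (\<xi> $ j / 2)) * (heat a \<xi> / a ^ 1 - G \<xi>)\<bar> \<le> (\<rho> \<xi> ^ 2 / 2) * (80 * N\<^sup>2 * \<rho> \<xi> ^ 2 * E)"
    unfolding abs_mult using x r self_le_power[OF r, of 2] by (intro mult_mono W) auto
  have b2: "\<bar>(h $ j / 2) * (heat a \<xi> / a ^ 1 - G \<xi>)\<bar> \<le> (\<rho> \<xi> ^ 2 / 2) * (80 * N\<^sup>2 * \<rho> \<xi> ^ 2 * E)"
  proof -
    have "\<bar>h $ j\<bar> \<le> \<rho> \<xi> ^ 2" using x(3) h one_le_power[OF r, of 2] by linarith
    then show ?thesis unfolding abs_mult by (intro mult_mono W) auto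
  qed
  have "\<bar>\<xi> $ j * (\<xi> \<bullet> h)\<bar> \<le> \<rho> \<xi> ^ 2"
    unfolding abs_mult power2_eq_square using x xh r by (intro mult_mono) auto
  then have b3: "\<bar>(- (\<xi> $ j * (\<xi> \<bullet> h) / 4)) * (heat a \<xi> / a ^ 2 - G \<xi>)\<bar> \<le> (\<rho> \<xi> ^ 2 / 4) * (80 * N\<^sup>2 * \<rho> \<xi> ^ 2 * E)"
    unfolding abs_mult[of "- (\<xi> $ j * (\<xi> \<bullet> h) / 4)"] by (intro mult_mono W) auto
  have p4: "\<rho> \<xi> ^ 2 / k * (80 * N\<^sup>2 * \<rho> \<xi> ^ 2 * E) = 80 / k * (N\<^sup>2 * \<rho> \<xi> ^ 4 * E)" for k
    by (simp add: power4_eq_xxxx power2_eq_square)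
  have "0 \<le> N\<^sup>2 * \<rho> \<xi> ^ 4 * E" using r by (simp add: E_def)
  then have "\<bar>dheat j a (\<xi> - h) - dG j \<xi> + \<epsilon> * (\<Sum>k\<in>UNIV. \<eta> $ k * ddG j k \<xi>)\<bar> \<le> 110 * (N\<^sup>2 * \<rho> \<xi> ^ 4 * E)"
    unfolding eq using T b1 b2 b3 unfolding p4 by linarith
  then show ?thesis by (simp add: h_def a_def E_def N_def mult_ac)
qed

text \<open>Here the zeroth term keeps its width \<open>1 - \<epsilon>\<^sup>2\<close>: replacing it would cost \<open>\<epsilon>\<^sup>2\<close>, too much for a remainder of order three.
  It is harmless, since it will be multiplied by the mass, which is zero.\<close>
lemma heat_expansion_near:
  assumes e: "0 < \<epsilon>" "\<epsilon> < 1" and near: "norm (\<epsilon> *\<^sub>R \<eta>) \<le> 1" "\<epsilon>\<^sup>2 \<le> 1/2"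
  shows "\<bar>heat (1 - \<epsilon>\<^sup>2) (\<xi> - \<epsilon> *\<^sub>R \<eta>) - heat (1 - \<epsilon>\<^sup>2) \<xi> + \<epsilon> * (\<Sum>k\<in>UNIV. \<eta> $ k * dG k \<xi>)
       - \<epsilon>\<^sup>2 / 2 * (\<Sum>k\<in>UNIV. \<Sum>l\<in>UNIV. \<eta> $ k * \<eta> $ l * ddG k l \<xi>)\<bar>
     \<le> 112 * (\<epsilon> * \<rho> \<eta>) ^ 3 * (\<rho> \<xi> ^ 4 * exp (- (norm \<xi>)\<^sup>2 / 8))"
proof -
  define h where "h = \<epsilon> *\<^sub>R \<eta>"
  define a where "a = 1 - \<epsilon>\<^sup>2"
  define E where "E = exp (- (norm \<xi>)\<^sup>2 / 8)"
  define N where "N = \<epsilon> * \<rho> \<eta>"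
  have a: "1/2 \<le> a" "a \<le> 1" "0 < a" using near by (auto simp: a_def)
  have h: "norm h \<le> 1" using near by (simp add: h_def)
  have hN: "norm h \<le> N" "\<epsilon> \<le> N" using scaled_norm_le e by (auto simp: h_def N_def)
  have r: "\<rho> \<xi> \<ge> 1" by (rule rho_ge_1)
  have N0: "0 \<le> N" using hN e by simp
  have x: "norm \<xi> \<le> \<rho> \<xi>" by (auto simp: \<rho>_def)
  have xh: "\<bar>\<xi> \<bullet> h\<bar> \<le> \<rho> \<xi> * norm h"
    using Cauchy_Schwarz_ineq2[of \<xi> h] mult_right_mono[OF x, of "norm h"] by simp
  have W: "\<bar>heat a \<xi> / a ^ n - G \<xi>\<bar> \<le> 80 * \<epsilon>\<^sup>2 * \<rho> \<xi> ^ 2 * E" if "n \<le> 2" for n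
  proof -
    have "\<bar>heat a \<xi> / a ^ n - G \<xi>\<bar> \<le> 80 * (1 - a) * \<rho> \<xi> ^ 2 * exp (- (norm \<xi>)\<^sup>2 / 4)"
      by (rule heat_width_difference[OF a(1,2) that])
    also have "\<dots> \<le> 80 * \<epsilon>\<^sup>2 * \<rho> \<xi> ^ 2 * E"
      by (intro mult_mono mult_left_mono) (auto simp: a_def E_def)
    finally show ?thesis .
  qed
  define T where "T = heat a (\<xi> - h) - heat a \<xi> - (\<xi> \<bullet> h) / (2 * a) * heat a \<xi>
      - ((\<xi> \<bullet> h)\<^sup>2 / (4 * a\<^sup>2) - (norm h)\<^sup>2 / (2 * a)) / 2 * heat a \<xi>"
  have T: "\<bar>T\<bar> \<le> 2 * (norm h) ^ 3 * \<rho> \<xi> ^ 3 * E"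
    unfolding T_def E_def by (rule heat_taylor[OF a(1,2) h])
  also have "\<dots> \<le> 2 * N ^ 3 * \<rho> \<xi> ^ 4 * E"
    using hN r N0 by (intro mult_mono mult_left_mono power_mono power_increasing) (auto simp: E_def)
  finally have T: "\<bar>T\<bar> \<le> 2 * N ^ 3 * \<rho> \<xi> ^ 4 * E" .
  have s1: "\<epsilon> * (\<Sum>k\<in>UNIV. \<eta> $ k * dG k \<xi>) = - ((\<xi> \<bullet> h) / 2 * G \<xi>)"
    unfolding sum_dG[symmetric] by (simp add: h_def sum_distrib_left mult_ac)
  have s2: "\<epsilon>\<^sup>2 / 2 * (\<Sum>k\<in>UNIV. \<Sum>l\<in>UNIV. \<eta> $ k * \<eta> $ l * ddG k l \<xi>)
      = ((\<xi> \<bullet> h)\<^sup>2 / 4 - (norm h)\<^sup>2 / 2) * G \<xi> / 2"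
    unfolding sum_sum_ddG[symmetric] by (simp add: h_def sum_distrib_left mult_ac power2_eq_square)
  have eq: "heat a (\<xi> - h) - heat a \<xi> + \<epsilon> * (\<Sum>k\<in>UNIV. \<eta> $ k * dG k \<xi>)
       - \<epsilon>\<^sup>2 / 2 * (\<Sum>k\<in>UNIV. \<Sum>l\<in>UNIV. \<eta> $ k * \<eta> $ l * ddG k l \<xi>)
     = T + ((\<xi> \<bullet> h) / 2) * (heat a \<xi> / a ^ 1 - G \<xi>) + ((\<xi> \<bullet> h)\<^sup>2 / 8) * (heat a \<xi> / a ^ 2 - G \<xi>)
        + (- (norm h)\<^sup>2 / 4) * (heat a \<xi> / a ^ 1 - G \<xi>)"
    unfolding s1 s2 using a by (simp add: T_def field_simps power2_eq_square)
  have r2: "\<rho> \<xi> \<le> \<rho> \<xi> ^ 2" "1 \<le> \<rho> \<xi> ^ 2" using self_le_power[OF r, of 2] one_le_power[OF r, of 2] by auto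
  have hh: "(norm h)\<^sup>2 \<le> norm h" using h by (simp add: power2_eq_square mult_left_le)
  have b0: "\<rho> \<xi> * norm h \<le> \<rho> \<xi> ^ 2 * norm h" using r2 by (intro mult_right_mono) auto
  have b1: "\<bar>((\<xi> \<bullet> h) / 2) * (heat a \<xi> / a ^ 1 - G \<xi>)\<bar> \<le> (\<rho> \<xi> ^ 2 * norm h) * (80 * \<epsilon>\<^sup>2 * \<rho> \<xi> ^ 2 * E)"
    unfolding abs_mult using xh b0 r by (intro mult_mono W) auto
  have "(norm h)\<^sup>2 \<le> \<rho> \<xi> ^ 2 * norm h" using hh mult_right_mono[OF r2(2), of "norm h"] by simp
  then have b2: "\<bar>(- (norm h)\<^sup>2 / 4) * (heat a \<xi> / a ^ 1 - G \<xi>)\<bar> \<le> (\<rho> \<xi> ^ 2 * norm h / 4) * (80 * \<epsilon>\<^sup>2 * \<rho> \<xi> ^ 2 * E)"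
    unfolding abs_mult by (intro mult_mono W) auto
  have "(\<xi> \<bullet> h)\<^sup>2 \<le> (\<rho> \<xi> * norm h)\<^sup>2" using xh by (rule abs_le_square_iff[THEN iffD1, OF order_trans]) simp
  also have "\<dots> \<le> \<rho> \<xi> ^ 2 * norm h" unfolding power_mult_distrib using hh by (intro mult_left_mono) auto
  finally have b3: "\<bar>((\<xi> \<bullet> h)\<^sup>2 / 8) * (heat a \<xi> / a ^ 2 - G \<xi>)\<bar> \<le> (\<rho> \<xi> ^ 2 * norm h / 8) * (80 * \<epsilon>\<^sup>2 * \<rho> \<xi> ^ 2 * E)"
    unfolding abs_mult by (intro mult_mono W) auto
  have "norm h * \<epsilon>\<^sup>2 \<le> N * N\<^sup>2" using hN e by (intro mult_mono power_mono) auto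
  then have "norm h * \<epsilon>\<^sup>2 * (\<rho> \<xi> ^ 4 * E) \<le> N ^ 3 * (\<rho> \<xi> ^ 4 * E)"
    by (intro mult_right_mono) (auto simp: E_def power3_eq_cube power2_eq_square)
  then have p4: "\<rho> \<xi> ^ 2 * norm h * (80 * \<epsilon>\<^sup>2 * \<rho> \<xi> ^ 2 * E) \<le> 80 * (N ^ 3 * \<rho> \<xi> ^ 4 * E)"
    by (simp add: power4_eq_xxxx power2_eq_square mult_ac)
  have p0: "0 \<le> N ^ 3 * \<rho> \<xi> ^ 4 * E" using r N0 by (simp add: E_def)
  define M where "M = \<rho> \<xi> ^ 2 * norm h * (80 * \<epsilon>\<^sup>2 * \<rho> \<xi> ^ 2 * E)"
  have eqs: "(\<rho> \<xi> ^ 2 * norm h / 4) * (80 * \<epsilon>\<^sup>2 * \<rho> \<xi> ^ 2 * E) = M / 4"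
    "(\<rho> \<xi> ^ 2 * norm h / 8) * (80 * \<epsilon>\<^sup>2 * \<rho> \<xi> ^ 2 * E) = M / 8"
    "2 * N ^ 3 * \<rho> \<xi> ^ 4 * E = 2 * (N ^ 3 * \<rho> \<xi> ^ 4 * E)"
    by (simp_all add: M_def)
  have "\<bar>heat a (\<xi> - h) - heat a \<xi> + \<epsilon> * (\<Sum>k\<in>UNIV. \<eta> $ k * dG k \<xi>)
       - \<epsilon>\<^sup>2 / 2 * (\<Sum>k\<in>UNIV. \<Sum>l\<in>UNIV. \<eta> $ k * \<eta> $ l * ddG k l \<xi>)\<bar> \<le> 112 * (N ^ 3 * \<rho> \<xi> ^ 4 * E)"
    unfolding eq using T[unfolded eqs] b1[folded M_def] b2[unfolded eqs] b3[unfolded eqs] p4[folded M_def] p0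
    by linarith
  then show ?thesis by (simp add: h_def a_def E_def N_def mult_ac)
qed

text \<open>Two regimes in one inequality.  Where Taylor expansion applies, \<open>\<epsilon> * \<rho> \<eta> \<le> 2\<close> and the second-order remainder may be lowered to the
  power \<open>p\<close>.  Elsewhere \<open>2 * (\<epsilon> * \<rho> \<eta>) \<ge> 1\<close>: the terms subtracted are raised to the power \<open>p\<close>, and the kernel itself is kept
  with the weight \<open>\<rho> \<xi> powr m\<close> moved onto \<open>\<epsilon> \<eta>\<close>, which gains \<open>\<epsilon> powr m\<close>.  An intermediate power \<open>p\<close> is needed because
  only moments of order less than \<open>m - 3/2\<close> are controlled by the norm.\<close>
lemma dheat_expansion_weighted:
  assumes m: "0 \<le> m" and p: "1 \<le> p" "p \<le> 2" and e: "0 < \<epsilon>" "\<epsilon> < 1"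
  shows "\<rho> \<xi> powr m * \<bar>dheat j (1 - \<epsilon>\<^sup>2) (\<xi> - \<epsilon> *\<^sub>R \<eta>) - dG j \<xi> + \<epsilon> * (\<Sum>k\<in>UNIV. \<eta> $ k * ddG j k \<xi>)\<bar>
     \<le> 440 * exp (4 * (m + 4)\<^sup>2) * (\<epsilon> * \<rho> \<eta>) powr p * exp (- (norm \<xi>)\<^sup>2 / 16)
       + exp (4 * m\<^sup>2) * 2 powr m * (\<epsilon> * \<rho> \<eta>) powr m
          * ((1 - \<epsilon>\<^sup>2) powr (-2) * exp (- (norm (\<xi> - \<epsilon> *\<^sub>R \<eta>))\<^sup>2 / (16 * (1 - \<epsilon>\<^sup>2))))"
    (is "?L \<le> ?A + ?B")
proof -
  define h where "h = \<epsilon> *\<^sub>R \<eta>"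
  define a where "a = 1 - \<epsilon>\<^sup>2"
  define N where "N = \<epsilon> * \<rho> \<eta>"
  define E where "E = exp (- (norm \<xi>)\<^sup>2 / 8)"
  have a: "0 < a" "a \<le> 1" using e by (auto simp: a_def power_less_one_iff)
  have N0: "0 < N" using e rho_pos by (simp add: N_def)
  have r: "\<rho> \<xi> \<ge> 1" by (rule rho_ge_1)
  note near = kernel_near_weight[OF m, of \<xi>, folded E_def]
  show ?thesis
  proof (cases "norm h \<le> 1 \<and> \<epsilon>\<^sup>2 \<le> 1/2")
    case True
    have B0: "0 \<le> ?B" by simp
    \<comment> \<open>as \<open>N = \<epsilon> + norm h\<close>\<close>
    have "N \<le> 2" using True e by (simp add: N_def \<rho>_def h_def algebra_simps)
    have "N\<^sup>2 = N powr p * N powr (2 - p)" using N0 by (simp flip: powr_add)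
    moreover have "N powr (2 - p) \<le> 2 powr (2 - p)" using \<open>N \<le> 2\<close> N0 p by (intro powr_mono2) auto
    moreover have "2 powr (2 - p) \<le> 2 powr (2::real)" using p by (intro powr_mono) auto
    ultimately have N2: "N\<^sup>2 \<le> N powr p * 4" by (simp add: mult_left_mono)
    have "\<bar>dheat j a (\<xi> - h) - dG j \<xi> + \<epsilon> * (\<Sum>k\<in>UNIV. \<eta> $ k * ddG j k \<xi>)\<bar>
        \<le> 110 * N\<^sup>2 * (\<rho> \<xi> ^ 4 * E)"
      using dheat_expansion_near[of \<epsilon> \<eta> j \<xi>] e True by (simp add: a_def h_def N_def E_def)
    also have "\<dots> \<le> 110 * (N powr p * 4) * (\<rho> \<xi> ^ 4 * E)"
      using N2 r by (intro mult_right_mono) (auto simp: E_def)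
    finally have "?L \<le> \<rho> \<xi> powr m * (110 * (N powr p * 4) * (\<rho> \<xi> ^ 4 * E))"
      by (intro mult_left_mono) (auto simp: a_def h_def)
    also have "\<dots> = 440 * N powr p * (\<rho> \<xi> powr m * (\<rho> \<xi> ^ 4 * E))" by simp
    also have "\<dots> \<le> 440 * N powr p * (exp (4 * (m + 4)\<^sup>2) * exp (- (norm \<xi>)\<^sup>2 / 16))"
      using near by (intro mult_left_mono) auto
    also have "\<dots> = ?A" by (simp add: N_def)
    finally show ?thesis using B0 by linarith
  next
    case False
    then have far: "\<rho> h \<le> 2 * N" using rho_scale_cases[OF e] by (simp add: h_def N_def)
    then have N1: "1 \<le> 2 * N" using rho_ge_1[of h] by linarith
    have "2 * N \<le> (2 * N) powr p" using powr_mono[of 1 p "2 * N"] N1 p by simp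
    also have "\<dots> = 2 powr p * N powr p" by (rule powr_mult)
    also have "\<dots> \<le> 2 powr 2 * N powr p" using p by (intro mult_right_mono powr_mono) auto
    finally have hp: "\<rho> h \<le> 4 * N powr p" using far by simp
    have x: "\<bar>\<xi> $ j\<bar> \<le> \<rho> \<xi>" "norm \<xi> \<le> \<rho> \<xi>" "\<bar>h $ j\<bar> \<le> norm h" "norm h \<le> \<rho> h"
      using component_le_norm_cart[of \<xi> j] component_le_norm_cart[of h j] by (auto simp: \<rho>_def)
    have xh: "\<bar>\<xi> \<bullet> h\<bar> \<le> \<rho> \<xi> * \<rho> h"
      using Cauchy_Schwarz_ineq2[of \<xi> h] mult_mono[OF x(2) x(4)] r by simp
    have "\<bar>\<xi> $ j * (\<xi> \<bullet> h)\<bar> \<le> \<rho> \<xi> * (\<rho> \<xi> * \<rho> h)"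
      unfolding abs_mult using x xh r by (intro mult_mono) auto
    then have y1: "\<bar>\<xi> $ j * (\<xi> \<bullet> h)\<bar> \<le> \<rho> \<xi> ^ 2 * \<rho> h" by (simp add: power2_eq_square mult_ac)
    have r2: "\<rho> \<xi> \<le> \<rho> \<xi> ^ 2" "1 \<le> \<rho> \<xi> ^ 2" using self_le_power[OF r, of 2] one_le_power[OF r, of 2] by auto
    have y2: "\<bar>\<xi> $ j\<bar> \<le> \<rho> \<xi> ^ 2 * \<rho> h" using x(1) r2 rho_ge_1[of h] mult_left_mono[of 1 "\<rho> h" "\<rho> \<xi> ^ 2"] by simp
    have y3: "\<bar>h $ j\<bar> \<le> \<rho> \<xi> ^ 2 * \<rho> h" using x(3,4) mult_right_mono[OF r2(2), of "\<rho> h"] rho_pos[of h] by linarith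
    have "\<bar>- (\<xi> $ j / 2) - (\<xi> $ j * (\<xi> \<bullet> h) / 4 - h $ j / 2)\<bar> \<le> 2 * (\<rho> \<xi> ^ 2 * \<rho> h)"
      using y1 y2 y3 by linarith
    also have "\<dots> \<le> 2 * (\<rho> \<xi> ^ 4 * \<rho> h)"
      using r rho_pos[of h] by (intro mult_left_mono mult_right_mono power_increasing) auto
    finally have "\<bar>(- (\<xi> $ j / 2) - (\<xi> $ j * (\<xi> \<bullet> h) / 4 - h $ j / 2)) * G \<xi>\<bar> \<le> 2 * (\<rho> \<xi> ^ 4 * \<rho> h) * E"
      unfolding abs_mult using G_nonneg[of \<xi>] order_trans[OF G_le[of \<xi>], of E] rho_pos[of h]
      by (intro mult_mono) (auto simp: E_def)
    moreover have "(\<Sum>k\<in>UNIV. h $ k * ddG j k \<xi>) = \<epsilon> * (\<Sum>k\<in>UNIV. \<eta> $ k * ddG j k \<xi>)"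
      by (simp add: h_def sum_distrib_left mult_ac)
    ultimately have Q: "\<bar>dG j \<xi> - \<epsilon> * (\<Sum>k\<in>UNIV. \<eta> $ k * ddG j k \<xi>)\<bar> \<le> 2 * (\<rho> \<xi> ^ 4 * \<rho> h) * E"
      by (simp add: sum_ddG dG_def algebra_simps)
    have "?L \<le> \<rho> \<xi> powr m * (a powr (-2) * exp (- (norm (\<xi> - h))\<^sup>2 / (8 * a)) + 2 * (\<rho> \<xi> ^ 4 * \<rho> h) * E)"
      using Q dheat_le[OF a(1), of j "\<xi> - h"] by (intro mult_left_mono) (auto simp: h_def a_def)
    also have "\<dots> = a powr (-2) * (\<rho> \<xi> powr m * exp (- (norm (\<xi> - h))\<^sup>2 / (8 * a)))
       + 2 * \<rho> h * (\<rho> \<xi> powr m * (\<rho> \<xi> ^ 4 * E))"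
      by (simp add: algebra_simps)
    also have "\<dots> \<le> a powr (-2) * (exp (4 * m\<^sup>2) * (2 * N) powr m * exp (- (norm (\<xi> - h))\<^sup>2 / (16 * a)))
       + 2 * (4 * N powr p) * (exp (4 * (m + 4)\<^sup>2) * exp (- (norm \<xi>)\<^sup>2 / 16))"
      using hp r rho_pos[of h]
      by (intro add_mono mult_mono[OF _ near] mult_left_mono[OF kernel_far_weight[OF a far m]]) (auto simp: E_def)
    also have "\<dots> \<le> ?B + ?A"
    proof (intro add_mono)
      show "a powr (-2) * (exp (4 * m\<^sup>2) * (2 * N) powr m * exp (- (norm (\<xi> - h))\<^sup>2 / (16 * a))) \<le> ?B"
        using N0 by (simp add: powr_mult N_def h_def a_def mult_ac)
    qed (simp add: N_def)
    finally show ?thesis by linarith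
  qed
qed

lemma abs_combination_le:
  fixes u s n z :: real
  assumes "\<bar>u\<bar> \<le> z" "0 \<le> s" "s \<le> z" "0 \<le> n" "n \<le> z"
  shows "\<bar>- u / 2 - (s / 4 - n / 2) / 2\<bar> \<le> 2 * z"
proof -
  have "- u / 2 - (s / 4 - n / 2) / 2 \<le> 2 * z" "- (- u / 2 - (s / 4 - n / 2) / 2) \<le> 2 * z"
    using assms by (simp_all add: abs_le_iff field_simps)
  then show ?thesis by (simp add: abs_le_iff)
qed

text \<open>The width of the zeroth term is cut off at \<open>1/2\<close>: this term is integrated against a density of mass zero, so its width is free, and the
  cut-off keeps it bounded as \<open>\<epsilon>\<close> tends to \<open>1\<close>, that is, for small times.\<close>
lemma heat_expansion_weighted:
  assumes m: "0 \<le> m" and p: "2 \<le> p" "p \<le> 3" and e: "0 < \<epsilon>" "\<epsilon> < 1"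
  shows "\<rho> \<xi> powr m * \<bar>heat (1 - \<epsilon>\<^sup>2) (\<xi> - \<epsilon> *\<^sub>R \<eta>) - heat (max (1 - \<epsilon>\<^sup>2) (1/2)) \<xi>
         + \<epsilon> * (\<Sum>k\<in>UNIV. \<eta> $ k * dG k \<xi>)
         - \<epsilon>\<^sup>2 / 2 * (\<Sum>k\<in>UNIV. \<Sum>l\<in>UNIV. \<eta> $ k * \<eta> $ l * ddG k l \<xi>)\<bar>
     \<le> 440 * exp (4 * (m + 4)\<^sup>2) * (\<epsilon> * \<rho> \<eta>) powr p * exp (- (norm \<xi>)\<^sup>2 / 16)
       + exp (4 * m\<^sup>2) * 2 powr m * (\<epsilon> * \<rho> \<eta>) powr m
          * ((1 - \<epsilon>\<^sup>2) powr (-(3/2)) * exp (- (norm (\<xi> - \<epsilon> *\<^sub>R \<eta>))\<^sup>2 / (16 * (1 - \<epsilon>\<^sup>2))))"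
    (is "?L \<le> ?A + ?B")
proof -
  define h where "h = \<epsilon> *\<^sub>R \<eta>"
  define a where "a = 1 - \<epsilon>\<^sup>2"
  define N where "N = \<epsilon> * \<rho> \<eta>"
  define E where "E = exp (- (norm \<xi>)\<^sup>2 / 8)"
  have a: "0 < a" "a \<le> 1" using e by (auto simp: a_def power_less_one_iff)
  have N0: "0 < N" using e rho_pos by (simp add: N_def)
  have r: "\<rho> \<xi> \<ge> 1" by (rule rho_ge_1)
  note near = kernel_near_weight[OF m, of \<xi>, folded E_def]
  show ?thesis
  proof (cases "norm h \<le> 1 \<and> \<epsilon>\<^sup>2 \<le> 1/2")
    case True
    have B0: "0 \<le> ?B" by simp
    have mx: "max (1 - \<epsilon>\<^sup>2) (1/2) = a" using True by (simp add: a_def)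
    \<comment> \<open>as \<open>N = \<epsilon> + norm h\<close>\<close>
    have "N \<le> 2" using True e by (simp add: N_def \<rho>_def h_def algebra_simps)
    have "N ^ 3 = N powr p * N powr (3 - p)" using N0 by (simp flip: powr_add)
    moreover have "N powr (3 - p) \<le> 2 powr (3 - p)" using \<open>N \<le> 2\<close> N0 p by (intro powr_mono2) auto
    moreover have "2 powr (3 - p) \<le> 2 powr (1::real)" using p by (intro powr_mono) auto
    ultimately have N2: "N ^ 3 \<le> N powr p * 2" by (simp add: mult_left_mono)
    have "\<bar>heat a (\<xi> - h) - heat a \<xi> + \<epsilon> * (\<Sum>k\<in>UNIV. \<eta> $ k * dG k \<xi>)
         - \<epsilon>\<^sup>2 / 2 * (\<Sum>k\<in>UNIV. \<Sum>l\<in>UNIV. \<eta> $ k * \<eta> $ l * ddG k l \<xi>)\<bar>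
        \<le> 112 * N ^ 3 * (\<rho> \<xi> ^ 4 * E)"
      using heat_expansion_near[of \<epsilon> \<eta> \<xi>] e True by (simp add: a_def h_def N_def E_def)
    also have "\<dots> \<le> 112 * (N powr p * 2) * (\<rho> \<xi> ^ 4 * E)"
      using N2 r by (intro mult_right_mono) (auto simp: E_def)
    finally have "?L \<le> \<rho> \<xi> powr m * (112 * (N powr p * 2) * (\<rho> \<xi> ^ 4 * E))"
      unfolding mx by (intro mult_left_mono) (auto simp: a_def h_def)
    also have "\<dots> = 224 * N powr p * (\<rho> \<xi> powr m * (\<rho> \<xi> ^ 4 * E))" by simp
    also have "\<dots> \<le> 440 * N powr p * (exp (4 * (m + 4)\<^sup>2) * exp (- (norm \<xi>)\<^sup>2 / 16))"
      using r by (intro mult_mono[OF _ near]) (auto simp: E_def)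
    also have "\<dots> = ?A" by (simp add: N_def)
    finally show ?thesis using B0 by linarith
  next
    case False
    then have far: "\<rho> h \<le> 2 * N" using rho_scale_cases[OF e] by (simp add: h_def N_def)
    then have N1: "1 \<le> 2 * N" using rho_ge_1[of h] by linarith
    have "(2 * N)\<^sup>2 \<le> (2 * N) powr p" using powr_mono[of 2 p "2 * N"] N1 p N0 by simp
    also have "\<dots> = 2 powr p * N powr p" by (rule powr_mult)
    also have "\<dots> \<le> 2 powr 3 * N powr p" using p by (intro mult_right_mono powr_mono) auto
    finally have "(2 * N)\<^sup>2 \<le> 8 * N powr p" by simp
    moreover have "(\<rho> h)\<^sup>2 \<le> (2 * N)\<^sup>2" using far rho_pos[of h] by (intro power_mono) auto
    ultimately have hp: "(\<rho> h)\<^sup>2 \<le> 8 * N powr p" by linarith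
    have x: "norm \<xi> \<le> \<rho> \<xi>" "norm h \<le> \<rho> h" by (auto simp: \<rho>_def)
    have rh: "1 \<le> \<rho> h" by (rule rho_ge_1)
    define Z where "Z = \<rho> \<xi> ^ 2 * (\<rho> h)\<^sup>2"
    have rr: "1 \<le> \<rho> \<xi> * \<rho> h" using mult_mono[OF r rh] r by simp
    have Z1: "\<rho> \<xi> * \<rho> h \<le> Z" "(\<rho> h)\<^sup>2 \<le> Z" "1 \<le> Z"
      using self_le_power[OF rr, of 2] one_le_power[OF rr, of 2] rh
        mult_right_mono[OF one_le_power[OF r, of 2], of "(\<rho> h)\<^sup>2"]
      by (auto simp: Z_def power_mult_distrib)
    have xh: "\<bar>\<xi> \<bullet> h\<bar> \<le> \<rho> \<xi> * \<rho> h"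
      using Cauchy_Schwarz_ineq2[of \<xi> h] mult_mono[OF x] r by simp
    then have "(\<xi> \<bullet> h)\<^sup>2 \<le> (\<rho> \<xi> * \<rho> h)\<^sup>2" by (rule abs_le_square_iff[THEN iffD1, OF order_trans]) simp
    then have y1: "(\<xi> \<bullet> h)\<^sup>2 \<le> Z" by (simp add: Z_def power_mult_distrib)
    have y2: "\<bar>\<xi> \<bullet> h\<bar> \<le> Z" using xh Z1 by linarith
    have "(norm h)\<^sup>2 \<le> (\<rho> h)\<^sup>2" using x by (intro power_mono) auto
    then have y3: "(norm h)\<^sup>2 \<le> Z" using Z1 by linarith
    have y4: "(norm h)\<^sup>2 \<ge> 0" "(\<xi> \<bullet> h)\<^sup>2 \<ge> 0" by auto
    have "\<bar>- (\<xi> \<bullet> h) / 2 - ((\<xi> \<bullet> h)\<^sup>2 / 4 - (norm h)\<^sup>2 / 2) / 2\<bar> \<le> 2 * Z"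
      by (rule abs_combination_le[OF y2 y4(2) y1 y4(1) y3])
    then have "\<bar>(- (\<xi> \<bullet> h) / 2 - ((\<xi> \<bullet> h)\<^sup>2 / 4 - (norm h)\<^sup>2 / 2) / 2) * G \<xi>\<bar> \<le> 2 * Z * E"
      unfolding abs_mult using G_nonneg[of \<xi>] order_trans[OF G_le[of \<xi>], of E] Z1
      by (intro mult_mono) (auto simp: E_def)
    moreover have "\<epsilon> * (\<Sum>k\<in>UNIV. \<eta> $ k * dG k \<xi>) = - ((\<xi> \<bullet> h) / 2 * G \<xi>)"
      unfolding sum_dG[symmetric] by (simp add: h_def sum_distrib_left mult_ac)
    moreover have "\<epsilon>\<^sup>2 / 2 * (\<Sum>k\<in>UNIV. \<Sum>l\<in>UNIV. \<eta> $ k * \<eta> $ l * ddG k l \<xi>)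
      = ((\<xi> \<bullet> h)\<^sup>2 / 4 - (norm h)\<^sup>2 / 2) * G \<xi> / 2"
      unfolding sum_sum_ddG[symmetric] by (simp add: h_def sum_distrib_left mult_ac power2_eq_square)
    ultimately have Q: "\<bar>\<epsilon> * (\<Sum>k\<in>UNIV. \<eta> $ k * dG k \<xi>)
        - \<epsilon>\<^sup>2 / 2 * (\<Sum>k\<in>UNIV. \<Sum>l\<in>UNIV. \<eta> $ k * \<eta> $ l * ddG k l \<xi>)\<bar> \<le> 2 * Z * E"
      by (simp only: algebra_simps) (simp add: algebra_simps)
    define b where "b = max a (1/2)"
    have b: "1/2 \<le> b" "b \<le> 1" using a by (auto simp: b_def)
    have "heat b \<xi> \<le> 1 * exp (- (norm \<xi>)\<^sup>2 / 8)"
      unfolding heat_def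
    proof (intro mult_mono)
      show "(4 * pi * b) powr - (3 / 2) \<le> 1" using heat_exponent_bounds(5)[OF b, of 0 0] by simp
      have "(norm \<xi>)\<^sup>2 / 8 \<le> (norm \<xi>)\<^sup>2 / (4 * b)" using b by (intro divide_left_mono) auto
      then show "exp (- (norm \<xi>)\<^sup>2 / (4 * b)) \<le> exp (- (norm \<xi>)\<^sup>2 / 8)" by simp
    qed auto
    also have "\<dots> \<le> Z * E" using Z1 by (intro mult_mono) (auto simp: E_def)
    finally have hb: "\<bar>heat b \<xi>\<bar> \<le> Z * E" using heat_nonneg[of b \<xi>] by simp
    have "heat a (\<xi> - h) \<le> a powr (-(3/2)) * exp (- (norm (\<xi> - h))\<^sup>2 / (4 * a))"
      by (rule heat_le[OF a(1)])
    also have "\<dots> \<le> a powr (-(3/2)) * exp (- (norm (\<xi> - h))\<^sup>2 / (8 * a))"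
    proof -
      have "(norm (\<xi> - h))\<^sup>2 / (8 * a) \<le> (norm (\<xi> - h))\<^sup>2 / (4 * a)" using a by (intro divide_left_mono) auto
      then show ?thesis by (intro mult_left_mono) auto
    qed
    finally have ha: "\<bar>heat a (\<xi> - h)\<bar> \<le> a powr (-(3/2)) * exp (- (norm (\<xi> - h))\<^sup>2 / (8 * a))"
      using heat_nonneg[of a "\<xi> - h"] by simp
    have ZE: "3 * Z * E \<le> 3 * (\<rho> \<xi> ^ 4 * (\<rho> h)\<^sup>2) * E"
      unfolding Z_def using r by (intro mult_left_mono mult_right_mono power_increasing) (auto simp: E_def)
    have "?L \<le> \<rho> \<xi> powr m * (a powr (-(3/2)) * exp (- (norm (\<xi> - h))\<^sup>2 / (8 * a)) + 3 * (\<rho> \<xi> ^ 4 * (\<rho> h)\<^sup>2) * E)"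
      using Q ha hb ZE unfolding a_def[symmetric] h_def[symmetric] b_def[symmetric] by (intro mult_left_mono, linarith, simp)
    also have "\<dots> = a powr (-(3/2)) * (\<rho> \<xi> powr m * exp (- (norm (\<xi> - h))\<^sup>2 / (8 * a)))
       + 3 * (\<rho> h)\<^sup>2 * (\<rho> \<xi> powr m * (\<rho> \<xi> ^ 4 * E))"
      by (simp add: algebra_simps)
    also have "\<dots> \<le> a powr (-(3/2)) * (exp (4 * m\<^sup>2) * (2 * N) powr m * exp (- (norm (\<xi> - h))\<^sup>2 / (16 * a)))
       + 3 * (8 * N powr p) * (exp (4 * (m + 4)\<^sup>2) * exp (- (norm \<xi>)\<^sup>2 / 16))"
      using hp r rho_pos[of h]
      by (intro add_mono mult_mono[OF _ near] mult_left_mono[OF kernel_far_weight[OF a far m]]) (auto simp: E_def)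
    also have "\<dots> \<le> ?B + ?A"
    proof (intro add_mono)
      show "a powr (-(3/2)) * (exp (4 * m\<^sup>2) * (2 * N) powr m * exp (- (norm (\<xi> - h))\<^sup>2 / (16 * a))) \<le> ?B"
        using N0 by (simp add: powr_mult N_def h_def a_def mult_ac)
    qed (simp add: N_def)
    finally show ?thesis by linarith
  qed
qed

section \<open>Weighted energies and Gaussian integrals\<close>

text \<open>The square of the weighted norm as an extended nonnegative number: estimates can be stated before finiteness is known.\<close>
definition wnorm_sq :: "real \<Rightarrow> (real^3 \<Rightarrow> 'b::euclidean_space) \<Rightarrow> ennreal"
  where "wnorm_sq m f = (\<integral>\<^sup>+\<xi>. ennreal ((\<rho> \<xi> powr m * norm (f \<xi>))\<^sup>2) \<partial>lborel)"

text \<open>A Gaussian wide enough to dominate the heat kernel of width \<open>a\<close> and its first derivatives, times powers of the weight, up to a power of \<open>a\<close>.\<close>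
definition gauss_env :: "real \<Rightarrow> real^3 \<Rightarrow> real"
  where "gauss_env a x = exp (- (norm x)\<^sup>2 / (16 * a))"

text \<open>The potential of the weighted energy density with kernel \<open>norm x powr (- 3/2)\<close>.  Any exponent strictly between \<open>1\<close> and \<open>2\<close> would serve: the
  complementary part of the squared Biot-Savart kernel, here \<open>norm x powr (- 5/2)\<close>, must be locally integrable, and the
  potential must be so mild that averaging it over a Gaussian of width \<open>a\<close> leaves an integrable singularity in time.\<close>
definition energy_potential :: "real \<Rightarrow> (real^3 \<Rightarrow> 'b::euclidean_space) \<Rightarrow> real^3 \<Rightarrow> ennreal"
  where "energy_potential m w \<eta> = (\<integral>\<^sup>+\<zeta>. ennreal (norm (\<eta> - \<zeta>) powr (-(3/2))) * ennreal ((\<rho> \<zeta> powr m * norm (w \<zeta>))\<^sup>2) \<partial>lborel)"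

lemma measurable_rho [measurable]: "\<rho> \<in> borel_measurable borel"
  unfolding \<rho>_def[abs_def] by measurable

lemma measurable_gauss_env [measurable]: "gauss_env a \<in> borel_measurable borel"
  unfolding gauss_env_def[abs_def] by measurable

lemma gauss_env_nonneg: "0 \<le> gauss_env a x" unfolding gauss_env_def by simp

lemma nn_integral_bound_real:
  assumes "(M::ennreal) < \<infinity>" shows "\<exists>c\<ge>0. M \<le> ennreal c"
  using assms by (intro exI[of _ "enn2real M"]) (auto simp: less_top)

lemma square_add_le_ennreal: "((x::ennreal) + y)\<^sup>2 \<le> 2 * x\<^sup>2 + 2 * y\<^sup>2"
proof (cases "x = \<infinity> \<or> y = \<infinity>")
  case True
  then show ?thesis by (auto simp: power2_eq_square ennreal_mult_top ennreal_top_mult)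
next
  case False
  then obtain u v where uv: "x = ennreal u" "y = ennreal v" "u \<ge> 0" "v \<ge> 0"
    by (metis ennreal_cases infinity_ennreal_def)
  have "(u + v)\<^sup>2 \<le> 2 * u\<^sup>2 + 2 * v\<^sup>2"
    using zero_le_power2[of "u - v"] by (simp add: power2_eq_square algebra_simps)
  then have "ennreal ((u + v)\<^sup>2) \<le> ennreal (2 * u\<^sup>2 + 2 * v\<^sup>2)" by (rule ennreal_leI)
  moreover have "ennreal (2 * u\<^sup>2 + 2 * v\<^sup>2) = 2 * ennreal (u\<^sup>2) + 2 * ennreal (v\<^sup>2)"
    by (simp add: ennreal_plus ennreal_mult)
  moreover have "ennreal ((u + v)\<^sup>2) = (x + y)\<^sup>2" using uv by (simp add: ennreal_power flip: ennreal_plus)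
  ultimately show ?thesis using uv by (simp add: ennreal_power)
qed

lemma Cauchy_Schwarz_weighted:
  fixes k u v :: "'a \<Rightarrow> real"
  assumes [measurable]: "k \<in> borel_measurable M" "u \<in> borel_measurable M" "v \<in> borel_measurable M"
    and nn: "\<And>x. 0 \<le> k x" "\<And>x. 0 \<le> u x" "\<And>x. 0 \<le> v x"
  shows "(\<integral>\<^sup>+x. ennreal (k x * (u x * v x)) \<partial>M)\<^sup>2
    \<le> (\<integral>\<^sup>+x. ennreal (k x * (u x)\<^sup>2) \<partial>M) * (\<integral>\<^sup>+x. ennreal (k x * (v x)\<^sup>2) \<partial>M)"
proof -
  have eq: "ennreal (k x * (u x * v x)) = ennreal (sqrt (k x) * u x) * ennreal (sqrt (k x) * v x)" for x
    using nn[of x] by (simp add: ac_simps flip: ennreal_mult)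
  have sq: "(ennreal (sqrt (k x) * y))\<^sup>2 = ennreal (k x * y\<^sup>2)" if "0 \<le> y" for x y
    using nn(1)[of x] that by (simp add: ennreal_power power_mult_distrib)
  show ?thesis
    unfolding eq
    using Cauchy_Schwarz_nn_integral[of "\<lambda>x. ennreal (sqrt (k x) * u x)" M "\<lambda>x. ennreal (sqrt (k x) * v x)"]
    by (simp add: sq nn)
qed

lemma DIM_real3: "real DIM(real^3) = 3" by simp

lemma rho_integral_finite:
  assumes "3 < q" shows "(\<integral>\<^sup>+x. ennreal (\<rho> x powr (-q)) \<partial>lborel) < \<infinity>"
proof -
  have "real DIM(real^3) < q" by (subst DIM_real3) (rule assms)
  then show ?thesis unfolding \<rho>_def by (rule nn_integral_inverse_power_decay_finite[where q = q])
qed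

lemma gauss_env_integral_finite: "(\<integral>\<^sup>+x. ennreal (gauss_env 1 x) \<partial>lborel) < \<infinity>"
proof -
  have "gauss_env 1 x \<le> exp (5\<^sup>2 / (4 * (1/16))) * (1 + norm x) powr (- 5)" for x
  proof -
    have "\<rho> x powr 5 \<le> exp (5\<^sup>2 / (4 * (1/16))) * exp (1/16 * (norm x)\<^sup>2)"
      by (rule rho_powr_le_exp) auto
    then have "\<rho> x powr 5 * gauss_env 1 x \<le> exp (5\<^sup>2 / (4 * (1/16))) * exp (1/16 * (norm x)\<^sup>2) * gauss_env 1 x"
      by (intro mult_right_mono gauss_env_nonneg) auto
    also have "\<dots> = exp (5\<^sup>2 / (4 * (1/16)))" by (simp add: gauss_env_def mult.assoc flip: exp_add)
    finally have "\<rho> x powr 5 * gauss_env 1 x * \<rho> x powr (-5) \<le> exp (5\<^sup>2 / (4 * (1/16))) * \<rho> x powr (-5)"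
      by (intro mult_right_mono) auto
    moreover have "\<rho> x powr 5 * gauss_env 1 x * \<rho> x powr (-5) = gauss_env 1 x"
    proof -
      have "\<rho> x powr 5 * \<rho> x powr (-5) = 1" using rho_pos[of x] by (simp add: powr_minus)
      then show ?thesis by (metis mult.assoc mult.commute mult_1)
    qed
    ultimately show ?thesis unfolding \<rho>_def by (simp only:)
  qed
  then have "(\<integral>\<^sup>+x. ennreal (gauss_env 1 x) \<partial>lborel)
    \<le> (\<integral>\<^sup>+x. ennreal (exp (5\<^sup>2 / (4 * (1/16)))) * ennreal ((1 + norm (x::real^3)) powr (- 5)) \<partial>lborel)"
    by (intro nn_integral_mono) (simp flip: ennreal_mult')
  also have "\<dots> = ennreal (exp (5\<^sup>2 / (4 * (1/16)))) * (\<integral>\<^sup>+x. ennreal ((1 + norm (x::real^3)) powr (- 5)) \<partial>lborel)"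
    by (rule nn_integral_cmult) measurable
  also have "\<dots> < \<infinity>"
  proof -
    have "(3::real) < 5" by simp
    from rho_integral_finite[OF this] show ?thesis by (simp only: \<rho>_def) (simp add: ennreal_mult_less_top)
  qed
  finally show ?thesis .
qed

lemma rho_singular_bounded:
  assumes q: "3 < q" and p: "0 \<le> p" "p < 3"
  shows "\<exists>C\<ge>0. \<forall>t. (\<integral>\<^sup>+x. ennreal (\<rho> x powr (-q)) * ennreal (norm (t - x) powr (-p)) \<partial>lborel) \<le> ennreal C"
proof -
  let ?I = "\<integral>\<^sup>+x. ennreal (norm (x::real^3) powr (-p)) * indicator (ball 0 1) x \<partial>lborel"
  let ?J = "\<integral>\<^sup>+x. ennreal (\<rho> x powr (-q)) \<partial>lborel"
  have "?I < \<infinity>" by (rule nn_integral_singularity_finite) (use p in \<open>simp_all add: DIM_real3\<close>)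
  then have "1 * ?I + ?J < \<infinity>" using rho_integral_finite[OF q] by (simp add: less_top)
  then obtain C where C: "C \<ge> 0" "1 * ?I + ?J \<le> ennreal C" using nn_integral_bound_real by blast
  have b: "ennreal (\<rho> x powr (-q)) \<le> 1" for x
    using powr_mono2'[of "-q" 1 "\<rho> x"] rho_ge_1[of x] q by simp
  have "(\<integral>\<^sup>+x. ennreal (\<rho> x powr (-q)) * ennreal (norm (t - x) powr (-p)) \<partial>lborel) \<le> 1 * ?I + ?J" for t
    by (rule nn_integral_singular_kernel_le[OF p(1) _ b]) measurable
  then show ?thesis using C by (meson order_trans)
qed

lemma gauss_env_scale: "0 < a \<Longrightarrow> gauss_env a (sqrt a *\<^sub>R x) = gauss_env 1 x"
  by (simp add: gauss_env_def power_mult_distrib)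

lemma sqrt_cube:
  assumes "0 < a" shows "sqrt a ^ 3 = a powr (3/2)"
proof -
  have "sqrt a ^ 3 = sqrt a powr real 3" using assms by (intro powr_realpow[symmetric]) simp
  also have "\<dots> = (a powr (1/2)) powr 3" using assms by (simp add: powr_half_sqrt)
  also have "\<dots> = a powr (3/2)" by (simp add: powr_powr)
  finally show ?thesis .
qed

lemma gauss_env_integral:
  assumes a: "0 < a"
  shows "(\<integral>\<^sup>+x. ennreal (gauss_env a x) \<partial>lborel) = ennreal (a powr (3/2)) * (\<integral>\<^sup>+x. ennreal (gauss_env 1 x) \<partial>lborel)"
proof -
  have "(\<integral>\<^sup>+x. ennreal (gauss_env a x) \<partial>lborel) = ennreal (\<bar>sqrt a\<bar> ^ DIM(real^3)) * (\<integral>\<^sup>+x. ennreal (gauss_env a (0 + sqrt a *\<^sub>R x)) \<partial>lborel)"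
    by (rule nn_integral_lborel_affine) (use a in auto)
  moreover have "\<bar>sqrt a\<bar> ^ DIM(real^3) = a powr (3/2)"
    using a sqrt_cube[OF a] by (simp del: powr_half_sqrt)
  ultimately show ?thesis
    using a by (simp only: gauss_env_scale add_0_left)
qed

lemma gauss_env_integral_outer: "(\<integral>\<^sup>+\<xi>. ennreal (gauss_env a (\<xi> - y)) \<partial>lborel) = (\<integral>\<^sup>+x. ennreal (gauss_env a x) \<partial>lborel)"
  using nn_integral_lborel_affine[of "\<lambda>x. ennreal (gauss_env a x)" 1 "- y"] by simp

lemma powr_neg_cube: "0 < (\<epsilon>::real) \<Longrightarrow> \<epsilon> powr (-3) = 1 / \<epsilon> ^ 3"
  by (simp add: powr_minus inverse_eq_divide)

lemma nn_integral_inner_affine: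
  fixes f :: "real^3 \<Rightarrow> ennreal"
  assumes f[measurable]: "f \<in> borel_measurable borel" and e: "0 < \<epsilon>"
  shows "(\<integral>\<^sup>+\<eta>. f (\<xi> - \<epsilon> *\<^sub>R \<eta>) \<partial>lborel) = ennreal (\<epsilon> powr (-3)) * (\<integral>\<^sup>+x. f x \<partial>lborel)"
proof -
  have "(\<integral>\<^sup>+x. f x \<partial>lborel) = ennreal (\<epsilon> ^ 3) * (\<integral>\<^sup>+\<eta>. f (\<xi> - \<epsilon> *\<^sub>R \<eta>) \<partial>lborel)"
    using nn_integral_lborel_affine[OF f, of "- \<epsilon>" \<xi>] e by simp
  moreover have "ennreal (\<epsilon> powr (-3)) * ennreal (\<epsilon> ^ 3) = 1"
    using e by (simp add: powr_neg_cube flip: ennreal_mult')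
  ultimately show ?thesis by (metis mult.assoc mult_1)
qed

lemma gauss_env_integral_inner:
  assumes e: "0 < \<epsilon>"
  shows "(\<integral>\<^sup>+\<eta>. ennreal (gauss_env a (\<xi> - \<epsilon> *\<^sub>R \<eta>)) \<partial>lborel) = ennreal (\<epsilon> powr (-3)) * (\<integral>\<^sup>+x. ennreal (gauss_env a x) \<partial>lborel)"
  by (rule nn_integral_inner_affine[OF _ e]) measurable

text \<open>By scaling, the variable \<open>\<eta>\<close> lives on the length \<open>sqrt a / \<epsilon>\<close>, whose cube times its power \<open>- 3/2\<close> is
  \<open>\<epsilon> powr (- 3/2) * a powr (3/4)\<close>; uniformity in the pole \<open>\<zeta>\<close> comes from the splitting at distance one.\<close>
lemma gauss_env_singular_bounded:
  "\<exists>C\<ge>0. \<forall>a>0. \<forall>\<epsilon>>0. \<forall>\<xi> \<zeta>. (\<integral>\<^sup>+\<eta>. ennreal (gauss_env a (\<xi> - \<epsilon> *\<^sub>R \<eta>)) * ennreal (norm (\<eta> - \<zeta>) powr (-(3/2))) \<partial>lborel)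
     \<le> ennreal (C * \<epsilon> powr (-(3/2)) * a powr (3/4))"
proof -
  let ?I = "\<integral>\<^sup>+x. ennreal (norm (x::real^3) powr (-(3/2))) * indicator (ball 0 1) x \<partial>lborel"
  let ?J = "\<integral>\<^sup>+x. ennreal (gauss_env 1 x) \<partial>lborel"
  have p: "(0::real) \<le> 3/2" "3/2 < real DIM(real^3)" by (simp, subst DIM_real3, simp)
  have "?I < \<infinity>" by (rule nn_integral_singularity_finite[where p = "3/2", OF p])
  then have "1 * ?I + ?J < \<infinity>" using gauss_env_integral_finite by (simp add: less_top)
  then obtain C where C: "C \<ge> 0" "1 * ?I + ?J \<le> ennreal C" using nn_integral_bound_real by blast
  have b: "ennreal (gauss_env 1 x) \<le> 1" for x by (simp add: gauss_env_def)
  have one: "(\<integral>\<^sup>+x. ennreal (gauss_env 1 x) * ennreal (norm (t - x) powr (-(3/2))) \<partial>lborel) \<le> ennreal C" for t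
    by (rule order_trans[OF nn_integral_singular_kernel_le[where p = "3/2", OF p(1) _ b] C(2)]) measurable
  have two: "(\<integral>\<^sup>+x. ennreal (gauss_env a x) * ennreal (norm (t - x) powr (-(3/2))) \<partial>lborel) \<le> ennreal (C * a powr (3/4))"
    if a: "a > 0" for a t
  proof -
    have n: "norm (t - sqrt a *\<^sub>R x) powr (-(3/2)) = a powr (-(3/4)) * norm ((1 / sqrt a) *\<^sub>R t - x) powr (-(3/2))" for x
    proof -
      have "t - sqrt a *\<^sub>R x = sqrt a *\<^sub>R ((1 / sqrt a) *\<^sub>R t - x)" using a by (simp add: scaleR_diff_right)
      then have "norm (t - sqrt a *\<^sub>R x) = sqrt a * norm ((1 / sqrt a) *\<^sub>R t - x)" using a by simp
      then have "norm (t - sqrt a *\<^sub>R x) powr (-(3/2)) = sqrt a powr (-(3/2)) * norm ((1 / sqrt a) *\<^sub>R t - x) powr (-(3/2))"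
        by (simp only: powr_mult)
      then show ?thesis using a by (simp add: powr_half_sqrt[symmetric] powr_powr)
    qed
    have "(\<integral>\<^sup>+x. ennreal (gauss_env a x) * ennreal (norm (t - x) powr (-(3/2))) \<partial>lborel)
      = ennreal (a powr (3/2)) * (\<integral>\<^sup>+x. ennreal (gauss_env 1 x) * ennreal (norm (t - sqrt a *\<^sub>R x) powr (-(3/2))) \<partial>lborel)"
      using nn_integral_lborel_affine[of "\<lambda>x. ennreal (gauss_env a x) * ennreal (norm (t - x) powr (-(3/2)))" "sqrt a" 0] a
      by (simp add: gauss_env_scale sqrt_cube)
    also have "(\<integral>\<^sup>+x. ennreal (gauss_env 1 x) * ennreal (norm (t - sqrt a *\<^sub>R x) powr (-(3/2))) \<partial>lborel)
      = (\<integral>\<^sup>+x. ennreal (a powr (-(3/4))) * (ennreal (gauss_env 1 x) * ennreal (norm ((1 / sqrt a) *\<^sub>R t - x) powr (-(3/2)))) \<partial>lborel)"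
      unfolding n by (simp add: ennreal_mult' mult_ac)
    also have "\<dots> = ennreal (a powr (-(3/4))) * (\<integral>\<^sup>+x. ennreal (gauss_env 1 x) * ennreal (norm ((1 / sqrt a) *\<^sub>R t - x) powr (-(3/2))) \<partial>lborel)"
      by (rule nn_integral_cmult) measurable
    also have "ennreal (a powr (3/2)) * \<dots> \<le> ennreal (a powr (3/2)) * (ennreal (a powr (-(3/4))) * ennreal C)"
      by (intro mult_left_mono one) auto
    also have "\<dots> = ennreal (C * a powr (3/4))"
      using C(1) by (simp add: powr_diff flip: ennreal_mult' mult.assoc powr_add)
    finally show ?thesis .
  qed
  have "(\<integral>\<^sup>+\<eta>. ennreal (gauss_env a (\<xi> - \<epsilon> *\<^sub>R \<eta>)) * ennreal (norm (\<eta> - \<zeta>) powr (-(3/2))) \<partial>lborel)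
     \<le> ennreal (C * \<epsilon> powr (-(3/2)) * a powr (3/4))" if a: "a > 0" and e: "\<epsilon> > 0" for a \<epsilon> \<xi> \<zeta>
  proof -
    have n: "norm (\<eta> - \<zeta>) powr (-(3/2)) = \<epsilon> powr (3/2) * norm ((\<xi> - \<epsilon> *\<^sub>R \<zeta>) - (\<xi> - \<epsilon> *\<^sub>R \<eta>)) powr (-(3/2))" for \<eta>
    proof -
      have "(\<xi> - \<epsilon> *\<^sub>R \<zeta>) - (\<xi> - \<epsilon> *\<^sub>R \<eta>) = \<epsilon> *\<^sub>R (\<eta> - \<zeta>)" by (simp add: scaleR_diff_right)
      then have "norm ((\<xi> - \<epsilon> *\<^sub>R \<zeta>) - (\<xi> - \<epsilon> *\<^sub>R \<eta>)) = \<epsilon> * norm (\<eta> - \<zeta>)" using e by simp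
      then have "norm ((\<xi> - \<epsilon> *\<^sub>R \<zeta>) - (\<xi> - \<epsilon> *\<^sub>R \<eta>)) powr (-(3/2)) = \<epsilon> powr (-(3/2)) * norm (\<eta> - \<zeta>) powr (-(3/2))"
        by (simp only: powr_mult)
      moreover have "\<epsilon> powr (3/2) * \<epsilon> powr (-(3/2)) = 1" using e by (simp flip: powr_add)
      ultimately show ?thesis by (simp flip: mult.assoc)
    qed
    have "(\<integral>\<^sup>+\<eta>. ennreal (gauss_env a (\<xi> - \<epsilon> *\<^sub>R \<eta>)) * ennreal (norm (\<eta> - \<zeta>) powr (-(3/2))) \<partial>lborel)
      = (\<integral>\<^sup>+\<eta>. ennreal (\<epsilon> powr (3/2)) * (ennreal (gauss_env a (\<xi> - \<epsilon> *\<^sub>R \<eta>)) * ennreal (norm ((\<xi> - \<epsilon> *\<^sub>R \<zeta>) - (\<xi> - \<epsilon> *\<^sub>R \<eta>)) powr (-(3/2)))) \<partial>lborel)"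
      by (intro nn_integral_cong) (subst n, simp only: ennreal_mult'[OF powr_ge_zero] mult.left_commute)
    also have "\<dots> = ennreal (\<epsilon> powr (-3)) * (\<integral>\<^sup>+x. ennreal (\<epsilon> powr (3/2)) * (ennreal (gauss_env a x) * ennreal (norm ((\<xi> - \<epsilon> *\<^sub>R \<zeta>) - x) powr (-(3/2)))) \<partial>lborel)"
      by (rule nn_integral_inner_affine[OF _ e, of "\<lambda>x. ennreal (\<epsilon> powr (3/2)) * (ennreal (gauss_env a x) * ennreal (norm ((\<xi> - \<epsilon> *\<^sub>R \<zeta>) - x) powr (-(3/2))))"]) measurable
    also have "\<dots> = ennreal (\<epsilon> powr (-3)) * (ennreal (\<epsilon> powr (3/2)) * (\<integral>\<^sup>+x. ennreal (gauss_env a x) * ennreal (norm ((\<xi> - \<epsilon> *\<^sub>R \<zeta>) - x) powr (-(3/2))) \<partial>lborel))"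
      by (subst nn_integral_cmult) measurable
    also have "\<dots> \<le> ennreal (\<epsilon> powr (-3)) * (ennreal (\<epsilon> powr (3/2)) * ennreal (C * a powr (3/4)))"
      by (intro mult_left_mono two a) auto
    also have "\<dots> = ennreal (C * \<epsilon> powr (-(3/2)) * a powr (3/4))"
    proof -
      have "\<epsilon> powr (-3) * \<epsilon> powr (3/2) = \<epsilon> powr (-(3/2))" by (simp flip: powr_add)
      then have "\<epsilon> powr (-3) * (\<epsilon> powr (3/2) * (C * a powr (3/4))) = C * \<epsilon> powr (-(3/2)) * a powr (3/4)"
        by (metis mult.assoc mult.commute)
      then show ?thesis using C(1) by (simp flip: ennreal_mult')
    qed
    finally show ?thesis .
  qed
  then show ?thesis using C(1) by blast
qed

lemma measurable_energy_potential [measurable]: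
  assumes [measurable]: "w \<in> borel_measurable borel"
  shows "energy_potential m w \<in> borel_measurable borel"
  unfolding energy_potential_def[abs_def] by measurable

text \<open>Tonelli's theorem moves the integration against \<open>\<phi>\<close> inside the potential, so that a bound uniform in the pole gives the energy.\<close>
lemma nn_integral_energy_potential_le:
  assumes [measurable]: "w \<in> borel_measurable borel" "\<phi> \<in> borel_measurable borel"
    and b: "\<And>\<zeta>. (\<integral>\<^sup>+\<eta>. \<phi> \<eta> * ennreal (norm (\<eta> - \<zeta>) powr (-(3/2))) \<partial>lborel) \<le> M"
  shows "(\<integral>\<^sup>+\<eta>. \<phi> \<eta> * energy_potential m w \<eta> \<partial>lborel) \<le> M * wnorm_sq m w"
proof -
  let ?\<omega> = "\<lambda>\<zeta>. ennreal ((\<rho> \<zeta> powr m * norm (w \<zeta>))\<^sup>2)"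
  have "(\<integral>\<^sup>+\<eta>. \<phi> \<eta> * energy_potential m w \<eta> \<partial>lborel)
     = (\<integral>\<^sup>+\<eta>. (\<integral>\<^sup>+\<zeta>. \<phi> \<eta> * (ennreal (norm (\<eta> - \<zeta>) powr (-(3/2))) * ?\<omega> \<zeta>) \<partial>lborel) \<partial>lborel)"
    unfolding energy_potential_def by (intro nn_integral_cong nn_integral_cmult[symmetric]) measurable
  also have "\<dots> = (\<integral>\<^sup>+\<zeta>. (\<integral>\<^sup>+\<eta>. \<phi> \<eta> * (ennreal (norm (\<eta> - \<zeta>) powr (-(3/2))) * ?\<omega> \<zeta>) \<partial>lborel) \<partial>lborel)"
    by (rule lborel_pair.Fubini'[symmetric]) measurable
  also have "\<dots> = (\<integral>\<^sup>+\<zeta>. (\<integral>\<^sup>+\<eta>. \<phi> \<eta> * ennreal (norm (\<eta> - \<zeta>) powr (-(3/2))) \<partial>lborel) * ?\<omega> \<zeta> \<partial>lborel)"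
    by (intro nn_integral_cong) (subst nn_integral_multc[symmetric], measurable, simp add: mult_ac)
  also have "\<dots> \<le> (\<integral>\<^sup>+\<zeta>. M * ?\<omega> \<zeta> \<partial>lborel)"
    by (intro nn_integral_mono mult_right_mono b) auto
  also have "\<dots> = M * wnorm_sq m w"
    unfolding wnorm_sq_def by (rule nn_integral_cmult) measurable
  finally show ?thesis .
qed

section \<open>Biot-Savart velocities and bilinear estimates\<close>

lemma norm_integral_le_nn_integral:
  fixes f :: "'a \<Rightarrow> 'b::{banach,second_countable_topology}"
  shows "ennreal (norm (LINT x|M. f x)) \<le> (\<integral>\<^sup>+x. ennreal (norm (f x)) \<partial>M)"
proof (cases "integrable M f")
  case True then show ?thesis by (rule integral_norm_bound_ennreal)
next
  case False then show ?thesis by (simp add: not_integrable_integral_eq)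
qed

lemma norm_cross3_le: "norm (cross3 x y) \<le> norm x * norm y"
proof -
  have "(norm (cross3 x y))\<^sup>2 \<le> (norm x * norm y)\<^sup>2"
    using norm_cross_dot[of x y] zero_le_power2[of "x \<bullet> y"] by linarith
  then show ?thesis by (rule power2_le_imp_le) simp
qed

lemma measurable_cross3 [measurable]:
  assumes [measurable]: "f \<in> borel_measurable M" "g \<in> borel_measurable M"
  shows "(\<lambda>x. cross3 (f x) (g x)) \<in> borel_measurable M"
  by (rule borel_measurable_continuous_Pair) (auto intro!: continuous_on_cross continuous_intros)

lemma measurable_biot_savart [measurable]:
  assumes [measurable]: "w \<in> borel_measurable borel"
  shows "biot_savart w \<in> borel_measurable borel"
  unfolding biot_savart_def[abs_def] by measurable

text \<open>The kernel has size \<open>norm x powr (- 2)\<close>, written as a product whose factors go to the two sides of a Cauchy-Schwarz inequality.\<close>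
lemma biot_savart_kernel_norm_le:
  "norm ((1 / norm x ^ 3) *\<^sub>R cross3 x y) \<le> (norm x powr (-(5/4)) * norm x powr (-(3/4))) * norm y"
proof (cases "x = 0")
  case False
  then have n: "norm x > 0" by simp
  have "norm ((1 / norm x ^ 3) *\<^sub>R cross3 x y) \<le> 1 / norm x ^ 3 * (norm x * norm y)"
    by (simp add: norm_cross3_le divide_right_mono)
  also have "\<dots> = (1 / norm x ^ 2) * norm y" using n by (simp add: power2_eq_square power3_eq_cube)
  also have "1 / norm x ^ 2 = norm x powr (-2)" using n by (simp add: powr_minus inverse_eq_divide)
  also have "norm x powr (-2) = norm x powr (-(5/4)) * norm x powr (-(3/4))" by (simp flip: powr_add)
  finally show ?thesis .
qed simp

lemma mult_cancel_middle:
  fixes A b c D n :: real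
  assumes "b * c = 1" shows "(A * b) * (D * (c * n)) = (A * D) * n"
proof -
  have "(A * b) * (D * (c * n)) = (b * c) * ((A * D) * n)" by (simp only: mult_ac)
  then show ?thesis using assms by simp
qed

text \<open>Cauchy-Schwarz, with the weight \<open>\<rho> \<zeta> powr (- m)\<close> and the more singular factor \<open>norm x powr (- 5/4)\<close> on one side, and the
  vorticity with its weight on the other.\<close>
lemma biot_savart_potential_le:
  assumes [measurable]: "w \<in> borel_measurable borel"
  shows "(\<integral>\<^sup>+\<zeta>. ennreal (norm ((1 / norm (\<eta> - \<zeta>) ^ 3) *\<^sub>R cross3 (\<eta> - \<zeta>) (w \<zeta>))) \<partial>lborel)\<^sup>2
    \<le> (\<integral>\<^sup>+\<zeta>. ennreal (\<rho> \<zeta> powr (-(2 * m))) * ennreal (norm (\<eta> - \<zeta>) powr (-(5/2))) \<partial>lborel) * energy_potential m w \<eta>"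
proof -
  let ?f = "\<lambda>\<zeta>. ennreal (norm (\<eta> - \<zeta>) powr (-(5/4)) * \<rho> \<zeta> powr (-m))"
  let ?g = "\<lambda>\<zeta>. ennreal (norm (\<eta> - \<zeta>) powr (-(3/4)) * (\<rho> \<zeta> powr m * norm (w \<zeta>)))"
  have le: "ennreal (norm ((1 / norm (\<eta> - \<zeta>) ^ 3) *\<^sub>R cross3 (\<eta> - \<zeta>) (w \<zeta>))) \<le> ?f \<zeta> * ?g \<zeta>" for \<zeta>
  proof -
    have "\<rho> \<zeta> powr (-m) * \<rho> \<zeta> powr m = 1" using rho_pos[of \<zeta>] by (simp flip: powr_add)
    then have "(norm (\<eta> - \<zeta>) powr (-(5/4)) * \<rho> \<zeta> powr (-m)) * (norm (\<eta> - \<zeta>) powr (-(3/4)) * (\<rho> \<zeta> powr m * norm (w \<zeta>)))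
       = (norm (\<eta> - \<zeta>) powr (-(5/4)) * norm (\<eta> - \<zeta>) powr (-(3/4))) * norm (w \<zeta>)"
      by (rule mult_cancel_middle)
    then have "norm ((1 / norm (\<eta> - \<zeta>) ^ 3) *\<^sub>R cross3 (\<eta> - \<zeta>) (w \<zeta>))
      \<le> (norm (\<eta> - \<zeta>) powr (-(5/4)) * \<rho> \<zeta> powr (-m)) * (norm (\<eta> - \<zeta>) powr (-(3/4)) * (\<rho> \<zeta> powr m * norm (w \<zeta>)))"
      using biot_savart_kernel_norm_le[of "\<eta> - \<zeta>" "w \<zeta>"] by (simp only:)
    then show ?thesis by (subst ennreal_mult[symmetric]) (auto intro!: ennreal_leI)
  qed
  have "(\<integral>\<^sup>+\<zeta>. ennreal (norm ((1 / norm (\<eta> - \<zeta>) ^ 3) *\<^sub>R cross3 (\<eta> - \<zeta>) (w \<zeta>))) \<partial>lborel)\<^sup>2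
     \<le> (\<integral>\<^sup>+\<zeta>. ?f \<zeta> * ?g \<zeta> \<partial>lborel)\<^sup>2"
    by (intro power_mono nn_integral_mono le) auto
  also have "\<dots> \<le> (\<integral>\<^sup>+\<zeta>. (?f \<zeta>)\<^sup>2 \<partial>lborel) * (\<integral>\<^sup>+\<zeta>. (?g \<zeta>)\<^sup>2 \<partial>lborel)"
    by (rule Cauchy_Schwarz_nn_integral) measurable
  also have "(\<integral>\<^sup>+\<zeta>. (?g \<zeta>)\<^sup>2 \<partial>lborel) = energy_potential m w \<eta>"
    unfolding energy_potential_def
  proof (intro nn_integral_cong)
    fix \<zeta>
    have "(norm (\<eta> - \<zeta>) powr (-(3/4)))\<^sup>2 = norm (\<eta> - \<zeta>) powr (-(3/2))"
      by (simp add: power2_eq_square flip: powr_add)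
    then show "(?g \<zeta>)\<^sup>2 = ennreal (norm (\<eta> - \<zeta>) powr (-(3/2))) * ennreal ((\<rho> \<zeta> powr m * norm (w \<zeta>))\<^sup>2)"
      by (subst ennreal_power, simp) (simp only: power_mult_distrib[of "norm (\<eta> - \<zeta>) powr (-(3/4))"] ennreal_mult'[OF powr_ge_zero])
  qed
  also have "(\<integral>\<^sup>+\<zeta>. (?f \<zeta>)\<^sup>2 \<partial>lborel)
     = (\<integral>\<^sup>+\<zeta>. ennreal (\<rho> \<zeta> powr (-(2 * m))) * ennreal (norm (\<eta> - \<zeta>) powr (-(5/2))) \<partial>lborel)"
  proof (intro nn_integral_cong)
    fix \<zeta>
    have a: "(norm (\<eta> - \<zeta>) powr (-(5/4)))\<^sup>2 = norm (\<eta> - \<zeta>) powr (-(5/2))"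
      by (simp add: power2_eq_square flip: powr_add)
    have b: "(\<rho> \<zeta> powr (-m))\<^sup>2 = \<rho> \<zeta> powr (-(2 * m))"
      by (simp add: power2_eq_square flip: powr_add)
    have "(?f \<zeta>)\<^sup>2 = ennreal ((norm (\<eta> - \<zeta>) powr (-(5/4)) * \<rho> \<zeta> powr (-m))\<^sup>2)"
      by (rule ennreal_power) simp
    also have "\<dots> = ennreal (norm (\<eta> - \<zeta>) powr (-(5/2)) * \<rho> \<zeta> powr (-(2 * m)))"
      unfolding power_mult_distrib a b ..
    also have "\<dots> = ennreal (\<rho> \<zeta> powr (-(2 * m))) * ennreal (norm (\<eta> - \<zeta>) powr (-(5/2)))"
      by (subst mult.commute, rule ennreal_mult) simp_all
    finally show "(?f \<zeta>)\<^sup>2 = ennreal (\<rho> \<zeta> powr (-(2 * m))) * ennreal (norm (\<eta> - \<zeta>) powr (-(5/2)))" .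
  qed
  finally show ?thesis .
qed

text \<open>The factor of the previous estimate that does not involve the vorticity is bounded uniformly: \<open>5/2 < 3\<close> handles the
  singularity and \<open>2 * m > 3\<close> the decay at infinity.\<close>
lemma biot_savart_sq_le:
  assumes m: "3/2 < m"
  shows "\<exists>C\<ge>0. \<forall>w \<in> borel_measurable borel. \<forall>\<eta>.
    (\<integral>\<^sup>+\<zeta>. ennreal (norm ((1 / norm (\<eta> - \<zeta>) ^ 3) *\<^sub>R cross3 (\<eta> - \<zeta>) (w \<zeta>))) \<partial>lborel)\<^sup>2 \<le> ennreal C * energy_potential m w \<eta> \<and>
    ennreal ((norm (biot_savart w \<eta>))\<^sup>2) \<le> ennreal C * energy_potential m w \<eta>"
proof -
  have m2: "3 < 2 * m" and p: "(0::real) \<le> 5/2" "(5/2::real) < 3" using m by auto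
  obtain C where C: "C \<ge> 0" "\<And>t. (\<integral>\<^sup>+x. ennreal (\<rho> x powr (-(2 * m))) * ennreal (norm (t - x) powr (-(5/2))) \<partial>lborel) \<le> ennreal C"
    using rho_singular_bounded[OF m2 p] by blast
  {
    fix w :: "real^3 \<Rightarrow> real^3" and \<eta> assume w [measurable]: "w \<in> borel_measurable borel"
    let ?V = "\<integral>\<^sup>+\<zeta>. ennreal (norm ((1 / norm (\<eta> - \<zeta>) ^ 3) *\<^sub>R cross3 (\<eta> - \<zeta>) (w \<zeta>))) \<partial>lborel"
    have 1: "?V\<^sup>2 \<le> ennreal C * energy_potential m w \<eta>"
      by (rule order_trans[OF biot_savart_potential_le[OF w, of \<eta> m]]) (intro mult_right_mono C(2), simp)
    have "norm (biot_savart w \<eta>) \<le> norm (LINT \<zeta>|lborel. (1 / norm (\<eta> - \<zeta>) ^ 3) *\<^sub>R cross3 (\<eta> - \<zeta>) (w \<zeta>))"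
    proof -
      have "1 / (4 * pi) \<le> 1" using pi_gt3 by simp
      then show ?thesis unfolding biot_savart_def norm_scaleR by (intro mult_left_le_one_le) auto
    qed
    then have "ennreal (norm (biot_savart w \<eta>)) \<le> ennreal (norm (LINT \<zeta>|lborel. (1 / norm (\<eta> - \<zeta>) ^ 3) *\<^sub>R cross3 (\<eta> - \<zeta>) (w \<zeta>)))"
      by (rule ennreal_leI)
    also have "\<dots> \<le> ?V" by (rule norm_integral_le_nn_integral)
    finally have "(ennreal (norm (biot_savart w \<eta>)))\<^sup>2 \<le> ?V\<^sup>2" by (intro power_mono) auto
    then have "ennreal ((norm (biot_savart w \<eta>))\<^sup>2) \<le> ennreal C * energy_potential m w \<eta>"
      using 1 by (simp add: ennreal_power)
    note 1 this
  }
  then show ?thesis using C(1) by blast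
qed

text \<open>Cauchy-Schwarz leaves the velocity with the weight \<open>\<rho> \<eta> powr (- (m - p))\<close>; its square is integrable against the potential
  because \<open>2 * (m - p) > 3\<close>.  This limits the moments of the nonlinearity that are available.\<close>
lemma moment_bilinear_bound:
  assumes m: "3/2 < m" and p: "3 < 2 * (m - p)"
  shows "\<exists>C\<ge>0. \<forall>w \<in> borel_measurable borel. \<forall>w' \<in> borel_measurable borel.
    (\<integral>\<^sup>+\<eta>. ennreal (\<rho> \<eta> powr p * (norm (w \<eta> :: real^3) * norm (biot_savart w' \<eta>))) \<partial>lborel)\<^sup>2
      \<le> ennreal C * wnorm_sq m w * wnorm_sq m w'"
proof -
  obtain B where B: "B \<ge> 0" "\<And>w \<eta>. w \<in> borel_measurable borel \<Longrightarrow>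
     ennreal ((norm (biot_savart w \<eta>))\<^sup>2) \<le> ennreal B * energy_potential m w \<eta>"
    using biot_savart_sq_le[OF m] by blast
  have q: "(0::real) \<le> 3/2" "(3/2::real) < 3" by auto
  obtain K where K: "K \<ge> 0" "\<And>t. (\<integral>\<^sup>+x. ennreal (\<rho> x powr (-(2 * (m - p)))) * ennreal (norm (t - x) powr (-(3/2))) \<partial>lborel) \<le> ennreal K"
    using rho_singular_bounded[OF p q] by blast
  have "(\<integral>\<^sup>+\<eta>. ennreal (\<rho> \<eta> powr p * (norm (w \<eta>) * norm (biot_savart w' \<eta>))) \<partial>lborel)\<^sup>2
      \<le> ennreal (B * K) * wnorm_sq m w * wnorm_sq m w'"
    if [measurable]: "w \<in> borel_measurable borel" "w' \<in> borel_measurable borel" for w w' :: "real^3 \<Rightarrow> real^3"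
  proof -
    have sp: "\<rho> \<eta> powr p = \<rho> \<eta> powr m * \<rho> \<eta> powr (-(m - p))" for \<eta> by (simp flip: powr_add)
    have eq: "ennreal (\<rho> \<eta> powr p * (norm (w \<eta>) * norm (biot_savart w' \<eta>)))
      = ennreal (\<rho> \<eta> powr m * norm (w \<eta>)) * ennreal (\<rho> \<eta> powr (-(m - p)) * norm (biot_savart w' \<eta>))" for \<eta>
      unfolding sp by (subst ennreal_mult[symmetric]) (auto simp: mult_ac)
    have "(\<integral>\<^sup>+\<eta>. ennreal (\<rho> \<eta> powr p * (norm (w \<eta>) * norm (biot_savart w' \<eta>))) \<partial>lborel)\<^sup>2
      \<le> (\<integral>\<^sup>+\<eta>. (ennreal (\<rho> \<eta> powr m * norm (w \<eta>)))\<^sup>2 \<partial>lborel)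
        * (\<integral>\<^sup>+\<eta>. (ennreal (\<rho> \<eta> powr (-(m - p)) * norm (biot_savart w' \<eta>)))\<^sup>2 \<partial>lborel)"
      unfolding eq by (rule Cauchy_Schwarz_nn_integral) measurable
    also have "(\<integral>\<^sup>+\<eta>. (ennreal (\<rho> \<eta> powr m * norm (w \<eta>)))\<^sup>2 \<partial>lborel) = wnorm_sq m w"
      unfolding wnorm_sq_def by (intro nn_integral_cong ennreal_power) simp
    also have "(\<integral>\<^sup>+\<eta>. (ennreal (\<rho> \<eta> powr (-(m - p)) * norm (biot_savart w' \<eta>)))\<^sup>2 \<partial>lborel)
      \<le> (\<integral>\<^sup>+\<eta>. ennreal B * (ennreal (\<rho> \<eta> powr (-(2 * (m - p)))) * energy_potential m w' \<eta>) \<partial>lborel)"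
    proof (intro nn_integral_mono)
      fix \<eta>
      have b: "(\<rho> \<eta> powr (-(m - p)))\<^sup>2 = \<rho> \<eta> powr (-(2 * (m - p)))"
        by (simp add: power2_eq_square flip: powr_add)
      have "(ennreal (\<rho> \<eta> powr (-(m - p)) * norm (biot_savart w' \<eta>)))\<^sup>2
         = ennreal ((\<rho> \<eta> powr (-(m - p)) * norm (biot_savart w' \<eta>))\<^sup>2)" by (rule ennreal_power) simp
      also have "\<dots> = ennreal (\<rho> \<eta> powr (-(2 * (m - p)))) * ennreal ((norm (biot_savart w' \<eta>))\<^sup>2)"
        unfolding power_mult_distrib b by (rule ennreal_mult) auto
      also have "\<dots> \<le> ennreal (\<rho> \<eta> powr (-(2 * (m - p)))) * (ennreal B * energy_potential m w' \<eta>)"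
        by (intro mult_left_mono B) auto
      finally show "(ennreal (\<rho> \<eta> powr (-(m - p)) * norm (biot_savart w' \<eta>)))\<^sup>2
         \<le> ennreal B * (ennreal (\<rho> \<eta> powr (-(2 * (m - p)))) * energy_potential m w' \<eta>)" by (simp only: mult.left_commute)
    qed
    also have "\<dots> = ennreal B * (\<integral>\<^sup>+\<eta>. ennreal (\<rho> \<eta> powr (-(2 * (m - p)))) * energy_potential m w' \<eta> \<partial>lborel)"
      by (rule nn_integral_cmult) measurable
    also have "\<dots> \<le> ennreal B * (ennreal K * wnorm_sq m w')"
    proof (intro mult_left_mono nn_integral_energy_potential_le)
      fix \<zeta>
      show "(\<integral>\<^sup>+\<eta>. ennreal (\<rho> \<eta> powr (-(2 * (m - p)))) * ennreal (norm (\<eta> - \<zeta>) powr (-(3/2))) \<partial>lborel) \<le> ennreal K"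
        using K(2)[of \<zeta>] by (simp only: norm_minus_commute)
    qed auto
    also have "wnorm_sq m w * (ennreal B * (ennreal K * wnorm_sq m w')) = ennreal (B * K) * wnorm_sq m w * wnorm_sq m w'"
      using B(1) by (simp only: ennreal_mult'[OF B(1)] mult_ac)
    finally show ?thesis by (simp add: mult_left_mono)
  qed
  then show ?thesis using B(1) K(1) by (intro exI[of _ "B * K"]) auto
qed

text \<open>The square root of the Gaussian kernel is shared between vorticity and velocity.  The factor with the velocity is bounded
  uniformly in \<open>\<xi>\<close> through the potential and contributes \<open>\<epsilon> powr (- 3/2) * a powr (3/4)\<close>; the factor with the vorticity is integrated in
  \<open>\<xi>\<close> and contributes \<open>a powr (3/2)\<close>.\<close>
lemma gaussian_bilinear_bound:
  assumes m: "3/2 < m"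
  shows "\<exists>C\<ge>0. \<forall>w \<in> borel_measurable borel. \<forall>w' \<in> borel_measurable borel. \<forall>a>0. \<forall>\<epsilon>>0.
    (\<integral>\<^sup>+\<xi>. (\<integral>\<^sup>+\<eta>. ennreal (gauss_env a (\<xi> - \<epsilon> *\<^sub>R \<eta>) * ((\<rho> \<eta> powr m * norm (w \<eta> :: real^3)) * norm (biot_savart w' \<eta>))) \<partial>lborel)\<^sup>2 \<partial>lborel)
      \<le> ennreal (C * \<epsilon> powr (-(3/2)) * a powr (9/4)) * wnorm_sq m w * wnorm_sq m w'"
proof -
  obtain B where B: "B \<ge> 0" "\<And>w \<eta>. w \<in> borel_measurable borel \<Longrightarrow>
     ennreal ((norm (biot_savart w \<eta>))\<^sup>2) \<le> ennreal B * energy_potential m w \<eta>"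
    using biot_savart_sq_le[OF m] by blast
  obtain K where K: "K \<ge> 0" "\<And>a \<epsilon> \<xi> \<zeta>. a > 0 \<Longrightarrow> \<epsilon> > 0 \<Longrightarrow>
    (\<integral>\<^sup>+\<eta>. ennreal (gauss_env a (\<xi> - \<epsilon> *\<^sub>R \<eta>)) * ennreal (norm (\<eta> - \<zeta>) powr (-(3/2))) \<partial>lborel) \<le> ennreal (K * \<epsilon> powr (-(3/2)) * a powr (3/4))"
    using gauss_env_singular_bounded by blast
  obtain J where J: "J \<ge> 0" "(\<integral>\<^sup>+x. ennreal (gauss_env 1 x) \<partial>lborel) \<le> ennreal J"
    using nn_integral_bound_real[OF gauss_env_integral_finite] by blast
  have "(\<integral>\<^sup>+\<xi>. (\<integral>\<^sup>+\<eta>. ennreal (gauss_env a (\<xi> - \<epsilon> *\<^sub>R \<eta>) * ((\<rho> \<eta> powr m * norm (w \<eta>)) * norm (biot_savart w' \<eta>))) \<partial>lborel)\<^sup>2 \<partial>lborel)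
      \<le> ennreal ((B * K * J) * \<epsilon> powr (-(3/2)) * a powr (9/4)) * wnorm_sq m w * wnorm_sq m w'"
    if [measurable]: "w \<in> borel_measurable borel" "w' \<in> borel_measurable borel" and a: "a > 0" and e: "\<epsilon> > 0"
    for w w' :: "real^3 \<Rightarrow> real^3" and a \<epsilon>
  proof -
    define Q where "Q = ennreal B * (ennreal (K * \<epsilon> powr (-(3/2)) * a powr (3/4)) * wnorm_sq m w')"
    have 1: "(\<integral>\<^sup>+\<eta>. ennreal (gauss_env a (\<xi> - \<epsilon> *\<^sub>R \<eta>) * (norm (biot_savart w' \<eta>))\<^sup>2) \<partial>lborel) \<le> Q" for \<xi>
    proof -
      have "(\<integral>\<^sup>+\<eta>. ennreal (gauss_env a (\<xi> - \<epsilon> *\<^sub>R \<eta>) * (norm (biot_savart w' \<eta>))\<^sup>2) \<partial>lborel)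
        \<le> (\<integral>\<^sup>+\<eta>. ennreal B * (ennreal (gauss_env a (\<xi> - \<epsilon> *\<^sub>R \<eta>)) * energy_potential m w' \<eta>) \<partial>lborel)"
      proof (intro nn_integral_mono)
        fix \<eta>
        have "ennreal (gauss_env a (\<xi> - \<epsilon> *\<^sub>R \<eta>) * (norm (biot_savart w' \<eta>))\<^sup>2)
          = ennreal (gauss_env a (\<xi> - \<epsilon> *\<^sub>R \<eta>)) * ennreal ((norm (biot_savart w' \<eta>))\<^sup>2)"
          by (rule ennreal_mult) (auto simp: gauss_env_nonneg)
        also have "\<dots> \<le> ennreal (gauss_env a (\<xi> - \<epsilon> *\<^sub>R \<eta>)) * (ennreal B * energy_potential m w' \<eta>)"
          by (intro mult_left_mono B) auto
        finally show "ennreal (gauss_env a (\<xi> - \<epsilon> *\<^sub>R \<eta>) * (norm (biot_savart w' \<eta>))\<^sup>2)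
          \<le> ennreal B * (ennreal (gauss_env a (\<xi> - \<epsilon> *\<^sub>R \<eta>)) * energy_potential m w' \<eta>)" by (simp only: mult.left_commute)
      qed
      also have "\<dots> = ennreal B * (\<integral>\<^sup>+\<eta>. ennreal (gauss_env a (\<xi> - \<epsilon> *\<^sub>R \<eta>)) * energy_potential m w' \<eta> \<partial>lborel)"
        by (rule nn_integral_cmult) measurable
      also have "\<dots> \<le> Q" unfolding Q_def
        by (intro mult_left_mono nn_integral_energy_potential_le K a e) auto
      finally show ?thesis .
    qed
    have 2: "(\<integral>\<^sup>+\<eta>. ennreal (gauss_env a (\<xi> - \<epsilon> *\<^sub>R \<eta>) * ((\<rho> \<eta> powr m * norm (w \<eta>)) * norm (biot_savart w' \<eta>))) \<partial>lborel)\<^sup>2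
       \<le> (\<integral>\<^sup>+\<eta>. ennreal (gauss_env a (\<xi> - \<epsilon> *\<^sub>R \<eta>) * (\<rho> \<eta> powr m * norm (w \<eta>))\<^sup>2) \<partial>lborel) * Q" for \<xi>
      by (rule order_trans[OF Cauchy_Schwarz_weighted mult_left_mono[OF 1]]) (auto simp: gauss_env_nonneg)
    have "(\<integral>\<^sup>+\<xi>. (\<integral>\<^sup>+\<eta>. ennreal (gauss_env a (\<xi> - \<epsilon> *\<^sub>R \<eta>) * ((\<rho> \<eta> powr m * norm (w \<eta>)) * norm (biot_savart w' \<eta>))) \<partial>lborel)\<^sup>2 \<partial>lborel)
      \<le> (\<integral>\<^sup>+\<xi>. (\<integral>\<^sup>+\<eta>. ennreal (gauss_env a (\<xi> - \<epsilon> *\<^sub>R \<eta>) * (\<rho> \<eta> powr m * norm (w \<eta>))\<^sup>2) \<partial>lborel) * Q \<partial>lborel)"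
      by (intro nn_integral_mono 2)
    also have "\<dots> = (\<integral>\<^sup>+\<xi>. (\<integral>\<^sup>+\<eta>. ennreal (gauss_env a (\<xi> - \<epsilon> *\<^sub>R \<eta>) * (\<rho> \<eta> powr m * norm (w \<eta>))\<^sup>2) \<partial>lborel) \<partial>lborel) * Q"
      by (rule nn_integral_multc) measurable
    also have "(\<integral>\<^sup>+\<xi>. (\<integral>\<^sup>+\<eta>. ennreal (gauss_env a (\<xi> - \<epsilon> *\<^sub>R \<eta>) * (\<rho> \<eta> powr m * norm (w \<eta>))\<^sup>2) \<partial>lborel) \<partial>lborel)
       = (\<integral>\<^sup>+\<eta>. (\<integral>\<^sup>+\<xi>. ennreal (gauss_env a (\<xi> - \<epsilon> *\<^sub>R \<eta>) * (\<rho> \<eta> powr m * norm (w \<eta>))\<^sup>2) \<partial>lborel) \<partial>lborel)"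
      by (rule lborel_pair.Fubini'[symmetric]) measurable
    also have "\<dots> = (\<integral>\<^sup>+\<eta>. (\<integral>\<^sup>+x. ennreal (gauss_env a x) \<partial>lborel) * ennreal ((\<rho> \<eta> powr m * norm (w \<eta>))\<^sup>2) \<partial>lborel)"
      by (intro nn_integral_cong)
        (simp only: ennreal_mult[OF gauss_env_nonneg zero_le_power2], subst nn_integral_multc, measurable, simp only: gauss_env_integral_outer)
    also have "\<dots> = (\<integral>\<^sup>+x. ennreal (gauss_env a x) \<partial>lborel) * wnorm_sq m w"
      unfolding wnorm_sq_def by (rule nn_integral_cmult) measurable
    also have "\<dots> \<le> ennreal (a powr (3/2) * J) * wnorm_sq m w"
      unfolding gauss_env_integral[OF a] using J by (intro mult_right_mono) (simp_all add: ennreal_mult' mult_left_mono)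
    finally have "(\<integral>\<^sup>+\<xi>. (\<integral>\<^sup>+\<eta>. ennreal (gauss_env a (\<xi> - \<epsilon> *\<^sub>R \<eta>) * ((\<rho> \<eta> powr m * norm (w \<eta>)) * norm (biot_savart w' \<eta>))) \<partial>lborel)\<^sup>2 \<partial>lborel)
      \<le> ennreal (a powr (3/2) * J) * wnorm_sq m w * Q" by (simp add: mult_right_mono)
    also have "\<dots> = ennreal ((a powr (3/2) * J) * (B * (K * \<epsilon> powr (-(3/2)) * a powr (3/4)))) * wnorm_sq m w * wnorm_sq m w'"
      unfolding Q_def using B(1) J(1) K(1) by (subst ennreal_mult, simp, simp) (simp only: ennreal_mult' mult_ac)
    also have "(a powr (3/2) * J) * (B * (K * \<epsilon> powr (-(3/2)) * a powr (3/4))) = (B * K * J) * \<epsilon> powr (-(3/2)) * a powr (9/4)"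
    proof -
      have "a powr (9/4) = a powr (3/2) * a powr (3/4)" by (simp flip: powr_add)
      then show ?thesis by (simp only: mult_ac)
    qed
    finally show ?thesis .
  qed
  then show ?thesis using B(1) K(1) J(1) by (intro exI[of _ "B * K * J"]) auto
qed

section \<open>Integrated bounds for the expansion remainders\<close>

text \<open>Remainders of the two kernels after the expansions to order one and two respectively.\<close>
definition dheat_rem :: "3 \<Rightarrow> real \<Rightarrow> real^3 \<Rightarrow> real^3 \<Rightarrow> real"
  where "dheat_rem j \<epsilon> \<xi> \<eta> = dheat j (1 - \<epsilon>\<^sup>2) (\<xi> - \<epsilon> *\<^sub>R \<eta>) - dG j \<xi> + \<epsilon> * (\<Sum>k\<in>UNIV. \<eta> $ k * ddG j k \<xi>)"

definition heat_rem :: "real \<Rightarrow> real^3 \<Rightarrow> real^3 \<Rightarrow> real"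
  where "heat_rem \<epsilon> \<xi> \<eta> = heat (1 - \<epsilon>\<^sup>2) (\<xi> - \<epsilon> *\<^sub>R \<eta>) - heat (max (1 - \<epsilon>\<^sup>2) (1/2)) \<xi>
         + \<epsilon> * (\<Sum>k\<in>UNIV. \<eta> $ k * dG k \<xi>)
         - \<epsilon>\<^sup>2 / 2 * (\<Sum>k\<in>UNIV. \<Sum>l\<in>UNIV. \<eta> $ k * \<eta> $ l * ddG k l \<xi>)"

lemma measurable_G [measurable]: "G \<in> borel_measurable borel"
  unfolding G_def[abs_def] by measurable

lemma measurable_heat [measurable]: "heat a \<in> borel_measurable borel"
  unfolding heat_def[abs_def] by measurable

lemma measurable_vec_nth_real [measurable (raw)]:
  "f \<in> borel_measurable M \<Longrightarrow> (\<lambda>x. (f x :: real^3) $ i) \<in> borel_measurable M"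
  by (rule measurable_compose[of f M borel "\<lambda>v. v $ i"]) (auto intro!: borel_measurable_continuous_onI continuous_intros)

lemma measurable_dheat [measurable]: "dheat j a \<in> borel_measurable borel"
  unfolding dheat_def[abs_def] by measurable

lemma measurable_dG [measurable]: "dG j \<in> borel_measurable borel"
  unfolding dG_def[abs_def] by measurable

lemma measurable_ddG [measurable]: "ddG j k \<in> borel_measurable borel"
  unfolding ddG_def[abs_def] by measurable

text \<open>The pattern of both integrated bounds: \<open>X\<close> is a moment, multiplied by a fixed Gaussian in \<open>\<xi>\<close> (the Taylor regime), and \<open>Y\<close> is
  a Gaussian average (the far regime).\<close>
lemma nn_integral_square_two_term:
  assumes h: "\<And>\<xi>. 0 \<le> h \<xi>" "\<And>\<xi>. ennreal (h \<xi>) \<le> ennreal (\<alpha> * gauss_env 1 \<xi>) * X + ennreal \<beta> * Y \<xi>"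
    and [measurable]: "Y \<in> borel_measurable borel"
    and X: "X\<^sup>2 \<le> ennreal x * Z" and Y: "(\<integral>\<^sup>+\<xi>. (Y \<xi>)\<^sup>2 \<partial>lborel) \<le> ennreal y * Z"
    and J: "(\<integral>\<^sup>+\<xi>. ennreal (gauss_env 1 \<xi>) \<partial>lborel) \<le> ennreal J"
    and nn: "0 \<le> \<alpha>" "0 \<le> \<beta>" "0 \<le> x" "0 \<le> y" "0 \<le> J"
  shows "(\<integral>\<^sup>+\<xi>. ennreal ((h \<xi>)\<^sup>2) \<partial>lborel) \<le> ennreal (2 * \<alpha>\<^sup>2 * J * x + 2 * \<beta>\<^sup>2 * y) * Z"
proof -
  have pt: "ennreal ((h \<xi>)\<^sup>2) \<le> ennreal (2 * \<alpha>\<^sup>2) * X\<^sup>2 * ennreal (gauss_env 1 \<xi>) + ennreal (2 * \<beta>\<^sup>2) * (Y \<xi>)\<^sup>2" for \<xi>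
  proof -
    have g: "(gauss_env 1 \<xi>)\<^sup>2 \<le> gauss_env 1 \<xi>" using gauss_env_nonneg[of 1 \<xi>] by (simp add: power2_eq_square mult_left_le gauss_env_def)
    have "ennreal ((h \<xi>)\<^sup>2) = (ennreal (h \<xi>))\<^sup>2" using h(1) by (simp add: ennreal_power)
    also have "\<dots> \<le> (ennreal (\<alpha> * gauss_env 1 \<xi>) * X + ennreal \<beta> * Y \<xi>)\<^sup>2" by (intro power_mono h) auto
    also have "\<dots> \<le> 2 * (ennreal (\<alpha> * gauss_env 1 \<xi>) * X)\<^sup>2 + 2 * (ennreal \<beta> * Y \<xi>)\<^sup>2" by (rule square_add_le_ennreal)
    also have "2 * (ennreal (\<alpha> * gauss_env 1 \<xi>) * X)\<^sup>2 = ennreal (2 * (\<alpha>\<^sup>2 * (gauss_env 1 \<xi>)\<^sup>2)) * X\<^sup>2"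
      using nn gauss_env_nonneg[of 1 \<xi>] by (simp add: power_mult_distrib ennreal_power ennreal_mult mult_ac)
    also have "\<dots> \<le> ennreal (2 * (\<alpha>\<^sup>2 * gauss_env 1 \<xi>)) * X\<^sup>2"
      using g by (intro mult_right_mono ennreal_leI mult_left_mono) auto
    also have "\<dots> = ennreal (2 * \<alpha>\<^sup>2) * X\<^sup>2 * ennreal (gauss_env 1 \<xi>)"
      using gauss_env_nonneg[of 1 \<xi>] by (simp add: ennreal_mult mult_ac)
    also have "2 * (ennreal \<beta> * Y \<xi>)\<^sup>2 = ennreal (2 * \<beta>\<^sup>2) * (Y \<xi>)\<^sup>2"
      using nn by (simp add: power_mult_distrib ennreal_power ennreal_mult mult_ac)
    finally show ?thesis by simp
  qed
  have "(\<integral>\<^sup>+\<xi>. ennreal ((h \<xi>)\<^sup>2) \<partial>lborel)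
     \<le> (\<integral>\<^sup>+\<xi>. ennreal (2 * \<alpha>\<^sup>2) * X\<^sup>2 * ennreal (gauss_env 1 \<xi>) + ennreal (2 * \<beta>\<^sup>2) * (Y \<xi>)\<^sup>2 \<partial>lborel)"
    by (intro nn_integral_mono pt)
  also have "\<dots> = ennreal (2 * \<alpha>\<^sup>2) * X\<^sup>2 * (\<integral>\<^sup>+\<xi>. ennreal (gauss_env 1 \<xi>) \<partial>lborel) + ennreal (2 * \<beta>\<^sup>2) * (\<integral>\<^sup>+\<xi>. (Y \<xi>)\<^sup>2 \<partial>lborel)"
    by (subst nn_integral_add, measurable) (simp add: nn_integral_cmult)
  also have "\<dots> \<le> ennreal (2 * \<alpha>\<^sup>2) * (ennreal x * Z) * ennreal J + ennreal (2 * \<beta>\<^sup>2) * (ennreal y * Z)"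
    by (intro add_mono mult_mono X Y J order_refl) auto
  also have "\<dots> = ennreal (2 * \<alpha>\<^sup>2 * J * x) * Z + ennreal (2 * \<beta>\<^sup>2 * y) * Z"
    using nn by (simp add: ennreal_mult mult_ac)
  also have "\<dots> = ennreal (2 * \<alpha>\<^sup>2 * J * x + 2 * \<beta>\<^sup>2 * y) * Z"
    using nn by (simp add: distrib_right)
  finally show ?thesis .
qed

lemma one_minus_sq_bounds: "0 < \<epsilon> \<Longrightarrow> \<epsilon> < 1 \<Longrightarrow> 0 < 1 - \<epsilon>\<^sup>2 \<and> 1 - \<epsilon>\<^sup>2 < (1::real)"
  by (simp add: power_less_one_iff)

text \<open>The Taylor regime gives \<open>\<epsilon> powr p\<close> times a moment of order \<open>p\<close> of the nonlinearity.  The far regime gives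
  \<open>\<epsilon> powr m\<close> times a Gaussian average with the kernel bound \<open>a powr (- 2)\<close>, where \<open>a = 1 - \<epsilon>\<^sup>2\<close>.\<close>
lemma duhamel_expansion_bound:
  assumes p: "1 \<le> p" "p \<le> 2" and mp: "3 < 2 * (m - p)"
  shows "\<exists>C\<ge>0. \<forall>w \<in> borel_measurable borel. \<forall>F \<in> borel_measurable borel.
    (\<forall>\<eta>. \<bar>F \<eta>\<bar> \<le> 2 * (norm (w \<eta>) * norm (biot_savart w \<eta>))) \<longrightarrow>
    (\<forall>j \<epsilon>. 0 < \<epsilon> \<longrightarrow> \<epsilon> < 1 \<longrightarrow>
      (\<integral>\<^sup>+\<xi>. ennreal ((\<rho> \<xi> powr m * \<bar>LINT \<eta>|lborel. dheat_rem j \<epsilon> \<xi> \<eta> * F \<eta>\<bar>)\<^sup>2) \<partial>lborel)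
        \<le> ennreal (C * \<epsilon> powr (2 * p) * (1 - \<epsilon>\<^sup>2) powr (-(7/4))) * (wnorm_sq m w)\<^sup>2)"
proof -
  have m: "3/2 < m" "0 \<le> m" using p mp by auto
  obtain C1 where C1: "C1 \<ge> 0" "\<And>w w'. w \<in> borel_measurable borel \<Longrightarrow> w' \<in> borel_measurable borel \<Longrightarrow>
    (\<integral>\<^sup>+\<eta>. ennreal (\<rho> \<eta> powr p * (norm (w \<eta> :: real^3) * norm (biot_savart w' \<eta>))) \<partial>lborel)\<^sup>2
      \<le> ennreal C1 * wnorm_sq m w * wnorm_sq m w'" using moment_bilinear_bound[OF m(1) mp] by blast
  obtain C2 where C2: "C2 \<ge> 0" "\<And>w w' a \<epsilon>. w \<in> borel_measurable borel \<Longrightarrow> w' \<in> borel_measurable borel \<Longrightarrow> a > 0 \<Longrightarrow> \<epsilon> > 0 \<Longrightarrow>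
    (\<integral>\<^sup>+\<xi>. (\<integral>\<^sup>+\<eta>. ennreal (gauss_env a (\<xi> - \<epsilon> *\<^sub>R \<eta>) * ((\<rho> \<eta> powr m * norm (w \<eta> :: real^3)) * norm (biot_savart w' \<eta>))) \<partial>lborel)\<^sup>2 \<partial>lborel)
      \<le> ennreal (C2 * \<epsilon> powr (-(3/2)) * a powr (9/4)) * wnorm_sq m w * wnorm_sq m w'"
    using gaussian_bilinear_bound[OF m(1)] by blast
  obtain J where J: "J \<ge> 0" "(\<integral>\<^sup>+x. ennreal (gauss_env 1 x) \<partial>lborel) \<le> ennreal J"
    using nn_integral_bound_real[OF gauss_env_integral_finite] by blast
  define A where "A = 440 * exp (4 * (m + 4)\<^sup>2)"
  define B where "B = exp (4 * m\<^sup>2) * 2 powr m"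
  have AB: "A \<ge> 0" "B \<ge> 0" by (auto simp: A_def B_def)
  define C where "C = 2 * (2 * A)\<^sup>2 * J * C1 + 2 * (2 * B)\<^sup>2 * C2"
  have "(\<integral>\<^sup>+\<xi>. ennreal ((\<rho> \<xi> powr m * \<bar>LINT \<eta>|lborel. dheat_rem j \<epsilon> \<xi> \<eta> * F \<eta>\<bar>)\<^sup>2) \<partial>lborel)
        \<le> ennreal (C * \<epsilon> powr (2 * p) * (1 - \<epsilon>\<^sup>2) powr (-(7/4))) * (wnorm_sq m w)\<^sup>2"
    if [measurable]: "w \<in> borel_measurable borel" "F \<in> borel_measurable borel"
      and F: "\<And>\<eta>. \<bar>F \<eta>\<bar> \<le> 2 * (norm (w \<eta>) * norm (biot_savart w \<eta>))" and e: "0 < \<epsilon>" "\<epsilon> < 1"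
    for w F j \<epsilon>
  proof -
    define a where "a = 1 - \<epsilon>\<^sup>2"
    have a: "0 < a" "a < 1" using one_minus_sq_bounds[OF e] by (auto simp: a_def)
    define \<alpha> where "\<alpha> = 2 * A * \<epsilon> powr p"
    define \<beta> where "\<beta> = 2 * B * \<epsilon> powr m * a powr (-2)"
    define X where "X = (\<integral>\<^sup>+\<eta>. ennreal (\<rho> \<eta> powr p * (norm (w \<eta>) * norm (biot_savart w \<eta>))) \<partial>lborel)"
    define Y where "Y \<xi> = (\<integral>\<^sup>+\<eta>. ennreal (gauss_env a (\<xi> - \<epsilon> *\<^sub>R \<eta>) * ((\<rho> \<eta> powr m * norm (w \<eta>)) * norm (biot_savart w \<eta>))) \<partial>lborel)" for \<xi>
    have [measurable]: "Y \<in> borel_measurable borel" unfolding Y_def[abs_def] by measurable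
    have "(\<integral>\<^sup>+\<xi>. ennreal ((\<rho> \<xi> powr m * \<bar>LINT \<eta>|lborel. dheat_rem j \<epsilon> \<xi> \<eta> * F \<eta>\<bar>)\<^sup>2) \<partial>lborel)
      \<le> ennreal (2 * \<alpha>\<^sup>2 * J * C1 + 2 * \<beta>\<^sup>2 * (C2 * \<epsilon> powr (-(3/2)) * a powr (9/4))) * (wnorm_sq m w)\<^sup>2"
    proof (rule nn_integral_square_two_term[where X = X and Y = Y])
      fix \<xi>
      have "ennreal (\<rho> \<xi> powr m * \<bar>LINT \<eta>|lborel. dheat_rem j \<epsilon> \<xi> \<eta> * F \<eta>\<bar>)
          = ennreal (\<rho> \<xi> powr m) * ennreal (norm (LINT \<eta>|lborel. dheat_rem j \<epsilon> \<xi> \<eta> * F \<eta>))"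
        by (simp add: ennreal_mult)
      also have "\<dots> \<le> ennreal (\<rho> \<xi> powr m) * (\<integral>\<^sup>+\<eta>. ennreal (norm (dheat_rem j \<epsilon> \<xi> \<eta> * F \<eta>)) \<partial>lborel)"
        by (intro mult_left_mono norm_integral_le_nn_integral) auto
      also have "\<dots> = (\<integral>\<^sup>+\<eta>. ennreal (\<rho> \<xi> powr m) * ennreal (norm (dheat_rem j \<epsilon> \<xi> \<eta> * F \<eta>)) \<partial>lborel)"
        unfolding dheat_rem_def by (rule nn_integral_cmult[symmetric]) measurable
      also have "\<dots> \<le> (\<integral>\<^sup>+\<eta>. ennreal (\<alpha> * gauss_env 1 \<xi>) * ennreal (\<rho> \<eta> powr p * (norm (w \<eta>) * norm (biot_savart w \<eta>)))
          + ennreal \<beta> * ennreal (gauss_env a (\<xi> - \<epsilon> *\<^sub>R \<eta>) * ((\<rho> \<eta> powr m * norm (w \<eta>)) * norm (biot_savart w \<eta>))) \<partial>lborel)"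
      proof (intro nn_integral_mono)
        fix \<eta>
        let ?wv = "norm (w \<eta>) * norm (biot_savart w \<eta>)"
        have k: "\<rho> \<xi> powr m * \<bar>dheat_rem j \<epsilon> \<xi> \<eta>\<bar> \<le> A * (\<epsilon> * \<rho> \<eta>) powr p * gauss_env 1 \<xi>
            + B * (\<epsilon> * \<rho> \<eta>) powr m * (a powr (-2) * gauss_env a (\<xi> - \<epsilon> *\<^sub>R \<eta>))"
          using dheat_expansion_weighted[OF m(2) p e, of \<xi> j \<eta>]
          by (simp only: dheat_rem_def A_def B_def gauss_env_def a_def mult_1_right)
        have "\<rho> \<xi> powr m * \<bar>dheat_rem j \<epsilon> \<xi> \<eta> * F \<eta>\<bar> = (\<rho> \<xi> powr m * \<bar>dheat_rem j \<epsilon> \<xi> \<eta>\<bar>) * \<bar>F \<eta>\<bar>"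
          by (simp add: abs_mult)
        also have "\<dots> \<le> (A * (\<epsilon> * \<rho> \<eta>) powr p * gauss_env 1 \<xi>
            + B * (\<epsilon> * \<rho> \<eta>) powr m * (a powr (-2) * gauss_env a (\<xi> - \<epsilon> *\<^sub>R \<eta>))) * (2 * ?wv)"
          using AB by (intro mult_mono k F) (auto simp: gauss_env_nonneg)
        also have "\<dots> = \<alpha> * gauss_env 1 \<xi> * (\<rho> \<eta> powr p * ?wv)
           + \<beta> * (gauss_env a (\<xi> - \<epsilon> *\<^sub>R \<eta>) * ((\<rho> \<eta> powr m * norm (w \<eta>)) * norm (biot_savart w \<eta>)))"
          by (simp add: \<alpha>_def \<beta>_def powr_mult algebra_simps)
        finally have "ennreal (\<rho> \<xi> powr m * \<bar>dheat_rem j \<epsilon> \<xi> \<eta> * F \<eta>\<bar>) \<le> ennreal (\<dots>)" by (rule ennreal_leI)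
        then show "ennreal (\<rho> \<xi> powr m) * ennreal (norm (dheat_rem j \<epsilon> \<xi> \<eta> * F \<eta>))
          \<le> ennreal (\<alpha> * gauss_env 1 \<xi>) * ennreal (\<rho> \<eta> powr p * ?wv)
            + ennreal \<beta> * ennreal (gauss_env a (\<xi> - \<epsilon> *\<^sub>R \<eta>) * ((\<rho> \<eta> powr m * norm (w \<eta>)) * norm (biot_savart w \<eta>)))"
          using AB e a by (simp add: ennreal_mult ennreal_plus gauss_env_nonneg \<alpha>_def \<beta>_def)
      qed
      also have "\<dots> = ennreal (\<alpha> * gauss_env 1 \<xi>) * X + ennreal \<beta> * Y \<xi>"
        unfolding X_def Y_def by (subst nn_integral_add, measurable) (simp add: nn_integral_cmult)
      finally show "ennreal (\<rho> \<xi> powr m * \<bar>LINT \<eta>|lborel. dheat_rem j \<epsilon> \<xi> \<eta> * F \<eta>\<bar>) \<le> ennreal (\<alpha> * gauss_env 1 \<xi>) * X + ennreal \<beta> * Y \<xi>" .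
    next
      show "X\<^sup>2 \<le> ennreal C1 * (wnorm_sq m w)\<^sup>2"
        using C1(2)[of w w] by (simp add: X_def power2_eq_square mult_ac)
      show "(\<integral>\<^sup>+\<xi>. (Y \<xi>)\<^sup>2 \<partial>lborel) \<le> ennreal (C2 * \<epsilon> powr (-(3/2)) * a powr (9/4)) * (wnorm_sq m w)\<^sup>2"
        using C2(2)[of w w a \<epsilon>] a e by (simp add: Y_def power2_eq_square mult_ac)
    qed (use J C1 C2 AB in \<open>auto simp: \<alpha>_def \<beta>_def\<close>)
    also have "\<dots> \<le> ennreal (C * \<epsilon> powr (2 * p) * a powr (-(7/4))) * (wnorm_sq m w)\<^sup>2"
    proof (intro mult_right_mono ennreal_leI)
      have e2: "(\<epsilon> powr q)\<^sup>2 = \<epsilon> powr (2 * q)" for q by (simp add: power2_eq_square flip: powr_add)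
      \<comment> \<open>the square root of this, a power \<open>- 7/8 > - 1\<close>, is the final singularity in time\<close>
      have a4: "(a powr (-2))\<^sup>2 * a powr (9/4) = a powr (-(7/4))" by (simp add: power2_eq_square flip: powr_add)
      have a1: "1 \<le> a powr (-(7/4))" using powr_mono'[of "-(7/4)" 0 a] a by simp
      have "2 * \<alpha>\<^sup>2 * J * C1 = (2 * (2 * A)\<^sup>2 * J * C1) * \<epsilon> powr (2 * p) * 1"
        unfolding \<alpha>_def power_mult_distrib e2 by simp
      also have "\<dots> \<le> (2 * (2 * A)\<^sup>2 * J * C1) * \<epsilon> powr (2 * p) * a powr (-(7/4))"
        using a1 J C1 by (intro mult_left_mono) auto
      finally have 1: "2 * \<alpha>\<^sup>2 * J * C1 \<le> (2 * (2 * A)\<^sup>2 * J * C1) * \<epsilon> powr (2 * p) * a powr (-(7/4))" .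
      \<comment> \<open>the loss \<open>\<epsilon> powr (- 3/2)\<close> comes from the change of variables \<open>\<epsilon> \<eta>\<close>; the hypothesis on \<open>m - p\<close> covers it\<close>
      have em: "\<epsilon> powr (2 * m) * \<epsilon> powr (-(3/2)) \<le> \<epsilon> powr (2 * p)"
        unfolding powr_add[symmetric] using mp e by (intro powr_mono') auto
      have "2 * \<beta>\<^sup>2 * (C2 * \<epsilon> powr (-(3/2)) * a powr (9/4))
         = (2 * (2 * B)\<^sup>2 * C2) * (\<epsilon> powr (2 * m) * \<epsilon> powr (-(3/2))) * ((a powr (-2))\<^sup>2 * a powr (9/4))"
        unfolding \<beta>_def power_mult_distrib e2 by simp
      also have "\<dots> \<le> (2 * (2 * B)\<^sup>2 * C2) * \<epsilon> powr (2 * p) * a powr (-(7/4))"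
        unfolding a4 using em C2 by (intro mult_right_mono mult_left_mono) auto
      finally show "2 * \<alpha>\<^sup>2 * J * C1 + 2 * \<beta>\<^sup>2 * (C2 * \<epsilon> powr (-(3/2)) * a powr (9/4)) \<le> C * \<epsilon> powr (2 * p) * a powr (-(7/4))"
        using 1 unfolding C_def by (simp only: distrib_right)
    qed auto
    finally show ?thesis by (simp add: a_def)
  qed
  moreover have "C \<ge> 0" using J C1 C2 by (simp add: C_def)
  ultimately show ?thesis by blast
qed

text \<open>Here the far regime is Young's convolution inequality, proved by Cauchy-Schwarz with the constant function \<open>1\<close> as second factor; the factor
  \<open>a powr (- 3/2)\<close> of the kernel is compensated by the integral of the Gaussian, so no singularity in time remains.\<close>
lemma linear_expansion_bound:
  assumes p: "2 \<le> p" "p \<le> 3" and mp: "3 < 2 * (m - p)"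
  shows "\<exists>C\<ge>0. \<forall>f \<in> borel_measurable borel.
    (\<forall>\<epsilon>. 0 < \<epsilon> \<longrightarrow> \<epsilon> < 1 \<longrightarrow>
      (\<integral>\<^sup>+\<xi>. ennreal ((\<rho> \<xi> powr m * \<bar>LINT \<eta>|lborel. heat_rem \<epsilon> \<xi> \<eta> * (f \<eta> :: real)\<bar>)\<^sup>2) \<partial>lborel)
        \<le> ennreal (C * \<epsilon> powr (2 * p)) * wnorm_sq m f)"
proof -
  have m: "0 \<le> m" using p mp by auto
  obtain C1 where C1: "C1 \<ge> 0" "(\<integral>\<^sup>+x. ennreal (\<rho> x powr (-(2 * (m - p)))) \<partial>lborel) \<le> ennreal C1"
    using nn_integral_bound_real[OF rho_integral_finite[OF mp]] by blast
  obtain J where J: "J \<ge> 0" "(\<integral>\<^sup>+x. ennreal (gauss_env 1 x) \<partial>lborel) \<le> ennreal J"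
    using nn_integral_bound_real[OF gauss_env_integral_finite] by blast
  define A where "A = 440 * exp (4 * (m + 4)\<^sup>2)"
  define B where "B = exp (4 * m\<^sup>2) * 2 powr m"
  have AB: "A \<ge> 0" "B \<ge> 0" by (auto simp: A_def B_def)
  define C where "C = 2 * A\<^sup>2 * J * C1 + 2 * B\<^sup>2 * J\<^sup>2"
  have "(\<integral>\<^sup>+\<xi>. ennreal ((\<rho> \<xi> powr m * \<bar>LINT \<eta>|lborel. heat_rem \<epsilon> \<xi> \<eta> * f \<eta>\<bar>)\<^sup>2) \<partial>lborel)
        \<le> ennreal (C * \<epsilon> powr (2 * p)) * wnorm_sq m f"
    if [measurable]: "f \<in> borel_measurable borel" and e: "0 < \<epsilon>" "\<epsilon> < 1"
    for f :: "real^3 \<Rightarrow> real" and \<epsilon>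
  proof -
    define a where "a = 1 - \<epsilon>\<^sup>2"
    have a: "0 < a" "a < 1" using one_minus_sq_bounds[OF e] by (auto simp: a_def)
    define \<alpha> where "\<alpha> = A * \<epsilon> powr p"
    define \<beta> where "\<beta> = B * \<epsilon> powr m * a powr (-(3/2))"
    define X where "X = (\<integral>\<^sup>+\<eta>. ennreal (\<rho> \<eta> powr p * \<bar>f \<eta>\<bar>) \<partial>lborel)"
    define Y where "Y \<xi> = (\<integral>\<^sup>+\<eta>. ennreal (gauss_env a (\<xi> - \<epsilon> *\<^sub>R \<eta>) * ((\<rho> \<eta> powr m * \<bar>f \<eta>\<bar>) * 1)) \<partial>lborel)" for \<xi>
    define y where "y = \<epsilon> powr (-3) * (a powr (3/2) * J) * (a powr (3/2) * J)"
    have [measurable]: "Y \<in> borel_measurable borel" unfolding Y_def[abs_def] by measurable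
    have "(\<integral>\<^sup>+\<xi>. ennreal ((\<rho> \<xi> powr m * \<bar>LINT \<eta>|lborel. heat_rem \<epsilon> \<xi> \<eta> * f \<eta>\<bar>)\<^sup>2) \<partial>lborel)
      \<le> ennreal (2 * \<alpha>\<^sup>2 * J * C1 + 2 * \<beta>\<^sup>2 * y) * wnorm_sq m f"
    proof (rule nn_integral_square_two_term[where X = X and Y = Y])
      fix \<xi>
      have "ennreal (\<rho> \<xi> powr m * \<bar>LINT \<eta>|lborel. heat_rem \<epsilon> \<xi> \<eta> * f \<eta>\<bar>)
          = ennreal (\<rho> \<xi> powr m) * ennreal (norm (LINT \<eta>|lborel. heat_rem \<epsilon> \<xi> \<eta> * f \<eta>))"
        by (simp add: ennreal_mult)
      also have "\<dots> \<le> ennreal (\<rho> \<xi> powr m) * (\<integral>\<^sup>+\<eta>. ennreal (norm (heat_rem \<epsilon> \<xi> \<eta> * f \<eta>)) \<partial>lborel)"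
        by (intro mult_left_mono norm_integral_le_nn_integral) auto
      also have "\<dots> = (\<integral>\<^sup>+\<eta>. ennreal (\<rho> \<xi> powr m) * ennreal (norm (heat_rem \<epsilon> \<xi> \<eta> * f \<eta>)) \<partial>lborel)"
        unfolding heat_rem_def by (rule nn_integral_cmult[symmetric]) measurable
      also have "\<dots> \<le> (\<integral>\<^sup>+\<eta>. ennreal (\<alpha> * gauss_env 1 \<xi>) * ennreal (\<rho> \<eta> powr p * \<bar>f \<eta>\<bar>)
          + ennreal \<beta> * ennreal (gauss_env a (\<xi> - \<epsilon> *\<^sub>R \<eta>) * ((\<rho> \<eta> powr m * \<bar>f \<eta>\<bar>) * 1)) \<partial>lborel)"
      proof (intro nn_integral_mono)
        fix \<eta>
        have k: "\<rho> \<xi> powr m * \<bar>heat_rem \<epsilon> \<xi> \<eta>\<bar> \<le> A * (\<epsilon> * \<rho> \<eta>) powr p * gauss_env 1 \<xi>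
            + B * (\<epsilon> * \<rho> \<eta>) powr m * (a powr (-(3/2)) * gauss_env a (\<xi> - \<epsilon> *\<^sub>R \<eta>))"
          using heat_expansion_weighted[OF m p e, of \<xi> \<eta>]
          by (simp only: heat_rem_def A_def B_def gauss_env_def a_def mult_1_right)
        have "\<rho> \<xi> powr m * \<bar>heat_rem \<epsilon> \<xi> \<eta> * f \<eta>\<bar> = (\<rho> \<xi> powr m * \<bar>heat_rem \<epsilon> \<xi> \<eta>\<bar>) * \<bar>f \<eta>\<bar>"
          by (simp add: abs_mult)
        also have "\<dots> \<le> (A * (\<epsilon> * \<rho> \<eta>) powr p * gauss_env 1 \<xi>
            + B * (\<epsilon> * \<rho> \<eta>) powr m * (a powr (-(3/2)) * gauss_env a (\<xi> - \<epsilon> *\<^sub>R \<eta>))) * \<bar>f \<eta>\<bar>"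
          by (intro mult_right_mono k) auto
        also have "\<dots> = \<alpha> * gauss_env 1 \<xi> * (\<rho> \<eta> powr p * \<bar>f \<eta>\<bar>)
           + \<beta> * (gauss_env a (\<xi> - \<epsilon> *\<^sub>R \<eta>) * ((\<rho> \<eta> powr m * \<bar>f \<eta>\<bar>) * 1))"
          by (simp add: \<alpha>_def \<beta>_def powr_mult algebra_simps)
        finally have "ennreal (\<rho> \<xi> powr m * \<bar>heat_rem \<epsilon> \<xi> \<eta> * f \<eta>\<bar>) \<le> ennreal (\<dots>)" by (rule ennreal_leI)
        then show "ennreal (\<rho> \<xi> powr m) * ennreal (norm (heat_rem \<epsilon> \<xi> \<eta> * f \<eta>))
          \<le> ennreal (\<alpha> * gauss_env 1 \<xi>) * ennreal (\<rho> \<eta> powr p * \<bar>f \<eta>\<bar>)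
            + ennreal \<beta> * ennreal (gauss_env a (\<xi> - \<epsilon> *\<^sub>R \<eta>) * ((\<rho> \<eta> powr m * \<bar>f \<eta>\<bar>) * 1))"
          using AB e a by (simp add: ennreal_mult ennreal_plus gauss_env_nonneg \<alpha>_def \<beta>_def)
      qed
      also have "\<dots> = ennreal (\<alpha> * gauss_env 1 \<xi>) * X + ennreal \<beta> * Y \<xi>"
        unfolding X_def Y_def by (subst nn_integral_add, measurable) (simp add: nn_integral_cmult)
      finally show "ennreal (\<rho> \<xi> powr m * \<bar>LINT \<eta>|lborel. heat_rem \<epsilon> \<xi> \<eta> * f \<eta>\<bar>) \<le> ennreal (\<alpha> * gauss_env 1 \<xi>) * X + ennreal \<beta> * Y \<xi>" .
    next
      have eq: "ennreal (\<rho> \<eta> powr p * \<bar>f \<eta>\<bar>) = ennreal (\<rho> \<eta> powr (-(m - p))) * ennreal (\<rho> \<eta> powr m * norm (f \<eta>))" for \<eta>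
      proof -
        have "\<rho> \<eta> powr p = \<rho> \<eta> powr (-(m - p)) * \<rho> \<eta> powr m" by (simp flip: powr_add)
        then show ?thesis by (subst ennreal_mult[symmetric]) (auto simp: mult_ac)
      qed
      have "X\<^sup>2 \<le> (\<integral>\<^sup>+\<eta>. (ennreal (\<rho> \<eta> powr (-(m - p))))\<^sup>2 \<partial>lborel) * (\<integral>\<^sup>+\<eta>. (ennreal (\<rho> \<eta> powr m * norm (f \<eta>)))\<^sup>2 \<partial>lborel)"
        unfolding X_def eq by (rule Cauchy_Schwarz_nn_integral) measurable
      also have "(\<integral>\<^sup>+\<eta>. (ennreal (\<rho> \<eta> powr m * norm (f \<eta>)))\<^sup>2 \<partial>lborel) = wnorm_sq m f"
        unfolding wnorm_sq_def by (intro nn_integral_cong ennreal_power) simp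
      also have "(\<integral>\<^sup>+\<eta>. (ennreal (\<rho> \<eta> powr (-(m - p))))\<^sup>2 \<partial>lborel) = (\<integral>\<^sup>+\<eta>. ennreal (\<rho> \<eta> powr (-(2 * (m - p)))) \<partial>lborel)"
        by (intro nn_integral_cong, subst ennreal_power, simp) (simp add: power2_eq_square flip: powr_add)
      also have "\<dots> * wnorm_sq m f \<le> ennreal C1 * wnorm_sq m f" using C1 by (intro mult_right_mono) auto
      finally show "X\<^sup>2 \<le> ennreal C1 * wnorm_sq m f" .
      let ?I = "\<integral>\<^sup>+x. ennreal (gauss_env a x) \<partial>lborel"
      have I: "?I \<le> ennreal (a powr (3/2) * J)"
        unfolding gauss_env_integral[OF a(1)] using J by (simp add: ennreal_mult' mult_left_mono)
      have "(\<integral>\<^sup>+\<xi>. (Y \<xi>)\<^sup>2 \<partial>lborel)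
        \<le> (\<integral>\<^sup>+\<xi>. (\<integral>\<^sup>+\<eta>. ennreal (gauss_env a (\<xi> - \<epsilon> *\<^sub>R \<eta>) * (\<rho> \<eta> powr m * \<bar>f \<eta>\<bar>)\<^sup>2) \<partial>lborel)
            * (\<integral>\<^sup>+\<eta>. ennreal (gauss_env a (\<xi> - \<epsilon> *\<^sub>R \<eta>) * 1\<^sup>2) \<partial>lborel) \<partial>lborel)"
        unfolding Y_def by (intro nn_integral_mono Cauchy_Schwarz_weighted) (auto simp: gauss_env_nonneg)
      also have "\<dots> = (\<integral>\<^sup>+\<xi>. (\<integral>\<^sup>+\<eta>. ennreal (gauss_env a (\<xi> - \<epsilon> *\<^sub>R \<eta>) * (\<rho> \<eta> powr m * \<bar>f \<eta>\<bar>)\<^sup>2) \<partial>lborel) * (ennreal (\<epsilon> powr (-3)) * ?I) \<partial>lborel)"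
        by (simp only: one_power2 mult_1_right gauss_env_integral_inner[OF e(1)])
      also have "\<dots> = (\<integral>\<^sup>+\<xi>. (\<integral>\<^sup>+\<eta>. ennreal (gauss_env a (\<xi> - \<epsilon> *\<^sub>R \<eta>) * (\<rho> \<eta> powr m * \<bar>f \<eta>\<bar>)\<^sup>2) \<partial>lborel) \<partial>lborel) * (ennreal (\<epsilon> powr (-3)) * ?I)"
        by (rule nn_integral_multc) measurable
      also have "(\<integral>\<^sup>+\<xi>. (\<integral>\<^sup>+\<eta>. ennreal (gauss_env a (\<xi> - \<epsilon> *\<^sub>R \<eta>) * (\<rho> \<eta> powr m * \<bar>f \<eta>\<bar>)\<^sup>2) \<partial>lborel) \<partial>lborel)
         = (\<integral>\<^sup>+\<eta>. (\<integral>\<^sup>+\<xi>. ennreal (gauss_env a (\<xi> - \<epsilon> *\<^sub>R \<eta>) * (\<rho> \<eta> powr m * \<bar>f \<eta>\<bar>)\<^sup>2) \<partial>lborel) \<partial>lborel)"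
        by (rule lborel_pair.Fubini'[symmetric]) measurable
      also have "\<dots> = (\<integral>\<^sup>+\<eta>. ?I * ennreal ((\<rho> \<eta> powr m * norm (f \<eta>))\<^sup>2) \<partial>lborel)"
        by (intro nn_integral_cong)
          (simp only: ennreal_mult[OF gauss_env_nonneg zero_le_power2], subst nn_integral_multc, measurable, simp only: gauss_env_integral_outer real_norm_def)
      also have "\<dots> = ?I * wnorm_sq m f"
        unfolding wnorm_sq_def by (rule nn_integral_cmult) measurable
      also have "?I * wnorm_sq m f * (ennreal (\<epsilon> powr (-3)) * ?I)
         \<le> ennreal (a powr (3/2) * J) * wnorm_sq m f * (ennreal (\<epsilon> powr (-3)) * ennreal (a powr (3/2) * J))"
        by (intro mult_mono I order_refl) auto
      also have "\<dots> = ennreal y * wnorm_sq m f"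
        unfolding y_def using J(1) by (simp add: ennreal_mult mult_ac)
      finally show "(\<integral>\<^sup>+\<xi>. (Y \<xi>)\<^sup>2 \<partial>lborel) \<le> ennreal y * wnorm_sq m f" .
    qed (use J C1 AB in \<open>auto simp: \<alpha>_def \<beta>_def y_def\<close>)
    also have "\<dots> \<le> ennreal (C * \<epsilon> powr (2 * p)) * wnorm_sq m f"
    proof (intro mult_right_mono ennreal_leI)
      have e2: "(x powr q)\<^sup>2 = x powr (2 * q)" for x q :: real by (simp add: power2_eq_square flip: powr_add)
      have a4: "a powr (2 * - (3/2)) * (a powr (3/2) * a powr (3/2)) = 1" unfolding powr_add[symmetric] using a by simp
      have 1: "2 * \<alpha>\<^sup>2 * J * C1 = (2 * A\<^sup>2 * J * C1) * \<epsilon> powr (2 * p)"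
        unfolding \<alpha>_def power_mult_distrib e2 by simp
      have em: "\<epsilon> powr (2 * m) * \<epsilon> powr (-3) \<le> \<epsilon> powr (2 * p)"
        unfolding powr_add[symmetric] using mp e by (intro powr_mono') auto
      have "2 * \<beta>\<^sup>2 * y = (2 * B\<^sup>2 * J\<^sup>2) * (\<epsilon> powr (2 * m) * \<epsilon> powr (-3)) * (a powr (2 * - (3/2)) * (a powr (3/2) * a powr (3/2)))"
        unfolding \<beta>_def y_def power_mult_distrib e2 by (simp only: power2_eq_square mult_ac)
      also have "\<dots> \<le> (2 * B\<^sup>2 * J\<^sup>2) * \<epsilon> powr (2 * p)"
        unfolding a4 mult_1_right using em by (intro mult_left_mono) auto
      finally show "2 * \<alpha>\<^sup>2 * J * C1 + 2 * \<beta>\<^sup>2 * y \<le> C * \<epsilon> powr (2 * p)"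
        using 1 unfolding C_def by (simp only: distrib_right)
    qed auto
    finally show ?thesis .
  qed
  moreover have "C \<ge> 0" using J C1 by (simp add: C_def)
  ultimately show ?thesis by blast
qed

section \<open>The tensor algebra of the asymptotic profiles\<close>

lemma hfield_eq:
  "hfield i j \<xi> = - (G \<xi> / 4) *\<^sub>R (\<xi> $ i *\<^sub>R cross3 (axis j 1) \<xi> + \<xi> $ j *\<^sub>R cross3 (axis i 1) \<xi>)"
proof -
  have pl: "pfield j (\<xi> + t *\<^sub>R axis i 1) = pfield j \<xi> + t *\<^sub>R pfield j (axis i 1)" for i j and t :: real
    by (simp add: pfield_def cross_add_right cross_mult_right scaleR_add_right)
  have p: "pderiv3 i (ffield j) \<xi> = G \<xi> *\<^sub>R pfield j (axis i 1) + (- (\<xi> $ i / 2) * G \<xi>) *\<^sub>R pfield j \<xi>" for i j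
  proof (rule pderiv3_eqI)
    have d: "((\<lambda>t. pfield j \<xi> + t *\<^sub>R pfield j (axis i 1)) has_vector_derivative pfield j (axis i 1)) (at (0::real))"
      by (auto intro!: derivative_eq_intros simp: has_vector_derivative_def)
    show "((\<lambda>t. ffield j (\<xi> + t *\<^sub>R axis i 1)) has_vector_derivative
       G \<xi> *\<^sub>R pfield j (axis i 1) + (- (\<xi> $ i / 2) * G \<xi>) *\<^sub>R pfield j \<xi>) (at 0)"
      unfolding ffield_eq pl using has_vector_derivative_scaleR[OF has_deriv_G_line d] by simp
  qed
  have c: "cross3 (axis j 1) (axis i 1) = - cross3 (axis i 1) (axis j 1)" for i j :: 3
    by (rule cross_skew)
  show ?thesis
    unfolding hfield_def p by (simp add: pfield_def c[of j i] algebra_simps)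
qed

text \<open>An antisymmetric matrix is given by its axial vector, which accounts for the three \<open>f\<^sub>i\<close>.  In \<open>T\<close> only the part symmetric in
  the last two indices matters, and such tensors without totally symmetric part form a space of dimension
  \<open>18 - 10 = 8\<close>: three dimensions for the traces, carried by the \<open>g\<^sub>i\<close>, and five trace-free ones, carried by the
  \<open>h\<^sub>i\<^sub>j\<close>.  The five pairs in \<open>S\<close> suffice because the sum of the \<open>h\<^sub>i\<^sub>i\<close> is zero.\<close>
lemma w_app_coefficients_exist:
  fixes A :: "3 \<Rightarrow> 3 \<Rightarrow> real" and T :: "3 \<Rightarrow> 3 \<Rightarrow> 3 \<Rightarrow> real"
  assumes A: "\<And>i j. A i j + A j i = 0"
    and T: "\<And>i j k. T i j k + T i k j + T j i k + T j k i + T k i j + T k j i = 0"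
  shows "\<exists>b c d. \<forall>\<tau> \<xi> i. w_app b c d \<tau> \<xi> $ i
     = exp (- \<tau>) * (\<Sum>j\<in>UNIV. A i j * dG j \<xi>) + exp (- (3/2) * \<tau>) * (\<Sum>j\<in>UNIV. \<Sum>k\<in>UNIV. T i j k * ddG j k \<xi>)"
proof -
  define U where "U i j k = (T i j k + T i k j) / 2" for i j k
  have U_sum: "(\<Sum>j\<in>UNIV. \<Sum>k\<in>UNIV. T i j k * ddG j k \<xi>) = (\<Sum>j\<in>UNIV. \<Sum>k\<in>UNIV. U i j k * ddG j k \<xi>)" for i \<xi>
    by (simp add: U_def sum_3 ddG_def field_simps)
  have Us: "U i j k = U i k j" for i j k by (simp add: U_def)
  have U3: "U i j k + U j i k + U k i j = 0" for i j k using T[of i j k] by (simp add: U_def field_simps)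
  have Ud: "U i i i = 0" for i using U3[of i i i] by simp
  have Ue: "U j i i = - 2 * U i i j" for i j using U3[of i i j] Us[of i i j] by simp
  have A0: "A i i = 0" for i using A[of i i] by simp
  have A1: "A j i = - A i j" for i j using A[of i j] by simp
  \<comment> \<open>\<open>g\<^sub>i\<close> has coefficient tensor with trace \<open>- 2\<close> times the \<open>i\<close>-th unit vector, and that of \<open>h\<^sub>i\<^sub>j\<close> is trace free\<close>
  define c where "c i = - (U i 1 1 + U i 2 2 + U i 3 3) / 2" for i :: 3
  \<comment> \<open>the axial vector of \<open>A\<close>\<close>
  define b where "b i = (if i = 1 then A 2 3 else if i = 2 then - A 1 3 else A 1 2)" for i :: 3
  \<comment> \<open>read off from the coefficients of the monomials in \<open>\<xi>\<close> once the multiples of \<open>g\<^sub>i\<close> are subtracted\<close>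
  define d where "d i j = (if i = 1 \<and> j = 1 then U 2 1 3
     else if i = 2 \<and> j = 2 then - U 1 2 3
     else if i = 1 \<and> j = 2 then - 2 * (U 1 1 3 - c 3 / 2)
     else if i = 1 \<and> j = 3 then 2 * (U 1 1 2 - c 2 / 2)
     else U 1 2 2 + c 1)" for i j :: 3
  have n3: "(norm \<xi>)\<^sup>2 = (\<xi> $ 1)\<^sup>2 + (\<xi> $ 2)\<^sup>2 + (\<xi> $ 3)\<^sup>2" for \<xi> :: "real^3"
    unfolding power2_norm_eq_inner by (simp add: inner_vec_def sum_3 power2_eq_square)
  have Ssum: "(\<Sum>(i, j)\<in>S. F i j) = F 1 1 + F 1 2 + F 1 3 + F 2 2 + F 2 3" for F :: "3 \<Rightarrow> 3 \<Rightarrow> real^3"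
    by (simp add: S_def)
  have f: "(\<Sum>i\<in>UNIV. (b i * r) *\<^sub>R ffield i \<xi>) $ l = r * (\<Sum>j\<in>UNIV. A l j * dG j \<xi>)" for r \<xi> l
    using exhaust_3[of l]
    by (elim disjE) (simp_all add: sum_3 ffield_eq pfield_def cross3_def axis_def dG_def b_def A0
        A1[of 1 2] A1[of 1 3] A1[of 2 3] algebra_simps)
  have g: "(\<Sum>i\<in>UNIV. (c i * r) *\<^sub>R gfield i \<xi>) $ l + (\<Sum>(i, j)\<in>S. (d i j * r) *\<^sub>R hfield i j \<xi>) $ l
     = r * (\<Sum>j\<in>UNIV. \<Sum>k\<in>UNIV. U l j k * ddG j k \<xi>)" for r \<xi> l
  proof -
    have e: "U 1 1 1 = 0" "U 2 2 2 = 0" "U 3 3 3 = 0" "U 2 1 1 = - 2 * U 1 1 2" "U 3 1 1 = - 2 * U 1 1 3"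
      "U 1 2 2 = - 2 * U 2 1 2" "U 3 2 2 = - 2 * U 2 2 3" "U 1 3 3 = - 2 * U 3 1 3" "U 2 3 3 = - 2 * U 3 2 3"
      "U 3 1 2 = - U 1 2 3 - U 2 1 3"
      "U 1 2 1 = U 1 1 2" "U 1 3 1 = U 1 1 3" "U 2 2 1 = U 2 1 2" "U 2 3 2 = U 2 2 3" "U 3 3 1 = U 3 1 3" "U 3 3 2 = U 3 2 3"
      "U 1 3 2 = U 1 2 3" "U 2 3 1 = U 2 1 3" "U 3 2 1 = U 3 1 2"
      using Ud Ue[of 2 1] Ue[of 3 1] Ue[of 1 2] Ue[of 3 2] Ue[of 1 3] Ue[of 2 3] U3[of 1 2 3]
        Us[of 1 2 1] Us[of 1 3 1] Us[of 2 2 1] Us[of 2 3 2] Us[of 3 3 1] Us[of 3 3 2] Us[of 1 3 2] Us[of 2 3 1] Us[of 3 2 1]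
      by auto
    show ?thesis
      using exhaust_3[of l]
      by (elim disjE) (simp_all add: Ssum sum_3 gfield_eq hfield_eq cross3_def axis_def ddG_def c_def d_def e n3,
         simp_all add: field_simps power2_eq_square)
  qed
  have "w_app b c d \<tau> \<xi> $ i
     = exp (- \<tau>) * (\<Sum>j\<in>UNIV. A i j * dG j \<xi>) + exp (- (3/2) * \<tau>) * (\<Sum>j\<in>UNIV. \<Sum>k\<in>UNIV. T i j k * ddG j k \<xi>)" for \<tau> \<xi> i
    unfolding w_app_def vector_add_component f U_sum g[symmetric] by simp
  then show ?thesis by blast
qed

section \<open>Moments of divergence-free fields\<close>

text \<open>The functions \<open>s ^ (- n) * exp (- 1 / s)\<close>, extended by zero: the building blocks of smooth cut-offs.\<close>
definition flat :: "nat \<Rightarrow> real \<Rightarrow> real"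
  where "flat n s = (if s > 0 then inverse s ^ n * exp (- inverse s) else 0)"

lemma flat_nonneg: "0 \<le> flat n s" unfolding flat_def by simp

lemma flat_le: "flat n s \<le> fact (n + k) * s ^ k" if "0 < s"
proof -
  have e: "inverse s ^ (n + k) / fact (n + k) \<le> exp (inverse s)"
  proof -
    have "(\<Sum>i\<in>{n + k}. inverse s ^ i /\<^sub>R fact i) \<le> (\<Sum>i. inverse s ^ i /\<^sub>R fact i)"
      using that by (intro sum_le_suminf summable_exp_generic) auto
    then show ?thesis by (simp add: exp_def divide_inverse mult.commute)
  qed
  have "inverse s ^ n * exp (- inverse s) * exp (inverse s) = inverse s ^ n"
    by (simp add: mult.assoc flip: exp_add)
  also have "inverse s ^ n = (s ^ k * fact (n + k)) * (inverse s ^ (n + k) / fact (n + k))"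
    using that by (simp add: power_add field_simps)
  also have "\<dots> \<le> (s ^ k * fact (n + k)) * exp (inverse s)"
    using that e by (intro mult_left_mono) auto
  finally show ?thesis using that by (simp add: flat_def mult.commute)
qed

text \<open>The derivative stays in the family, and at \<open>s = 0\<close> it exists because every function of the family vanishes to all orders there.\<close>
lemma flat_has_derivative:
  "(flat n has_real_derivative flat (n + 2) s - real n * flat (n + 1) s) (at s)"
proof -
  consider "s > 0" | "s < 0" | "s = 0" by linarith
  then show ?thesis
  proof cases
    case 1
    have p: "((\<lambda>s. inverse s ^ n) has_real_derivative - real n * inverse s ^ (n + 1)) (at s)"
    proof -
      have "s \<noteq> 0" using 1 by simp
      from DERIV_power[OF DERIV_inverse[OF this], of n] show ?thesis
        by (rule DERIV_cong) (cases n, simp_all add: algebra_simps)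
    qed
    have "((\<lambda>s. inverse s ^ n * exp (- inverse s)) has_real_derivative flat (n + 2) s - real n * flat (n + 1) s) (at s)"
      by (rule derivative_eq_intros p refl)+ (use 1 in \<open>auto simp: flat_def power2_eq_square algebra_simps\<close>)
    then show ?thesis
      by (rule has_field_derivative_transform_within_open[of _ _ _ "{0<..}"]) (use 1 in \<open>auto simp: flat_def\<close>)
  next
    case 2
    have "((\<lambda>s. 0) has_real_derivative flat (n + 2) s - real n * flat (n + 1) s) (at s)"
      using 2 by (simp add: flat_def)
    then show ?thesis
      by (rule has_field_derivative_transform_within_open[of _ _ _ "{..<0}"]) (use 2 in \<open>auto simp: flat_def\<close>)
  next
    case 3
    have "(\<lambda>h. flat n h / h) \<midarrow>0\<rightarrow> 0"
    proof (rule Lim_null_comparison)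
      show "\<forall>\<^sub>F h in at 0. norm (flat n h / h) \<le> fact (n + 2) * \<bar>h\<bar>"
      proof (intro always_eventually allI)
        fix h :: real
        show "norm (flat n h / h) \<le> fact (n + 2) * \<bar>h\<bar>"
        proof (cases "h > 0")
          case True
          then show ?thesis using flat_le[OF True, of n 2] flat_nonneg[of n h]
            by (simp add: divide_le_eq power2_eq_square mult.assoc)
        next
          case False
          then have "norm (flat n h / h) = 0" by (simp add: flat_def)
          moreover have "0 \<le> fact (n + 2) * \<bar>h\<bar>" by (intro mult_nonneg_nonneg) auto
          ultimately show ?thesis by linarith
        qed
      qed
      show "(\<lambda>h. fact (n + 2) * \<bar>h\<bar>) \<midarrow>0\<rightarrow> (0::real)"
        by (auto intro!: tendsto_eq_intros)
    qed
    then show ?thesis using 3 by (simp add: DERIV_def flat_def)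
  qed
qed

text \<open>An algebra of functions closed under partial derivatives.  Smoothness of its members then needs no computation of higher derivatives:
  it is one induction on the order.\<close>
inductive bump_algebra :: "real \<Rightarrow> (real^3 \<Rightarrow> real) \<Rightarrow> bool" for R :: real
  where
    const: "bump_algebra R (\<lambda>x. c)"
  | coord: "bump_algebra R (\<lambda>x. x $ i)"
  | bump: "bump_algebra R (\<lambda>x. flat n (1 - (norm x)\<^sup>2 / R\<^sup>2))"
  | add: "bump_algebra R f \<Longrightarrow> bump_algebra R g \<Longrightarrow> bump_algebra R (\<lambda>x. f x + g x)"
  | mult: "bump_algebra R f \<Longrightarrow> bump_algebra R g \<Longrightarrow> bump_algebra R (\<lambda>x. f x * g x)"

lemma has_derivative_line:
  fixes f :: "real^3 \<Rightarrow> real"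
  assumes "(f has_derivative f') (at x)"
  shows "((\<lambda>t. f (x + t *\<^sub>R axis j 1)) has_vector_derivative f' (axis j 1)) (at 0)"
proof -
  have "((\<lambda>t::real. x + t *\<^sub>R axis j 1) has_derivative (\<lambda>t. t *\<^sub>R axis j 1)) (at 0)"
    by (auto intro!: derivative_eq_intros)
  moreover have "(f has_derivative f') (at (x + 0 *\<^sub>R axis j 1))" using assms by simp
  ultimately have "((\<lambda>t. f (x + t *\<^sub>R axis j 1)) has_derivative (\<lambda>t. f' (t *\<^sub>R axis j 1))) (at 0)"
    by (rule has_derivative_compose)
  moreover have "f' (t *\<^sub>R axis j 1) = t *\<^sub>R f' (axis j 1)" for t
    using assms has_derivative_bounded_linear bounded_linear.linear linear_scale by blast
  ultimately show ?thesis by (simp add: has_vector_derivative_def)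
qed

lemma pderiv3_has_derivative:
  fixes f :: "real^3 \<Rightarrow> real"
  assumes "(f has_derivative f') (at x)" shows "pderiv3 j f x = f' (axis j 1)"
  by (rule pderiv3_eqI) (rule has_derivative_line[OF assms])

lemma bump_inner_has_derivative:
  "((\<lambda>x. flat n (1 - (norm x)\<^sup>2 / R\<^sup>2)) has_derivative
     (\<lambda>h. - (2 * (x \<bullet> h) / R\<^sup>2) * (flat (n + 2) (1 - (norm x)\<^sup>2 / R\<^sup>2) - real n * flat (n + 1) (1 - (norm x)\<^sup>2 / R\<^sup>2)))) (at (x::real^3))"
proof -
  have "((\<lambda>x. 1 - (norm x)\<^sup>2 / R\<^sup>2) has_derivative (\<lambda>h. - (2 * (x \<bullet> h) / R\<^sup>2))) (at x)"
    unfolding power2_norm_eq_inner by (cases "R = 0") (auto intro!: derivative_eq_intros simp: inner_commute fun_eq_iff field_simps power2_eq_square power4_eq_xxxx)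
  from has_derivative_compose[OF this has_field_derivative_imp_has_derivative[OF flat_has_derivative]]
  show ?thesis by (simp add: mult.commute)
qed

lemma bump_algebra_derivative:
  assumes "bump_algebra R f"
  shows "(\<forall>x. f differentiable (at x)) \<and> (\<forall>j. bump_algebra R (pderiv3 j f))"
  using assms
proof induction
  case (const c)
  have "pderiv3 j (\<lambda>x. c) = (\<lambda>x. 0)" for j
    using pderiv3_has_derivative[OF has_derivative_const] by auto
  then show ?case using bump_algebra.const[of R 0] by simp
next
  case (coord i)
  have d: "((\<lambda>x. x $ i) has_derivative (\<lambda>h. h $ i)) (at x)" for x :: "real^3"
    by (intro bounded_linear_imp_has_derivative bounded_linear_vec_nth)
  then have "pderiv3 j (\<lambda>x. x $ i) = (\<lambda>x. axis j 1 $ i :: real)" for j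
    using pderiv3_has_derivative[OF d] by auto
  moreover have "(\<lambda>x. x $ i) differentiable (at x)" for x :: "real^3"
    using d unfolding differentiable_def by blast
  ultimately show ?case using bump_algebra.const by auto
next
  case (bump n)
  have "pderiv3 j (\<lambda>x. flat n (1 - (norm x)\<^sup>2 / R\<^sup>2))
     = (\<lambda>x. ((-2 / R\<^sup>2) * x $ j) * (flat (n + 2) (1 - (norm x)\<^sup>2 / R\<^sup>2) + (- real n) * flat (n + 1) (1 - (norm x)\<^sup>2 / R\<^sup>2)))" for j
    using pderiv3_has_derivative[OF bump_inner_has_derivative] by (auto simp: inner_axis)
  moreover have "bump_algebra R (\<lambda>x. ((-2 / R\<^sup>2) * x $ j) * (flat (n + 2) (1 - (norm x)\<^sup>2 / R\<^sup>2) + (- real n) * flat (n + 1) (1 - (norm x)\<^sup>2 / R\<^sup>2)))" for j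
    by (intro bump_algebra.intros)
  moreover have "(\<lambda>x. flat n (1 - (norm x)\<^sup>2 / R\<^sup>2)) differentiable (at x)" for x :: "real^3"
    using bump_inner_has_derivative unfolding differentiable_def by blast
  ultimately show ?case by auto
next
  case (add f g)
  have "pderiv3 j (\<lambda>x. f x + g x) = (\<lambda>x. pderiv3 j f x + pderiv3 j g x)" for j
  proof
    fix x
    obtain f' g' where d: "(f has_derivative f') (at x)" "(g has_derivative g') (at x)"
      using add by (auto simp: differentiable_def) metis
    show "pderiv3 j (\<lambda>x. f x + g x) x = pderiv3 j f x + pderiv3 j g x"
      using pderiv3_has_derivative[OF has_derivative_add[OF d]] pderiv3_has_derivative[OF d(1)]
        pderiv3_has_derivative[OF d(2)] by simp
  qed
  then show ?case using add by (auto intro!: bump_algebra.add derivative_intros)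
next
  case (mult f g)
  have "pderiv3 j (\<lambda>x. f x * g x) = (\<lambda>x. f x * pderiv3 j g x + pderiv3 j f x * g x)" for j
  proof
    fix x
    obtain f' g' where d: "(f has_derivative f') (at x)" "(g has_derivative g') (at x)"
      using mult by (auto simp: differentiable_def) metis
    show "pderiv3 j (\<lambda>x. f x * g x) x = f x * pderiv3 j g x + pderiv3 j f x * g x"
      using pderiv3_has_derivative[OF has_derivative_mult[OF d]] pderiv3_has_derivative[OF d(1)]
        pderiv3_has_derivative[OF d(2)] by simp
  qed
  then show ?case using mult by (auto intro!: bump_algebra.add bump_algebra.mult derivative_intros)
qed

lemma bump_algebra_C_times: "bump_algebra R f \<Longrightarrow> C_times k f"
proof (induction k arbitrary: f)
  case 0
  then have "f differentiable_on UNIV" using bump_algebra_derivative by (auto simp: differentiable_on_def)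
  then show ?case by (simp add: differentiable_imp_continuous_on)
next
  case (Suc k)
  then show ?case using bump_algebra_derivative[OF Suc.prems] by (auto simp: differentiable_on_def)
qed

lemma test_function_cutoff:
  assumes P: "bump_algebra R P" and R: "R > 0"
  shows "test_function (\<lambda>x. P x * flat 0 (1 - (norm x)\<^sup>2 / R\<^sup>2))"
  unfolding test_function_def
proof (intro conjI allI)
  show "C_times k (\<lambda>x. P x * flat 0 (1 - (norm x)\<^sup>2 / R\<^sup>2))" for k
    by (intro bump_algebra_C_times[where R = R] bump_algebra.mult P bump_algebra.bump)
  have "{\<xi>. P \<xi> * flat 0 (1 - (norm \<xi>)\<^sup>2 / R\<^sup>2) \<noteq> 0} \<subseteq> cball 0 R"
  proof
    fix x assume "x \<in> {\<xi>. P \<xi> * flat 0 (1 - (norm \<xi>)\<^sup>2 / R\<^sup>2) \<noteq> 0}"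
    then have "1 - (norm x)\<^sup>2 / R\<^sup>2 > 0" by (auto simp: flat_def split: if_splits)
    then have "(norm x)\<^sup>2 < R\<^sup>2" using R by (simp add: field_simps)
    then show "x \<in> cball 0 R" using R power2_less_imp_less[of "norm x" R] by simp
  qed
  then have "bounded {\<xi>. P \<xi> * flat 0 (1 - (norm \<xi>)\<^sup>2 / R\<^sup>2) \<noteq> 0}" by (rule bounded_subset[OF bounded_cball])
  then show "compact (closure {\<xi>. P \<xi> * flat 0 (1 - (norm \<xi>)\<^sup>2 / R\<^sup>2) \<noteq> 0})" by simp
qed

text \<open>Test the divergence against \<open>P\<close> times a smooth cut-off at radius \<open>n + 1\<close> and remove the cut-off by dominated convergence.  The gradient of
  the cut-off is \<open>O (1 / n)\<close> and supported where \<open>norm x \<le> n + 1\<close>, which compensates the one additional power of growth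
  of \<open>P\<close> over its gradient.\<close>
lemma div_free_orthogonal_gradient:
  fixes P :: "real^3 \<Rightarrow> real" and w :: "real^3 \<Rightarrow> real^3"
  assumes P: "\<And>R. bump_algebra R P" and P': "\<And>x. (P has_derivative (\<lambda>h. D x \<bullet> h)) (at x)"
    and bP: "\<And>x. \<bar>P x\<bar> \<le> \<rho> x ^ 3" and bD: "\<And>x. norm (D x) \<le> 3 * \<rho> x ^ 2"
    and D [measurable]: "D \<in> borel_measurable borel"
    and df: "div_free w" and w [measurable]: "w \<in> borel_measurable borel"
    and int: "integrable lborel (\<lambda>x. \<rho> x ^ 2 * norm (w x))"
  shows "(LINT x|lborel. w x \<bullet> D x) = 0"
proof -
  define u where "u n x = 1 - (norm x)\<^sup>2 / (real (Suc n))\<^sup>2" for n :: nat and x :: "real^3"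
  define g where "g n x = flat 0 (u n x) *\<^sub>R D x - (2 * P x / (real (Suc n))\<^sup>2 * flat 2 (u n x)) *\<^sub>R x" for n x
  have [measurable]: "P \<in> borel_measurable borel"
  proof (rule borel_measurable_continuous_onI)
    show "continuous_on UNIV P"
      using bump_algebra_C_times[OF P[of 1], of 0] by simp
  qed
  have [measurable]: "flat n \<in> borel_measurable borel" for n
    unfolding flat_def[abs_def] by measurable
  have [measurable]: "u n \<in> borel_measurable borel" for n
    unfolding u_def[abs_def] by measurable
  have gr: "grad (\<lambda>x. P x * flat 0 (u n x)) x = g n x" for n x
  proof -
    have d: "((\<lambda>x. P x * flat 0 (u n x)) has_derivative
      (\<lambda>h. P x * (- (2 * (x \<bullet> h) / (real (Suc n))\<^sup>2) * (flat (0 + 2) (u n x) - real 0 * flat (0 + 1) (u n x)))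
         + (D x \<bullet> h) * flat 0 (u n x))) (at x)"
      unfolding u_def by (rule has_derivative_mult[OF P' bump_inner_has_derivative])
    have "pderiv3 j (\<lambda>x. P x * flat 0 (u n x)) x = g n x $ j" for j
      using pderiv3_has_derivative[OF d] by (simp add: g_def inner_axis mult_ac numeral_2_eq_2)
    then show ?thesis by (simp add: grad_def vec_eq_iff)
  qed
  have zero: "(LINT x|lborel. w x \<bullet> g n x) = 0" for n
  proof -
    have "test_function (\<lambda>x. P x * flat 0 (u n x))"
      unfolding u_def by (rule test_function_cutoff[OF P]) simp
    then show ?thesis using df unfolding div_free_def gr[symmetric] by blast
  qed
  have u0: "(\<lambda>n. u n x) \<longlonglongrightarrow> 1" for x
  proof -
    have "(\<lambda>n. 1 - (norm x)\<^sup>2 * (inverse (real (Suc n)))\<^sup>2) \<longlonglongrightarrow> 1 - (norm x)\<^sup>2 * 0\<^sup>2"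
      by (intro tendsto_intros LIMSEQ_inverse_real_of_nat)
    then show ?thesis by (simp add: u_def divide_inverse power_inverse)
  qed
  have fc: "(\<lambda>n. flat k (u n x)) \<longlonglongrightarrow> flat k 1" for k x
    using isCont_tendsto_compose[OF DERIV_isCont[OF flat_has_derivative] u0] .
  \<comment> \<open>the cut-offs tend to the constant \<open>flat 0 1 = exp (- 1)\<close> instead of \<open>1\<close>; this does not matter for a vanishing integral\<close>
  have lim: "(\<lambda>n. w x \<bullet> g n x) \<longlonglongrightarrow> w x \<bullet> (exp (-1) *\<^sub>R D x)" for x
  proof -
    have "(\<lambda>n. 2 * P x * (inverse (real (Suc n)))\<^sup>2 * flat 2 (u n x)) \<longlonglongrightarrow> 2 * P x * 0\<^sup>2 * flat 2 1"
      by (intro tendsto_intros LIMSEQ_inverse_real_of_nat fc)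
    then have "(\<lambda>n. 2 * P x / (real (Suc n))\<^sup>2 * flat 2 (u n x)) \<longlonglongrightarrow> 0"
      by (simp add: divide_inverse power_inverse)
    then have "(\<lambda>n. w x \<bullet> g n x) \<longlonglongrightarrow> w x \<bullet> (flat 0 1 *\<^sub>R D x - 0 *\<^sub>R x)"
      unfolding g_def by (intro tendsto_intros fc)
    then show ?thesis by (simp add: flat_def)
  qed
  have f2: "flat 2 s \<le> 2" if "s \<le> 1" for s
    using flat_le[of s 2 0] that by (cases "s > 0") (auto simp: flat_def numeral_2_eq_2)
  have f0: "flat 0 s \<le> 1" for s by (simp add: flat_def)
  have bound: "norm (w x \<bullet> g n x) \<le> 11 * (\<rho> x ^ 2 * norm (w x))" for n x
  proof -
    have r1: "1 \<le> \<rho> x" by (rule rho_ge_1)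
    have u1: "u n x \<le> 1" by (simp add: u_def)
    have t2: "norm ((2 * P x / (real (Suc n))\<^sup>2 * flat 2 (u n x)) *\<^sub>R x) \<le> 8 * \<rho> x ^ 2"
    proof (cases "u n x > 0")
      case True
      then have "(norm x)\<^sup>2 < (real (Suc n))\<^sup>2" by (simp add: u_def field_simps del: of_nat_Suc)
      then have nx: "norm x \<le> real (Suc n)" by (meson less_imp_le of_nat_0_le_iff power2_le_imp_le)
      have rn: "\<rho> x \<le> 2 * real (Suc n)" using nx by (simp add: \<rho>_def)
      have "norm ((2 * P x / (real (Suc n))\<^sup>2 * flat 2 (u n x)) *\<^sub>R x)
        = 2 * \<bar>P x\<bar> * flat 2 (u n x) * norm x / (real (Suc n))\<^sup>2"
        by (simp add: abs_mult flat_nonneg)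
      also have "\<dots> \<le> 2 * \<rho> x ^ 3 * 2 * real (Suc n) / (real (Suc n))\<^sup>2"
        using bP[of x] f2[OF u1] nx r1 flat_nonneg[of 2 "u n x"] by (intro divide_right_mono mult_mono) auto
      also have "\<dots> = (4 * \<rho> x ^ 2) * (\<rho> x / real (Suc n))"
        by (simp add: power2_eq_square power3_eq_cube field_simps del: of_nat_Suc)
      also have "\<dots> \<le> (4 * \<rho> x ^ 2) * 2"
        using rn by (intro mult_left_mono) (auto simp: divide_le_eq simp del: of_nat_Suc)
      finally show ?thesis by simp
    qed (simp add: flat_def)
    have t1: "norm (flat 0 (u n x) *\<^sub>R D x) \<le> 3 * \<rho> x ^ 2"
      using mult_mono[OF f0[of "u n x"] bD[of x]] flat_nonneg[of 0 "u n x"] by simp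
    have "norm (g n x) \<le> 11 * \<rho> x ^ 2"
      unfolding g_def using norm_triangle_ineq4 t1 t2 by (smt (verit))
    then have "norm (w x) * norm (g n x) \<le> norm (w x) * (11 * \<rho> x ^ 2)" by (intro mult_left_mono) auto
    then show ?thesis using Cauchy_Schwarz_ineq2[of "w x" "g n x"] by (simp add: mult_ac)
  qed
  have "(\<lambda>n. LINT x|lborel. w x \<bullet> g n x) \<longlonglongrightarrow> (LINT x|lborel. w x \<bullet> (exp (-1) *\<^sub>R D x))"
  proof (rule integral_dominated_convergence[where w = "\<lambda>x. 11 * (\<rho> x ^ 2 * norm (w x))"])
    show "(\<lambda>x. w x \<bullet> g n x) \<in> borel_measurable lborel" for n unfolding g_def by measurable
    show "integrable lborel (\<lambda>x. 11 * (\<rho> x ^ 2 * norm (w x)))" using int by simp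
  qed (use lim bound in \<open>auto\<close>)
  then have "(LINT x|lborel. w x \<bullet> (exp (-1) *\<^sub>R D x)) = 0"
    unfolding zero using LIMSEQ_unique tendsto_const by blast
  then show ?thesis by simp
qed

lemma component_le_rho: "\<bar>x $ i\<bar> \<le> \<rho> x"
  using component_le_norm_cart[of x i] by (simp add: \<rho>_def)

text \<open>Orthogonality to the gradients of the monomials \<open>x\<^sub>i\<close>, \<open>x\<^sub>i x\<^sub>j\<close> and \<open>x\<^sub>i x\<^sub>j x\<^sub>k\<close>.\<close>
lemma div_free_moments:
  assumes df: "div_free w" and w [measurable]: "w \<in> borel_measurable borel"
    and int: "integrable lborel (\<lambda>x. \<rho> x ^ 2 * norm (w x))"
  shows "(LINT x|lborel. w x $ i) = 0"
    and "(LINT x|lborel. x $ i * w x $ j + x $ j * w x $ i) = 0"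
    and "(LINT x|lborel. x $ i * x $ j * w x $ k + x $ i * x $ k * w x $ j + x $ j * x $ k * w x $ i) = 0"
proof -
  note r = rho_ge_1
  have c: "((\<lambda>x. x $ i) has_derivative (\<lambda>h. axis i 1 \<bullet> h)) (at x)" for x :: "real^3" and i
    using bounded_linear_imp_has_derivative[OF bounded_linear_vec_nth, of i] by (simp add: inner_axis')
  have rp: "\<rho> x \<le> \<rho> x ^ 2" "\<rho> x \<le> \<rho> x ^ 3" "1 \<le> \<rho> x ^ 2" "\<rho> x ^ 2 \<le> \<rho> x ^ 3" for x
    using self_le_power[OF r[of x], of 2] self_le_power[OF r[of x], of 3] one_le_power[OF r[of x], of 2]
      power_increasing[OF _ r[of x], of 2 3] by auto
  have pr: "\<bar>x $ i * x $ j\<bar> \<le> \<rho> x ^ 2" for x i j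
    unfolding abs_mult power2_eq_square using rho_pos[of x] by (intro mult_mono component_le_rho) auto
  have [measurable]: "(\<lambda>x::real^3. axis i (1::real)) \<in> borel_measurable borel" for i :: 3 by simp
  have "(LINT x|lborel. w x \<bullet> axis i 1) = 0"
  proof (rule div_free_orthogonal_gradient[where P = "\<lambda>x. x $ i", OF bump_algebra.coord c _ _ _ df w int])
    show "\<bar>x $ i\<bar> \<le> \<rho> x ^ 3" for x using component_le_rho[of x i] rp(2)[of x] by linarith
    show "norm (axis i (1::real)) \<le> 3 * \<rho> x ^ 2" for x using rp(3)[of x] by simp
  qed simp
  then show "(LINT x|lborel. w x $ i) = 0" by (simp add: inner_axis)
  have c2: "((\<lambda>x. x $ i * x $ j) has_derivative (\<lambda>h. (x $ i *\<^sub>R axis j 1 + x $ j *\<^sub>R axis i 1) \<bullet> h)) (at x)" for x :: "real^3" and i j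
    by (rule has_derivative_eq_rhs[OF has_derivative_mult[OF c c]]) (auto simp: inner_add_left fun_eq_iff)
  have "(LINT x|lborel. w x \<bullet> (x $ i *\<^sub>R axis j 1 + x $ j *\<^sub>R axis i 1)) = 0"
  proof (rule div_free_orthogonal_gradient[where P = "\<lambda>x. x $ i * x $ j", OF _ c2 _ _ _ df w int])
    show "bump_algebra R (\<lambda>x. x $ i * x $ j)" for R by (intro bump_algebra.intros)
    show "\<bar>x $ i * x $ j\<bar> \<le> \<rho> x ^ 3" for x using pr[of x i j] rp(4)[of x] by linarith
    show "norm (x $ i *\<^sub>R axis j 1 + x $ j *\<^sub>R axis i (1::real)) \<le> 3 * \<rho> x ^ 2" for x :: "real^3"
    proof -
      have "norm (x $ i *\<^sub>R axis j 1 + x $ j *\<^sub>R axis i (1::real)) \<le> \<bar>x $ i\<bar> + \<bar>x $ j\<bar>"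
        by (rule norm_triangle_le) simp
      then show ?thesis using component_le_rho[of x i] component_le_rho[of x j] rp(1)[of x] r[of x] by linarith
    qed
  qed measurable
  then show "(LINT x|lborel. x $ i * w x $ j + x $ j * w x $ i) = 0"
    by (simp add: inner_add_right inner_axis)
  have c3: "((\<lambda>x. x $ i * x $ j * x $ k) has_derivative
     (\<lambda>h. ((x $ i * x $ j) *\<^sub>R axis k 1 + (x $ i * x $ k) *\<^sub>R axis j 1 + (x $ j * x $ k) *\<^sub>R axis i 1) \<bullet> h)) (at x)" for x :: "real^3"
    by (rule has_derivative_eq_rhs[OF has_derivative_mult[OF c2 c]]) (auto simp: inner_add_left fun_eq_iff algebra_simps)
  have "(LINT x|lborel. w x \<bullet> ((x $ i * x $ j) *\<^sub>R axis k 1 + (x $ i * x $ k) *\<^sub>R axis j 1 + (x $ j * x $ k) *\<^sub>R axis i 1)) = 0"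
  proof (rule div_free_orthogonal_gradient[where P = "\<lambda>x. x $ i * x $ j * x $ k", OF _ c3 _ _ _ df w int])
    show "bump_algebra R (\<lambda>x. x $ i * x $ j * x $ k)" for R by (intro bump_algebra.intros)
    show "\<bar>x $ i * x $ j * x $ k\<bar> \<le> \<rho> x ^ 3" for x
    proof -
      have "\<bar>x $ i * x $ j * x $ k\<bar> \<le> \<rho> x ^ 2 * \<rho> x"
        unfolding abs_mult[of "x $ i * x $ j"] by (intro mult_mono pr component_le_rho) auto
      then show ?thesis by (simp add: power2_eq_square power3_eq_cube)
    qed
    show "norm ((x $ i * x $ j) *\<^sub>R axis k 1 + (x $ i * x $ k) *\<^sub>R axis j 1 + (x $ j * x $ k) *\<^sub>R axis i (1::real)) \<le> 3 * \<rho> x ^ 2" for x :: "real^3"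
    proof -
      have "norm ((x $ i * x $ j) *\<^sub>R axis k 1 + (x $ i * x $ k) *\<^sub>R axis j 1 + (x $ j * x $ k) *\<^sub>R axis i (1::real))
         \<le> \<bar>x $ i * x $ j\<bar> + \<bar>x $ i * x $ k\<bar> + \<bar>x $ j * x $ k\<bar>"
        by (intro norm_triangle_le add_mono) (auto simp: norm_triangle_le)
      then show ?thesis using pr[of x i j] pr[of x i k] pr[of x j k] by linarith
    qed
  qed measurable
  then show "(LINT x|lborel. x $ i * x $ j * w x $ k + x $ i * x $ k * w x $ j + x $ j * x $ k * w x $ i) = 0"
    by (simp add: inner_add_right inner_axis)
qed

section \<open>The mild formulation in terms of the heat kernel\<close>

text \<open>Substituting \<open>\<epsilon> \<eta>\<close> for \<open>\<eta>\<close> removes the dilation from the argument of \<open>f\<close> and puts the small parameter into the kernel.\<close>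
lemma exp_Lambda_kernel:
  assumes t: "\<tau> > 0" and [measurable]: "f \<in> borel_measurable borel"
  shows "exp_Lambda \<tau> f \<xi> = exp (- \<tau> / 2) *
    (LINT \<eta>|lborel. heat (1 - (exp (- \<tau> / 2))\<^sup>2) (\<xi> - exp (- \<tau> / 2) *\<^sub>R \<eta>) * f \<eta>)"
proof -
  define \<epsilon> where "\<epsilon> = exp (- \<tau> / 2)"
  define a where "a = 1 - \<epsilon>\<^sup>2"
  have e2: "\<epsilon>\<^sup>2 = exp (- \<tau>)" by (simp add: \<epsilon>_def power2_eq_square flip: exp_add)
  have e0: "\<epsilon> > 0" by (simp add: \<epsilon>_def)
  have ee: "exp (\<tau> / 2) * \<epsilon> = 1" by (simp add: \<epsilon>_def flip: exp_add)
  have e3: "exp \<tau> * \<epsilon> ^ 3 = \<epsilon>"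
  proof -
    have "exp \<tau> * \<epsilon>\<^sup>2 = 1" unfolding e2 by (simp flip: exp_add)
    then show ?thesis by (simp add: power2_eq_square power3_eq_cube)
  qed
  have a: "1 - exp (- \<tau>) = a" by (simp add: a_def e2)
  let ?g = "\<lambda>\<eta>. exp (- (norm (\<xi> - \<eta>))\<^sup>2 / (4 * a)) * f (exp (\<tau>/2) *\<^sub>R \<eta>)"
  have "(LINT \<eta>|lborel. ?g \<eta>) = \<bar>\<epsilon>\<bar> ^ DIM(real^3) * (LINT \<eta>|lborel. ?g (0 + \<epsilon> *\<^sub>R \<eta>))"
    by (rule lborel_integral_affine) (use e0 in auto)
  also have "\<dots> = \<epsilon> ^ 3 * (LINT \<eta>|lborel. exp (- (norm (\<xi> - \<epsilon> *\<^sub>R \<eta>))\<^sup>2 / (4 * a)) * f \<eta>)"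
    using e0 ee by simp
  finally have g: "(LINT \<eta>|lborel. ?g \<eta>) = \<epsilon> ^ 3 * (LINT \<eta>|lborel. exp (- (norm (\<xi> - \<epsilon> *\<^sub>R \<eta>))\<^sup>2 / (4 * a)) * f \<eta>)" .
  have "exp_Lambda \<tau> f \<xi> = exp \<tau> / (4 * pi * a) powr (3/2) * (\<epsilon> ^ 3 * (LINT \<eta>|lborel. exp (- (norm (\<xi> - \<epsilon> *\<^sub>R \<eta>))\<^sup>2 / (4 * a)) * f \<eta>))"
    using t unfolding exp_Lambda_def a g by simp
  also have "\<dots> = (exp \<tau> * \<epsilon> ^ 3) * ((4 * pi * a) powr (-(3/2)) * (LINT \<eta>|lborel. exp (- (norm (\<xi> - \<epsilon> *\<^sub>R \<eta>))\<^sup>2 / (4 * a)) * f \<eta>))"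
    unfolding powr_minus divide_inverse by (simp only: mult_ac)
  also have "\<dots> = \<epsilon> * (LINT \<eta>|lborel. heat a (\<xi> - \<epsilon> *\<^sub>R \<eta>) * f \<eta>)"
    unfolding e3 heat_def by (simp add: mult.assoc)
  finally show ?thesis by (simp add: a_def \<epsilon>_def)
qed

text \<open>The second derivative of the kernel along a line is bounded, so its difference quotients converge uniformly; this is what allows
  differentiation under the integral against a merely integrable density.\<close>
lemma heat_line_taylor:
  assumes a: "0 < a"
  shows "\<exists>K\<ge>0. \<forall>x t. \<bar>heat a (x + t *\<^sub>R axis j 1) - heat a x - t * dheat j a x\<bar> \<le> K * t\<^sup>2"
proof -
  define c where "c = (4 * pi * a) powr (-(3/2))"
  have c0: "0 \<le> c" by (simp add: c_def)
  define K where "K = c * (3 / (2 * a)) / 2"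
  have "\<bar>heat a (x + t *\<^sub>R axis j 1) - heat a x - t * dheat j a x\<bar> \<le> K * t\<^sup>2" for x :: "real^3" and t
  proof -
    define e where "e s = exp (- (norm (x + s *\<^sub>R axis j 1))\<^sup>2 / (4 * a))" for s :: real
    have n: "(norm (x + s *\<^sub>R axis j 1))\<^sup>2 = (norm x)\<^sup>2 + 2 * s * x $ j + s\<^sup>2" for s :: real
      unfolding power2_norm_eq_inner
      by (simp add: inner_add_left inner_add_right inner_axis inner_axis' power2_eq_square algebra_simps)
    define L where "L s = - ((x $ j + s) / (2 * a))" for s
    have de: "(e has_real_derivative L s * e s) (at s)" for s
      unfolding e_def n L_def using a by (auto intro!: derivative_eq_intros simp: field_simps)
    have dL: "(L has_real_derivative - 1 / (2 * a)) (at s)" for s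
      unfolding L_def using a by (auto intro!: derivative_eq_intros)
    define D where "D m s = (if m = 0 then e s else if m = 1 then L s * e s else ((L s)\<^sup>2 - 1 / (2 * a)) * e s)" for m :: nat and s
    have "\<exists>s. \<bar>s\<bar> \<le> \<bar>t\<bar> \<and> D 0 t = (\<Sum>m<2. D m 0 / fact m * t ^ m) + D 2 s / fact 2 * t ^ 2"
    proof (rule Maclaurin_bi_le)
      show "\<forall>m s. m < 2 \<and> \<bar>s\<bar> \<le> \<bar>t\<bar> \<longrightarrow> (D m has_real_derivative D (Suc m) s) (at s)"
      proof (intro allI impI, elim conjE)
        fix m :: nat and s assume "m < 2"
        then consider "m = 0" | "m = 1" by linarith
        then show "(D m has_real_derivative D (Suc m) s) (at s)"
        proof cases
          case 1 then show ?thesis using de by (simp add: D_def[abs_def])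
        next
          case 2
          have "((\<lambda>s. L s * e s) has_real_derivative ((L s)\<^sup>2 - 1 / (2 * a)) * e s) (at s)"
            by (rule derivative_eq_intros de dL refl)+ (simp add: algebra_simps power2_eq_square)
          then show ?thesis using 2 by (simp add: D_def[abs_def])
        qed
      qed
    qed simp
    then obtain s where "D 0 t = (\<Sum>m<2. D m 0 / fact m * t ^ m) + D 2 s / fact 2 * t ^ 2" by blast
    then have T: "D 0 t = D 0 0 + D 1 0 * t + D 2 s / 2 * t\<^sup>2"
      by (simp add: numeral_2_eq_2)
    have "\<bar>D 2 s\<bar> \<le> 3 / (2 * a)"
    proof -
      define z where "z = (norm (x + s *\<^sub>R axis j 1))\<^sup>2 / (4 * a)"
      have z0: "z \<ge> 0" using a by (simp add: z_def)
      have "\<bar>(x + s *\<^sub>R axis j 1) $ j\<bar> \<le> norm (x + s *\<^sub>R axis j 1)" by (rule component_le_norm_cart)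
      then have "(x $ j + s)\<^sup>2 \<le> (norm (x + s *\<^sub>R axis j 1))\<^sup>2"
        by (subst abs_le_square_iff[symmetric]) (simp add: axis_def)
      then have "(x $ j + s)\<^sup>2 / (4 * a\<^sup>2) \<le> (norm (x + s *\<^sub>R axis j 1))\<^sup>2 / (4 * a\<^sup>2)" by (intro divide_right_mono) auto
      moreover have "(norm (x + s *\<^sub>R axis j 1))\<^sup>2 / (4 * a\<^sup>2) = z / a" using a by (simp add: z_def power2_eq_square)
      moreover have "(L s)\<^sup>2 = (x $ j + s)\<^sup>2 / (4 * a\<^sup>2)" by (simp add: L_def power_divide power_mult_distrib)
      ultimately have Lz: "(L s)\<^sup>2 \<le> z / a" by linarith
      have ez: "e s = exp (- z)" by (simp add: e_def z_def)
      have "z \<le> exp z" using exp_ge_add_one_self[of z] by linarith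
      then have "z * exp (- z) \<le> 1" by (simp add: exp_minus field_simps)
      then have "z * exp (- z) / a \<le> 1 / a" using a by (intro divide_right_mono) auto
      moreover have "(L s)\<^sup>2 * exp (- z) \<le> z / a * exp (- z)" using Lz by (intro mult_right_mono) auto
      ultimately have 1: "(L s)\<^sup>2 * exp (- z) \<le> 1 / a" by simp
      have 2: "1 / (2 * a) * exp (- z) \<le> 1 / (2 * a) * 1" using a z0 by (intro mult_left_mono) auto
      have 3: "0 \<le> (L s)\<^sup>2 * exp (- z)" "0 \<le> 1 / (2 * a) * exp (- z)" using a by auto
      have "D 2 s = (L s)\<^sup>2 * exp (- z) - 1 / (2 * a) * exp (- z)" by (simp add: D_def ez left_diff_distrib)
      then have "\<bar>D 2 s\<bar> \<le> 1 / a + 1 / (2 * a)" using 1 2 3 by linarith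
      also have "\<dots> = 3 / (2 * a)" by simp
      finally show ?thesis .
    qed
    moreover have "heat a (x + t *\<^sub>R axis j 1) - heat a x - t * dheat j a x = c * (D 2 s / 2 * t\<^sup>2)"
    proof -
      have "heat a (x + t *\<^sub>R axis j 1) = c * D 0 t" "heat a x = c * D 0 0" "dheat j a x = c * D 1 0"
        by (simp_all add: heat_def dheat_def c_def D_def e_def L_def)
      then show ?thesis unfolding T by (simp add: algebra_simps)
    qed
    moreover have "\<bar>c * (D 2 s / 2 * t\<^sup>2)\<bar> = c * (\<bar>D 2 s\<bar> / 2 * t\<^sup>2)" using c0 by (simp add: abs_mult)
    moreover have "K * t\<^sup>2 = c * (3 / (2 * a) / 2 * t\<^sup>2)" by (simp add: K_def)
    ultimately show ?thesis
      using c0 by (simp only:) (intro mult_left_mono mult_right_mono divide_right_mono, auto)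
  qed
  moreover have "K \<ge> 0" using a c0 by (simp add: K_def)
  ultimately show ?thesis by blast
qed

lemma bounded_mult_integrable:
  fixes k f :: "'a \<Rightarrow> real"
  assumes "integrable M f" "k \<in> borel_measurable M" "\<And>x. \<bar>k x\<bar> \<le> B"
  shows "integrable M (\<lambda>x. k x * f x)"
proof (rule Bochner_Integration.integrable_bound[where f = "\<lambda>x. B * f x"])
  show "integrable M (\<lambda>x. B * f x)" using assms by simp
  show "(\<lambda>x. k x * f x) \<in> borel_measurable M" using assms by measurable
  show "AE x in M. norm (k x * f x) \<le> norm (B * f x)"
    by (auto simp: abs_mult intro!: mult_right_mono order_trans[OF assms(3) abs_ge_self])
qed

lemma heat_bounded:
  assumes "0 < a" shows "\<bar>heat a x\<bar> \<le> a powr (-(3/2))"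
proof -
  have "heat a x \<le> a powr (-(3/2)) * exp (- (norm x)\<^sup>2 / (4 * a))" by (rule heat_le[OF assms])
  also have "\<dots> \<le> a powr (-(3/2)) * 1" using assms by (intro mult_left_mono) auto
  finally show ?thesis using heat_nonneg[of a x] by simp
qed

lemma dheat_bounded:
  assumes "0 < a" shows "\<bar>dheat j a x\<bar> \<le> a powr (-2)"
proof -
  have "\<bar>dheat j a x\<bar> \<le> a powr (-2) * exp (- (norm x)\<^sup>2 / (8 * a))" by (rule dheat_le[OF assms])
  also have "\<dots> \<le> a powr (-2) * 1" using assms by (intro mult_left_mono) auto
  finally show ?thesis by simp
qed

lemma pderiv3_heat_integral:
  assumes a: "0 < a" and f: "integrable lborel f"
  shows "pderiv3 j (\<lambda>\<xi>. c * (LINT \<eta>|lborel. heat a (\<xi> - \<epsilon> *\<^sub>R \<eta>) * f \<eta>)) \<xi>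
     = c * (LINT \<eta>|lborel. dheat j a (\<xi> - \<epsilon> *\<^sub>R \<eta>) * (f \<eta> :: real))"
proof (rule pderiv3_eqI)
  have [measurable]: "f \<in> borel_measurable lborel" using f by auto
  obtain K where K: "K \<ge> 0" "\<And>x t. \<bar>heat a (x + t *\<^sub>R axis j 1) - heat a x - t * dheat j a x\<bar> \<le> K * t\<^sup>2"
    using heat_line_taylor[OF a] by blast
  define I where "I t = (LINT \<eta>|lborel. heat a (\<xi> + t *\<^sub>R axis j 1 - \<epsilon> *\<^sub>R \<eta>) * f \<eta>)" for t :: real
  define D where "D = (LINT \<eta>|lborel. dheat j a (\<xi> - \<epsilon> *\<^sub>R \<eta>) * f \<eta>)"
  define F where "F = (LINT \<eta>|lborel. \<bar>f \<eta>\<bar>)"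
  have i1: "integrable lborel (\<lambda>\<eta>. heat a (\<xi> + t *\<^sub>R axis j 1 - \<epsilon> *\<^sub>R \<eta>) * f \<eta>)" for t :: real
    by (rule bounded_mult_integrable[OF f _ heat_bounded[OF a]]) measurable
  have i2: "integrable lborel (\<lambda>\<eta>. dheat j a (\<xi> - \<epsilon> *\<^sub>R \<eta>) * f \<eta>)"
    by (rule bounded_mult_integrable[OF f _ dheat_bounded[OF a]]) measurable
  have F0: "F \<ge> 0" by (simp add: F_def)
  have est: "\<bar>I t - I 0 - t * D\<bar> \<le> K * F * t\<^sup>2" for t
  proof -
    have "I t - I 0 - t * D = (LINT \<eta>|lborel. heat a (\<xi> + t *\<^sub>R axis j 1 - \<epsilon> *\<^sub>R \<eta>) * f \<eta> - heat a (\<xi> + 0 *\<^sub>R axis j 1 - \<epsilon> *\<^sub>R \<eta>) * f \<eta> - t * (dheat j a (\<xi> - \<epsilon> *\<^sub>R \<eta>) * f \<eta>))"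
      unfolding I_def D_def using i1[of t] i1[of 0] i2 by (subst Bochner_Integration.integral_diff) auto
    also have "\<bar>\<dots>\<bar> \<le> (LINT \<eta>|lborel. K * t\<^sup>2 * \<bar>f \<eta>\<bar>)"
      unfolding real_norm_def[symmetric]
    proof (rule Bochner_Integration.integral_norm_bound_integral)
      show "integrable lborel (\<lambda>\<eta>. heat a (\<xi> + t *\<^sub>R axis j 1 - \<epsilon> *\<^sub>R \<eta>) * f \<eta> - heat a (\<xi> + 0 *\<^sub>R axis j 1 - \<epsilon> *\<^sub>R \<eta>) * f \<eta> - t * (dheat j a (\<xi> - \<epsilon> *\<^sub>R \<eta>) * f \<eta>))"
        using i1[of t] i1[of 0] i2 by auto
      show "integrable lborel (\<lambda>\<eta>. K * t\<^sup>2 * norm (f \<eta>))" using f by auto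
      fix \<eta>
      have "heat a (\<xi> + t *\<^sub>R axis j 1 - \<epsilon> *\<^sub>R \<eta>) * f \<eta> - heat a (\<xi> + 0 *\<^sub>R axis j 1 - \<epsilon> *\<^sub>R \<eta>) * f \<eta> - t * (dheat j a (\<xi> - \<epsilon> *\<^sub>R \<eta>) * f \<eta>)
        = (heat a ((\<xi> - \<epsilon> *\<^sub>R \<eta>) + t *\<^sub>R axis j 1) - heat a (\<xi> - \<epsilon> *\<^sub>R \<eta>) - t * dheat j a (\<xi> - \<epsilon> *\<^sub>R \<eta>)) * f \<eta>"
        by (simp add: algebra_simps)
      then show "norm (heat a (\<xi> + t *\<^sub>R axis j 1 - \<epsilon> *\<^sub>R \<eta>) * f \<eta> - heat a (\<xi> + 0 *\<^sub>R axis j 1 - \<epsilon> *\<^sub>R \<eta>) * f \<eta> - t * (dheat j a (\<xi> - \<epsilon> *\<^sub>R \<eta>) * f \<eta>))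
         \<le> K * t\<^sup>2 * norm (f \<eta>)"
        using K(2)[of "\<xi> - \<epsilon> *\<^sub>R \<eta>" t] by (simp add: abs_mult mult_right_mono)
    qed
    also have "\<dots> = K * F * t\<^sup>2" by (simp add: F_def)
    finally show ?thesis .
  qed
  have "(I has_real_derivative D) (at 0)"
    unfolding DERIV_def
  proof (rule LIM_zero_cancel, rule Lim_null_comparison)
    show "\<forall>\<^sub>F h in at 0. norm ((I (0 + h) - I 0) / h - D) \<le> K * F * \<bar>h\<bar>"
      unfolding eventually_at_filter
    proof (intro always_eventually allI impI)
      fix h :: real assume h: "h \<noteq> 0"
      have "\<bar>(I (0 + h) - I 0) / h - D\<bar> = \<bar>I h - I 0 - h * D\<bar> / \<bar>h\<bar>"
        using h by (simp add: field_simps flip: abs_divide)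
      also have "\<dots> \<le> K * F * h\<^sup>2 / \<bar>h\<bar>" by (intro divide_right_mono est) auto
      also have "\<dots> = K * F * \<bar>h\<bar>" using h by (simp add: power2_eq_square field_simps abs_mult_self_eq)
      finally show "norm ((I (0 + h) - I 0) / h - D) \<le> K * F * \<bar>h\<bar>" by simp
    qed
    show "(\<lambda>h. K * F * \<bar>h\<bar>) \<midarrow>0\<rightarrow> 0" by (auto intro!: tendsto_eq_intros)
  qed
  then have "((\<lambda>t. c * I t) has_real_derivative c * D) (at 0)" by (rule DERIV_cmult)
  then show "((\<lambda>t. c * (LINT \<eta>|lborel. heat a (\<xi> + t *\<^sub>R axis j 1 - \<epsilon> *\<^sub>R \<eta>) * f \<eta>)) has_vector_derivative
     c * (LINT \<eta>|lborel. dheat j a (\<xi> - \<epsilon> *\<^sub>R \<eta>) * f \<eta>)) (at 0)"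
    by (simp add: I_def D_def has_real_derivative_iff_has_vector_derivative)
qed

text \<open>The \<open>(i, j)\<close> entry of the antisymmetric matrix whose divergence is the nonlinearity.\<close>
definition flux :: "3 \<Rightarrow> 3 \<Rightarrow> (real^3 \<Rightarrow> real^3) \<Rightarrow> real^3 \<Rightarrow> real"
  where "flux i j u \<eta> = u \<eta> $ j * biot_savart u \<eta> $ i - biot_savart u \<eta> $ j * u \<eta> $ i"

lemma measurable_flux [measurable]: 
  assumes [measurable]: "u \<in> borel_measurable borel" shows "flux i j u \<in> borel_measurable borel"
proof -
  have [measurable]: "biot_savart u \<in> borel_measurable borel" by measurable
  have [measurable]: "(\<lambda>x. u x $ k) \<in> borel_measurable borel" "(\<lambda>x. biot_savart u x $ k) \<in> borel_measurable borel" for k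
    by (rule measurable_vec_nth_real, measurable)+
  show ?thesis unfolding flux_def[abs_def] by measurable
qed

lemma flux_le: "\<bar>flux i j u \<eta>\<bar> \<le> 2 * (norm (u \<eta>) * norm (biot_savart u \<eta>))"
proof -
  have "\<bar>u \<eta> $ j * biot_savart u \<eta> $ i\<bar> \<le> norm (u \<eta>) * norm (biot_savart u \<eta>)"
    "\<bar>biot_savart u \<eta> $ j * u \<eta> $ i\<bar> \<le> norm (biot_savart u \<eta>) * norm (u \<eta>)"
    unfolding abs_mult by (intro mult_mono component_le_norm_cart; simp)+
  then show ?thesis unfolding flux_def mult.commute[of "norm (biot_savart u \<eta>)"] by linarith
qed

text \<open>The derivative falls on the kernel.  One factor \<open>\<epsilon>\<close> comes from the semigroup and one from the shift \<open>\<Lambda> - 1/2\<close>.\<close>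
lemma duhamel_kernel:
  assumes s: "s < \<tau>" and m: "w s \<in> borel_measurable borel" and F: "integrable lborel (flux i j (w s))"
  shows "duhamel w i j \<tau> \<xi> s = (exp (- (\<tau> - s) / 2))\<^sup>2 *
    (LINT \<eta>|lborel. dheat j (1 - (exp (- (\<tau> - s) / 2))\<^sup>2) (\<xi> - exp (- (\<tau> - s) / 2) *\<^sub>R \<eta>) * flux i j (w s) \<eta>)"
proof -
  define \<epsilon> where "\<epsilon> = exp (- (\<tau> - s) / 2)"
  have e: "0 < \<epsilon>" "\<epsilon> < 1" using s by (auto simp: \<epsilon>_def)
  have a: "0 < 1 - \<epsilon>\<^sup>2" using one_minus_sq_bounds[OF e] by simp
  have "exp_Lambda_half (\<tau> - s) (flux i j (w s)) \<xi> = \<epsilon>\<^sup>2 * (LINT \<eta>|lborel. heat (1 - \<epsilon>\<^sup>2) (\<xi> - \<epsilon> *\<^sub>R \<eta>) * flux i j (w s) \<eta>)" for \<xi>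
    unfolding exp_Lambda_half_def using s m by (subst exp_Lambda_kernel) (auto simp: \<epsilon>_def power2_eq_square)
  then have "exp_Lambda_half (\<tau> - s) (flux i j (w s)) = (\<lambda>\<xi>. \<epsilon>\<^sup>2 * (LINT \<eta>|lborel. heat (1 - \<epsilon>\<^sup>2) (\<xi> - \<epsilon> *\<^sub>R \<eta>) * flux i j (w s) \<eta>))"
    by (rule ext)
  moreover have "flux i j (w s) = (\<lambda>\<eta>. w s \<eta> $ j * biot_savart (w s) \<eta> $ i - biot_savart (w s) \<eta> $ j * w s \<eta> $ i)"
    by (rule ext) (rule flux_def)
  ultimately have "duhamel w i j \<tau> \<xi> s = pderiv3 j (\<lambda>\<xi>. \<epsilon>\<^sup>2 * (LINT \<eta>|lborel. heat (1 - \<epsilon>\<^sup>2) (\<xi> - \<epsilon> *\<^sub>R \<eta>) * flux i j (w s) \<eta>)) \<xi>"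
    by (simp only: duhamel_def)
  also have "\<dots> = \<epsilon>\<^sup>2 * (LINT \<eta>|lborel. dheat j (1 - \<epsilon>\<^sup>2) (\<xi> - \<epsilon> *\<^sub>R \<eta>) * flux i j (w s) \<eta>)"
    by (rule pderiv3_heat_integral[OF a F])
  finally show ?thesis by (simp add: \<epsilon>_def)
qed

text \<open>Split off \<open>k n * (f n - f0)\<close>, controlled by the bound on the kernels, from \<open>(k n - k0) * f0\<close>, controlled by dominated convergence.\<close>
lemma integral_kernel_tendsto:
  fixes k :: "nat \<Rightarrow> 'a::euclidean_space \<Rightarrow> real"
  assumes [measurable]: "\<And>n. k n \<in> borel_measurable M" "k0 \<in> borel_measurable M"
    and bd: "\<And>n x. \<bar>k n x\<bar> \<le> B" and lim: "\<And>x. (\<lambda>n. k n x) \<longlonglongrightarrow> k0 x"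
    and f: "\<And>n. integrable M (f n)" "integrable M f0"
    and L1: "(\<lambda>n. LINT x|M. \<bar>f n x - f0 x\<bar>) \<longlonglongrightarrow> 0"
  shows "(\<lambda>n. LINT x|M. k n x * f n x) \<longlonglongrightarrow> (LINT x|M. k0 x * f0 x)"
proof -
  have [measurable]: "f0 \<in> borel_measurable M" using f(2) by auto
  have "(\<lambda>n. LINT x|M. k n x * f0 x) \<longlonglongrightarrow> (LINT x|M. k0 x * f0 x)"
  proof (rule integral_dominated_convergence[where w = "\<lambda>x. B * \<bar>f0 x\<bar>"])
    show "AE x in M. (\<lambda>n. k n x * f0 x) \<longlonglongrightarrow> k0 x * f0 x" using lim by (auto intro!: tendsto_intros)
    show "AE x in M. norm (k n x * f0 x) \<le> B * \<bar>f0 x\<bar>" for n using bd by (auto simp: abs_mult mult_right_mono)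
  qed (use f(2) in auto)
  moreover have "(\<lambda>n. (LINT x|M. k n x * f n x) - (LINT x|M. k n x * f0 x)) \<longlonglongrightarrow> 0"
  proof (rule Lim_null_comparison)
    show "(\<lambda>n. B * (LINT x|M. \<bar>f n x - f0 x\<bar>)) \<longlonglongrightarrow> 0" using tendsto_mult_left[OF L1, of B] by simp
    show "\<forall>\<^sub>F n in sequentially. norm ((LINT x|M. k n x * f n x) - (LINT x|M. k n x * f0 x)) \<le> B * (LINT x|M. \<bar>f n x - f0 x\<bar>)"
    proof (intro always_eventually allI)
      fix n
      have i: "integrable M (\<lambda>x. k n x * f n x)" "integrable M (\<lambda>x. k n x * f0 x)"
        using f bd by (auto intro!: bounded_mult_integrable)
      have "(LINT x|M. k n x * f n x) - (LINT x|M. k n x * f0 x) = (LINT x|M. k n x * f n x - k n x * f0 x)"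
        using i by simp
      also have "norm \<dots> \<le> (LINT x|M. B * \<bar>f n x - f0 x\<bar>)"
      proof (rule Bochner_Integration.integral_norm_bound_integral)
        show "norm (k n x * f n x - k n x * f0 x) \<le> B * \<bar>f n x - f0 x\<bar>" for x
          using bd[of n x] by (simp add: abs_mult mult_right_mono flip: right_diff_distrib)
      qed (use i f in auto)
      finally show "norm ((LINT x|M. k n x * f n x) - (LINT x|M. k n x * f0 x)) \<le> B * (LINT x|M. \<bar>f n x - f0 x\<bar>)" by simp
    qed
  qed
  ultimately show ?thesis by (rule Lim_transform)
qed

section \<open>The quadratic flux in weighted L1\<close>

lemma wnorm_sq_eq_wnorm:
  assumes [measurable]: "f \<in> borel_measurable borel" and fin: "wnorm_sq m f < \<infinity>"
  shows "wnorm_sq m f = ennreal ((wnorm m f)\<^sup>2)"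
    and "integrable lborel (\<lambda>\<xi>. (\<rho> \<xi> powr m * norm (f \<xi>))\<^sup>2)"
proof -
  show i: "integrable lborel (\<lambda>\<xi>. (\<rho> \<xi> powr m * norm (f \<xi>))\<^sup>2)"
    using fin by (intro integrableI_nonneg) (auto simp: wnorm_sq_def)
  have "(wnorm m f)\<^sup>2 = (LINT \<xi>|lborel. (\<rho> \<xi> powr m * norm (f \<xi>))\<^sup>2)"
    unfolding wnorm_def norm2_def by (simp add: abs_mult)
  then show "wnorm_sq m f = ennreal ((wnorm m f)\<^sup>2)"
    using nn_integral_eq_integral[OF i] by (simp add: wnorm_sq_def)
qed

lemma wnorm_le:
  assumes le: "wnorm_sq m f \<le> ennreal (a\<^sup>2)" and a: "0 \<le> a"
  shows "wnorm m f \<le> a"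
proof -
  have eq: "wnorm m f = sqrt (LINT \<xi>|lborel. (\<rho> \<xi> powr m * norm (f \<xi>))\<^sup>2)"
    unfolding wnorm_def norm2_def by simp
  have "(LINT \<xi>|lborel. (\<rho> \<xi> powr m * norm (f \<xi>))\<^sup>2) \<le> a\<^sup>2"
  proof (cases "integrable lborel (\<lambda>\<xi>. (\<rho> \<xi> powr m * norm (f \<xi>))\<^sup>2)")
    case True
    from nn_integral_eq_integral[OF True] le show ?thesis by (simp add: wnorm_sq_def)
  qed (simp add: not_integrable_integral_eq)
  then show ?thesis unfolding eq using a by (intro real_le_lsqrt) auto
qed

lemma L2w_wnorm_sq:
  assumes "f \<in> L2w m"
  shows "f \<in> borel_measurable borel" "wnorm_sq m f = ennreal ((wnorm m f)\<^sup>2)"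
proof -
  show m [measurable]: "f \<in> borel_measurable borel" using assms by (simp add: L2w_def L2_space_def)
  have "integrable lborel (\<lambda>\<xi>. (\<rho> \<xi> powr m * norm (f \<xi>))\<^sup>2)" using assms by (simp add: L2w_def L2_space_def)
  from nn_integral_eq_integral[OF this] have "wnorm_sq m f < \<infinity>" by (simp add: wnorm_sq_def)
  then show "wnorm_sq m f = ennreal ((wnorm m f)\<^sup>2)" using wnorm_sq_eq_wnorm[OF m] by simp
qed

lemma wnorm_nonneg: "0 \<le> wnorm m f" by (simp add: wnorm_def norm2_def)

lemma wnorm_sq_diff_le:
  fixes f g :: "real^3 \<Rightarrow> 'b::euclidean_space"
  assumes [measurable]: "f \<in> borel_measurable borel" "g \<in> borel_measurable borel"
  shows "wnorm_sq m (\<lambda>\<xi>. f \<xi> - g \<xi>) \<le> 2 * wnorm_sq m f + 2 * wnorm_sq m g"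
proof -
  have pt: "ennreal ((\<rho> \<xi> powr m * norm (f \<xi> - g \<xi>))\<^sup>2)
     \<le> 2 * ennreal ((\<rho> \<xi> powr m * norm (f \<xi>))\<^sup>2) + 2 * ennreal ((\<rho> \<xi> powr m * norm (g \<xi>))\<^sup>2)" for \<xi>
  proof -
    have "\<rho> \<xi> powr m * norm (f \<xi> - g \<xi>) \<le> \<rho> \<xi> powr m * norm (f \<xi>) + \<rho> \<xi> powr m * norm (g \<xi>)"
      using norm_triangle_ineq4[of "f \<xi>" "g \<xi>"] by (simp add: mult_left_mono flip: distrib_left)
    then have "(ennreal (\<rho> \<xi> powr m * norm (f \<xi> - g \<xi>)))\<^sup>2 \<le> (ennreal (\<rho> \<xi> powr m * norm (f \<xi>)) + ennreal (\<rho> \<xi> powr m * norm (g \<xi>)))\<^sup>2"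
      by (intro power_mono) (auto simp flip: ennreal_plus)
    also have "\<dots> \<le> 2 * (ennreal (\<rho> \<xi> powr m * norm (f \<xi>)))\<^sup>2 + 2 * (ennreal (\<rho> \<xi> powr m * norm (g \<xi>)))\<^sup>2"
      by (rule square_add_le_ennreal)
    finally show ?thesis by (simp add: ennreal_power)
  qed
  have "wnorm_sq m (\<lambda>\<xi>. f \<xi> - g \<xi>) \<le> (\<integral>\<^sup>+\<xi>. 2 * ennreal ((\<rho> \<xi> powr m * norm (f \<xi>))\<^sup>2) + 2 * ennreal ((\<rho> \<xi> powr m * norm (g \<xi>))\<^sup>2) \<partial>lborel)"
    unfolding wnorm_sq_def by (intro nn_integral_mono pt)
  also have "\<dots> = 2 * wnorm_sq m f + 2 * wnorm_sq m g"
    unfolding wnorm_sq_def by (subst nn_integral_add, measurable) (simp add: nn_integral_cmult)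
  finally show ?thesis .
qed

lemma wnorm_sq_diff_eq:
  assumes "f \<in> L2w m" "g \<in> L2w m"
  shows "wnorm_sq m (\<lambda>\<xi>. f \<xi> - g \<xi>) = ennreal ((wnorm m (\<lambda>\<xi>. f \<xi> - g \<xi>))\<^sup>2)"
proof -
  note [measurable] = L2w_wnorm_sq(1)[OF assms(1)] L2w_wnorm_sq(1)[OF assms(2)]
  have "wnorm_sq m (\<lambda>\<xi>. f \<xi> - g \<xi>) \<le> 2 * wnorm_sq m f + 2 * wnorm_sq m g" by (rule wnorm_sq_diff_le) measurable
  also have "\<dots> < \<infinity>" using L2w_wnorm_sq(2)[OF assms(1)] L2w_wnorm_sq(2)[OF assms(2)]
    by (simp add: ennreal_mult_less_top)
  finally show ?thesis by (intro wnorm_sq_eq_wnorm) measurable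
qed

lemma ennreal_square_less_top: "X\<^sup>2 < \<infinity> \<Longrightarrow> (X::ennreal) < \<infinity>"
  by (cases X rule: ennreal_cases) (auto simp: power2_eq_square ennreal_top_mult)

text \<open>The potential is finite almost everywhere, as its integral against \<open>\<rho> powr (- 4)\<close> is bounded by the energy; where it is finite, the
  Biot-Savart integral converges absolutely.\<close>
lemma biot_savart_integrable_AE:
  assumes m: "3/2 < m" and [measurable]: "f \<in> borel_measurable borel" and fin: "wnorm_sq m f < \<infinity>"
  shows "AE \<eta> in lborel. integrable lborel (\<lambda>\<zeta>. (1 / norm (\<eta> - \<zeta>) ^ 3) *\<^sub>R cross3 (\<eta> - \<zeta>) (f \<zeta>))"
proof -
  obtain B where B: "B \<ge> 0" "\<And>\<eta>.
    (\<integral>\<^sup>+\<zeta>. ennreal (norm ((1 / norm (\<eta> - \<zeta>) ^ 3) *\<^sub>R cross3 (\<eta> - \<zeta>) (f \<zeta>))) \<partial>lborel)\<^sup>2 \<le> ennreal B * energy_potential m f \<eta>"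
    using biot_savart_sq_le[OF m] assms(2) by blast
  have q: "(3::real) < 4" "(0::real) \<le> 3/2" "(3/2::real) < 3" by auto
  obtain K where K: "\<And>t. (\<integral>\<^sup>+x. ennreal (\<rho> x powr (-4)) * ennreal (norm (t - x) powr (-(3/2))) \<partial>lborel) \<le> ennreal K"
    using rho_singular_bounded[OF q] by blast
  have "(\<integral>\<^sup>+\<eta>. ennreal (\<rho> \<eta> powr (-4)) * energy_potential m f \<eta> \<partial>lborel) \<le> ennreal K * wnorm_sq m f"
  proof (rule nn_integral_energy_potential_le)
    show "(\<integral>\<^sup>+\<eta>. ennreal (\<rho> \<eta> powr (-4)) * ennreal (norm (\<eta> - \<zeta>) powr (-(3/2))) \<partial>lborel) \<le> ennreal K" for \<zeta>
      using K[of \<zeta>] by (simp only: norm_minus_commute)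
  qed measurable
  also have "\<dots> < \<infinity>" using fin by (simp add: ennreal_mult_less_top)
  finally have "AE \<eta> in lborel. ennreal (\<rho> \<eta> powr (-4)) * energy_potential m f \<eta> \<noteq> \<infinity>"
    by (intro nn_integral_PInf_AE) auto
  then show ?thesis
  proof (rule AE_mp, intro AE_I2 impI)
    fix \<eta> assume "ennreal (\<rho> \<eta> powr (-4)) * energy_potential m f \<eta> \<noteq> \<infinity>"
    then have "energy_potential m f \<eta> < \<infinity>"
      using rho_pos[of \<eta>] by (auto simp: ennreal_mult_eq_top_iff less_top)
    then have "ennreal B * energy_potential m f \<eta> < \<infinity>" by (simp add: ennreal_mult_less_top)
    then have "(\<integral>\<^sup>+\<zeta>. ennreal (norm ((1 / norm (\<eta> - \<zeta>) ^ 3) *\<^sub>R cross3 (\<eta> - \<zeta>) (f \<zeta>))) \<partial>lborel)\<^sup>2 < \<infinity>"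
      using B(2)[of \<eta>] by (rule le_less_trans[rotated])
    then have "(\<integral>\<^sup>+\<zeta>. ennreal (norm ((1 / norm (\<eta> - \<zeta>) ^ 3) *\<^sub>R cross3 (\<eta> - \<zeta>) (f \<zeta>))) \<partial>lborel) < \<infinity>"
      by (rule ennreal_square_less_top)
    then show "integrable lborel (\<lambda>\<zeta>. (1 / norm (\<eta> - \<zeta>) ^ 3) *\<^sub>R cross3 (\<eta> - \<zeta>) (f \<zeta>))"
      by (intro integrableI_bounded) measurable
  qed
qed

text \<open>The Bochner integral is linear only where both integrals converge, hence the exceptional null set.\<close>
lemma biot_savart_diff_AE:
  assumes m: "3/2 < m" and f: "f \<in> L2w m" and g: "g \<in> L2w m"
  shows "AE \<eta> in lborel. biot_savart (\<lambda>\<xi>. f \<xi> - g \<xi>) \<eta> = biot_savart f \<eta> - biot_savart g \<eta>"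
proof -
  have "AE \<eta> in lborel. integrable lborel (\<lambda>\<zeta>. (1 / norm (\<eta> - \<zeta>) ^ 3) *\<^sub>R cross3 (\<eta> - \<zeta>) (f \<zeta>))"
    by (rule biot_savart_integrable_AE[OF m L2w_wnorm_sq(1)[OF f]]) (simp add: L2w_wnorm_sq(2)[OF f])
  moreover have "AE \<eta> in lborel. integrable lborel (\<lambda>\<zeta>. (1 / norm (\<eta> - \<zeta>) ^ 3) *\<^sub>R cross3 (\<eta> - \<zeta>) (g \<zeta>))"
    by (rule biot_savart_integrable_AE[OF m L2w_wnorm_sq(1)[OF g]]) (simp add: L2w_wnorm_sq(2)[OF g])
  ultimately show ?thesis
  proof eventually_elim
    case (elim \<eta>)
    have "(LINT \<zeta>|lborel. (1 / norm (\<eta> - \<zeta>) ^ 3) *\<^sub>R cross3 (\<eta> - \<zeta>) (f \<zeta> - g \<zeta>))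
      = (LINT \<zeta>|lborel. (1 / norm (\<eta> - \<zeta>) ^ 3) *\<^sub>R cross3 (\<eta> - \<zeta>) (f \<zeta>) - (1 / norm (\<eta> - \<zeta>) ^ 3) *\<^sub>R cross3 (\<eta> - \<zeta>) (g \<zeta>))"
      by (simp add: Cross3.right_diff_distrib scaleR_diff_right)
    also have "\<dots> = (LINT \<zeta>|lborel. (1 / norm (\<eta> - \<zeta>) ^ 3) *\<^sub>R cross3 (\<eta> - \<zeta>) (f \<zeta>))
        - (LINT \<zeta>|lborel. (1 / norm (\<eta> - \<zeta>) ^ 3) *\<^sub>R cross3 (\<eta> - \<zeta>) (g \<zeta>))"
      by (rule Bochner_Integration.integral_diff[OF elim])
    finally show ?case unfolding biot_savart_def by (simp add: scaleR_diff_right)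
  qed
qed

lemma ennreal_le_of_square_le:
  assumes "X\<^sup>2 \<le> ennreal (c\<^sup>2)" "0 \<le> c" shows "X \<le> ennreal c"
proof (cases X rule: ennreal_cases)
  case (real x)
  then show ?thesis using assms by (simp add: ennreal_power)
next
  case top
  then show ?thesis using assms by (simp add: power2_eq_square ennreal_top_mult top_unique)
qed

lemma moment_bilinear_bound_real:
  assumes m: "3/2 < m" and p: "3 < 2 * (m - p)"
  shows "\<exists>C\<ge>0. \<forall>w \<in> borel_measurable borel. \<forall>w' \<in> borel_measurable borel. \<forall>a\<ge>0. \<forall>b\<ge>0.
    wnorm_sq m w \<le> ennreal (a\<^sup>2) \<longrightarrow> wnorm_sq m w' \<le> ennreal (b\<^sup>2) \<longrightarrow>
    (\<integral>\<^sup>+\<eta>. ennreal (\<rho> \<eta> powr p * (norm (w \<eta> :: real^3) * norm (biot_savart w' \<eta>))) \<partial>lborel) \<le> ennreal (C * a * b)"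
proof -
  obtain C where C: "C \<ge> 0" "\<And>w w'. w \<in> borel_measurable borel \<Longrightarrow> w' \<in> borel_measurable borel \<Longrightarrow>
    (\<integral>\<^sup>+\<eta>. ennreal (\<rho> \<eta> powr p * (norm (w \<eta> :: real^3) * norm (biot_savart w' \<eta>))) \<partial>lborel)\<^sup>2
      \<le> ennreal C * wnorm_sq m w * wnorm_sq m w'" using moment_bilinear_bound[OF m p] by blast
  have "X \<le> ennreal (sqrt C * a * b)" if "X\<^sup>2 \<le> ennreal C * y * z" "y \<le> ennreal (a\<^sup>2)" "z \<le> ennreal (b\<^sup>2)" "a \<ge> 0" "b \<ge> 0" for X y z a b
  proof -
    have "X\<^sup>2 \<le> ennreal C * ennreal (a\<^sup>2) * ennreal (b\<^sup>2)"
      using that by (meson mult_mono order_trans order_refl zero_le)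
    also have "\<dots> = ennreal (C * a\<^sup>2 * b\<^sup>2)" using C by (simp add: ennreal_mult)
    also have "C * a\<^sup>2 * b\<^sup>2 = (sqrt C * a * b)\<^sup>2" using C by (simp add: power_mult_distrib)
    finally show ?thesis by (rule ennreal_le_of_square_le) (use that C in auto)
  qed
  then show ?thesis using C by (intro exI[of _ "sqrt C"]) (auto, blast?)
qed

lemma flux_diff_AE:
  assumes m: "3/2 < m" and f: "f \<in> L2w m" and g: "g \<in> L2w m"
  shows "AE \<eta> in lborel. \<bar>flux i j f \<eta> - flux i j g \<eta>\<bar>
    \<le> 2 * (norm (f \<eta> - g \<eta>) * norm (biot_savart f \<eta>) + norm (g \<eta>) * norm (biot_savart (\<lambda>\<xi>. f \<xi> - g \<xi>) \<eta>))"
  using biot_savart_diff_AE[OF m f g]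
proof eventually_elim
  case (elim \<eta>)
  define a where "a = f \<eta> - g \<eta>"
  define v where "v = biot_savart f \<eta>"
  define d where "d = biot_savart f \<eta> - biot_savart g \<eta>"
  have eq: "flux i j f \<eta> - flux i j g \<eta> = a $ j * v $ i - v $ j * a $ i + (g \<eta> $ j * d $ i - d $ j * g \<eta> $ i)"
    by (simp add: flux_def a_def v_def d_def algebra_simps)
  have b: "\<bar>x $ k * y $ l\<bar> \<le> norm x * norm y" for x y :: "real^3" and k l
    unfolding abs_mult by (intro mult_mono component_le_norm_cart) auto
  have "\<bar>flux i j f \<eta> - flux i j g \<eta>\<bar> \<le> 2 * (norm a * norm v + norm (g \<eta>) * norm d)"
    unfolding eq using b[of a j v i] b[of a i v j] b[of "g \<eta>" j d i] b[of "g \<eta>" i d j] by (simp add: mult.commute)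
  then show ?case unfolding elim by (simp add: a_def v_def d_def)
qed

text \<open>The flux is bilinear in vorticity and velocity, so both the bound and the local Lipschitz estimate follow from the
  bilinear moment bound with \<open>p = 1\<close>, which needs \<open>m > 5/2\<close>.\<close>
lemma flux_L1_bounds:
  assumes m: "5/2 < m"
  shows "\<exists>C\<ge>0.
    (\<forall>f \<in> L2w m. \<forall>i j. (\<integral>\<^sup>+\<eta>. ennreal \<bar>\<rho> \<eta> * flux i j f \<eta>\<bar> \<partial>lborel) \<le> ennreal (C * (wnorm m f)\<^sup>2)) \<and>
    (\<forall>f \<in> L2w m. \<forall>g \<in> L2w m. \<forall>i j.
      (\<integral>\<^sup>+\<eta>. ennreal \<bar>\<rho> \<eta> * flux i j f \<eta> - \<rho> \<eta> * flux i j g \<eta>\<bar> \<partial>lborel)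
        \<le> ennreal (C * wnorm m (\<lambda>\<xi>. f \<xi> - g \<xi>) * (wnorm m f + wnorm m g)))"
proof -
  have m1: "3/2 < m" "3 < 2 * (m - 1)" using m by auto
  obtain C where C: "C \<ge> 0" "\<And>w w' a b. w \<in> borel_measurable borel \<Longrightarrow> w' \<in> borel_measurable borel \<Longrightarrow> a \<ge> 0 \<Longrightarrow> b \<ge> 0 \<Longrightarrow>
    wnorm_sq m w \<le> ennreal (a\<^sup>2) \<Longrightarrow> wnorm_sq m w' \<le> ennreal (b\<^sup>2) \<Longrightarrow>
    (\<integral>\<^sup>+\<eta>. ennreal (\<rho> \<eta> powr 1 * (norm (w \<eta> :: real^3) * norm (biot_savart w' \<eta>))) \<partial>lborel) \<le> ennreal (C * a * b)"
    using moment_bilinear_bound_real[OF m1] by blast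
  have r: "\<rho> x powr 1 = \<rho> x" for x using rho_pos[of x] by simp
  have 1: "(\<integral>\<^sup>+\<eta>. ennreal \<bar>\<rho> \<eta> * flux i j f \<eta>\<bar> \<partial>lborel) \<le> ennreal (2 * C * (wnorm m f)\<^sup>2)" if f: "f \<in> L2w m" for f i j
  proof -
    note [measurable] = L2w_wnorm_sq(1)[OF f]
    have "(\<integral>\<^sup>+\<eta>. ennreal \<bar>\<rho> \<eta> * flux i j f \<eta>\<bar> \<partial>lborel)
      \<le> (\<integral>\<^sup>+\<eta>. 2 * ennreal (\<rho> \<eta> powr 1 * (norm (f \<eta>) * norm (biot_savart f \<eta>))) \<partial>lborel)"
    proof (intro nn_integral_mono)
      fix \<eta>
      have "\<bar>\<rho> \<eta> * flux i j f \<eta>\<bar> \<le> \<rho> \<eta> * (2 * (norm (f \<eta>) * norm (biot_savart f \<eta>)))"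
        using mult_left_mono[OF flux_le[of i j f \<eta>], of "\<rho> \<eta>"] rho_pos[of \<eta>] by (simp add: abs_mult)
      then have "ennreal \<bar>\<rho> \<eta> * flux i j f \<eta>\<bar> \<le> ennreal (2 * (\<rho> \<eta> powr 1 * (norm (f \<eta>) * norm (biot_savart f \<eta>))))"
        unfolding r by (intro ennreal_leI) (simp only: mult.left_commute)
      then show "ennreal \<bar>\<rho> \<eta> * flux i j f \<eta>\<bar> \<le> 2 * ennreal (\<rho> \<eta> powr 1 * (norm (f \<eta>) * norm (biot_savart f \<eta>)))"
        by (simp add: ennreal_mult)
    qed
    also have "\<dots> = 2 * (\<integral>\<^sup>+\<eta>. ennreal (\<rho> \<eta> powr 1 * (norm (f \<eta>) * norm (biot_savart f \<eta>))) \<partial>lborel)"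
      by (rule nn_integral_cmult) measurable
    also have "\<dots> \<le> 2 * ennreal (C * wnorm m f * wnorm m f)"
      using L2w_wnorm_sq(2)[OF f] by (intro mult_left_mono C) (auto simp: wnorm_nonneg)
    also have "\<dots> = ennreal (2 * C * (wnorm m f)\<^sup>2)"
      using C wnorm_nonneg[of m f] by (simp add: ennreal_mult power2_eq_square mult_ac)
    finally show ?thesis .
  qed
  have 2: "(\<integral>\<^sup>+\<eta>. ennreal \<bar>\<rho> \<eta> * flux i j f \<eta> - \<rho> \<eta> * flux i j g \<eta>\<bar> \<partial>lborel)
        \<le> ennreal (2 * C * wnorm m (\<lambda>\<xi>. f \<xi> - g \<xi>) * (wnorm m f + wnorm m g))"
    if f: "f \<in> L2w m" and g: "g \<in> L2w m" for f g i j
  proof -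
    note [measurable] = L2w_wnorm_sq(1)[OF f] L2w_wnorm_sq(1)[OF g]
    define d where "d = (\<lambda>\<xi>. f \<xi> - g \<xi>)"
    have [measurable]: "d \<in> borel_measurable borel" unfolding d_def by measurable
    have dsq: "wnorm_sq m d \<le> ennreal ((wnorm m d)\<^sup>2)" using wnorm_sq_diff_eq[OF f g] by (simp add: d_def)
    have "(\<integral>\<^sup>+\<eta>. ennreal \<bar>\<rho> \<eta> * flux i j f \<eta> - \<rho> \<eta> * flux i j g \<eta>\<bar> \<partial>lborel)
      \<le> (\<integral>\<^sup>+\<eta>. 2 * (ennreal (\<rho> \<eta> powr 1 * (norm (d \<eta>) * norm (biot_savart f \<eta>)))
           + ennreal (\<rho> \<eta> powr 1 * (norm (g \<eta>) * norm (biot_savart d \<eta>)))) \<partial>lborel)"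
    proof (rule nn_integral_mono_AE)
      show "AE \<eta> in lborel. ennreal \<bar>\<rho> \<eta> * flux i j f \<eta> - \<rho> \<eta> * flux i j g \<eta>\<bar>
        \<le> 2 * (ennreal (\<rho> \<eta> powr 1 * (norm (d \<eta>) * norm (biot_savart f \<eta>)))
           + ennreal (\<rho> \<eta> powr 1 * (norm (g \<eta>) * norm (biot_savart d \<eta>))))"
        using flux_diff_AE[OF m1(1) f g, of i j]
      proof eventually_elim
        case (elim \<eta>)
        have "\<bar>\<rho> \<eta> * flux i j f \<eta> - \<rho> \<eta> * flux i j g \<eta>\<bar> = \<rho> \<eta> * \<bar>flux i j f \<eta> - flux i j g \<eta>\<bar>"
          using rho_pos[of \<eta>] by (simp add: abs_mult flip: right_diff_distrib)
        also have "\<dots> \<le> \<rho> \<eta> * (2 * (norm (d \<eta>) * norm (biot_savart f \<eta>) + norm (g \<eta>) * norm (biot_savart d \<eta>)))"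
          using elim rho_pos[of \<eta>] unfolding d_def by (intro mult_left_mono) auto
        also have "\<dots> = 2 * (\<rho> \<eta> powr 1 * (norm (d \<eta>) * norm (biot_savart f \<eta>)) + \<rho> \<eta> powr 1 * (norm (g \<eta>) * norm (biot_savart d \<eta>)))"
          unfolding r by (simp add: algebra_simps)
        finally have "ennreal \<bar>\<rho> \<eta> * flux i j f \<eta> - \<rho> \<eta> * flux i j g \<eta>\<bar> \<le> ennreal (\<dots>)" by (rule ennreal_leI)
        then show ?case by (simp add: ennreal_mult ennreal_plus)
      qed
    qed
    also have "\<dots> = 2 * ((\<integral>\<^sup>+\<eta>. ennreal (\<rho> \<eta> powr 1 * (norm (d \<eta>) * norm (biot_savart f \<eta>))) \<partial>lborel)
        + (\<integral>\<^sup>+\<eta>. ennreal (\<rho> \<eta> powr 1 * (norm (g \<eta>) * norm (biot_savart d \<eta>))) \<partial>lborel))"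
      by (subst nn_integral_cmult, measurable) (subst nn_integral_add, measurable)
    also have "\<dots> \<le> 2 * (ennreal (C * wnorm m d * wnorm m f) + ennreal (C * wnorm m g * wnorm m d))"
      using L2w_wnorm_sq(2)[OF f] L2w_wnorm_sq(2)[OF g] dsq
      by (intro mult_left_mono add_mono C) (auto simp: wnorm_nonneg)
    also have "\<dots> = ennreal (2 * C * wnorm m d * (wnorm m f + wnorm m g))"
    proof -
      have n: "0 \<le> C * wnorm m d * wnorm m f" "0 \<le> C * wnorm m g * wnorm m d" using C by (auto simp: wnorm_nonneg)
      have "2 * (ennreal (C * wnorm m d * wnorm m f) + ennreal (C * wnorm m g * wnorm m d))
         = ennreal (2 * (C * wnorm m d * wnorm m f + C * wnorm m g * wnorm m d))"
        using n by (simp add: ennreal_mult ennreal_plus)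
      then show ?thesis by (simp add: algebra_simps)
    qed
    finally show ?thesis by (simp add: d_def)
  qed
  show ?thesis using C(1) 1 2 by (intro exI[of _ "2 * C"]) auto
qed

section \<open>Decaying vorticities and integration in time\<close>

text \<open>The part of the hypotheses that concerns the size of the solution and its continuity in time; the equation itself only enters at the end.\<close>
locale decaying_vorticity =
  fixes m B :: real and w :: "real \<Rightarrow> real^3 \<Rightarrow> real^3"
  assumes m: "5/2 < m" and B0: "0 \<le> B"
    and L2w: "\<And>s. 0 \<le> s \<Longrightarrow> w s \<in> L2w m"
    and cont: "\<And>s. 0 \<le> s \<Longrightarrow> ((\<lambda>\<sigma>. wnorm m (\<lambda>\<xi>. w \<sigma> \<xi> - w s \<xi>)) \<longlongrightarrow> 0) (at s within {0..})"
    and decay: "\<And>s. 0 \<le> s \<Longrightarrow> wnorm m (w s) \<le> B * exp (- s)"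
begin

lemma w_measurable: "0 \<le> s \<Longrightarrow> w s \<in> borel_measurable borel"
  using L2w_wnorm_sq(1)[OF L2w] .

lemma decay': "0 \<le> s \<Longrightarrow> wnorm m (w s) \<le> B"
  using decay[of s] mult_left_mono[of "exp (- s)" 1 B] B0 by simp

lemma flux_rho_integrable:
  assumes "0 \<le> s" shows "integrable lborel (\<lambda>\<eta>. \<rho> \<eta> * flux i j (w s) \<eta>)"
proof -
  note [measurable] = w_measurable[OF assms]
  obtain C where "(\<integral>\<^sup>+\<eta>. ennreal \<bar>\<rho> \<eta> * flux i j (w s) \<eta>\<bar> \<partial>lborel) \<le> ennreal (C * (wnorm m (w s))\<^sup>2)"
    using flux_L1_bounds[OF m] L2w[OF assms] by blast
  then have "(\<integral>\<^sup>+\<eta>. ennreal \<bar>\<rho> \<eta> * flux i j (w s) \<eta>\<bar> \<partial>lborel) < \<infinity>"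
    by (rule le_less_trans) simp
  then show ?thesis by (intro integrableI_bounded) auto
qed

lemma flux_weighted_integrable:
  assumes s: "0 \<le> s" and [measurable]: "k \<in> borel_measurable borel" and k: "\<And>\<eta>. \<bar>k \<eta>\<bar> \<le> M * \<rho> \<eta>"
  shows "integrable lborel (\<lambda>\<eta>. k \<eta> * flux i j (w s) \<eta>)"
proof -
  have "integrable lborel (\<lambda>\<eta>. (k \<eta> / \<rho> \<eta>) * (\<rho> \<eta> * flux i j (w s) \<eta>))"
  proof (rule bounded_mult_integrable[OF flux_rho_integrable[OF s]])
    show "\<bar>k x / \<rho> x\<bar> \<le> M" for x
      using k[of x] rho_pos[of x] by (simp add: abs_div divide_le_eq)
  qed measurable
  moreover have "(k \<eta> / \<rho> \<eta>) * (\<rho> \<eta> * flux i j (w s) \<eta>) = k \<eta> * flux i j (w s) \<eta>" for \<eta>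
    using rho_pos[of \<eta>] by simp
  ultimately show ?thesis by simp
qed

lemma flux_integrable: "0 \<le> s \<Longrightarrow> integrable lborel (flux i j (w s))"
  using flux_weighted_integrable[of s "\<lambda>_. 1" 1] rho_ge_1 by simp

text \<open>Continuity of the solution in the weighted norm becomes continuity of \<open>\<rho> * flux\<close> in \<open>L\<^sup>1\<close>, against which a kernel of
  linear growth, divided by \<open>\<rho>\<close>, is bounded.\<close>
lemma flux_integral_tendsto:
  assumes s: "\<And>n. 0 \<le> s n" "0 \<le> s0" "s \<longlonglongrightarrow> s0"
    and [measurable]: "\<And>n. k n \<in> borel_measurable borel" "k0 \<in> borel_measurable borel"
    and k: "\<And>n \<eta>. \<bar>k n \<eta>\<bar> \<le> M * \<rho> \<eta>" and lim: "\<And>\<eta>. (\<lambda>n. k n \<eta>) \<longlonglongrightarrow> k0 \<eta>"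
  shows "(\<lambda>n. LINT \<eta>|lborel. k n \<eta> * flux i j (w (s n)) \<eta>) \<longlonglongrightarrow> (LINT \<eta>|lborel. k0 \<eta> * flux i j (w s0) \<eta>)"
proof -
  obtain C where C: "C \<ge> 0" "\<And>f g. f \<in> L2w m \<Longrightarrow> g \<in> L2w m \<Longrightarrow>
      (\<integral>\<^sup>+\<eta>. ennreal \<bar>\<rho> \<eta> * flux i j f \<eta> - \<rho> \<eta> * flux i j g \<eta>\<bar> \<partial>lborel)
        \<le> ennreal (C * wnorm m (\<lambda>\<xi>. f \<xi> - g \<xi>) * (wnorm m f + wnorm m g))"
    using flux_L1_bounds[OF m] by blast
  define \<phi> where "\<phi> \<sigma> = wnorm m (\<lambda>\<xi>. w \<sigma> \<xi> - w s0 \<xi>)" for \<sigma>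
  have "\<phi> s0 = 0" by (simp add: \<phi>_def wnorm_def norm2_def)
  moreover have "(\<phi> \<longlongrightarrow> 0) (at s0 within {0..})" using cont[OF s(2)] unfolding \<phi>_def .
  ultimately have "continuous (at s0 within {0..}) \<phi>" by (simp add: continuous_within)
  moreover have "(\<forall>n. s n \<in> {0..}) \<and> s \<longlonglongrightarrow> s0" using s by auto
  ultimately have "(\<phi> \<circ> s) \<longlonglongrightarrow> \<phi> s0" unfolding continuous_within_sequentially by blast
  then have \<phi>: "(\<lambda>n. \<phi> (s n)) \<longlonglongrightarrow> 0" unfolding \<open>\<phi> s0 = 0\<close> comp_def .
  have L1: "(\<lambda>n. LINT \<eta>|lborel. \<bar>\<rho> \<eta> * flux i j (w (s n)) \<eta> - \<rho> \<eta> * flux i j (w s0) \<eta>\<bar>) \<longlonglongrightarrow> 0"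
  proof (rule Lim_null_comparison)
    show "(\<lambda>n. C * \<phi> (s n) * (2 * B)) \<longlonglongrightarrow> 0" using \<phi> by (auto intro!: tendsto_eq_intros)
    show "\<forall>\<^sub>F n in sequentially. norm (LINT \<eta>|lborel. \<bar>\<rho> \<eta> * flux i j (w (s n)) \<eta> - \<rho> \<eta> * flux i j (w s0) \<eta>\<bar>) \<le> C * \<phi> (s n) * (2 * B)"
    proof (intro always_eventually allI)
      fix n
      have i: "integrable lborel (\<lambda>\<eta>. \<bar>\<rho> \<eta> * flux i j (w (s n)) \<eta> - \<rho> \<eta> * flux i j (w s0) \<eta>\<bar>)"
        using flux_rho_integrable[OF s(1)[of n]] flux_rho_integrable[OF s(2)] by auto
      have "ennreal (LINT \<eta>|lborel. \<bar>\<rho> \<eta> * flux i j (w (s n)) \<eta> - \<rho> \<eta> * flux i j (w s0) \<eta>\<bar>)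
         \<le> ennreal (C * wnorm m (\<lambda>\<xi>. w (s n) \<xi> - w s0 \<xi>) * (wnorm m (w (s n)) + wnorm m (w s0)))"
        using C(2)[OF L2w[OF s(1)[of n]] L2w[OF s(2)]] nn_integral_eq_integral[OF i] by simp
      also have "\<dots> \<le> ennreal (C * \<phi> (s n) * (2 * B))"
        unfolding \<phi>_def using decay'[OF s(1)[of n]] decay'[OF s(2)] C(1)
        by (intro ennreal_leI mult_left_mono mult_nonneg_nonneg wnorm_nonneg) auto
      finally show "norm (LINT \<eta>|lborel. \<bar>\<rho> \<eta> * flux i j (w (s n)) \<eta> - \<rho> \<eta> * flux i j (w s0) \<eta>\<bar>) \<le> C * \<phi> (s n) * (2 * B)"
        using B0 C(1) by (subst (asm) ennreal_le_iff) (auto simp: \<phi>_def wnorm_nonneg)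
    qed
  qed
  have "(\<lambda>n. LINT \<eta>|lborel. (k n \<eta> / \<rho> \<eta>) * (\<rho> \<eta> * flux i j (w (s n)) \<eta>)) \<longlonglongrightarrow> (LINT \<eta>|lborel. (k0 \<eta> / \<rho> \<eta>) * (\<rho> \<eta> * flux i j (w s0) \<eta>))"
  proof (rule integral_kernel_tendsto[OF _ _ _ _ _ _ L1])
    show "\<bar>k n x / \<rho> x\<bar> \<le> M" for n x
      using k[of n x] rho_pos[of x] by (simp add: abs_div divide_le_eq)
    show "(\<lambda>n. k n x / \<rho> x) \<longlonglongrightarrow> k0 x / \<rho> x" for x
      using rho_pos[of x] by (intro tendsto_intros lim) auto
  qed (use flux_rho_integrable s in auto)
  moreover have "(k \<eta> / \<rho> \<eta>) * (\<rho> \<eta> * c) = k \<eta> * c" for k \<eta> c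
    using rho_pos[of \<eta>] by simp
  ultimately show ?thesis by simp
qed

definition flux_mass :: "3 \<Rightarrow> 3 \<Rightarrow> real \<Rightarrow> real"
  where "flux_mass i j s = (LINT \<eta>|lborel. flux i j (w s) \<eta>)"

definition flux_moment :: "3 \<Rightarrow> 3 \<Rightarrow> 3 \<Rightarrow> real \<Rightarrow> real"
  where "flux_moment i j k s = (LINT \<eta>|lborel. \<eta> $ k * flux i j (w s) \<eta>)"

lemma flux_weighted_continuous:
  assumes [measurable]: "k \<in> borel_measurable borel" and k: "\<And>\<eta>. \<bar>k \<eta>\<bar> \<le> \<rho> \<eta>"
  shows "continuous_on {0..} (\<lambda>s. LINT \<eta>|lborel. k \<eta> * flux i j (w s) \<eta>)"
  unfolding continuous_on_sequentially comp_def
proof (intro ballI allI impI, elim conjE)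
  fix x :: "nat \<Rightarrow> real" and a :: real assume "a \<in> {0..}" "\<forall>n. x n \<in> {0..}" "x \<longlonglongrightarrow> a"
  then show "(\<lambda>n. LINT \<eta>|lborel. k \<eta> * flux i j (w (x n)) \<eta>) \<longlonglongrightarrow> (LINT \<eta>|lborel. k \<eta> * flux i j (w a) \<eta>)"
    using k by (intro flux_integral_tendsto[where M = 1 and k = "\<lambda>_. k"]) auto
qed

lemma flux_mass_continuous: "continuous_on {0..} (flux_mass i j)"
  using flux_weighted_continuous[of "\<lambda>_. 1" i j] rho_ge_1 by (simp add: flux_mass_def[abs_def])

lemma flux_moment_continuous: "continuous_on {0..} (flux_moment i j k)"
  unfolding flux_moment_def[abs_def] by (rule flux_weighted_continuous) (auto intro: component_le_rho)

lemma flux_moment_bounds: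
  assumes C: "\<And>f i j. f \<in> L2w m \<Longrightarrow> (\<integral>\<^sup>+\<eta>. ennreal \<bar>\<rho> \<eta> * flux i j f \<eta>\<bar> \<partial>lborel) \<le> ennreal (C * (wnorm m f)\<^sup>2)"
    and C0: "0 \<le> C" and s: "0 \<le> s"
  shows "\<bar>flux_mass i j s\<bar> \<le> C * B\<^sup>2 * exp (- 2 * s)" "\<bar>flux_moment i j k s\<bar> \<le> C * B\<^sup>2 * exp (- 2 * s)"
proof -
  have *: "\<bar>LINT \<eta>|lborel. k \<eta> * flux i j (w s) \<eta>\<bar> \<le> C * B\<^sup>2 * exp (- 2 * s)"
    if [measurable]: "k \<in> borel_measurable borel" and k: "\<And>\<eta>. \<bar>k \<eta>\<bar> \<le> \<rho> \<eta>" for k :: "real^3 \<Rightarrow> real"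
  proof -
    have "ennreal \<bar>LINT \<eta>|lborel. k \<eta> * flux i j (w s) \<eta>\<bar> \<le> (\<integral>\<^sup>+\<eta>. ennreal (norm (k \<eta> * flux i j (w s) \<eta>)) \<partial>lborel)"
      using norm_integral_le_nn_integral[of lborel "\<lambda>\<eta>. k \<eta> * flux i j (w s) \<eta>"] by simp
    also have "\<dots> \<le> (\<integral>\<^sup>+\<eta>. ennreal \<bar>\<rho> \<eta> * flux i j (w s) \<eta>\<bar> \<partial>lborel)"
      using k by (intro nn_integral_mono ennreal_leI) (auto simp: abs_mult intro!: mult_right_mono order_trans[OF k abs_ge_self])
    also have "\<dots> \<le> ennreal (C * (wnorm m (w s))\<^sup>2)" by (rule C[OF L2w[OF s]])
    also have "\<dots> \<le> ennreal (C * (B * exp (- s))\<^sup>2)"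
      using decay[OF s] C0 by (intro ennreal_leI mult_left_mono power_mono) (auto simp: wnorm_nonneg)
    finally have "\<bar>LINT \<eta>|lborel. k \<eta> * flux i j (w s) \<eta>\<bar> \<le> C * (B * exp (- s))\<^sup>2"
      using C0 by (subst (asm) ennreal_le_iff) auto
    also have "\<dots> = C * B\<^sup>2 * exp (- 2 * s)" by (simp add: power2_eq_square flip: exp_add)
    finally show ?thesis .
  qed
  show "\<bar>flux_mass i j s\<bar> \<le> C * B\<^sup>2 * exp (- 2 * s)"
    using *[of "\<lambda>_. 1"] rho_ge_1 by (simp add: flux_mass_def)
  show "\<bar>flux_moment i j k s\<bar> \<le> C * B\<^sup>2 * exp (- 2 * s)"
    unfolding flux_moment_def by (rule *) (auto intro: component_le_rho)
qed

end

text \<open>A crude bound, blowing up as \<open>\<epsilon>\<close> tends to \<open>1\<close>; it serves only for continuity away from the final time.\<close>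
lemma dheat_rem_bounded:
  assumes e: "0 < \<epsilon>" "\<epsilon> < 1"
  shows "\<bar>dheat_rem j \<epsilon> \<xi> \<eta>\<bar> \<le> ((1 - \<epsilon>\<^sup>2) powr (-2) + 2 * \<rho> \<xi> ^ 2) * \<rho> \<eta>"
proof -
  have a: "0 < 1 - \<epsilon>\<^sup>2" using one_minus_sq_bounds[OF e] by simp
  have r: "1 \<le> \<rho> \<xi>" "1 \<le> \<rho> \<eta>" by (rule rho_ge_1)+
  have G1: "0 \<le> G \<xi>" "G \<xi> \<le> 1" using G_nonneg[of \<xi>] order_trans[OF G_le[of \<xi>], of 1] by auto
  have x: "\<bar>\<xi> $ j\<bar> \<le> \<rho> \<xi>" "norm \<xi> \<le> \<rho> \<xi>" "\<bar>\<eta> $ j\<bar> \<le> \<rho> \<eta>" "norm \<eta> \<le> \<rho> \<eta>"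
    using component_le_rho by (auto simp: \<rho>_def)
  have 1: "\<bar>dheat j (1 - \<epsilon>\<^sup>2) (\<xi> - \<epsilon> *\<^sub>R \<eta>)\<bar> \<le> (1 - \<epsilon>\<^sup>2) powr (-2) * \<rho> \<eta>"
    using dheat_bounded[OF a, of j "\<xi> - \<epsilon> *\<^sub>R \<eta>"] mult_left_mono[OF r(2), of "(1 - \<epsilon>\<^sup>2) powr (-2)"] by simp
  have rr: "\<rho> \<xi> \<le> \<rho> \<xi> ^ 2" "1 \<le> \<rho> \<xi> ^ 2" using self_le_power[OF r(1), of 2] one_le_power[OF r(1), of 2] by auto
  have P: "\<rho> \<xi> \<le> \<rho> \<xi> ^ 2 * \<rho> \<eta>" "\<rho> \<eta> \<le> \<rho> \<xi> ^ 2 * \<rho> \<eta>"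
  proof -
    show "\<rho> \<xi> \<le> \<rho> \<xi> ^ 2 * \<rho> \<eta>" using rr mult_left_mono[OF r(2), of "\<rho> \<xi> ^ 2"] by linarith
    show "\<rho> \<eta> \<le> \<rho> \<xi> ^ 2 * \<rho> \<eta>" using mult_right_mono[OF rr(2), of "\<rho> \<eta>"] r by linarith
  qed
  have 2: "\<bar>dG j \<xi>\<bar> \<le> \<rho> \<xi> ^ 2 * \<rho> \<eta> / 2"
  proof -
    have "\<bar>dG j \<xi>\<bar> = \<bar>\<xi> $ j\<bar> / 2 * G \<xi>" using G1 by (simp add: dG_def abs_mult)
    also have "\<dots> \<le> \<rho> \<xi> / 2 * 1" using x G1 r by (intro mult_mono) auto
    finally show ?thesis using P by simp
  qed
  have xh: "\<bar>\<xi> \<bullet> \<eta>\<bar> \<le> \<rho> \<xi> * \<rho> \<eta>"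
    using Cauchy_Schwarz_ineq2[of \<xi> \<eta>] mult_mono[OF x(2) x(4)] r by simp
  have "\<bar>\<xi> $ j * (\<xi> \<bullet> \<eta>)\<bar> \<le> \<rho> \<xi> * (\<rho> \<xi> * \<rho> \<eta>)"
    unfolding abs_mult using x xh r by (intro mult_mono) auto
  then have y: "\<bar>\<xi> $ j * (\<xi> \<bullet> \<eta>)\<bar> \<le> \<rho> \<xi> ^ 2 * \<rho> \<eta>" by (simp add: power2_eq_square mult_ac)
  have 3: "\<bar>\<epsilon> * (\<Sum>k\<in>UNIV. \<eta> $ k * ddG j k \<xi>)\<bar> \<le> \<rho> \<xi> ^ 2 * \<rho> \<eta>"
  proof -
    have "\<bar>\<xi> $ j * (\<xi> \<bullet> \<eta>) / 4 - \<eta> $ j / 2\<bar> \<le> \<rho> \<xi> ^ 2 * \<rho> \<eta>" using y x(3) P(2) by linarith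
    then have "\<bar>(\<xi> $ j * (\<xi> \<bullet> \<eta>) / 4 - \<eta> $ j / 2) * G \<xi>\<bar> \<le> \<rho> \<xi> ^ 2 * \<rho> \<eta> * 1"
      unfolding abs_mult using G1 by (intro mult_mono) auto
    then have "\<epsilon> * \<bar>(\<xi> $ j * (\<xi> \<bullet> \<eta>) / 4 - \<eta> $ j / 2) * G \<xi>\<bar> \<le> 1 * (\<rho> \<xi> ^ 2 * \<rho> \<eta>)"
      using e by (intro mult_mono) auto
    then show ?thesis using e by (simp add: sum_ddG abs_mult)
  qed
  have "\<bar>dheat_rem j \<epsilon> \<xi> \<eta>\<bar> \<le> (1 - \<epsilon>\<^sup>2) powr (-2) * \<rho> \<eta> + 2 * (\<rho> \<xi> ^ 2 * \<rho> \<eta>)"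
    unfolding dheat_rem_def using 1 2 3 by linarith
  then show ?thesis by (simp add: algebra_simps)
qed

lemma dheat_rem_tendsto:
  assumes e: "\<epsilon> \<longlonglongrightarrow> \<epsilon>0" "0 < \<epsilon>0" "\<epsilon>0 < 1" and x: "\<xi> \<longlonglongrightarrow> \<xi>0"
  shows "(\<lambda>n. dheat_rem j (\<epsilon> n) (\<xi> n) \<eta>) \<longlonglongrightarrow> dheat_rem j \<epsilon>0 \<xi>0 \<eta>"
proof -
  have a: "1 - \<epsilon>0\<^sup>2 \<noteq> 0" using one_minus_sq_bounds[OF e(2,3)] by simp
  then show ?thesis
    unfolding dheat_rem_def dheat_def heat_def dG_def ddG_def G_def
    by (intro tendsto_intros e x) auto
qed

text \<open>Minkowski's integral inequality for the weighted norm: Cauchy-Schwarz in time with the weight \<open>h\<close> itself, followed by Tonelli.  With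
  this choice of weight the two factors are bounded by the same integral of \<open>h\<close>.\<close>
lemma minkowski_time:
  assumes [measurable]: "E \<in> borel_measurable (lborel \<Otimes>\<^sub>M lborel)" "h \<in> borel_measurable borel" "T \<in> sets borel"
    and h: "\<And>s. s \<in> T \<Longrightarrow> 0 < h s"
    and E: "\<And>s. s \<in> T \<Longrightarrow> (\<integral>\<^sup>+\<xi>. ennreal ((\<rho> \<xi> powr m * \<bar>E (s, \<xi>)\<bar>)\<^sup>2) \<partial>lborel) \<le> ennreal ((b * h s)\<^sup>2)"
    and H: "(\<integral>\<^sup>+s. ennreal (h s) * indicator T s \<partial>lborel) \<le> ennreal H" "0 \<le> H" and b: "0 \<le> b"
  shows "(\<integral>\<^sup>+\<xi>. (\<integral>\<^sup>+s. ennreal (\<rho> \<xi> powr m * \<bar>E (s, \<xi>)\<bar>) * indicator T (s::real) \<partial>lborel)\<^sup>2 \<partial>lborel) \<le> ennreal ((b * H)\<^sup>2)"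
proof -
  define Q where "Q \<xi> = (\<integral>\<^sup>+s. ennreal (inverse (h s)) * (ennreal ((\<rho> \<xi> powr m * \<bar>E (s, \<xi>)\<bar>)\<^sup>2) * indicator T s) \<partial>lborel)" for \<xi>
  have 1: "(\<integral>\<^sup>+s. ennreal (\<rho> \<xi> powr m * \<bar>E (s, \<xi>)\<bar>) * indicator T s \<partial>lborel)\<^sup>2 \<le> ennreal H * Q \<xi>" for \<xi>
  proof -
    have split: "(\<integral>\<^sup>+s. ennreal (\<rho> \<xi> powr m * \<bar>E (s, \<xi>)\<bar>) * indicator T s \<partial>lborel)
      = (\<integral>\<^sup>+s. (ennreal (sqrt (h s)) * indicator T s) * (ennreal (inverse (sqrt (h s)) * (\<rho> \<xi> powr m * \<bar>E (s, \<xi>)\<bar>)) * indicator T s) \<partial>lborel)"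
    proof (intro nn_integral_cong)
      fix s
      show "ennreal (\<rho> \<xi> powr m * \<bar>E (s, \<xi>)\<bar>) * indicator T s
        = (ennreal (sqrt (h s)) * indicator T s) * (ennreal (inverse (sqrt (h s)) * (\<rho> \<xi> powr m * \<bar>E (s, \<xi>)\<bar>)) * indicator T s)"
      proof (cases "s \<in> T")
        case True
        then have "sqrt (h s) * (inverse (sqrt (h s)) * (\<rho> \<xi> powr m * \<bar>E (s, \<xi>)\<bar>)) = \<rho> \<xi> powr m * \<bar>E (s, \<xi>)\<bar>"
          using h[OF True] by simp
        then show ?thesis using True h[OF True] by (simp add: ennreal_mult[symmetric])
      qed simp
    qed
    have cs: "(\<integral>\<^sup>+s. ennreal (\<rho> \<xi> powr m * \<bar>E (s, \<xi>)\<bar>) * indicator T s \<partial>lborel)\<^sup>2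
      \<le> (\<integral>\<^sup>+s. (ennreal (sqrt (h s)) * indicator T s)\<^sup>2 \<partial>lborel)
        * (\<integral>\<^sup>+s. (ennreal (inverse (sqrt (h s)) * (\<rho> \<xi> powr m * \<bar>E (s, \<xi>)\<bar>)) * indicator T s)\<^sup>2 \<partial>lborel)"
      unfolding split by (rule Cauchy_Schwarz_nn_integral) measurable
    have f1: "(\<integral>\<^sup>+s. (ennreal (sqrt (h s)) * indicator T s)\<^sup>2 \<partial>lborel) = (\<integral>\<^sup>+s. ennreal (h s) * indicator T s \<partial>lborel)"
    proof (intro nn_integral_cong)
      fix s
      show "(ennreal (sqrt (h s)) * indicator T s)\<^sup>2 = ennreal (h s) * indicator T s"
      proof (cases "s \<in> T")
        case True
        have "(ennreal (sqrt (h s)))\<^sup>2 = ennreal ((sqrt (h s))\<^sup>2)"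
          using h[OF True] by (intro ennreal_power) simp
        then show ?thesis using True h[OF True] by simp
      qed simp
    qed
    have f2: "(\<integral>\<^sup>+s. (ennreal (inverse (sqrt (h s)) * (\<rho> \<xi> powr m * \<bar>E (s, \<xi>)\<bar>)) * indicator T s)\<^sup>2 \<partial>lborel) = Q \<xi>"
      unfolding Q_def
    proof (intro nn_integral_cong)
      fix s
      show "(ennreal (inverse (sqrt (h s)) * (\<rho> \<xi> powr m * \<bar>E (s, \<xi>)\<bar>)) * indicator T s)\<^sup>2
        = ennreal (inverse (h s)) * (ennreal ((\<rho> \<xi> powr m * \<bar>E (s, \<xi>)\<bar>)\<^sup>2) * indicator T s)"
      proof (cases "s \<in> T")
        case True
        have "(inverse (sqrt (h s)) * (\<rho> \<xi> powr m * \<bar>E (s, \<xi>)\<bar>))\<^sup>2 = inverse (h s) * (\<rho> \<xi> powr m * \<bar>E (s, \<xi>)\<bar>)\<^sup>2"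
          using h[OF True] by (simp only: power_mult_distrib power_inverse) simp
        moreover have "(ennreal (inverse (sqrt (h s)) * (\<rho> \<xi> powr m * \<bar>E (s, \<xi>)\<bar>)))\<^sup>2
          = ennreal ((inverse (sqrt (h s)) * (\<rho> \<xi> powr m * \<bar>E (s, \<xi>)\<bar>))\<^sup>2)"
          using h[OF True] by (intro ennreal_power) simp
        moreover have "ennreal (inverse (h s) * (\<rho> \<xi> powr m * \<bar>E (s, \<xi>)\<bar>)\<^sup>2)
          = ennreal (inverse (h s)) * ennreal ((\<rho> \<xi> powr m * \<bar>E (s, \<xi>)\<bar>)\<^sup>2)"
          using h[OF True] by (intro ennreal_mult) auto
        ultimately show ?thesis using True by simp
      qed simp
    qed
    from cs show ?thesis unfolding f1 f2 by (rule order_trans) (intro mult_right_mono H, simp)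
  qed
  have "(\<integral>\<^sup>+\<xi>. (\<integral>\<^sup>+s. ennreal (\<rho> \<xi> powr m * \<bar>E (s, \<xi>)\<bar>) * indicator T s \<partial>lborel)\<^sup>2 \<partial>lborel) \<le> (\<integral>\<^sup>+\<xi>. ennreal H * Q \<xi> \<partial>lborel)"
    by (intro nn_integral_mono 1)
  also have "\<dots> = ennreal H * (\<integral>\<^sup>+\<xi>. Q \<xi> \<partial>lborel)"
    unfolding Q_def by (rule nn_integral_cmult) measurable
  also have "(\<integral>\<^sup>+\<xi>. Q \<xi> \<partial>lborel) = (\<integral>\<^sup>+s. (\<integral>\<^sup>+\<xi>. ennreal (inverse (h s)) * (ennreal ((\<rho> \<xi> powr m * \<bar>E (s, \<xi>)\<bar>)\<^sup>2) * indicator T s) \<partial>lborel) \<partial>lborel)"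
    unfolding Q_def by (rule lborel_pair.Fubini') measurable
  also have "\<dots> \<le> (\<integral>\<^sup>+s. ennreal (b\<^sup>2) * (ennreal (h s) * indicator T s) \<partial>lborel)"
  proof (intro nn_integral_mono)
    fix s :: real
    show "(\<integral>\<^sup>+\<xi>. ennreal (inverse (h s)) * (ennreal ((\<rho> \<xi> powr m * \<bar>E (s, \<xi>)\<bar>)\<^sup>2) * indicator T s) \<partial>lborel)
      \<le> ennreal (b\<^sup>2) * (ennreal (h s) * indicator T s)"
    proof (cases "s \<in> T")
      case True
      have "(\<integral>\<^sup>+\<xi>. ennreal (inverse (h s)) * (ennreal ((\<rho> \<xi> powr m * \<bar>E (s, \<xi>)\<bar>)\<^sup>2) * indicator T s) \<partial>lborel)
        = ennreal (inverse (h s)) * (\<integral>\<^sup>+\<xi>. ennreal ((\<rho> \<xi> powr m * \<bar>E (s, \<xi>)\<bar>)\<^sup>2) \<partial>lborel)"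
        using True by (simp add: nn_integral_cmult)
      also have "\<dots> \<le> ennreal (inverse (h s)) * ennreal ((b * h s)\<^sup>2)"
        by (intro mult_left_mono E True) auto
      also have "\<dots> = ennreal (b\<^sup>2 * h s)"
        using h[OF True] by (simp add: ennreal_mult'[symmetric] power2_eq_square field_simps)
      finally show ?thesis using True h[OF True] by (simp add: ennreal_mult)
    qed simp
  qed
  also have "\<dots> = ennreal (b\<^sup>2) * (\<integral>\<^sup>+s. ennreal (h s) * indicator T s \<partial>lborel)"
    by (rule nn_integral_cmult) measurable
  also have "\<dots> \<le> ennreal (b\<^sup>2) * ennreal H" by (intro mult_left_mono H) auto
  also have "ennreal H * (ennreal (b\<^sup>2) * ennreal H) = ennreal ((b * H)\<^sup>2)"
    using H(2) by (simp add: ennreal_mult[symmetric] power2_eq_square mult_ac)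
  finally show ?thesis by (simp add: mult_left_mono)
qed

lemma one_minus_exp_powr_le:
  assumes "0 < (\<sigma>::real)"
  shows "(1 - exp (- \<sigma>)) powr (-(7/8)) \<le> 2 + 2 * (\<sigma> powr (-(7/8)) * indicator (ball 0 1) \<sigma>)"
proof -
  have e: "1 + \<sigma> \<le> exp \<sigma>" by (rule exp_ge_add_one_self)
  have ge: "\<sigma> / (1 + \<sigma>) \<le> 1 - exp (- \<sigma>)"
  proof -
    have "exp (- \<sigma>) \<le> 1 / (1 + \<sigma>)" using e assms by (simp add: exp_minus inverse_eq_divide frac_le)
    moreover have "\<sigma> / (1 + \<sigma>) = 1 - 1 / (1 + \<sigma>)" using assms by (simp add: field_simps)
    ultimately show ?thesis by linarith
  qed
  have two: "2 powr (7/8) \<le> (2::real)" using powr_mono[of "7/8" 1 2] by simp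
  show ?thesis
  proof (cases "\<sigma> < 1")
    case True
    have "\<sigma> / 2 \<le> \<sigma> / (1 + \<sigma>)" using True assms by (intro divide_left_mono) auto
    then have "\<sigma> / 2 \<le> 1 - exp (- \<sigma>)" using ge by linarith
    then have "(1 - exp (- \<sigma>)) powr (-(7/8)) \<le> (\<sigma> / 2) powr (-(7/8))"
      using assms by (intro powr_mono2') simp_all
    also have "\<dots> = 2 powr (7/8) * \<sigma> powr (-(7/8))"
      using assms by (simp add: powr_divide powr_minus field_simps)
    also have "\<dots> \<le> 2 * \<sigma> powr (-(7/8))" using two by (intro mult_right_mono) auto
    finally show ?thesis using True assms by simp
  next
    case False
    have "1 / 2 \<le> \<sigma> / (1 + \<sigma>)" using False by (simp add: field_simps)
    then have "1 / 2 \<le> 1 - exp (- \<sigma>)" using ge by linarith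
    then have "(1 - exp (- \<sigma>)) powr (-(7/8)) \<le> (1 / 2) powr (-(7/8))"
      by (intro powr_mono2') simp_all
    also have "\<dots> = 2 powr (7/8)" by (simp add: powr_divide powr_minus)
    finally show ?thesis using two False by simp
  qed
qed

text \<open>The singularity at the final time and the decay at infinity are separated by estimating a product by a sum, so that the bound is uniform in \<open>\<tau>\<close>.\<close>
lemma time_weight_integral:
  assumes \<kappa>: "0 < \<kappa>"
  shows "\<exists>H\<ge>0. \<forall>\<tau>. (\<integral>\<^sup>+s. ennreal (exp (- \<kappa> * s) * (1 - exp (- (\<tau> - s))) powr (-(7/8))) * indicator {0..<\<tau>} s \<partial>lborel) \<le> ennreal H"
proof -
  \<comment> \<open>chosen so that \<open>c * (1 + s) \<le> exp (\<kappa> * s / 2)\<close>\<close>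
  define c where "c = min 1 (\<kappa> / 2)"
  have c: "0 < c" "c \<le> 1" "c \<le> \<kappa> / 2" using \<kappa> by (auto simp: c_def)
  have q: "(2::real) > DIM(real)" and p: "(0::real) \<le> 7/8" "7/8 < real DIM(real)" by simp_all
  let ?I = "\<integral>\<^sup>+x. ennreal (norm (x::real) powr (-(7/8))) * indicator (ball 0 1) x \<partial>lborel"
  let ?J = "\<integral>\<^sup>+x. ennreal ((1 + norm (x::real)) powr (-2)) \<partial>lborel"
  have fin: "?I < \<infinity>" "?J < \<infinity>"
    by (rule nn_integral_singularity_finite[where p = "7/8", OF p])
      (rule nn_integral_inverse_power_decay_finite[where q = 2, OF q])
  then have "ennreal (2 / c\<^sup>2) * ?J + 2 * ?I < \<infinity>" by (simp add: ennreal_mult_less_top)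
  then obtain H where H: "H \<ge> 0" "ennreal (2 / c\<^sup>2) * ?J + 2 * ?I \<le> ennreal H" using nn_integral_bound_real by blast
  have pt: "ennreal (exp (- \<kappa> * s) * (1 - exp (- (\<tau> - s))) powr (-(7/8))) * indicator {0..<\<tau>} s
     \<le> ennreal (2 / c\<^sup>2) * ennreal ((1 + norm s) powr (-2)) + 2 * (ennreal (norm (\<tau> - s) powr (-(7/8))) * indicator (ball 0 1) (\<tau> - s))" for s \<tau>
  proof (cases "s \<in> {0..<\<tau>}")
    case True
    then have s: "0 \<le> s" "0 < \<tau> - s" by auto
    have "c * (1 + s) \<le> 1 + \<kappa> * s / 2" using c s mult_right_mono[OF c(3) s(1)] by (simp add: distrib_left)
    also have "\<dots> \<le> exp (\<kappa> * s / 2)" by (rule exp_ge_add_one_self)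
    finally have "(c * (1 + s))\<^sup>2 \<le> (exp (\<kappa> * s / 2))\<^sup>2" using c s by (intro power_mono) auto
    also have "\<dots> = exp (\<kappa> * s)" by (simp add: power2_eq_square flip: exp_add)
    finally have "exp (- \<kappa> * s) \<le> 1 / (c * (1 + s))\<^sup>2"
      using c s by (simp add: exp_minus inverse_eq_divide frac_le)
    also have "\<dots> = (1 / c\<^sup>2) * (1 + s) powr (-2)"
      using s by (simp add: powr_minus inverse_eq_divide power_mult_distrib)
    finally have e: "exp (- \<kappa> * s) \<le> (1 / c\<^sup>2) * (1 + s) powr (-2)" .
    have e1: "exp (- \<kappa> * s) \<le> 1" using \<kappa> s by simp
    let ?i = "(\<tau> - s) powr (-(7/8)) * indicator (ball 0 1) (\<tau> - s)"
    have "exp (- \<kappa> * s) * (1 - exp (- (\<tau> - s))) powr (-(7/8)) \<le> exp (- \<kappa> * s) * (2 + 2 * ?i)"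
      by (intro mult_left_mono one_minus_exp_powr_le s) auto
    also have "\<dots> = 2 * exp (- \<kappa> * s) + exp (- \<kappa> * s) * (2 * ?i)" by (simp add: algebra_simps)
    also have "\<dots> \<le> 2 * ((1 / c\<^sup>2) * (1 + s) powr (-2)) + 1 * (2 * ?i)"
      using e e1 by (intro add_mono mult_left_mono mult_right_mono) auto
    finally have "ennreal (exp (- \<kappa> * s) * (1 - exp (- (\<tau> - s))) powr (-(7/8))) \<le> ennreal (2 / c\<^sup>2 * (1 + s) powr (-2) + 2 * ?i)"
      by (intro ennreal_leI) simp
    also have "\<dots> = ennreal (2 / c\<^sup>2) * ennreal ((1 + s) powr (-2)) + 2 * ennreal ?i"
    proof -
      have "ennreal (2 / c\<^sup>2 * (1 + s) powr (-2) + 2 * ?i) = ennreal (2 / c\<^sup>2 * (1 + s) powr (-2)) + ennreal (2 * ?i)"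
        by (rule ennreal_plus) auto
      moreover have "ennreal (2 / c\<^sup>2 * (1 + s) powr (-2)) = ennreal (2 / c\<^sup>2) * ennreal ((1 + s) powr (-2))"
        by (rule ennreal_mult) auto
      moreover have "ennreal (2 * ?i) = ennreal 2 * ennreal ?i" by (rule ennreal_mult) auto
      ultimately show ?thesis by simp
    qed
    also have "ennreal ?i = ennreal (norm (\<tau> - s) powr (-(7/8))) * indicator (ball 0 1) (\<tau> - s)"
      using s by (simp add: indicator_def)
    finally show ?thesis using True s by simp
  qed simp
  have ind [measurable]: "(indicator (ball 0 1) :: real \<Rightarrow> ennreal) \<in> borel_measurable borel"
    by (rule borel_measurable_indicator) (rule borel_open, rule open_ball)
  have [measurable]: "(\<lambda>s. indicator (ball 0 1) (\<tau> - s) :: ennreal) \<in> borel_measurable borel" for \<tau> :: real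
    by (rule measurable_compose[OF _ ind]) simp
  have "(\<integral>\<^sup>+s. ennreal (exp (- \<kappa> * s) * (1 - exp (- (\<tau> - s))) powr (-(7/8))) * indicator {0..<\<tau>} s \<partial>lborel) \<le> ennreal H" for \<tau>
  proof -
    have "(\<integral>\<^sup>+s. ennreal (exp (- \<kappa> * s) * (1 - exp (- (\<tau> - s))) powr (-(7/8))) * indicator {0..<\<tau>} s \<partial>lborel)
      \<le> (\<integral>\<^sup>+s. ennreal (2 / c\<^sup>2) * ennreal ((1 + norm s) powr (-2)) + 2 * (ennreal (norm (\<tau> - s) powr (-(7/8))) * indicator (ball 0 1) (\<tau> - s)) \<partial>lborel)"
      by (intro nn_integral_mono pt)
    also have "\<dots> = ennreal (2 / c\<^sup>2) * ?J + 2 * (\<integral>\<^sup>+s. ennreal (norm (\<tau> - s) powr (-(7/8))) * indicator (ball 0 1) (\<tau> - s) \<partial>lborel)"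
      by (simp add: nn_integral_add nn_integral_cmult)
    also have "(\<integral>\<^sup>+s. ennreal (norm (\<tau> - s) powr (-(7/8))) * indicator (ball 0 1) (\<tau> - s) \<partial>lborel) = ?I"
      by (rule nn_integral_reflect_translate) (intro borel_measurable_times_ennreal ind, measurable)
    finally show ?thesis using H(2) by simp
  qed
  then show ?thesis using H(1) by blast
qed

section \<open>Expansion of the Duhamel term\<close>

text \<open>Predicates for admissible constants.  The constants have to be fixed before the initial value, because the final constant must not depend
  on the solution; naming the property lets the lemmas about one solution take them as parameters.\<close>
definition duhamel_constant :: "real \<Rightarrow> real \<Rightarrow> real \<Rightarrow> bool"
  where "duhamel_constant m p C \<longleftrightarrow> 0 \<le> C \<and>
    (\<forall>w \<in> borel_measurable borel. \<forall>F \<in> borel_measurable borel.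
    (\<forall>\<eta>. \<bar>F \<eta>\<bar> \<le> 2 * (norm (w \<eta>) * norm (biot_savart w \<eta>))) \<longrightarrow>
    (\<forall>j \<epsilon>. 0 < \<epsilon> \<longrightarrow> \<epsilon> < 1 \<longrightarrow>
      (\<integral>\<^sup>+\<xi>. ennreal ((\<rho> \<xi> powr m * \<bar>LINT \<eta>|lborel. dheat_rem j \<epsilon> \<xi> \<eta> * F \<eta>\<bar>)\<^sup>2) \<partial>lborel)
        \<le> ennreal (C * \<epsilon> powr (2 * p) * (1 - \<epsilon>\<^sup>2) powr (-(7/4))) * (wnorm_sq m w)\<^sup>2))"

definition time_constant :: "real \<Rightarrow> real \<Rightarrow> bool"
  where "time_constant \<kappa> H \<longleftrightarrow> 0 \<le> H \<and>
    (\<forall>\<tau>. (\<integral>\<^sup>+s. ennreal (exp (- \<kappa> * s) * (1 - exp (- (\<tau> - s))) powr (-(7/8))) * indicator {0..<\<tau>} s \<partial>lborel) \<le> ennreal H)"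

lemma exponential_tail_integral:
  assumes c: "continuous_on {0..} f" and b: "\<And>s. 0 \<le> s \<Longrightarrow> \<bar>f s\<bar> \<le> K * exp (- a * s)" and a: "0 < a" and K: "0 \<le> K"
  shows "set_integrable lborel {0..} (f :: real \<Rightarrow> real)"
    and "0 \<le> \<tau> \<Longrightarrow> \<bar>(LBINT s:{0..}. f s) - (LBINT s:{0..\<tau>}. f s)\<bar> \<le> K * exp (- a * \<tau>) / a"
proof -
  have fm: "set_borel_measurable borel {0..} f"
    using borel_measurable_continuous_on_indicator[OF _ c] by (simp add: set_borel_measurable_def)
  have tail: "(\<integral>\<^sup>+s. ennreal (K * exp (- a * s)) * indicator {\<tau>..} s \<partial>lborel) = ennreal (K * exp (- a * \<tau>) / a)" for \<tau>
  proof -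
    have "(\<integral>\<^sup>+s. ennreal (K * exp (- a * s)) * indicator {\<tau>..} s \<partial>lborel) = ennreal (0 - (- K * exp (- a * \<tau>) / a))"
    proof (rule nn_integral_FTC_atLeast)
      show "((\<lambda>s. - K * exp (- a * s) / a) has_real_derivative K * exp (- a * x)) (at x)" for x
        using a by (auto intro!: derivative_eq_intros)
      have "((\<lambda>s. exp (- a * s)) \<longlongrightarrow> 0) at_top"
        using a by (intro filterlim_compose[OF exp_at_bot] filterlim_tendsto_neg_mult_at_bot[OF tendsto_const])
          (auto simp: filterlim_ident)
      then have "((\<lambda>s. (- K / a) * exp (- a * s)) \<longlongrightarrow> (- K / a) * 0) at_top" by (rule tendsto_mult_left)
      then show "((\<lambda>s. - K * exp (- a * s) / a) \<longlongrightarrow> 0) at_top" by simp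
    qed (use K in auto)
    then show ?thesis by simp
  qed
  have fm2: "(\<lambda>s. indicator {0..} s *\<^sub>R f s) \<in> borel_measurable borel" using fm by (simp add: set_borel_measurable_def)
  show i: "set_integrable lborel {0..} f"
    unfolding set_integrable_def
  proof (rule integrableI_bounded)
    have "(\<integral>\<^sup>+s. ennreal (norm (indicator {0..} s *\<^sub>R f s)) \<partial>lborel) \<le> (\<integral>\<^sup>+s. ennreal (K * exp (- a * s)) * indicator {0..} s \<partial>lborel)"
      using b by (intro nn_integral_mono) (auto simp: indicator_def intro!: ennreal_leI)
    also have "\<dots> < \<infinity>" unfolding tail by simp
    finally show "(\<integral>\<^sup>+s. ennreal (norm (indicator {0..} s *\<^sub>R f s)) \<partial>lborel) < \<infinity>" .
  qed (use fm2 in simp)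
  assume t: "0 \<le> \<tau>"
  have un: "{0..} = {0..\<tau>} \<union> {\<tau><..}" using t by auto
  have i2: "set_integrable lborel {0..\<tau>} f" "set_integrable lborel {\<tau><..} f"
    by (rule set_integrable_subset[OF i]; use t in auto)+
  have "(LBINT s:{0..}. f s) = (LBINT s:{0..\<tau>}. f s) + (LBINT s:{\<tau><..}. f s)"
    unfolding un by (rule set_integral_Un) (use i2 in auto)
  then have eq: "(LBINT s:{0..}. f s) - (LBINT s:{0..\<tau>}. f s) = (LBINT s:{\<tau><..}. f s)" by simp
  have "ennreal \<bar>LBINT s:{\<tau><..}. f s\<bar> \<le> (\<integral>\<^sup>+s. ennreal (norm (indicator {\<tau><..} s *\<^sub>R f s)) \<partial>lborel)"
    using norm_integral_le_nn_integral[of lborel "\<lambda>s. indicator {\<tau><..} s *\<^sub>R f s"] by (simp add: set_lebesgue_integral_def)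
  also have "\<dots> \<le> (\<integral>\<^sup>+s. ennreal (K * exp (- a * s)) * indicator {\<tau>..} s \<partial>lborel)"
    using b t by (intro nn_integral_mono) (auto simp: indicator_def intro!: ennreal_leI)
  also have "\<dots> = ennreal (K * exp (- a * \<tau>) / a)" by (rule tail)
  finally show "\<bar>(LBINT s:{0..}. f s) - (LBINT s:{0..\<tau>}. f s)\<bar> \<le> K * exp (- a * \<tau>) / a"
    unfolding eq using K a by (subst (asm) ennreal_le_iff) auto
qed

context decaying_vorticity
begin

text \<open>The Duhamel integrand with its kernel replaced by the expansion remainder, as a function of time and space together: Tonelli's theorem
  requires joint measurability.\<close>
definition duhamel_rem :: "3 \<Rightarrow> 3 \<Rightarrow> real \<Rightarrow> real \<times> (real^3) \<Rightarrow> real"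
  where "duhamel_rem i j \<tau> p = (exp (- (\<tau> - fst p) / 2))\<^sup>2 *
     (LINT \<eta>|lborel. dheat_rem j (exp (- (\<tau> - fst p) / 2)) (snd p) \<eta> * flux i j (w (fst p)) \<eta>)"

definition duhamel_lead :: "3 \<Rightarrow> 3 \<Rightarrow> real \<Rightarrow> real^3 \<Rightarrow> real \<Rightarrow> real"
  where "duhamel_lead i j \<tau> \<xi> s = exp (- \<tau>) * dG j \<xi> * (exp s * flux_mass i j s)
     - exp (- (3/2) * \<tau>) * (\<Sum>k\<in>UNIV. ddG j k \<xi> * (exp (3/2 * s) * flux_moment i j k s))"

text \<open>With \<open>\<epsilon> = exp (- (\<tau> - s) / 2)\<close>, the prefactors \<open>\<epsilon>\<^sup>2\<close> and \<open>\<epsilon> ^ 3\<close> factor into a power of \<open>exp (- \<tau>)\<close>, the rate of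
  the profile, and the growing weight in \<open>s\<close> under the coefficient integral.\<close>
lemma duhamel_decomposition:
  assumes s: "0 \<le> s" "s < \<tau>"
  shows "duhamel w i j \<tau> \<xi> s = duhamel_rem i j \<tau> (s, \<xi>) + duhamel_lead i j \<tau> \<xi> s"
proof -
  define \<epsilon> where "\<epsilon> = exp (- (\<tau> - s) / 2)"
  have e: "0 < \<epsilon>" "\<epsilon> < 1" using s by (auto simp: \<epsilon>_def)
  have e2: "\<epsilon>\<^sup>2 = exp (- \<tau>) * exp s" by (simp add: \<epsilon>_def power2_eq_square flip: exp_add)
  have e3: "\<epsilon>\<^sup>2 * \<epsilon> = exp (- (3/2) * \<tau>) * exp (3/2 * s)"
    unfolding e2 by (simp add: \<epsilon>_def flip: exp_add) (simp add: field_simps)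
  have a: "0 < 1 - \<epsilon>\<^sup>2" using one_minus_sq_bounds[OF e] by simp
  note [measurable] = w_measurable[OF s(1)]
  let ?F = "flux i j (w s)"
  have i1: "integrable lborel (\<lambda>\<eta>. dheat j (1 - \<epsilon>\<^sup>2) (\<xi> - \<epsilon> *\<^sub>R \<eta>) * ?F \<eta>)"
    by (rule bounded_mult_integrable[OF flux_integrable[OF s(1)] _ dheat_bounded[OF a]]) measurable
  have i2: "integrable lborel (\<lambda>\<eta>. dG j \<xi> * ?F \<eta>)" using flux_integrable[OF s(1)] by simp
  have i3: "integrable lborel (\<lambda>\<eta>. \<eta> $ k * ?F \<eta>)" for k
    by (rule flux_weighted_integrable[OF s(1), of _ 1]) (auto intro: component_le_rho)
  have i4: "integrable lborel (\<lambda>\<eta>. \<epsilon> * (\<Sum>k\<in>UNIV. ddG j k \<xi> * (\<eta> $ k * ?F \<eta>)))"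
    using i3 by auto
  have "(LINT \<eta>|lborel. dheat_rem j \<epsilon> \<xi> \<eta> * ?F \<eta>)
    = (LINT \<eta>|lborel. (dheat j (1 - \<epsilon>\<^sup>2) (\<xi> - \<epsilon> *\<^sub>R \<eta>) * ?F \<eta> - dG j \<xi> * ?F \<eta>) + \<epsilon> * (\<Sum>k\<in>UNIV. ddG j k \<xi> * (\<eta> $ k * ?F \<eta>)))"
    by (intro Bochner_Integration.integral_cong refl) (simp add: dheat_rem_def sum_3 algebra_simps)
  also have "\<dots> = (LINT \<eta>|lborel. dheat j (1 - \<epsilon>\<^sup>2) (\<xi> - \<epsilon> *\<^sub>R \<eta>) * ?F \<eta>) - (LINT \<eta>|lborel. dG j \<xi> * ?F \<eta>)
      + (LINT \<eta>|lborel. \<epsilon> * (\<Sum>k\<in>UNIV. ddG j k \<xi> * (\<eta> $ k * ?F \<eta>)))"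
    using i1 i2 i4 by simp
  also have "(LINT \<eta>|lborel. \<epsilon> * (\<Sum>k\<in>UNIV. ddG j k \<xi> * (\<eta> $ k * ?F \<eta>))) = \<epsilon> * (\<Sum>k\<in>UNIV. ddG j k \<xi> * flux_moment i j k s)"
    using i3 by (simp add: flux_moment_def)
  also have "(LINT \<eta>|lborel. dG j \<xi> * ?F \<eta>) = dG j \<xi> * flux_mass i j s" by (simp add: flux_mass_def)
  finally have K: "(LINT \<eta>|lborel. dheat_rem j \<epsilon> \<xi> \<eta> * ?F \<eta>)
    = (LINT \<eta>|lborel. dheat j (1 - \<epsilon>\<^sup>2) (\<xi> - \<epsilon> *\<^sub>R \<eta>) * ?F \<eta>) - dG j \<xi> * flux_mass i j s + \<epsilon> * (\<Sum>k\<in>UNIV. ddG j k \<xi> * flux_moment i j k s)" .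
  have "duhamel_lead i j \<tau> \<xi> s = (exp (- \<tau>) * exp s) * (dG j \<xi> * flux_mass i j s)
      - (exp (- (3/2) * \<tau>) * exp (3/2 * s)) * (\<Sum>k\<in>UNIV. ddG j k \<xi> * flux_moment i j k s)"
    unfolding duhamel_lead_def sum_distrib_left by (simp only: mult_ac)
  then have L: "duhamel_lead i j \<tau> \<xi> s = \<epsilon>\<^sup>2 * (dG j \<xi> * flux_mass i j s) - (\<epsilon>\<^sup>2 * \<epsilon>) * (\<Sum>k\<in>UNIV. ddG j k \<xi> * flux_moment i j k s)"
    unfolding e3[symmetric] e2[symmetric] .
  have "duhamel w i j \<tau> \<xi> s = \<epsilon>\<^sup>2 * (LINT \<eta>|lborel. dheat j (1 - \<epsilon>\<^sup>2) (\<xi> - \<epsilon> *\<^sub>R \<eta>) * ?F \<eta>)"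
    unfolding \<epsilon>_def by (rule duhamel_kernel[where w = w, OF s(2) w_measurable[OF s(1)] flux_integrable[OF s(1)]])
  then show ?thesis unfolding duhamel_rem_def fst_conv snd_conv \<epsilon>_def[symmetric] K L by (simp add: algebra_simps)
qed

text \<open>Along a convergent sequence the kernels converge pointwise with a common linear bound, while the flux converges in \<open>L\<^sup>1\<close> with the weight
  \<open>\<rho>\<close>.  The purpose is joint measurability.\<close>
lemma duhamel_rem_continuous: "continuous_on ({0..<\<tau>} \<times> UNIV) (duhamel_rem i j \<tau>)"
  unfolding continuous_on_sequentially comp_def
proof (intro ballI allI impI, elim conjE)
  fix x :: "nat \<Rightarrow> real \<times> (real^3)" and a assume a: "a \<in> {0..<\<tau>} \<times> UNIV" and x: "\<forall>n. x n \<in> {0..<\<tau>} \<times> UNIV" "x \<longlonglongrightarrow> a"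
  define s where "s n = fst (x n)" for n
  define \<xi> where "\<xi> n = snd (x n)" for n
  define \<epsilon> where "\<epsilon> n = exp (- (\<tau> - s n) / 2)" for n
  define \<epsilon>0 where "\<epsilon>0 = exp (- (\<tau> - fst a) / 2)"
  have s: "0 \<le> s n" "s n < \<tau>" for n using x(1) by (auto simp: s_def mem_Times_iff)
  have s0: "0 \<le> fst a" "fst a < \<tau>" using a by auto
  have lims: "s \<longlonglongrightarrow> fst a" "\<xi> \<longlonglongrightarrow> snd a"
    unfolding s_def \<xi>_def by (intro tendsto_fst tendsto_snd x(2))+
  have e: "0 < \<epsilon> n" "\<epsilon> n < 1" for n using s[of n] by (auto simp: \<epsilon>_def)
  have e0: "0 < \<epsilon>0" "\<epsilon>0 < 1" using s0 by (auto simp: \<epsilon>0_def)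
  have le: "\<epsilon> \<longlonglongrightarrow> \<epsilon>0" unfolding \<epsilon>_def \<epsilon>0_def by (intro tendsto_intros lims) simp
  have a0: "1 - \<epsilon>0\<^sup>2 \<noteq> 0" using one_minus_sq_bounds[OF e0] by simp
  define Mn where "Mn n = (1 - (\<epsilon> n)\<^sup>2) powr (-2) + 2 * \<rho> (\<xi> n) ^ 2" for n
  have "Mn \<longlonglongrightarrow> (1 - \<epsilon>0\<^sup>2) powr (-2) + 2 * \<rho> (snd a) ^ 2"
    unfolding Mn_def \<rho>_def using a0 by (intro tendsto_intros le lims) auto
  then have "Bseq Mn" by (intro convergent_imp_Bseq convergentI)
  then obtain M where M: "\<And>n. norm (Mn n) \<le> M" unfolding Bseq_def by blast
  have "(\<lambda>n. LINT \<eta>|lborel. dheat_rem j (\<epsilon> n) (\<xi> n) \<eta> * flux i j (w (s n)) \<eta>) \<longlonglongrightarrow> (LINT \<eta>|lborel. dheat_rem j \<epsilon>0 (snd a) \<eta> * flux i j (w (fst a)) \<eta>)"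
  proof (rule flux_integral_tendsto[OF s(1) s0(1) lims(1)])
    show "(\<lambda>\<eta>. dheat_rem j (\<epsilon> n) (\<xi> n) \<eta>) \<in> borel_measurable borel" for n unfolding dheat_rem_def by measurable
    show "(\<lambda>\<eta>. dheat_rem j \<epsilon>0 (snd a) \<eta>) \<in> borel_measurable borel" unfolding dheat_rem_def by measurable
    show "\<bar>dheat_rem j (\<epsilon> n) (\<xi> n) \<eta>\<bar> \<le> M * \<rho> \<eta>" for n \<eta>
    proof -
      have "\<bar>dheat_rem j (\<epsilon> n) (\<xi> n) \<eta>\<bar> \<le> Mn n * \<rho> \<eta>" unfolding Mn_def by (rule dheat_rem_bounded[OF e])
      also have "\<dots> \<le> M * \<rho> \<eta>" using M[of n] rho_pos[of \<eta>] by (intro mult_right_mono) auto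
      finally show ?thesis .
    qed
    show "(\<lambda>n. dheat_rem j (\<epsilon> n) (\<xi> n) \<eta>) \<longlonglongrightarrow> dheat_rem j \<epsilon>0 (snd a) \<eta>" for \<eta>
      by (rule dheat_rem_tendsto[OF le e0 lims(2)])
  qed
  then have "(\<lambda>n. (\<epsilon> n)\<^sup>2 * (LINT \<eta>|lborel. dheat_rem j (\<epsilon> n) (\<xi> n) \<eta> * flux i j (w (s n)) \<eta>))
     \<longlonglongrightarrow> \<epsilon>0\<^sup>2 * (LINT \<eta>|lborel. dheat_rem j \<epsilon>0 (snd a) \<eta> * flux i j (w (fst a)) \<eta>)"
    by (intro tendsto_mult tendsto_power le)
  then show "(\<lambda>n. duhamel_rem i j \<tau> (x n)) \<longlonglongrightarrow> duhamel_rem i j \<tau> a"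
    by (simp add: duhamel_rem_def \<epsilon>_def \<epsilon>0_def s_def \<xi>_def)
qed

text \<open>At time \<open>s\<close> the norm of the remainder is at most a constant times
  \<open>exp (- \<nu> * (\<tau> - s)) * (1 - exp (- (\<tau> - s))) powr (- 7/8) * exp (- 2 * s)\<close>.  Pulling out \<open>exp (- \<nu> * \<tau>)\<close> leaves the
  weight \<open>exp (- (2 - \<nu>) * s)\<close>, integrable because \<open>\<nu> < 2\<close>.\<close>
lemma duhamel_rem_time_bound:
  assumes \<nu>: "3/2 < \<nu>" "\<nu> < 2" and C: "duhamel_constant m (2 * \<nu> - 2) C" and H: "time_constant (2 - \<nu>) H" and \<tau>: "0 \<le> \<tau>"
  shows "(\<integral>\<^sup>+\<xi>. (\<integral>\<^sup>+s. ennreal (\<rho> \<xi> powr m * \<bar>duhamel_rem i j \<tau> (s, \<xi>)\<bar>) * indicator {0..<\<tau>} s \<partial>lborel)\<^sup>2 \<partial>lborel)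
     \<le> ennreal (((sqrt C * B\<^sup>2) * (H * exp (- \<nu> * \<tau>)))\<^sup>2)"
proof -
  define h where "h s = exp (- \<nu> * (\<tau> - s)) * (1 - exp (- (\<tau> - s))) powr (-(7/8)) * exp (- 2 * s)" for s
  define E where "E p = indicator ({0..<\<tau>} \<times> UNIV) p *\<^sub>R duhamel_rem i j \<tau> p" for p
  have C0: "0 \<le> C" using C by (simp add: duhamel_constant_def)
  have "E \<in> borel_measurable borel" unfolding E_def
    by (intro borel_measurable_continuous_on_indicator duhamel_rem_continuous)
      (simp add: borel_prod[symmetric] pair_measureI)
  then have Em: "E \<in> borel_measurable (lborel \<Otimes>\<^sub>M lborel)" by (simp add: lborel_prod)
  have "(\<integral>\<^sup>+\<xi>. (\<integral>\<^sup>+s. ennreal (\<rho> \<xi> powr m * \<bar>E (s, \<xi>)\<bar>) * indicator {0..<\<tau>} s \<partial>lborel)\<^sup>2 \<partial>lborel)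
     \<le> ennreal (((sqrt C * B\<^sup>2) * (H * exp (- \<nu> * \<tau>)))\<^sup>2)"
  proof (rule minkowski_time[OF Em, where h = h])
    show "h \<in> borel_measurable borel" unfolding h_def[abs_def] by measurable
    show "0 < h s" if "s \<in> {0..<\<tau>}" for s using that by (simp add: h_def)
    show "(\<integral>\<^sup>+\<xi>. ennreal ((\<rho> \<xi> powr m * \<bar>E (s, \<xi>)\<bar>)\<^sup>2) \<partial>lborel) \<le> ennreal ((sqrt C * B\<^sup>2 * h s)\<^sup>2)" if s: "s \<in> {0..<\<tau>}" for s
    proof -
      define \<epsilon> where "\<epsilon> = exp (- (\<tau> - s) / 2)"
      have s': "0 \<le> s" "s < \<tau>" using s by auto
      have e: "0 < \<epsilon>" "\<epsilon> < 1" using s' by (auto simp: \<epsilon>_def)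
      note [measurable] = w_measurable[OF s'(1)]
      let ?L = "\<lambda>\<xi>. LINT \<eta>|lborel. dheat_rem j \<epsilon> \<xi> \<eta> * flux i j (w s) \<eta>"
      have Lm [measurable]: "?L \<in> borel_measurable borel"
        unfolding dheat_rem_def by measurable
      have "(\<integral>\<^sup>+\<xi>. ennreal ((\<rho> \<xi> powr m * \<bar>E (s, \<xi>)\<bar>)\<^sup>2) \<partial>lborel)
         = (\<integral>\<^sup>+\<xi>. ennreal (\<epsilon> ^ 4) * ennreal ((\<rho> \<xi> powr m * \<bar>?L \<xi>\<bar>)\<^sup>2) \<partial>lborel)"
      proof (intro nn_integral_cong)
        fix \<xi>
        have "E (s, \<xi>) = \<epsilon>\<^sup>2 * ?L \<xi>" using s by (simp add: E_def duhamel_rem_def \<epsilon>_def)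
        then have "(\<rho> \<xi> powr m * \<bar>E (s, \<xi>)\<bar>)\<^sup>2 = \<epsilon> ^ 4 * (\<rho> \<xi> powr m * \<bar>?L \<xi>\<bar>)\<^sup>2"
          by (simp add: abs_mult power2_eq_square power4_eq_xxxx)
        then show "ennreal ((\<rho> \<xi> powr m * \<bar>E (s, \<xi>)\<bar>)\<^sup>2) = ennreal (\<epsilon> ^ 4) * ennreal ((\<rho> \<xi> powr m * \<bar>?L \<xi>\<bar>)\<^sup>2)"
          using e by (simp add: ennreal_mult)
      qed
      also have "\<dots> = ennreal (\<epsilon> ^ 4) * (\<integral>\<^sup>+\<xi>. ennreal ((\<rho> \<xi> powr m * \<bar>?L \<xi>\<bar>)\<^sup>2) \<partial>lborel)"
        by (rule nn_integral_cmult) measurable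
      also have "\<dots> \<le> ennreal (\<epsilon> ^ 4) * (ennreal (C * \<epsilon> powr (2 * (2 * \<nu> - 2)) * (1 - \<epsilon>\<^sup>2) powr (-(7/4))) * (wnorm_sq m (w s))\<^sup>2)"
        using C e flux_le w_measurable[OF s'(1)] measurable_flux[OF w_measurable[OF s'(1)]]
        unfolding duhamel_constant_def by (intro mult_left_mono) auto
      also have "\<dots> \<le> ennreal (\<epsilon> ^ 4) * (ennreal (C * \<epsilon> powr (2 * (2 * \<nu> - 2)) * (1 - \<epsilon>\<^sup>2) powr (-(7/4))) * (ennreal ((B * exp (- s))\<^sup>2))\<^sup>2)"
        unfolding L2w_wnorm_sq(2)[OF L2w[OF s'(1)]] using decay[OF s'(1)]
        by (intro mult_left_mono power_mono ennreal_leI) (auto simp: wnorm_nonneg)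
      also have "\<dots> = ennreal (\<epsilon> ^ 4 * ((C * \<epsilon> powr (2 * (2 * \<nu> - 2)) * (1 - \<epsilon>\<^sup>2) powr (-(7/4))) * ((B * exp (- s))\<^sup>2)\<^sup>2))"
        using e C0 by (simp add: ennreal_mult ennreal_power)
      also have "\<epsilon> ^ 4 * ((C * \<epsilon> powr (2 * (2 * \<nu> - 2)) * (1 - \<epsilon>\<^sup>2) powr (-(7/4))) * ((B * exp (- s))\<^sup>2)\<^sup>2) = (sqrt C * B\<^sup>2 * h s)\<^sup>2"
      proof -
        have a: "0 < 1 - \<epsilon>\<^sup>2" using one_minus_sq_bounds[OF e] by simp
        have e2: "\<epsilon>\<^sup>2 = exp (- (\<tau> - s))" by (simp add: \<epsilon>_def power2_eq_square flip: exp_add)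
        \<comment> \<open>the prefactor \<open>\<epsilon>\<^sup>2\<close> of the integrand, squared, against the expansion bound with \<open>p = 2 * \<nu> - 2\<close>\<close>
        have "\<epsilon> ^ 4 * \<epsilon> powr (2 * (2 * \<nu> - 2)) = \<epsilon> powr 4 * \<epsilon> powr (2 * (2 * \<nu> - 2))" using e by simp
        also have "\<dots> = \<epsilon> powr (4 * \<nu>)" unfolding powr_add[symmetric] by (simp add: algebra_simps)
        also have "\<dots> = (exp (- \<nu> * (\<tau> - s)))\<^sup>2"
          unfolding \<epsilon>_def powr_def by (simp add: power2_eq_square field_simps flip: exp_add)
        finally have p1: "\<epsilon> ^ 4 * \<epsilon> powr (2 * (2 * \<nu> - 2)) = (exp (- \<nu> * (\<tau> - s)))\<^sup>2" .
        have p2: "(1 - \<epsilon>\<^sup>2) powr (-(7/4)) = ((1 - exp (- (\<tau> - s))) powr (-(7/8)))\<^sup>2"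
          unfolding e2 by (simp add: power2_eq_square flip: powr_add)
        have p3: "((B * exp (- s))\<^sup>2)\<^sup>2 = (B\<^sup>2)\<^sup>2 * (exp (- 2 * s))\<^sup>2"
          by (simp add: power2_eq_square mult_ac flip: exp_add)
        have "\<epsilon> ^ 4 * ((C * \<epsilon> powr (2 * (2 * \<nu> - 2)) * (1 - \<epsilon>\<^sup>2) powr (-(7/4))) * ((B * exp (- s))\<^sup>2)\<^sup>2)
          = C * (\<epsilon> ^ 4 * \<epsilon> powr (2 * (2 * \<nu> - 2))) * (1 - \<epsilon>\<^sup>2) powr (-(7/4)) * ((B * exp (- s))\<^sup>2)\<^sup>2"
          by (simp only: mult_ac)
        also have "\<dots> = (sqrt C)\<^sup>2 * (exp (- \<nu> * (\<tau> - s)))\<^sup>2 * ((1 - exp (- (\<tau> - s))) powr (-(7/8)))\<^sup>2 * ((B\<^sup>2)\<^sup>2 * (exp (- 2 * s))\<^sup>2)"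
          unfolding p1 p2 p3 using C0 by simp
        also have "\<dots> = (sqrt C * B\<^sup>2 * h s)\<^sup>2" unfolding h_def power_mult_distrib by (simp only: mult_ac)
        finally show ?thesis .
      qed
      finally show ?thesis .
    qed
    have heq: "h s = exp (- \<nu> * \<tau>) * (exp (- (2 - \<nu>) * s) * (1 - exp (- (\<tau> - s))) powr (-(7/8)))" for s
    proof -
      have "exp (- \<nu> * (\<tau> - s)) * exp (- 2 * s) = exp (- \<nu> * \<tau>) * exp (- (2 - \<nu>) * s)"
        unfolding exp_add[symmetric] by (simp add: algebra_simps)
      moreover have "h s = (exp (- \<nu> * (\<tau> - s)) * exp (- 2 * s)) * (1 - exp (- (\<tau> - s))) powr (-(7/8))"
        unfolding h_def by (simp only: mult_ac)
      ultimately show ?thesis by (simp only: mult.assoc)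
    qed
    have "(\<integral>\<^sup>+s. ennreal (h s) * indicator {0..<\<tau>} s \<partial>lborel)
      = (\<integral>\<^sup>+s. ennreal (exp (- \<nu> * \<tau>)) * (ennreal (exp (- (2 - \<nu>) * s) * (1 - exp (- (\<tau> - s))) powr (-(7/8))) * indicator {0..<\<tau>} s) \<partial>lborel)"
      unfolding heq by (intro nn_integral_cong) (simp only: ennreal_mult'[OF exp_ge_zero] mult.assoc)
    also have "\<dots> = ennreal (exp (- \<nu> * \<tau>)) * (\<integral>\<^sup>+s. ennreal (exp (- (2 - \<nu>) * s) * (1 - exp (- (\<tau> - s))) powr (-(7/8))) * indicator {0..<\<tau>} s \<partial>lborel)"
      by (rule nn_integral_cmult) measurable
    also have "\<dots> \<le> ennreal (exp (- \<nu> * \<tau>)) * ennreal H"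
      using H unfolding time_constant_def by (intro mult_left_mono) auto
    also have "\<dots> = ennreal (H * exp (- \<nu> * \<tau>))" by (subst mult.commute[of H], rule ennreal_mult'[symmetric]) simp
    finally show "(\<integral>\<^sup>+s. ennreal (h s) * indicator {0..<\<tau>} s \<partial>lborel) \<le> ennreal (H * exp (- \<nu> * \<tau>))" .
    show "0 \<le> H * exp (- \<nu> * \<tau>)" using H by (simp add: time_constant_def)
    show "0 \<le> sqrt C * B\<^sup>2" using C0 by simp
  qed simp
  moreover have "ennreal (\<rho> \<xi> powr m * \<bar>E (s, \<xi>)\<bar>) * indicator {0..<\<tau>} s = ennreal (\<rho> \<xi> powr m * \<bar>duhamel_rem i j \<tau> (s, \<xi>)\<bar>) * indicator {0..<\<tau>} s" for s \<xi>
    by (simp add: E_def indicator_def)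
  ultimately show ?thesis by simp
qed

lemma duhamel_rem_time_measurable:
  "(\<lambda>\<xi>. \<integral>\<^sup>+s. ennreal (\<rho> \<xi> powr m * \<bar>duhamel_rem i j \<tau> (s, \<xi>)\<bar>) * indicator {0..<\<tau>} s \<partial>lborel) \<in> borel_measurable borel"
proof -
  define E where "E p = indicator ({0..<\<tau>} \<times> UNIV) p *\<^sub>R duhamel_rem i j \<tau> p" for p
  have "E \<in> borel_measurable borel" unfolding E_def
    by (intro borel_measurable_continuous_on_indicator duhamel_rem_continuous)
      (simp add: borel_prod[symmetric] pair_measureI)
  then have Em [measurable]: "E \<in> borel_measurable (lborel \<Otimes>\<^sub>M lborel)" by (simp add: lborel_prod)
  have "(\<lambda>\<xi>. \<integral>\<^sup>+s. ennreal (\<rho> \<xi> powr m * \<bar>E (s, \<xi>)\<bar>) * indicator {0..<\<tau>} s \<partial>lborel) \<in> borel_measurable borel"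
    by measurable
  moreover have "ennreal (\<rho> \<xi> powr m * \<bar>E (s, \<xi>)\<bar>) * indicator {0..<\<tau>} s = ennreal (\<rho> \<xi> powr m * \<bar>duhamel_rem i j \<tau> (s, \<xi>)\<bar>) * indicator {0..<\<tau>} s" for s \<xi>
    by (simp add: E_def indicator_def)
  ultimately show ?thesis by simp
qed

text \<open>Integration of the pointwise decomposition.  It fails at \<open>s = \<tau>\<close>, where the semigroup is the identity and not a kernel, but that is a null set.\<close>
lemma duhamel_integral_remainder:
  assumes i: "set_integrable lborel {0..\<tau>} (duhamel w i j \<tau> \<xi>)" and \<tau>: "0 \<le> \<tau>"
  shows "ennreal \<bar>(LBINT s:{0..\<tau>}. duhamel w i j \<tau> \<xi> s)
      - (exp (- \<tau>) * dG j \<xi> * (LBINT s:{0..\<tau>}. exp s * flux_mass i j s)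
         - exp (- (3/2) * \<tau>) * (\<Sum>k\<in>UNIV. ddG j k \<xi> * (LBINT s:{0..\<tau>}. exp (3/2 * s) * flux_moment i j k s)))\<bar>
    \<le> (\<integral>\<^sup>+s. ennreal \<bar>duhamel_rem i j \<tau> (s, \<xi>)\<bar> * indicator {0..<\<tau>} s \<partial>lborel)"
proof -
  have c0: "continuous_on {0..\<tau>} (\<lambda>s. exp s * flux_mass i j s)"
    by (intro continuous_intros continuous_on_subset[OF flux_mass_continuous]) auto
  have c1: "continuous_on {0..\<tau>} (\<lambda>s. exp (3/2 * s) * flux_moment i j k s)" for k
    by (intro continuous_intros continuous_on_subset[OF flux_moment_continuous]) auto
  have i0: "set_integrable lborel {0..\<tau>} (\<lambda>s. exp s * flux_mass i j s)"
    by (rule borel_integrable_atLeastAtMost'[OF c0])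
  have i1: "set_integrable lborel {0..\<tau>} (\<lambda>s. exp (3/2 * s) * flux_moment i j k s)" for k
    by (rule borel_integrable_atLeastAtMost'[OF c1])
  have L: "(LBINT s:{0..\<tau>}. duhamel_lead i j \<tau> \<xi> s) = exp (- \<tau>) * dG j \<xi> * (LBINT s:{0..\<tau>}. exp s * flux_mass i j s)
         - exp (- (3/2) * \<tau>) * (\<Sum>k\<in>UNIV. ddG j k \<xi> * (LBINT s:{0..\<tau>}. exp (3/2 * s) * flux_moment i j k s))"
    and iL: "set_integrable lborel {0..\<tau>} (duhamel_lead i j \<tau> \<xi>)"
  proof -
    have e: "indicator {0..\<tau>} s *\<^sub>R duhamel_lead i j \<tau> \<xi> s
      = (exp (- \<tau>) * dG j \<xi>) * (indicator {0..\<tau>} s *\<^sub>R (exp s * flux_mass i j s))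
        - exp (- (3/2) * \<tau>) * (\<Sum>k\<in>UNIV. ddG j k \<xi> * (indicator {0..\<tau>} s *\<^sub>R (exp (3/2 * s) * flux_moment i j k s)))" for s
      by (cases "s \<in> {0..\<tau>}") (simp_all add: duhamel_lead_def)
    note ii = i0[unfolded set_integrable_def] i1[unfolded set_integrable_def]
    show "set_integrable lborel {0..\<tau>} (duhamel_lead i j \<tau> \<xi>)"
      unfolding set_integrable_def e
      by (intro Bochner_Integration.integrable_diff integrable_mult_right Bochner_Integration.integrable_sum ii)
    show "(LBINT s:{0..\<tau>}. duhamel_lead i j \<tau> \<xi> s) = exp (- \<tau>) * dG j \<xi> * (LBINT s:{0..\<tau>}. exp s * flux_mass i j s)
         - exp (- (3/2) * \<tau>) * (\<Sum>k\<in>UNIV. ddG j k \<xi> * (LBINT s:{0..\<tau>}. exp (3/2 * s) * flux_moment i j k s))"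
      unfolding set_lebesgue_integral_def e
      by (subst Bochner_Integration.integral_diff)
        (intro integrable_mult_right Bochner_Integration.integrable_sum ii,
         intro integrable_mult_right Bochner_Integration.integrable_sum ii,
         subst integral_mult_right_zero, subst integral_mult_right_zero,
         subst Bochner_Integration.integral_sum, intro integrable_mult_right ii, simp only: integral_mult_right_zero)
  qed
  have "ennreal \<bar>(LBINT s:{0..\<tau>}. duhamel w i j \<tau> \<xi> s) - (LBINT s:{0..\<tau>}. duhamel_lead i j \<tau> \<xi> s)\<bar>
     = ennreal (norm (LINT s|lborel. indicator {0..\<tau>} s *\<^sub>R (duhamel w i j \<tau> \<xi> s - duhamel_lead i j \<tau> \<xi> s)))"
    using set_integral_diff(2)[OF i iL] by (simp add: set_lebesgue_integral_def)
  also have "\<dots> \<le> (\<integral>\<^sup>+s. ennreal (norm (indicator {0..\<tau>} s *\<^sub>R (duhamel w i j \<tau> \<xi> s - duhamel_lead i j \<tau> \<xi> s))) \<partial>lborel)"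
    by (rule norm_integral_le_nn_integral)
  also have "\<dots> = (\<integral>\<^sup>+s. ennreal \<bar>duhamel_rem i j \<tau> (s, \<xi>)\<bar> * indicator {0..<\<tau>} s \<partial>lborel)"
  proof (rule nn_integral_cong_AE)
    have "AE s in lborel. s \<noteq> \<tau>" by (rule AE_lborel_singleton)
    then show "AE s in lborel. ennreal (norm (indicator {0..\<tau>} s *\<^sub>R (duhamel w i j \<tau> \<xi> s - duhamel_lead i j \<tau> \<xi> s)))
       = ennreal \<bar>duhamel_rem i j \<tau> (s, \<xi>)\<bar> * indicator {0..<\<tau>} s"
    proof eventually_elim
      case (elim s)
      show ?case
      proof (cases "s \<in> {0..<\<tau>}")
        case True
        then show ?thesis using duhamel_decomposition[of s \<tau> i j \<xi>] by simp
      next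
        case False
        then have "s \<notin> {0..\<tau>}" using elim by auto
        then show ?thesis using False by simp
      qed
    qed
  qed
  finally show ?thesis unfolding L .
qed

end

section \<open>Expansion of the linear flow\<close>

definition moment2_constant :: "real \<Rightarrow> real \<Rightarrow> bool"
  where "moment2_constant m C \<longleftrightarrow> 0 \<le> C \<and>
    (\<forall>f \<in> borel_measurable borel. \<forall>a\<ge>0. wnorm_sq m f \<le> ennreal (a\<^sup>2) \<longrightarrow>
      (\<integral>\<^sup>+\<eta>. ennreal (\<rho> \<eta> ^ 2 * norm (f \<eta> :: real^3)) \<partial>lborel) \<le> ennreal (C * a))"

definition linear_constant :: "real \<Rightarrow> real \<Rightarrow> real \<Rightarrow> bool"
  where "linear_constant m p C \<longleftrightarrow> 0 \<le> C \<and>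
    (\<forall>f \<in> borel_measurable borel. \<forall>\<epsilon>. 0 < \<epsilon> \<longrightarrow> \<epsilon> < 1 \<longrightarrow>
      (\<integral>\<^sup>+\<xi>. ennreal ((\<rho> \<xi> powr m * \<bar>LINT \<eta>|lborel. heat_rem \<epsilon> \<xi> \<eta> * (f \<eta> :: real)\<bar>)\<^sup>2) \<partial>lborel)
        \<le> ennreal (C * \<epsilon> powr (2 * p)) * wnorm_sq m f)"

definition flux_constant :: "real \<Rightarrow> real \<Rightarrow> bool"
  where "flux_constant m C \<longleftrightarrow> 0 \<le> C \<and>
    (\<forall>f \<in> L2w m. \<forall>i j. (\<integral>\<^sup>+\<eta>. ennreal \<bar>\<rho> \<eta> * flux i j f \<eta>\<bar> \<partial>lborel) \<le> ennreal (C * (wnorm m f)\<^sup>2))"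

text \<open>A common majorant of all profiles.\<close>
definition profile :: "real^3 \<Rightarrow> real"
  where "profile \<xi> = (\<Sum>j\<in>UNIV. \<bar>dG j \<xi>\<bar>) + (\<Sum>j\<in>UNIV. \<Sum>k\<in>UNIV. \<bar>ddG j k \<xi>\<bar>)"

text \<open>Cauchy-Schwarz with the weight \<open>\<rho> powr (2 - m)\<close>, which is square integrable for \<open>m > 7/2\<close>.\<close>
lemma moment2_constant_exists:
  assumes m: "7/2 < m" shows "\<exists>C. moment2_constant m C"
proof -
  have mp: "3 < 2 * (m - 2)" using m by simp
  obtain C1 where C1: "C1 \<ge> 0" "(\<integral>\<^sup>+x. ennreal (\<rho> x powr (-(2 * (m - 2)))) \<partial>lborel) \<le> ennreal C1"
    using nn_integral_bound_real[OF rho_integral_finite[OF mp]] by blast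
  have "(\<integral>\<^sup>+\<eta>. ennreal (\<rho> \<eta> ^ 2 * norm (f \<eta>)) \<partial>lborel) \<le> ennreal (sqrt C1 * a)"
    if [measurable]: "f \<in> borel_measurable borel" and a: "0 \<le> a" and le: "wnorm_sq m f \<le> ennreal (a\<^sup>2)" for f :: "real^3 \<Rightarrow> real^3" and a
  proof -
    let ?X = "\<integral>\<^sup>+\<eta>. ennreal (\<rho> \<eta> ^ 2 * norm (f \<eta>)) \<partial>lborel"
    have eq: "ennreal (\<rho> \<eta> ^ 2 * norm (f \<eta>)) = ennreal (\<rho> \<eta> powr (-(m - 2))) * ennreal (\<rho> \<eta> powr m * norm (f \<eta>))" for \<eta>
    proof -
      have "\<rho> \<eta> powr (-(m - 2)) * \<rho> \<eta> powr m = \<rho> \<eta> powr 2" unfolding powr_add[symmetric] by simp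
      then have "\<rho> \<eta> ^ 2 = \<rho> \<eta> powr (-(m - 2)) * \<rho> \<eta> powr m" using rho_pos[of \<eta>] by simp
      then show ?thesis by (subst ennreal_mult[symmetric]) (auto simp: mult_ac)
    qed
    have "?X\<^sup>2 \<le> (\<integral>\<^sup>+\<eta>. (ennreal (\<rho> \<eta> powr (-(m - 2))))\<^sup>2 \<partial>lborel) * (\<integral>\<^sup>+\<eta>. (ennreal (\<rho> \<eta> powr m * norm (f \<eta>)))\<^sup>2 \<partial>lborel)"
      unfolding eq by (rule Cauchy_Schwarz_nn_integral) measurable
    also have "(\<integral>\<^sup>+\<eta>. (ennreal (\<rho> \<eta> powr m * norm (f \<eta>)))\<^sup>2 \<partial>lborel) = wnorm_sq m f"
      unfolding wnorm_sq_def by (intro nn_integral_cong ennreal_power) simp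
    also have "(\<integral>\<^sup>+\<eta>. (ennreal (\<rho> \<eta> powr (-(m - 2))))\<^sup>2 \<partial>lborel) = (\<integral>\<^sup>+\<eta>. ennreal (\<rho> \<eta> powr (-(2 * (m - 2)))) \<partial>lborel)"
      by (intro nn_integral_cong, subst ennreal_power, simp) (simp add: power2_eq_square flip: powr_add)
    also have "\<dots> * wnorm_sq m f \<le> ennreal C1 * ennreal (a\<^sup>2)" using C1 le by (intro mult_mono) auto
    also have "\<dots> = ennreal ((sqrt C1 * a)\<^sup>2)" using C1 by (simp add: ennreal_mult power_mult_distrib)
    finally show ?thesis by (rule ennreal_le_of_square_le) (use C1 a in auto)
  qed
  then show ?thesis unfolding moment2_constant_def using C1(1) by (intro exI[of _ "sqrt C1"]) auto
qed

lemma measurable_profile [measurable]: "profile \<in> borel_measurable borel"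
  unfolding profile_def[abs_def] by measurable

lemma profile_nonneg: "0 \<le> profile \<xi>"
  unfolding profile_def by (intro add_nonneg_nonneg sum_nonneg) auto

lemma profile_wnorm_sq_finite:
  assumes m: "0 \<le> m" shows "\<exists>K\<ge>0. wnorm_sq m profile \<le> ennreal (K\<^sup>2)"
proof -
  obtain J where J: "J \<ge> 0" "(\<integral>\<^sup>+x. ennreal (gauss_env 1 x) \<partial>lborel) \<le> ennreal J"
    using nn_integral_bound_real[OF gauss_env_integral_finite] by blast
  define c where "c = 12 * exp (4 * (m + 4)\<^sup>2)"
  have c0: "0 \<le> c" by (simp add: c_def)
  have pt: "\<rho> \<xi> powr m * profile \<xi> \<le> c * gauss_env 1 \<xi>" for \<xi>
  proof -
    define E where "E = \<rho> \<xi> ^ 4 * exp (- (norm \<xi>)\<^sup>2 / 8)"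
    have r: "1 \<le> \<rho> \<xi>" by (rule rho_ge_1)
    have G1: "0 \<le> G \<xi>" "G \<xi> \<le> exp (- (norm \<xi>)\<^sup>2 / 8)"
      using G_nonneg[of \<xi>] order_trans[OF G_le[of \<xi>], of "exp (- (norm \<xi>)\<^sup>2 / 8)"] by auto
    have r4: "\<rho> \<xi> \<le> \<rho> \<xi> ^ 4" "\<rho> \<xi> ^ 2 \<le> \<rho> \<xi> ^ 4" "1 \<le> \<rho> \<xi> ^ 4" "0 \<le> \<rho> \<xi> ^ 4"
      using self_le_power[OF r, of 4] power_increasing[OF _ r, of 2 4] one_le_power[OF r, of 4] by auto
    have d: "\<bar>dG j \<xi>\<bar> \<le> E" for j
    proof -
      have "\<bar>- (\<xi> $ j / 2)\<bar> \<le> \<rho> \<xi> ^ 4" using component_le_rho[of \<xi> j] r4(1) by simp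
      then show ?thesis unfolding dG_def E_def abs_mult using G1 r4 by (intro mult_mono) auto
    qed
    have dd: "\<bar>ddG j k \<xi>\<bar> \<le> E" for j k
    proof -
      have "\<bar>\<xi> $ j * \<xi> $ k\<bar> \<le> \<rho> \<xi> ^ 2"
        unfolding abs_mult power2_eq_square using r by (intro mult_mono component_le_rho) auto
      moreover have gen: "\<bar>x / 4 - c\<bar> \<le> \<bar>x\<bar> / 4 + 1 / 2" if "0 \<le> c" "c \<le> 1/2" for x c :: real
        using that by linarith
      have "\<bar>\<xi> $ j * \<xi> $ k / 4 - (if j = k then 1/2 else 0)\<bar> \<le> \<bar>\<xi> $ j * \<xi> $ k\<bar> / 4 + 1 / 2"
        by (rule gen) auto
      ultimately have "\<bar>\<xi> $ j * \<xi> $ k / 4 - (if j = k then 1/2 else 0)\<bar> \<le> \<rho> \<xi> ^ 4"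
        using r4 by linarith
      then show ?thesis unfolding ddG_def E_def abs_mult using G1 r4 by (intro mult_mono) auto
    qed
    have "profile \<xi> \<le> 12 * E"
      unfolding profile_def using d[of 1] d[of 2] d[of 3] dd[of 1 1] dd[of 1 2] dd[of 1 3]
        dd[of 2 1] dd[of 2 2] dd[of 2 3] dd[of 3 1] dd[of 3 2] dd[of 3 3] by (simp add: sum_3)
    then have "\<rho> \<xi> powr m * profile \<xi> \<le> \<rho> \<xi> powr m * (12 * E)" by (intro mult_left_mono) auto
    also have "\<dots> = 12 * (\<rho> \<xi> powr m * E)" by simp
    also have "\<dots> \<le> 12 * (exp (4 * (m + 4)\<^sup>2) * exp (- (norm \<xi>)\<^sup>2 / 16))"
      unfolding E_def by (intro mult_left_mono kernel_near_weight m) auto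
    finally show ?thesis by (simp add: c_def gauss_env_def)
  qed
  have "wnorm_sq m profile \<le> (\<integral>\<^sup>+\<xi>. ennreal (c\<^sup>2) * ennreal (gauss_env 1 \<xi>) \<partial>lborel)"
    unfolding wnorm_sq_def
  proof (intro nn_integral_mono)
    fix \<xi>
    have g: "(gauss_env 1 \<xi>)\<^sup>2 \<le> gauss_env 1 \<xi>" using gauss_env_nonneg[of 1 \<xi>] by (simp add: power2_eq_square mult_left_le gauss_env_def)
    have "(\<rho> \<xi> powr m * norm (profile \<xi>))\<^sup>2 \<le> (c * gauss_env 1 \<xi>)\<^sup>2"
      using pt[of \<xi>] profile_nonneg[of \<xi>] by (intro power_mono) auto
    also have "\<dots> \<le> c\<^sup>2 * gauss_env 1 \<xi>" unfolding power_mult_distrib using g by (intro mult_left_mono) auto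
    finally have "ennreal ((\<rho> \<xi> powr m * norm (profile \<xi>))\<^sup>2) \<le> ennreal (c\<^sup>2 * gauss_env 1 \<xi>)" by (rule ennreal_leI)
    also have "\<dots> = ennreal (c\<^sup>2) * ennreal (gauss_env 1 \<xi>)" by (rule ennreal_mult) (auto simp: gauss_env_nonneg)
    finally show "ennreal ((\<rho> \<xi> powr m * norm (profile \<xi>))\<^sup>2) \<le> ennreal (c\<^sup>2) * ennreal (gauss_env 1 \<xi>)" .
  qed
  also have "\<dots> = ennreal (c\<^sup>2) * (\<integral>\<^sup>+\<xi>. ennreal (gauss_env 1 \<xi>) \<partial>lborel)" by (rule nn_integral_cmult) measurable
  also have "\<dots> \<le> ennreal (c\<^sup>2) * ennreal J" by (intro mult_left_mono J) auto
  also have "\<dots> = ennreal ((c * sqrt J)\<^sup>2)" using J by (simp add: ennreal_mult[symmetric] power_mult_distrib)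
  finally show ?thesis using c0 J by (intro exI[of _ "c * sqrt J"]) auto
qed

definition first_moment :: "(real^3 \<Rightarrow> real^3) \<Rightarrow> 3 \<Rightarrow> 3 \<Rightarrow> real"
  where "first_moment u i j = (LINT \<eta>|lborel. \<eta> $ j * u \<eta> $ i)"

definition second_moment :: "(real^3 \<Rightarrow> real^3) \<Rightarrow> 3 \<Rightarrow> 3 \<Rightarrow> 3 \<Rightarrow> real"
  where "second_moment u i j k = (LINT \<eta>|lborel. \<eta> $ j * \<eta> $ k * u \<eta> $ i)"

definition linear_rem :: "(real^3 \<Rightarrow> real^3) \<Rightarrow> 3 \<Rightarrow> real \<Rightarrow> real^3 \<Rightarrow> real"
  where "linear_rem u i \<tau> \<xi> = exp_Lambda \<tau> (\<lambda>\<eta>. u \<eta> $ i) \<xi> + exp (- \<tau>) * (\<Sum>j\<in>UNIV. first_moment u i j * dG j \<xi>)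
     - exp (- (3/2) * \<tau>) * (\<Sum>j\<in>UNIV. \<Sum>k\<in>UNIV. second_moment u i j k / 2 * ddG j k \<xi>)"

lemma init_integrable:
  assumes C: "moment2_constant m C" and u: "u \<in> L2w m"
  shows "integrable lborel (\<lambda>\<eta>. \<rho> \<eta> ^ 2 * norm (u \<eta> :: real^3))"
    and "(LINT \<eta>|lborel. \<rho> \<eta> ^ 2 * norm (u \<eta>)) \<le> C * wnorm m u"
proof -
  note [measurable] = L2w_wnorm_sq(1)[OF u]
  have le: "(\<integral>\<^sup>+\<eta>. ennreal (\<rho> \<eta> ^ 2 * norm (u \<eta>)) \<partial>lborel) \<le> ennreal (C * wnorm m u)"
    using C L2w_wnorm_sq[OF u] wnorm_nonneg[of m u] unfolding moment2_constant_def by auto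
  show i: "integrable lborel (\<lambda>\<eta>. \<rho> \<eta> ^ 2 * norm (u \<eta>))"
    by (intro integrableI_nonneg) (use le in \<open>auto intro: le_less_trans\<close>)
  have C0: "0 \<le> C * wnorm m u" using C by (simp add: moment2_constant_def wnorm_nonneg)
  show "(LINT \<eta>|lborel. \<rho> \<eta> ^ 2 * norm (u \<eta>)) \<le> C * wnorm m u"
  proof -
    have "(\<integral>\<^sup>+\<eta>. ennreal (\<rho> \<eta> ^ 2 * norm (u \<eta>)) \<partial>lborel) = ennreal (LINT \<eta>|lborel. \<rho> \<eta> ^ 2 * norm (u \<eta>))"
      by (rule nn_integral_eq_integral[OF i]) simp
    then show ?thesis using le C0 by simp
  qed
qed

lemma init_weighted_integrable:
  fixes u :: "real^3 \<Rightarrow> real^3"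
  assumes C: "moment2_constant m C" and u: "u \<in> L2w m"
    and [measurable]: "k \<in> borel_measurable borel" and k: "\<And>\<eta>. \<bar>k \<eta>\<bar> \<le> \<rho> \<eta> ^ 2"
  shows "integrable lborel (\<lambda>\<eta>. k \<eta> * u \<eta> $ i)" "\<bar>LINT \<eta>|lborel. k \<eta> * u \<eta> $ i\<bar> \<le> C * wnorm m u"
proof -
  note [measurable] = L2w_wnorm_sq(1)[OF u]
  have b: "norm (k \<eta> * u \<eta> $ i) \<le> \<rho> \<eta> ^ 2 * norm (u \<eta>)" for \<eta>
    unfolding real_norm_def abs_mult by (intro mult_mono k component_le_norm_cart) auto
  show i: "integrable lborel (\<lambda>\<eta>. k \<eta> * u \<eta> $ i)"
    by (rule Bochner_Integration.integrable_bound[OF init_integrable(1)[OF C u]]) (use b in auto)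
  have "norm (LINT \<eta>|lborel. k \<eta> * u \<eta> $ i) \<le> (LINT \<eta>|lborel. \<rho> \<eta> ^ 2 * norm (u \<eta>))"
    by (rule Bochner_Integration.integral_norm_bound_integral[OF i init_integrable(1)[OF C u] b])
  then show "\<bar>LINT \<eta>|lborel. k \<eta> * u \<eta> $ i\<bar> \<le> C * wnorm m u" using init_integrable(2)[OF C u] by simp
qed

lemma one_le_rho_sq: "\<bar>1::real\<bar> \<le> \<rho> \<eta> ^ 2" using one_le_power[OF rho_ge_1, of \<eta> 2] by simp
lemma comp_le_rho_sq: "\<bar>\<eta> $ j\<bar> \<le> \<rho> \<eta> ^ 2"
  using component_le_rho[of \<eta> j] self_le_power[OF rho_ge_1, of 2 \<eta>] by linarith
lemma comp2_le_rho_sq: "\<bar>\<eta> $ j * \<eta> $ k\<bar> \<le> \<rho> \<eta> ^ 2"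
  unfolding abs_mult power2_eq_square using rho_pos[of \<eta>] by (intro mult_mono component_le_rho) auto

text \<open>The vanishing mass is used here: it removes the zeroth-order term of the expansion.\<close>
lemma linear_rem_kernel:
  fixes u :: "real^3 \<Rightarrow> real^3"
  assumes C: "moment2_constant m C" and u: "u \<in> L2w m" and z: "(LINT \<eta>|lborel. u \<eta> $ i) = 0" and t: "0 < \<tau>"
  shows "linear_rem u i \<tau> \<xi> = exp (- \<tau> / 2) * (LINT \<eta>|lborel. heat_rem (exp (- \<tau> / 2)) \<xi> \<eta> * u \<eta> $ i)"
proof -
  note [measurable] = L2w_wnorm_sq(1)[OF u]
  define \<epsilon> where "\<epsilon> = exp (- \<tau> / 2)"
  have e: "0 < \<epsilon>" "\<epsilon> < 1" using t by (auto simp: \<epsilon>_def)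
  have a: "0 < 1 - \<epsilon>\<^sup>2" using one_minus_sq_bounds[OF e] by simp
  have e2: "exp (- \<tau>) = \<epsilon>\<^sup>2" by (simp add: \<epsilon>_def power2_eq_square flip: exp_add)
  have e3: "exp (- (3/2) * \<tau>) = \<epsilon> * \<epsilon>\<^sup>2" by (simp add: \<epsilon>_def power2_eq_square field_simps flip: exp_add)
  let ?f = "\<lambda>\<eta>. u \<eta> $ i"
  have i0: "integrable lborel ?f" using init_weighted_integrable(1)[OF C u, of "\<lambda>_. 1"] one_le_rho_sq by simp
  have i1: "integrable lborel (\<lambda>\<eta>. heat (1 - \<epsilon>\<^sup>2) (\<xi> - \<epsilon> *\<^sub>R \<eta>) * ?f \<eta>)"
    by (rule bounded_mult_integrable[OF i0 _ heat_bounded[OF a]]) measurable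
  have i2: "integrable lborel (\<lambda>\<eta>. heat (max (1 - \<epsilon>\<^sup>2) (1/2)) \<xi> * ?f \<eta>)" using i0 by simp
  have i3: "integrable lborel (\<lambda>\<eta>. \<eta> $ k * ?f \<eta>)" for k
    by (rule init_weighted_integrable(1)[OF C u]) (auto intro: comp_le_rho_sq)
  have i4: "integrable lborel (\<lambda>\<eta>. \<eta> $ k * \<eta> $ l * ?f \<eta>)" for k l
    by (rule init_weighted_integrable(1)[OF C u]) (auto intro: comp2_le_rho_sq simp flip: abs_mult)
  have i5: "integrable lborel (\<lambda>\<eta>. \<epsilon> * (\<Sum>k\<in>UNIV. dG k \<xi> * (\<eta> $ k * ?f \<eta>)))"
    using i3 by auto
  have i6: "integrable lborel (\<lambda>\<eta>. \<epsilon>\<^sup>2 / 2 * (\<Sum>k\<in>UNIV. \<Sum>l\<in>UNIV. ddG k l \<xi> * (\<eta> $ k * \<eta> $ l * ?f \<eta>)))"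
    using i4 by (intro integrable_mult_right Bochner_Integration.integrable_sum)
  have "(LINT \<eta>|lborel. heat_rem \<epsilon> \<xi> \<eta> * ?f \<eta>)
    = (LINT \<eta>|lborel. (heat (1 - \<epsilon>\<^sup>2) (\<xi> - \<epsilon> *\<^sub>R \<eta>) * ?f \<eta> - heat (max (1 - \<epsilon>\<^sup>2) (1/2)) \<xi> * ?f \<eta>)
        + \<epsilon> * (\<Sum>k\<in>UNIV. dG k \<xi> * (\<eta> $ k * ?f \<eta>))
        - \<epsilon>\<^sup>2 / 2 * (\<Sum>k\<in>UNIV. \<Sum>l\<in>UNIV. ddG k l \<xi> * (\<eta> $ k * \<eta> $ l * ?f \<eta>)))"
    by (intro Bochner_Integration.integral_cong refl) (simp add: heat_rem_def sum_3 algebra_simps)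
  also have "\<dots> = (LINT \<eta>|lborel. heat (1 - \<epsilon>\<^sup>2) (\<xi> - \<epsilon> *\<^sub>R \<eta>) * ?f \<eta>) - (LINT \<eta>|lborel. heat (max (1 - \<epsilon>\<^sup>2) (1/2)) \<xi> * ?f \<eta>)
        + (LINT \<eta>|lborel. \<epsilon> * (\<Sum>k\<in>UNIV. dG k \<xi> * (\<eta> $ k * ?f \<eta>)))
        - (LINT \<eta>|lborel. \<epsilon>\<^sup>2 / 2 * (\<Sum>k\<in>UNIV. \<Sum>l\<in>UNIV. ddG k l \<xi> * (\<eta> $ k * \<eta> $ l * ?f \<eta>)))"
    using i1 i2 i5 i6 by (simp only: Bochner_Integration.integral_diff Bochner_Integration.integral_add
      Bochner_Integration.integrable_diff Bochner_Integration.integrable_add)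
  also have "(LINT \<eta>|lborel. heat (max (1 - \<epsilon>\<^sup>2) (1/2)) \<xi> * ?f \<eta>) = 0" using z by simp
  also have "(LINT \<eta>|lborel. \<epsilon> * (\<Sum>k\<in>UNIV. dG k \<xi> * (\<eta> $ k * ?f \<eta>))) = \<epsilon> * (\<Sum>k\<in>UNIV. first_moment u i k * dG k \<xi>)"
    using i3 by (simp add: first_moment_def mult.commute)
  also have "(LINT \<eta>|lborel. \<epsilon>\<^sup>2 / 2 * (\<Sum>k\<in>UNIV. \<Sum>l\<in>UNIV. ddG k l \<xi> * (\<eta> $ k * \<eta> $ l * ?f \<eta>)))
     = \<epsilon>\<^sup>2 / 2 * (\<Sum>k\<in>UNIV. \<Sum>l\<in>UNIV. ddG k l \<xi> * second_moment u i k l)"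
    using i4 by (simp only: integral_mult_right_zero Bochner_Integration.integral_sum integrable_mult_right
      Bochner_Integration.integrable_sum second_moment_def)
  finally have K: "(LINT \<eta>|lborel. heat_rem \<epsilon> \<xi> \<eta> * ?f \<eta>) = (LINT \<eta>|lborel. heat (1 - \<epsilon>\<^sup>2) (\<xi> - \<epsilon> *\<^sub>R \<eta>) * ?f \<eta>)
     + \<epsilon> * (\<Sum>k\<in>UNIV. first_moment u i k * dG k \<xi>) - \<epsilon>\<^sup>2 / 2 * (\<Sum>k\<in>UNIV. \<Sum>l\<in>UNIV. ddG k l \<xi> * second_moment u i k l)" by simp
  have L: "exp_Lambda \<tau> ?f \<xi> = \<epsilon> * (LINT \<eta>|lborel. heat (1 - \<epsilon>\<^sup>2) (\<xi> - \<epsilon> *\<^sub>R \<eta>) * ?f \<eta>)"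
    unfolding \<epsilon>_def by (rule exp_Lambda_kernel[OF t]) measurable
  have S: "(\<Sum>j\<in>UNIV. \<Sum>k\<in>UNIV. second_moment u i j k / 2 * ddG j k \<xi>) = (\<Sum>k\<in>UNIV. \<Sum>l\<in>UNIV. ddG k l \<xi> * second_moment u i k l) / 2"
    by (simp add: sum_3 field_simps)
  show ?thesis
    unfolding linear_rem_def \<epsilon>_def[symmetric] K L e2 e3 S by (simp add: algebra_simps power2_eq_square)
qed

text \<open>For \<open>\<tau> > 0\<close> the prefactor \<open>\<epsilon>\<close> and the expansion bound with \<open>p = 2 * \<nu> - 1\<close> combine to \<open>\<epsilon> powr (2 * \<nu>)\<close>.  At \<open>\<tau> = 0\<close> the semigroup is the
  identity and each of the subtracted terms is bounded separately.\<close>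
lemma linear_rem_bound:
  fixes u :: "real^3 \<Rightarrow> real^3"
  assumes C2: "moment2_constant m C2" and CL: "linear_constant m (2 * \<nu> - 1) CL"
    and K: "wnorm_sq m profile \<le> ennreal (K\<^sup>2)" "0 \<le> K"
    and u: "u \<in> L2w m" and z: "(LINT \<eta>|lborel. u \<eta> $ i) = 0" and t: "0 \<le> \<tau>"
  shows "(\<integral>\<^sup>+\<xi>. ennreal ((\<rho> \<xi> powr m * \<bar>linear_rem u i \<tau> \<xi>\<bar>)\<^sup>2) \<partial>lborel)
     \<le> ennreal ((sqrt (CL + 2 + 2 * C2\<^sup>2 * K\<^sup>2) * wnorm m u * exp (- \<nu> * \<tau>))\<^sup>2)"
proof -
  note [measurable] = L2w_wnorm_sq(1)[OF u]
  let ?f = "\<lambda>\<eta>. u \<eta> $ i"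
  define R where "R = wnorm m u"
  have R0: "0 \<le> R" by (simp add: R_def wnorm_nonneg)
  have C0: "0 \<le> CL" "0 \<le> C2" using CL C2 by (auto simp: linear_constant_def moment2_constant_def)
  have fle: "wnorm_sq m ?f \<le> ennreal (R\<^sup>2)"
  proof -
    have "wnorm_sq m ?f \<le> wnorm_sq m u" unfolding wnorm_sq_def
      using component_le_norm_cart by (intro nn_integral_mono ennreal_leI power_mono mult_left_mono) auto
    then show ?thesis using L2w_wnorm_sq(2)[OF u] by (simp add: R_def)
  qed
  define Q where "Q = CL + 2 + 2 * C2\<^sup>2 * K\<^sup>2"
  have Q: "CL \<le> Q" "2 + 2 * C2\<^sup>2 * K\<^sup>2 \<le> Q" "0 \<le> Q" using C0 by (auto simp: Q_def)
  have target: "(sqrt Q * R * exp (- \<nu> * \<tau>))\<^sup>2 = Q * R\<^sup>2 * (exp (- \<nu> * \<tau>))\<^sup>2" using Q by (simp add: power_mult_distrib)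
  have "(\<integral>\<^sup>+\<xi>. ennreal ((\<rho> \<xi> powr m * \<bar>linear_rem u i \<tau> \<xi>\<bar>)\<^sup>2) \<partial>lborel) \<le> ennreal ((sqrt Q * R * exp (- \<nu> * \<tau>))\<^sup>2)"
  proof (cases "\<tau> = 0")
    case False
    then have t0: "0 < \<tau>" using t by simp
    define \<epsilon> where "\<epsilon> = exp (- \<tau> / 2)"
    have e: "0 < \<epsilon>" "\<epsilon> < 1" using t0 by (auto simp: \<epsilon>_def)
    let ?L = "\<lambda>\<xi>. LINT \<eta>|lborel. heat_rem \<epsilon> \<xi> \<eta> * ?f \<eta>"
    have [measurable]: "?L \<in> borel_measurable borel" unfolding heat_rem_def by measurable
    have "(\<integral>\<^sup>+\<xi>. ennreal ((\<rho> \<xi> powr m * \<bar>linear_rem u i \<tau> \<xi>\<bar>)\<^sup>2) \<partial>lborel)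
      = (\<integral>\<^sup>+\<xi>. ennreal (\<epsilon>\<^sup>2) * ennreal ((\<rho> \<xi> powr m * \<bar>?L \<xi>\<bar>)\<^sup>2) \<partial>lborel)"
    proof (intro nn_integral_cong)
      fix \<xi>
      have "linear_rem u i \<tau> \<xi> = \<epsilon> * ?L \<xi>" unfolding \<epsilon>_def by (rule linear_rem_kernel[OF C2 u z t0])
      then have "(\<rho> \<xi> powr m * \<bar>linear_rem u i \<tau> \<xi>\<bar>)\<^sup>2 = \<epsilon>\<^sup>2 * (\<rho> \<xi> powr m * \<bar>?L \<xi>\<bar>)\<^sup>2"
        by (simp add: abs_mult power_mult_distrib)
      then show "ennreal ((\<rho> \<xi> powr m * \<bar>linear_rem u i \<tau> \<xi>\<bar>)\<^sup>2) = ennreal (\<epsilon>\<^sup>2) * ennreal ((\<rho> \<xi> powr m * \<bar>?L \<xi>\<bar>)\<^sup>2)"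
        by (simp add: ennreal_mult)
    qed
    also have "\<dots> = ennreal (\<epsilon>\<^sup>2) * (\<integral>\<^sup>+\<xi>. ennreal ((\<rho> \<xi> powr m * \<bar>?L \<xi>\<bar>)\<^sup>2) \<partial>lborel)"
      by (rule nn_integral_cmult) measurable
    also have "\<dots> \<le> ennreal (\<epsilon>\<^sup>2) * (ennreal (CL * \<epsilon> powr (2 * (2 * \<nu> - 1))) * wnorm_sq m ?f)"
    proof (intro mult_left_mono)
      have "?f \<in> borel_measurable borel" by measurable
      then show "(\<integral>\<^sup>+\<xi>. ennreal ((\<rho> \<xi> powr m * \<bar>?L \<xi>\<bar>)\<^sup>2) \<partial>lborel) \<le> ennreal (CL * \<epsilon> powr (2 * (2 * \<nu> - 1))) * wnorm_sq m ?f"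
        using CL[unfolded linear_constant_def, THEN conjunct2, THEN bspec, of ?f, THEN spec, of \<epsilon>] e by simp
    qed simp
    also have "\<dots> \<le> ennreal (\<epsilon>\<^sup>2) * (ennreal (CL * \<epsilon> powr (2 * (2 * \<nu> - 1))) * ennreal (R\<^sup>2))"
      by (intro mult_left_mono fle) auto
    also have "\<dots> = ennreal (\<epsilon>\<^sup>2 * (CL * \<epsilon> powr (2 * (2 * \<nu> - 1)) * R\<^sup>2))"
      using C0 by (simp add: ennreal_mult)
    also have "\<dots> \<le> ennreal ((sqrt Q * R * exp (- \<nu> * \<tau>))\<^sup>2)"
    proof (rule ennreal_leI)
      have "\<epsilon>\<^sup>2 * \<epsilon> powr (2 * (2 * \<nu> - 1)) = \<epsilon> powr 2 * \<epsilon> powr (2 * (2 * \<nu> - 1))" using e by simp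
      also have "\<dots> = \<epsilon> powr (4 * \<nu>)" unfolding powr_add[symmetric] by (simp add: algebra_simps)
      also have "\<dots> = (exp (- \<nu> * \<tau>))\<^sup>2"
        unfolding \<epsilon>_def powr_def by (simp add: power2_eq_square field_simps flip: exp_add)
      finally have p: "\<epsilon>\<^sup>2 * \<epsilon> powr (2 * (2 * \<nu> - 1)) = (exp (- \<nu> * \<tau>))\<^sup>2" .
      have "\<epsilon>\<^sup>2 * (CL * \<epsilon> powr (2 * (2 * \<nu> - 1)) * R\<^sup>2) = CL * R\<^sup>2 * (\<epsilon>\<^sup>2 * \<epsilon> powr (2 * (2 * \<nu> - 1)))"
        by (simp only: mult_ac)
      also have "\<dots> \<le> Q * R\<^sup>2 * (exp (- \<nu> * \<tau>))\<^sup>2" unfolding p using Q by (intro mult_right_mono) auto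
      finally show "\<epsilon>\<^sup>2 * (CL * \<epsilon> powr (2 * (2 * \<nu> - 1)) * R\<^sup>2) \<le> (sqrt Q * R * exp (- \<nu> * \<tau>))\<^sup>2" unfolding target .
    qed
    finally show ?thesis .
  next
    case True
    have m1: "\<bar>first_moment u i j\<bar> \<le> C2 * R" for j
      unfolding first_moment_def R_def by (rule init_weighted_integrable(2)[OF C2 u]) (auto intro: comp_le_rho_sq)
    have m2: "\<bar>second_moment u i j k / 2\<bar> \<le> C2 * R" for j k
    proof -
      have "\<bar>second_moment u i j k\<bar> \<le> C2 * R"
        unfolding second_moment_def R_def by (rule init_weighted_integrable(2)[OF C2 u]) (auto intro: comp2_le_rho_sq simp flip: abs_mult)
      then show ?thesis using C0 R0 mult_nonneg_nonneg[of C2 R] by simp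
    qed
    have pt: "\<bar>linear_rem u i \<tau> \<xi>\<bar> \<le> \<bar>u \<xi> $ i\<bar> + C2 * R * profile \<xi>" for \<xi>
    proof -
      have "\<bar>\<Sum>j\<in>UNIV. first_moment u i j * dG j \<xi>\<bar> \<le> (\<Sum>j\<in>UNIV. C2 * R * \<bar>dG j \<xi>\<bar>)"
        by (rule order_trans[OF sum_abs]) (auto simp: abs_mult intro!: sum_mono mult_right_mono m1)
      moreover have "\<bar>\<Sum>j\<in>UNIV. \<Sum>k\<in>UNIV. second_moment u i j k / 2 * ddG j k \<xi>\<bar> \<le> (\<Sum>j\<in>UNIV. \<Sum>k\<in>UNIV. C2 * R * \<bar>ddG j k \<xi>\<bar>)"
        unfolding abs_mult[symmetric]
        by (rule order_trans[OF sum_abs] sum_mono order_trans[OF sum_abs])+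
          (simp only: abs_mult, intro mult_right_mono m2, simp)
      ultimately have "\<bar>linear_rem u i \<tau> \<xi>\<bar> \<le> \<bar>u \<xi> $ i\<bar> + (\<Sum>j\<in>UNIV. C2 * R * \<bar>dG j \<xi>\<bar>) + (\<Sum>j\<in>UNIV. \<Sum>k\<in>UNIV. C2 * R * \<bar>ddG j k \<xi>\<bar>)"
        unfolding linear_rem_def True by (simp add: exp_Lambda_def) 
      then show ?thesis unfolding profile_def by (simp add: sum_distrib_left distrib_left)
    qed
    have "(\<integral>\<^sup>+\<xi>. ennreal ((\<rho> \<xi> powr m * \<bar>linear_rem u i \<tau> \<xi>\<bar>)\<^sup>2) \<partial>lborel)
      \<le> (\<integral>\<^sup>+\<xi>. 2 * ennreal ((\<rho> \<xi> powr m * norm (?f \<xi>))\<^sup>2) + ennreal (2 * (C2 * R)\<^sup>2) * ennreal ((\<rho> \<xi> powr m * norm (profile \<xi>))\<^sup>2) \<partial>lborel)"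
    proof (intro nn_integral_mono)
      fix \<xi>
      let ?a = "\<rho> \<xi> powr m * norm (?f \<xi>)" and ?b = "\<rho> \<xi> powr m * norm (profile \<xi>)"
      have "\<rho> \<xi> powr m * \<bar>linear_rem u i \<tau> \<xi>\<bar> \<le> \<rho> \<xi> powr m * (\<bar>u \<xi> $ i\<bar> + C2 * R * profile \<xi>)"
        by (intro mult_left_mono pt) auto
      also have "\<dots> = ?a + C2 * R * ?b" using profile_nonneg[of \<xi>] by (simp add: algebra_simps)
      finally have "(\<rho> \<xi> powr m * \<bar>linear_rem u i \<tau> \<xi>\<bar>)\<^sup>2 \<le> (?a + C2 * R * ?b)\<^sup>2" by (intro power_mono) auto
      also have "\<dots> \<le> 2 * ?a\<^sup>2 + 2 * (C2 * R * ?b)\<^sup>2"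
        using zero_le_power2[of "?a - C2 * R * ?b"] by (simp add: power2_sum power2_diff)
      also have "\<dots> = 2 * ?a\<^sup>2 + 2 * (C2 * R)\<^sup>2 * ?b\<^sup>2" by (simp only: power_mult_distrib mult_ac)
      finally have "ennreal ((\<rho> \<xi> powr m * \<bar>linear_rem u i \<tau> \<xi>\<bar>)\<^sup>2) \<le> ennreal (2 * ?a\<^sup>2 + 2 * (C2 * R)\<^sup>2 * ?b\<^sup>2)" by (rule ennreal_leI)
      also have "\<dots> = ennreal (2 * ?a\<^sup>2) + ennreal (2 * (C2 * R)\<^sup>2 * ?b\<^sup>2)" by (rule ennreal_plus) auto
      also have "ennreal (2 * ?a\<^sup>2) = ennreal 2 * ennreal (?a\<^sup>2)" by (rule ennreal_mult) auto
      also have "ennreal (2 * (C2 * R)\<^sup>2 * ?b\<^sup>2) = ennreal (2 * (C2 * R)\<^sup>2) * ennreal (?b\<^sup>2)" by (rule ennreal_mult) auto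
      finally show "ennreal ((\<rho> \<xi> powr m * \<bar>linear_rem u i \<tau> \<xi>\<bar>)\<^sup>2) \<le> 2 * ennreal (?a\<^sup>2) + ennreal (2 * (C2 * R)\<^sup>2) * ennreal (?b\<^sup>2)" by simp
    qed
    also have "\<dots> = 2 * wnorm_sq m ?f + ennreal (2 * (C2 * R)\<^sup>2) * wnorm_sq m profile"
      unfolding wnorm_sq_def by (subst nn_integral_add, measurable) (subst nn_integral_cmult, measurable, subst nn_integral_cmult, measurable)
    also have "\<dots> \<le> ennreal 2 * ennreal (R\<^sup>2) + ennreal (2 * (C2 * R)\<^sup>2) * ennreal (K\<^sup>2)"
      using fle K by (intro add_mono mult_mono) auto
    also have "\<dots> = ennreal (2 * R\<^sup>2 + 2 * (C2 * R)\<^sup>2 * K\<^sup>2)"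
      by (simp only: ennreal_mult[symmetric] zero_le_power2 ennreal_plus[symmetric] zero_le_mult_iff zero_le_numeral
         simp_thms mult_nonneg_nonneg)
    also have "\<dots> \<le> ennreal ((sqrt Q * R * exp (- \<nu> * \<tau>))\<^sup>2)"
    proof (rule ennreal_leI)
      have "2 * R\<^sup>2 + 2 * (C2 * R)\<^sup>2 * K\<^sup>2 = (2 + 2 * C2\<^sup>2 * K\<^sup>2) * R\<^sup>2" by (simp add: power_mult_distrib algebra_simps)
      also have "\<dots> \<le> Q * R\<^sup>2" using Q by (intro mult_right_mono) auto
      finally show "2 * R\<^sup>2 + 2 * (C2 * R)\<^sup>2 * K\<^sup>2 \<le> (sqrt Q * R * exp (- \<nu> * \<tau>))\<^sup>2"
        using True unfolding target by simp
    qed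
    finally show ?thesis .
  qed
  then show ?thesis by (simp only: Q_def R_def)
qed

section \<open>One component of the vorticity\<close>

lemma square_sum_five_ennreal:
  fixes a b1 b2 b3 c :: ennreal
  shows "(a + (b1 + (b2 + b3)) + c)\<^sup>2 \<le> 8 * a\<^sup>2 + 8 * b1\<^sup>2 + 8 * b2\<^sup>2 + 8 * b3\<^sup>2 + 8 * c\<^sup>2"
proof -
  have eq: "a + (b1 + (b2 + b3)) + c = (a + c) + (b1 + (b2 + b3))" by (simp only: add_ac)
  have "(a + (b1 + (b2 + b3)) + c)\<^sup>2 \<le> 2 * (a + c)\<^sup>2 + 2 * (b1 + (b2 + b3))\<^sup>2"
    unfolding eq by (rule square_add_le_ennreal)
  also have "\<dots> \<le> 2 * (2 * a\<^sup>2 + 2 * c\<^sup>2) + 2 * (2 * b1\<^sup>2 + 2 * (b2 + b3)\<^sup>2)"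
    by (intro add_mono mult_left_mono square_add_le_ennreal) auto
  also have "\<dots> \<le> 2 * (2 * a\<^sup>2 + 2 * c\<^sup>2) + 2 * (2 * b1\<^sup>2 + 2 * (2 * b2\<^sup>2 + 2 * b3\<^sup>2))"
    by (intro add_mono mult_left_mono square_add_le_ennreal order_refl) auto
  also have "\<dots> = 4 * a\<^sup>2 + 4 * b1\<^sup>2 + 8 * b2\<^sup>2 + 8 * b3\<^sup>2 + 4 * c\<^sup>2"
    by (simp add: distrib_left mult.assoc[symmetric] add_ac)
  also have "\<dots> \<le> 8 * a\<^sup>2 + 8 * b1\<^sup>2 + 8 * b2\<^sup>2 + 8 * b3\<^sup>2 + 8 * c\<^sup>2"
    by (intro add_mono mult_right_mono) auto
  finally show ?thesis .
qed

context decaying_vorticity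
begin

text \<open>The coefficients are integrals over all times, so that they do not depend on \<open>\<tau>\<close>.\<close>
definition coeff0 :: "3 \<Rightarrow> 3 \<Rightarrow> real"
  where "coeff0 i j = (LBINT s:{0..}. exp s * flux_mass i j s)"

definition coeff1 :: "3 \<Rightarrow> 3 \<Rightarrow> 3 \<Rightarrow> real"
  where "coeff1 i j k = (LBINT s:{0..}. exp (3/2 * s) * flux_moment i j k s)"

definition approx :: "3 \<Rightarrow> real \<Rightarrow> real^3 \<Rightarrow> real"
  where "approx i \<tau> \<xi> = exp (- \<tau>) * (\<Sum>j\<in>UNIV. (coeff0 i j - first_moment (w 0) i j) * dG j \<xi>)
     + exp (- (3/2) * \<tau>) * (\<Sum>j\<in>UNIV. \<Sum>k\<in>UNIV. (second_moment (w 0) i j k / 2 - coeff1 i j k) * ddG j k \<xi>)"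

lemma measurable_approx [measurable]: "approx i \<tau> \<in> borel_measurable borel"
  unfolding approx_def[abs_def] by measurable

text \<open>The integrands decay like \<open>exp (- s)\<close> and \<open>exp (- s / 2)\<close>, because the flux decays like \<open>exp (- 2 * s)\<close>.\<close>
lemma coeff_tails:
  assumes C: "flux_constant m C" and t: "0 \<le> \<tau>"
  shows "\<bar>coeff0 i j - (LBINT s:{0..\<tau>}. exp s * flux_mass i j s)\<bar> \<le> 2 * (C * B\<^sup>2) * exp (- \<tau>)"
    and "\<bar>coeff1 i j k - (LBINT s:{0..\<tau>}. exp (3/2 * s) * flux_moment i j k s)\<bar> \<le> 2 * (C * B\<^sup>2) * exp (- (1/2) * \<tau>)"
proof -
  have C0: "0 \<le> C" and Cb: "\<And>f i j. f \<in> L2w m \<Longrightarrow> (\<integral>\<^sup>+\<eta>. ennreal \<bar>\<rho> \<eta> * flux i j f \<eta>\<bar> \<partial>lborel) \<le> ennreal (C * (wnorm m f)\<^sup>2)"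
    using C by (auto simp: flux_constant_def)
  have K: "0 \<le> C * B\<^sup>2" using C0 by simp
  have b0: "\<bar>exp s * flux_mass i j s\<bar> \<le> C * B\<^sup>2 * exp (- 1 * s)" if "0 \<le> s" for s
  proof -
    have "exp s * \<bar>flux_mass i j s\<bar> \<le> exp s * (C * B\<^sup>2 * exp (- 2 * s))"
      by (intro mult_left_mono flux_moment_bounds(1)[OF Cb C0 that]) auto
    also have "\<dots> = C * B\<^sup>2 * (exp s * exp (- 2 * s))" by (simp only: mult_ac)
    also have "exp s * exp (- 2 * s) = exp (- 1 * s)" unfolding exp_add[symmetric] by simp
    finally show ?thesis by (simp add: abs_mult)
  qed
  have b1: "\<bar>exp (3/2 * s) * flux_moment i j k s\<bar> \<le> C * B\<^sup>2 * exp (- (1/2) * s)" if "0 \<le> s" for s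
  proof -
    have "exp (3/2 * s) * \<bar>flux_moment i j k s\<bar> \<le> exp (3/2 * s) * (C * B\<^sup>2 * exp (- 2 * s))"
      by (intro mult_left_mono flux_moment_bounds(2)[OF Cb C0 that]) auto
    also have "\<dots> = C * B\<^sup>2 * (exp (3/2 * s) * exp (- 2 * s))" by (simp only: mult_ac)
    also have "exp (3/2 * s) * exp (- 2 * s) = exp (- (1/2) * s)" unfolding exp_add[symmetric] by (simp add: field_simps)
    finally show ?thesis by (simp add: abs_mult)
  qed
  have c0: "continuous_on {0..} (\<lambda>s. exp s * flux_mass i j s)" by (intro continuous_intros flux_mass_continuous)
  have c1: "continuous_on {0..} (\<lambda>s. exp (3/2 * s) * flux_moment i j k s)" by (intro continuous_intros flux_moment_continuous)
  have "\<bar>coeff0 i j - (LBINT s:{0..\<tau>}. exp s * flux_mass i j s)\<bar> \<le> C * B\<^sup>2 * exp (- 1 * \<tau>) / 1"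
    unfolding coeff0_def by (rule exponential_tail_integral(2)[OF c0 b0 _ K t]) auto
  also have "\<dots> \<le> 2 * (C * B\<^sup>2) * exp (- \<tau>)" 
  proof -
    have "0 \<le> C * B\<^sup>2 * exp (- \<tau>)" by (intro mult_nonneg_nonneg K) simp
    moreover have "C * B\<^sup>2 * exp (- 1 * \<tau>) / 1 = C * B\<^sup>2 * exp (- \<tau>)" by simp
    moreover have "2 * (C * B\<^sup>2) * exp (- \<tau>) = 2 * (C * B\<^sup>2 * exp (- \<tau>))" by simp
    ultimately show ?thesis by linarith
  qed
  finally show "\<bar>coeff0 i j - (LBINT s:{0..\<tau>}. exp s * flux_mass i j s)\<bar> \<le> 2 * (C * B\<^sup>2) * exp (- \<tau>)" .
  have "\<bar>coeff1 i j k - (LBINT s:{0..\<tau>}. exp (3/2 * s) * flux_moment i j k s)\<bar> \<le> C * B\<^sup>2 * exp (- (1/2) * \<tau>) / (1/2)"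
    unfolding coeff1_def by (rule exponential_tail_integral(2)[OF c1 b1 _ K t]) auto
  then show "\<bar>coeff1 i j k - (LBINT s:{0..\<tau>}. exp (3/2 * s) * flux_moment i j k s)\<bar> \<le> 2 * (C * B\<^sup>2) * exp (- (1/2) * \<tau>)" by simp
qed

text \<open>The error made by replacing the coefficient integrals up to \<open>\<tau>\<close> by those over all times.\<close>
definition moment_tail :: "3 \<Rightarrow> real \<Rightarrow> real^3 \<Rightarrow> real"
  where "moment_tail i \<tau> \<xi> = exp (- (3/2) * \<tau>) * (\<Sum>j\<in>UNIV. \<Sum>k\<in>UNIV. (coeff1 i j k - (LBINT s:{0..\<tau>}. exp (3/2 * s) * flux_moment i j k s)) * ddG j k \<xi>)
     - exp (- \<tau>) * (\<Sum>j\<in>UNIV. (coeff0 i j - (LBINT s:{0..\<tau>}. exp s * flux_mass i j s)) * dG j \<xi>)"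

lemma moment_tail_bound:
  assumes C: "flux_constant m C" and t: "0 \<le> \<tau>"
  shows "\<bar>moment_tail i \<tau> \<xi>\<bar> \<le> 2 * (C * B\<^sup>2) * exp (- 2 * \<tau>) * profile \<xi>"
proof -
  define K where "K = 2 * (C * B\<^sup>2)"
  have e: "exp (- (3/2) * \<tau>) * exp (- (1/2) * \<tau>) = exp (- 2 * \<tau>)" "exp (- \<tau>) * exp (- \<tau>) = exp (- 2 * \<tau>)"
    unfolding exp_add[symmetric] by (simp_all add: field_simps)
  have 1: "\<bar>\<Sum>j\<in>UNIV. (coeff0 i j - (LBINT s:{0..\<tau>}. exp s * flux_mass i j s)) * dG j \<xi>\<bar> \<le> (\<Sum>j\<in>UNIV. K * exp (- \<tau>) * \<bar>dG j \<xi>\<bar>)"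
    by (rule order_trans[OF sum_abs], rule sum_mono, simp only: abs_mult K_def, intro mult_right_mono coeff_tails(1)[OF C t], simp)
  have 2: "\<bar>\<Sum>j\<in>UNIV. \<Sum>k\<in>UNIV. (coeff1 i j k - (LBINT s:{0..\<tau>}. exp (3/2 * s) * flux_moment i j k s)) * ddG j k \<xi>\<bar>
     \<le> (\<Sum>j\<in>UNIV. \<Sum>k\<in>UNIV. K * exp (- (1/2) * \<tau>) * \<bar>ddG j k \<xi>\<bar>)"
    by (rule order_trans[OF sum_abs], rule sum_mono, rule order_trans[OF sum_abs], rule sum_mono,
      simp only: abs_mult K_def, intro mult_right_mono coeff_tails(2)[OF C t], simp)
  have "\<bar>moment_tail i \<tau> \<xi>\<bar> \<le> exp (- (3/2) * \<tau>) * (\<Sum>j\<in>UNIV. \<Sum>k\<in>UNIV. K * exp (- (1/2) * \<tau>) * \<bar>ddG j k \<xi>\<bar>)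
      + exp (- \<tau>) * (\<Sum>j\<in>UNIV. K * exp (- \<tau>) * \<bar>dG j \<xi>\<bar>)"
    unfolding moment_tail_def
    by (rule order_trans[OF abs_triangle_ineq4])
      (simp only: abs_mult abs_exp_cancel, intro add_mono mult_left_mono 1 2, auto)
  also have "\<dots> = K * (exp (- (3/2) * \<tau>) * exp (- (1/2) * \<tau>)) * (\<Sum>j\<in>UNIV. \<Sum>k\<in>UNIV. \<bar>ddG j k \<xi>\<bar>)
      + K * (exp (- \<tau>) * exp (- \<tau>)) * (\<Sum>j\<in>UNIV. \<bar>dG j \<xi>\<bar>)"
    by (simp only: sum_3 distrib_left mult_ac)
  also have "\<dots> = K * exp (- 2 * \<tau>) * profile \<xi>" unfolding e profile_def by (simp only: distrib_left add.commute)
  finally show ?thesis by (simp only: K_def)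
qed

lemma duhamel_rem_slice_measurable:
  "(\<lambda>s. ennreal \<bar>duhamel_rem i j \<tau> (s, \<xi>)\<bar> * indicator {0..<\<tau>} s) \<in> borel_measurable borel"
proof -
  define E where "E p = indicator ({0..<\<tau>} \<times> UNIV) p *\<^sub>R duhamel_rem i j \<tau> p" for p
  have [measurable]: "E \<in> borel_measurable borel" unfolding E_def
    by (intro borel_measurable_continuous_on_indicator duhamel_rem_continuous)
      (simp add: borel_prod[symmetric] pair_measureI)
  have "(\<lambda>s. (s, \<xi>)) \<in> borel_measurable (borel :: real measure)" by simp
  then have [measurable]: "(\<lambda>s. E (s, \<xi>)) \<in> borel_measurable borel" by (rule measurable_compose) measurable
  have "(\<lambda>s. ennreal \<bar>E (s, \<xi>)\<bar> * indicator {0..<\<tau>} s) \<in> borel_measurable borel" by measurable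
  moreover have "ennreal \<bar>E (s, \<xi>)\<bar> * indicator {0..<\<tau>} s = ennreal \<bar>duhamel_rem i j \<tau> (s, \<xi>)\<bar> * indicator {0..<\<tau>} s" for s
    by (simp add: E_def indicator_def)
  ultimately show ?thesis by simp
qed

text \<open>The error in one component is the sum of five terms: the linear remainder, one Duhamel remainder for each \<open>j\<close>, and the tails of the
  coefficient integrals.  Each has weighted norm at most \<open>Q * exp (- \<nu> * \<tau>)\<close>, and squaring the sum costs the factor \<open>40 = 5 * 8\<close>.\<close>
lemma component_bound:
  assumes \<nu>: "3/2 < \<nu>" "\<nu> < 2"
    and Cf: "flux_constant m Cf" and C2: "moment2_constant m C2" and CL: "linear_constant m (2 * \<nu> - 1) CL"
    and CD: "duhamel_constant m (2 * \<nu> - 2) CD" and H: "time_constant (2 - \<nu>) H"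
    and K: "wnorm_sq m profile \<le> ennreal (K\<^sup>2)" "0 \<le> K"
    and z: "(LINT \<eta>|lborel. w 0 \<eta> $ i) = 0" and t: "0 \<le> \<tau>"
    and mild: "AE \<xi> in lborel. (\<forall>j. set_integrable lborel {0..\<tau>} (duhamel w i j \<tau> \<xi>)) \<and>
       w \<tau> \<xi> $ i = exp_Lambda \<tau> (\<lambda>\<eta>. w 0 \<eta> $ i) \<xi> + (\<Sum>j\<in>UNIV. LBINT s:{0..\<tau>}. duhamel w i j \<tau> \<xi> s)"
    and Q: "sqrt (CL + 2 + 2 * C2\<^sup>2 * K\<^sup>2) * wnorm m (w 0) \<le> Q" "sqrt CD * B\<^sup>2 * H \<le> Q" "2 * (Cf * B\<^sup>2) * K \<le> Q"
  shows "(\<integral>\<^sup>+\<xi>. ennreal ((\<rho> \<xi> powr m * \<bar>w \<tau> \<xi> $ i - approx i \<tau> \<xi>\<bar>)\<^sup>2) \<partial>lborel) \<le> ennreal (40 * (Q * exp (- \<nu> * \<tau>))\<^sup>2)"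
proof -
  have w0: "w 0 \<in> L2w m" by (rule L2w) simp
  note [measurable] = L2w_wnorm_sq(1)[OF w0]
  define q where "q = ennreal ((Q * exp (- \<nu> * \<tau>))\<^sup>2)"
  define Y where "Y j \<xi> = (\<integral>\<^sup>+s. ennreal (\<rho> \<xi> powr m * \<bar>duhamel_rem i j \<tau> (s, \<xi>)\<bar>) * indicator {0..<\<tau>} s \<partial>lborel)" for j \<xi>
  define L where "L \<xi> = ennreal (\<rho> \<xi> powr m * \<bar>linear_rem (w 0) i \<tau> \<xi>\<bar>)" for \<xi>
  define T where "T \<xi> = ennreal (\<rho> \<xi> powr m * (2 * (Cf * B\<^sup>2) * exp (- 2 * \<tau>) * profile \<xi>))" for \<xi>
  have Cf0: "0 \<le> Cf" using Cf by (simp add: flux_constant_def)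
  have H0: "0 \<le> H" using H by (simp add: time_constant_def)
  have Qq: "ennreal ((x * exp (- \<nu> * \<tau>))\<^sup>2) \<le> q" if "x \<le> Q" "0 \<le> x" for x
    unfolding q_def using that by (intro ennreal_leI power_mono mult_right_mono) auto
  have Ym [measurable]: "Y j \<in> borel_measurable borel" for j
    unfolding Y_def[abs_def] by (rule duhamel_rem_time_measurable)
  have Lm [measurable]: "L \<in> borel_measurable borel"
    unfolding L_def[abs_def] linear_rem_def exp_Lambda_def by measurable
  have Tm [measurable]: "T \<in> borel_measurable borel" unfolding T_def[abs_def] by measurable
  have Lb: "(\<integral>\<^sup>+\<xi>. (L \<xi>)\<^sup>2 \<partial>lborel) \<le> q"
  proof -
    have "(\<integral>\<^sup>+\<xi>. (L \<xi>)\<^sup>2 \<partial>lborel) = (\<integral>\<^sup>+\<xi>. ennreal ((\<rho> \<xi> powr m * \<bar>linear_rem (w 0) i \<tau> \<xi>\<bar>)\<^sup>2) \<partial>lborel)"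
      unfolding L_def by (intro nn_integral_cong ennreal_power) simp
    also have "\<dots> \<le> ennreal ((sqrt (CL + 2 + 2 * C2\<^sup>2 * K\<^sup>2) * wnorm m (w 0) * exp (- \<nu> * \<tau>))\<^sup>2)"
      by (rule linear_rem_bound[OF C2 CL K w0 z t])
    also have "\<dots> \<le> q"
      using CL by (intro Qq Q mult_nonneg_nonneg wnorm_nonneg) (auto simp: linear_constant_def)
    finally show ?thesis .
  qed
  have Yb: "(\<integral>\<^sup>+\<xi>. (Y j \<xi>)\<^sup>2 \<partial>lborel) \<le> q" for j
  proof -
    have "(\<integral>\<^sup>+\<xi>. (Y j \<xi>)\<^sup>2 \<partial>lborel) \<le> ennreal (((sqrt CD * B\<^sup>2) * (H * exp (- \<nu> * \<tau>)))\<^sup>2)"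
      unfolding Y_def by (rule duhamel_rem_time_bound[OF \<nu> CD H t])
    also have "(sqrt CD * B\<^sup>2) * (H * exp (- \<nu> * \<tau>)) = (sqrt CD * B\<^sup>2 * H) * exp (- \<nu> * \<tau>)" by (simp only: mult.assoc)
    also have "ennreal (\<dots>\<^sup>2) \<le> q"
      using CD H0 by (intro Qq Q) (auto simp: duhamel_constant_def)
    finally show ?thesis .
  qed
  have Tb: "(\<integral>\<^sup>+\<xi>. (T \<xi>)\<^sup>2 \<partial>lborel) \<le> q"
  proof -
    define c where "c = 2 * (Cf * B\<^sup>2) * exp (- 2 * \<tau>)"
    have c0: "0 \<le> c" using Cf0 by (simp add: c_def)
    have "(\<integral>\<^sup>+\<xi>. (T \<xi>)\<^sup>2 \<partial>lborel) = (\<integral>\<^sup>+\<xi>. ennreal (c\<^sup>2) * ennreal ((\<rho> \<xi> powr m * norm (profile \<xi>))\<^sup>2) \<partial>lborel)"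
    proof (intro nn_integral_cong)
      fix \<xi>
      have "(T \<xi>)\<^sup>2 = ennreal ((\<rho> \<xi> powr m * (c * profile \<xi>))\<^sup>2)"
        unfolding T_def c_def[symmetric] using c0 profile_nonneg[of \<xi>] by (intro ennreal_power) simp
      also have "(\<rho> \<xi> powr m * (c * profile \<xi>))\<^sup>2 = c\<^sup>2 * (\<rho> \<xi> powr m * norm (profile \<xi>))\<^sup>2"
        using profile_nonneg[of \<xi>] by (simp add: power_mult_distrib)
      also have "ennreal \<dots> = ennreal (c\<^sup>2) * ennreal ((\<rho> \<xi> powr m * norm (profile \<xi>))\<^sup>2)"
        by (rule ennreal_mult) auto
      finally show "(T \<xi>)\<^sup>2 = ennreal (c\<^sup>2) * ennreal ((\<rho> \<xi> powr m * norm (profile \<xi>))\<^sup>2)" .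
    qed
    also have "\<dots> = ennreal (c\<^sup>2) * wnorm_sq m profile" unfolding wnorm_sq_def by (rule nn_integral_cmult) measurable
    also have "\<dots> \<le> ennreal (c\<^sup>2) * ennreal (K\<^sup>2)" by (intro mult_left_mono K) auto
    also have "\<dots> = ennreal ((c * K)\<^sup>2)" by (simp add: ennreal_mult[symmetric] power_mult_distrib)
    also have "\<dots> \<le> ennreal ((2 * (Cf * B\<^sup>2) * K * exp (- \<nu> * \<tau>))\<^sup>2)"
    proof (intro ennreal_leI power_mono)
      have "exp (- 2 * \<tau>) \<le> exp (- \<nu> * \<tau>)" using \<nu> t by (simp add: mult_right_mono)
      then have "2 * (Cf * B\<^sup>2) * K * exp (- 2 * \<tau>) \<le> 2 * (Cf * B\<^sup>2) * K * exp (- \<nu> * \<tau>)"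
        using Cf0 K by (intro mult_left_mono) auto
      then show "c * K \<le> 2 * (Cf * B\<^sup>2) * K * exp (- \<nu> * \<tau>)" unfolding c_def by (simp only: mult_ac)
    qed (use c0 K in auto)
    also have "\<dots> \<le> q" using Cf0 K by (intro Qq Q) auto
    finally show ?thesis .
  qed
  have pt: "AE \<xi> in lborel. ennreal ((\<rho> \<xi> powr m * \<bar>w \<tau> \<xi> $ i - approx i \<tau> \<xi>\<bar>)\<^sup>2)
     \<le> 8 * (L \<xi>)\<^sup>2 + 8 * (Y 1 \<xi>)\<^sup>2 + 8 * (Y 2 \<xi>)\<^sup>2 + 8 * (Y 3 \<xi>)\<^sup>2 + 8 * (T \<xi>)\<^sup>2"
    using mild
  proof eventually_elim
    case (elim \<xi>)
    define N where "N j = (LBINT s:{0..\<tau>}. duhamel w i j \<tau> \<xi> s)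
      - (exp (- \<tau>) * dG j \<xi> * (LBINT s:{0..\<tau>}. exp s * flux_mass i j s)
         - exp (- (3/2) * \<tau>) * (\<Sum>k\<in>UNIV. ddG j k \<xi> * (LBINT s:{0..\<tau>}. exp (3/2 * s) * flux_moment i j k s)))" for j
    have NY: "ennreal (\<rho> \<xi> powr m * \<bar>N j\<bar>) \<le> Y j \<xi>" for j
    proof -
      have "ennreal (\<rho> \<xi> powr m * \<bar>N j\<bar>) = ennreal (\<rho> \<xi> powr m) * ennreal \<bar>N j\<bar>" by (rule ennreal_mult) auto
      also have "\<dots> \<le> ennreal (\<rho> \<xi> powr m) * (\<integral>\<^sup>+s. ennreal \<bar>duhamel_rem i j \<tau> (s, \<xi>)\<bar> * indicator {0..<\<tau>} s \<partial>lborel)"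
        unfolding N_def using elim t by (intro mult_left_mono duhamel_integral_remainder) auto
      also have "\<dots> = (\<integral>\<^sup>+s. ennreal (\<rho> \<xi> powr m) * (ennreal \<bar>duhamel_rem i j \<tau> (s, \<xi>)\<bar> * indicator {0..<\<tau>} s) \<partial>lborel)"
        by (rule nn_integral_cmult[symmetric]) (simp add: duhamel_rem_slice_measurable)
      also have "\<dots> = Y j \<xi>" unfolding Y_def by (intro nn_integral_cong) (simp add: ennreal_mult mult.assoc)
      finally show ?thesis .
    qed
    have id: "w \<tau> \<xi> $ i - approx i \<tau> \<xi> = linear_rem (w 0) i \<tau> \<xi> + (N 1 + (N 2 + N 3)) + moment_tail i \<tau> \<xi>"
      using elim unfolding linear_rem_def approx_def N_def moment_tail_def sum_3 by (simp add: algebra_simps)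
    let ?r = "\<rho> \<xi> powr m"
    have "?r * \<bar>w \<tau> \<xi> $ i - approx i \<tau> \<xi>\<bar>
      \<le> ?r * (\<bar>linear_rem (w 0) i \<tau> \<xi>\<bar> + (\<bar>N 1\<bar> + (\<bar>N 2\<bar> + \<bar>N 3\<bar>)) + 2 * (Cf * B\<^sup>2) * exp (- 2 * \<tau>) * profile \<xi>)"
      unfolding id using moment_tail_bound[OF Cf t, of i \<xi>] by (intro mult_left_mono, linarith, simp)
    also have "\<dots> = ?r * \<bar>linear_rem (w 0) i \<tau> \<xi>\<bar> + (?r * \<bar>N 1\<bar> + (?r * \<bar>N 2\<bar> + ?r * \<bar>N 3\<bar>)) + ?r * (2 * (Cf * B\<^sup>2) * exp (- 2 * \<tau>) * profile \<xi>)"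
      by (simp only: distrib_left)
    finally have "ennreal (?r * \<bar>w \<tau> \<xi> $ i - approx i \<tau> \<xi>\<bar>) \<le> ennreal (\<dots>)" by (rule ennreal_leI)
    also have "\<dots> = L \<xi> + (ennreal (?r * \<bar>N 1\<bar>) + (ennreal (?r * \<bar>N 2\<bar>) + ennreal (?r * \<bar>N 3\<bar>))) + T \<xi>"
      unfolding L_def T_def using Cf0 profile_nonneg[of \<xi>] by (simp add: ennreal_plus)
    also have "\<dots> \<le> L \<xi> + (Y 1 \<xi> + (Y 2 \<xi> + Y 3 \<xi>)) + T \<xi>"
      by (intro add_mono NY order_refl)
    finally have "(ennreal (?r * \<bar>w \<tau> \<xi> $ i - approx i \<tau> \<xi>\<bar>))\<^sup>2 \<le> (L \<xi> + (Y 1 \<xi> + (Y 2 \<xi> + Y 3 \<xi>)) + T \<xi>)\<^sup>2"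
      by (intro power_mono) auto
    also have "\<dots> \<le> 8 * (L \<xi>)\<^sup>2 + 8 * (Y 1 \<xi>)\<^sup>2 + 8 * (Y 2 \<xi>)\<^sup>2 + 8 * (Y 3 \<xi>)\<^sup>2 + 8 * (T \<xi>)\<^sup>2"
      by (rule square_sum_five_ennreal)
    finally show ?case by (subst ennreal_power[symmetric]) auto
  qed
  have "(\<integral>\<^sup>+\<xi>. ennreal ((\<rho> \<xi> powr m * \<bar>w \<tau> \<xi> $ i - approx i \<tau> \<xi>\<bar>)\<^sup>2) \<partial>lborel)
    \<le> (\<integral>\<^sup>+\<xi>. 8 * (L \<xi>)\<^sup>2 + 8 * (Y 1 \<xi>)\<^sup>2 + 8 * (Y 2 \<xi>)\<^sup>2 + 8 * (Y 3 \<xi>)\<^sup>2 + 8 * (T \<xi>)\<^sup>2 \<partial>lborel)"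
    by (rule nn_integral_mono_AE[OF pt])
  also have "\<dots> = 8 * (\<integral>\<^sup>+\<xi>. (L \<xi>)\<^sup>2 \<partial>lborel) + 8 * (\<integral>\<^sup>+\<xi>. (Y 1 \<xi>)\<^sup>2 \<partial>lborel) + 8 * (\<integral>\<^sup>+\<xi>. (Y 2 \<xi>)\<^sup>2 \<partial>lborel)
      + 8 * (\<integral>\<^sup>+\<xi>. (Y 3 \<xi>)\<^sup>2 \<partial>lborel) + 8 * (\<integral>\<^sup>+\<xi>. (T \<xi>)\<^sup>2 \<partial>lborel)"
    by (simp add: nn_integral_add nn_integral_cmult)
  also have "\<dots> \<le> 8 * q + 8 * q + 8 * q + 8 * q + 8 * q"
    by (intro add_mono mult_left_mono Lb Yb Tb) auto
  also have "\<dots> = 40 * q" by (simp flip: distrib_right)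
  also have "\<dots> = ennreal 40 * q" by simp
  also have "\<dots> = ennreal (40 * (Q * exp (- \<nu> * \<tau>))\<^sup>2)" unfolding q_def by (rule ennreal_mult[symmetric]) auto
  finally show ?thesis .
qed

lemma flux_antisym: "flux j i u \<eta> = - flux i j u \<eta>"
  by (simp add: flux_def algebra_simps)

lemma coeff0_antisym: "coeff0 j i = - coeff0 i j"
proof -
  have "flux_mass j i s = - flux_mass i j s" for s
  proof -
    have "(LINT \<eta>|lborel. flux j i (w s) \<eta>) = (LINT \<eta>|lborel. - flux i j (w s) \<eta>)"
      by (intro Bochner_Integration.integral_cong refl flux_antisym)
    then show ?thesis by (simp add: flux_mass_def)
  qed
  then show ?thesis unfolding coeff0_def set_lebesgue_integral_def by simp
qed

lemma coeff1_antisym: "coeff1 j i k = - coeff1 i j k"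
proof -
  have "flux_moment j i k s = - flux_moment i j k s" for s
  proof -
    have "(LINT \<eta>|lborel. \<eta> $ k * flux j i (w s) \<eta>) = (LINT \<eta>|lborel. - (\<eta> $ k * flux i j (w s) \<eta>))"
      by (intro Bochner_Integration.integral_cong refl) (simp add: flux_antisym[of j i])
    then show ?thesis by (simp add: flux_moment_def)
  qed
  then show ?thesis unfolding coeff1_def set_lebesgue_integral_def by simp
qed

end

section \<open>The asymptotic expansion\<close>

lemma wnorm_sq_cong_AE:
  assumes "AE \<xi> in lborel. f \<xi> = g \<xi>" shows "wnorm_sq m f = wnorm_sq m g"
  unfolding wnorm_sq_def by (rule nn_integral_cong_AE) (use assms in auto)

lemma wnorm_cong_AE:
  assumes "f \<in> L2w m" "g \<in> L2w m" "AE \<xi> in lborel. f \<xi> = g \<xi>" shows "wnorm m f = wnorm m g"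
proof -
  have "ennreal ((wnorm m f)\<^sup>2) = ennreal ((wnorm m g)\<^sup>2)"
    using wnorm_sq_cong_AE[OF assms(3), of m] L2w_wnorm_sq(2)[OF assms(1)] L2w_wnorm_sq(2)[OF assms(2)] by simp
  then have "(wnorm m f)\<^sup>2 = (wnorm m g)\<^sup>2" by simp
  then show ?thesis using wnorm_nonneg[of m f] wnorm_nonneg[of m g] by (simp add: power2_eq_iff_nonneg)
qed

lemma wnorm_sq_components:
  fixes f :: "real^3 \<Rightarrow> real^3"
  assumes [measurable]: "\<And>i. (\<lambda>\<xi>. f \<xi> $ i) \<in> borel_measurable borel"
  shows "wnorm_sq m f = (\<Sum>i\<in>UNIV. \<integral>\<^sup>+\<xi>. ennreal ((\<rho> \<xi> powr m * \<bar>f \<xi> $ i\<bar>)\<^sup>2) \<partial>lborel)"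
proof -
  have "wnorm_sq m f = (\<integral>\<^sup>+\<xi>. (\<Sum>i\<in>UNIV. ennreal ((\<rho> \<xi> powr m * \<bar>f \<xi> $ i\<bar>)\<^sup>2)) \<partial>lborel)"
    unfolding wnorm_sq_def
  proof (intro nn_integral_cong)
    fix \<xi>
    have "(\<rho> \<xi> powr m * norm (f \<xi>))\<^sup>2 = (\<Sum>i\<in>UNIV. (\<rho> \<xi> powr m * \<bar>f \<xi> $ i\<bar>)\<^sup>2)"
      by (simp only: power_mult_distrib norm_sq_vec3 sum_distrib_left power2_abs) (simp add: power2_eq_square)
    then show "ennreal ((\<rho> \<xi> powr m * norm (f \<xi>))\<^sup>2) = (\<Sum>i\<in>UNIV. ennreal ((\<rho> \<xi> powr m * \<bar>f \<xi> $ i\<bar>)\<^sup>2))"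
      by (simp add: sum_ennreal)
  qed
  also have "\<dots> = (\<Sum>i\<in>UNIV. \<integral>\<^sup>+\<xi>. ennreal ((\<rho> \<xi> powr m * \<bar>f \<xi> $ i\<bar>)\<^sup>2) \<partial>lborel)"
    by (rule nn_integral_sum) measurable
  finally show ?thesis .
qed

text \<open>With finite second moments the integrals of sums split, which turns the orthogonality relations into linear relations between moments.\<close>
lemma init_symmetries:
  assumes C: "moment2_constant m C" and u: "u \<in> L2w m" and d: "div_free u"
  shows "(LINT \<eta>|lborel. u \<eta> $ i) = 0"
    and "first_moment u i j + first_moment u j i = 0"
    and "second_moment u i j k + second_moment u j i k + second_moment u k i j = 0"
    and "second_moment u i j k = second_moment u i k j"
proof -
  note um = L2w_wnorm_sq(1)[OF u]
  note mo = div_free_moments[OF d um init_integrable(1)[OF C u]]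
  have i1: "integrable lborel (\<lambda>\<eta>. \<eta> $ k * u \<eta> $ i)" for k i
    by (rule init_weighted_integrable(1)[OF C u]) (auto intro: comp_le_rho_sq)
  have i2: "integrable lborel (\<lambda>\<eta>. \<eta> $ k * \<eta> $ l * u \<eta> $ i)" for k l i
    by (rule init_weighted_integrable(1)[OF C u]) (auto intro: comp2_le_rho_sq simp flip: abs_mult)
  show "(LINT \<eta>|lborel. u \<eta> $ i) = 0" by (rule mo(1))
  show "first_moment u i j + first_moment u j i = 0"
    using mo(2)[of i j] i1 by (simp add: first_moment_def)
  show "second_moment u i j k + second_moment u j i k + second_moment u k i j = 0"
    using mo(3)[of i j k] i2 by (simp add: second_moment_def)
  show "second_moment u i j k = second_moment u i k j"
    unfolding second_moment_def by (simp only: mult.commute mult.left_commute)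
qed

theorem theorem4p2:
  fixes \<nu> m r0 K0 :: real
  assumes "3/2 < \<nu>" and "\<nu> < 2" and "m > 2 * \<nu> + 1/2"
    and "global_constants m r0 K0"
  shows "\<exists>K5>0. \<forall>w0 \<in> L2w_sol m. wnorm m w0 \<le> r0 \<longrightarrow>
    (\<exists>(b :: 3 \<Rightarrow> real) (c :: 3 \<Rightarrow> real) (d :: 3 \<Rightarrow> 3 \<Rightarrow> real).
      \<forall>w. solution_from m w0 w \<longrightarrow>
        (\<forall>\<tau>\<ge>0. wnorm m (\<lambda>\<xi>. w \<tau> \<xi> - w_app b c d \<tau> \<xi>) \<le> K5 * exp (- \<nu> * \<tau>) * wnorm m w0))"
proof -
  note \<nu> = assms(1,2)
  have m: "5/2 < m" "7/2 < m" "0 \<le> m" using assms(1,3) by auto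
  obtain Cf where Cf: "flux_constant m Cf"
    using flux_L1_bounds[OF m(1)] unfolding flux_constant_def by blast
  obtain C2 where C2: "moment2_constant m C2" using moment2_constant_exists[OF m(2)] by blast
  obtain CL where CL: "linear_constant m (2 * \<nu> - 1) CL"
  proof -
    have "2 \<le> 2 * \<nu> - 1" "2 * \<nu> - 1 \<le> 3" "3 < 2 * (m - (2 * \<nu> - 1))" using assms(1-3) by auto
    from linear_expansion_bound[OF this] show ?thesis using that unfolding linear_constant_def by blast
  qed
  obtain CD where CD: "duhamel_constant m (2 * \<nu> - 2) CD"
  proof -
    have "1 \<le> 2 * \<nu> - 2" "2 * \<nu> - 2 \<le> 2" "3 < 2 * (m - (2 * \<nu> - 2))" using assms(1-3) by auto
    from duhamel_expansion_bound[OF this] show ?thesis using that unfolding duhamel_constant_def by blast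
  qed
  obtain H where H: "time_constant (2 - \<nu>) H"
    using time_weight_integral[of "2 - \<nu>"] \<nu> unfolding time_constant_def by auto
  obtain K where K: "wnorm_sq m profile \<le> ennreal (K\<^sup>2)" "0 \<le> K"
    using profile_wnorm_sq_finite[OF m(3)] by blast
  have nn: "0 \<le> Cf" "0 \<le> C2" "0 \<le> CL" "0 \<le> CD" "0 \<le> H"
    using Cf C2 CL CD H by (auto simp: flux_constant_def moment2_constant_def linear_constant_def duhamel_constant_def time_constant_def)
  have r0: "0 < r0" and K0: "1 \<le> K0" using assms(4) by (auto simp: global_constants_def)
  \<comment> \<open>linear remainder, Duhamel remainders and tails, each relative to \<open>wnorm m w0\<close>\<close>
  define q1 where "q1 = sqrt (CL + 2 + 2 * C2\<^sup>2 * K\<^sup>2)"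
  define q2 where "q2 = sqrt CD * H * K0\<^sup>2 * r0"
  define q3 where "q3 = 2 * Cf * K * K0\<^sup>2 * r0"
  define q where "q = q1 + q2 + q3"
  have qn: "0 < q1" "0 \<le> q2" "0 \<le> q3"
  proof -
    have "0 \<le> 2 * C2\<^sup>2 * K\<^sup>2" by simp
    then have "0 < CL + 2 + 2 * C2\<^sup>2 * K\<^sup>2" using nn(3) by linarith
    then show "0 < q1" unfolding q1_def by (rule real_sqrt_gt_zero)
    show "0 \<le> q2" "0 \<le> q3" using nn K r0 by (auto simp: q2_def q3_def)
  qed
  have "\<exists>(b :: 3 \<Rightarrow> real) (c :: 3 \<Rightarrow> real) (d :: 3 \<Rightarrow> 3 \<Rightarrow> real).
      \<forall>w. solution_from m w0 w \<longrightarrow>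
        (\<forall>\<tau>\<ge>0. wnorm m (\<lambda>\<xi>. w \<tau> \<xi> - w_app b c d \<tau> \<xi>) \<le> 11 * q * exp (- \<nu> * \<tau>) * wnorm m w0)"
    if w0: "w0 \<in> L2w_sol m" and small: "wnorm m w0 \<le> r0" for w0
  proof -
    define R where "R = wnorm m w0"
    have R: "0 \<le> R" "R \<le> r0" using small by (auto simp: R_def wnorm_nonneg)
    obtain w where sol: "solution_from m w0 w"
      and uniq: "\<And>w'. solution_from m w0 w' \<Longrightarrow> \<forall>\<tau>\<ge>0. AE \<xi> in lborel. w' \<tau> \<xi> = w \<tau> \<xi>"
      and dec: "\<And>\<tau>. 0 \<le> \<tau> \<Longrightarrow> wnorm m (w \<tau>) \<le> K0 * exp (- \<tau>) * wnorm m w0"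
      using assms(4) w0 small unfolding global_constants_def by blast
    have mild: "mild_solution m w" and ic: "AE \<xi> in lborel. w 0 \<xi> = w0 \<xi>"
      using sol by (auto simp: solution_from_def)
    interpret decaying_vorticity m "K0 * R" w
    proof
      show "5/2 < m" by (rule m(1))
      show "0 \<le> K0 * R" using K0 R by simp
      show "w s \<in> L2w m" if "0 \<le> s" for s
        using mild that by (simp add: mild_solution_def L2w_sol_def)
      show "((\<lambda>\<sigma>. wnorm m (\<lambda>\<xi>. w \<sigma> \<xi> - w s \<xi>)) \<longlongrightarrow> 0) (at s within {0..})" if "0 \<le> s" for s
        using mild that by (simp add: mild_solution_def)
      show "wnorm m (w s) \<le> K0 * R * exp (- s)" if "0 \<le> s" for s
        using dec[OF that] by (simp add: R_def mult_ac)
    qed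
    have u: "w 0 \<in> L2w m" "div_free (w 0)"
      using mild by (auto simp: mild_solution_def L2w_sol_def)
    have R0: "wnorm m (w 0) = R"
      unfolding R_def using w0 by (intro wnorm_cong_AE u ic) (simp add: L2w_sol_def)
    note sym = init_symmetries[OF C2 u]
    obtain b c d where app: "\<And>\<tau> \<xi> i. w_app b c d \<tau> \<xi> $ i = approx i \<tau> \<xi>"
    proof -
      have "\<exists>b c d. \<forall>\<tau> \<xi> i. w_app b c d \<tau> \<xi> $ i
        = exp (- \<tau>) * (\<Sum>j\<in>UNIV. (coeff0 i j - first_moment (w 0) i j) * dG j \<xi>)
          + exp (- (3/2) * \<tau>) * (\<Sum>j\<in>UNIV. \<Sum>k\<in>UNIV. (second_moment (w 0) i j k / 2 - coeff1 i j k) * ddG j k \<xi>)"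
      proof (rule w_app_coefficients_exist)
        show "coeff0 i j - first_moment (w 0) i j + (coeff0 j i - first_moment (w 0) j i) = 0" for i j
          using coeff0_antisym[of j i] sym(2)[of i j] by simp
        fix i j k
        show "second_moment (w 0) i j k / 2 - coeff1 i j k + (second_moment (w 0) i k j / 2 - coeff1 i k j)
          + (second_moment (w 0) j i k / 2 - coeff1 j i k) + (second_moment (w 0) j k i / 2 - coeff1 j k i)
          + (second_moment (w 0) k i j / 2 - coeff1 k i j) + (second_moment (w 0) k j i / 2 - coeff1 k j i) = 0"
          using coeff1_antisym[of j i k] coeff1_antisym[of k i j] coeff1_antisym[of k j i] sym(3)[of i j k]
            sym(4)[of i j k] sym(4)[of j i k] sym(4)[of k i j] by simp
      qed
      then show ?thesis using that unfolding approx_def by blast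
    qed
    have qR: "sqrt (CL + 2 + 2 * C2\<^sup>2 * K\<^sup>2) * wnorm m (w 0) \<le> q * R" "sqrt CD * (K0 * R)\<^sup>2 * H \<le> q * R"
      "2 * (Cf * (K0 * R)\<^sup>2) * K \<le> q * R"
    proof -
      \<comment> \<open>the quadratic contributions become linear in the size of the data because the data are bounded by \<open>r0\<close>\<close>
      have RR: "R * R \<le> r0 * R" using R by (intro mult_right_mono) auto
      show "sqrt (CL + 2 + 2 * C2\<^sup>2 * K\<^sup>2) * wnorm m (w 0) \<le> q * R"
        unfolding R0 q1_def[symmetric] using qn R by (intro mult_right_mono) (auto simp: q_def)
      have "sqrt CD * (K0 * R)\<^sup>2 * H = (sqrt CD * H * K0\<^sup>2) * (R * R)" by (simp only: power2_eq_square mult_ac)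
      also have "\<dots> \<le> (sqrt CD * H * K0\<^sup>2) * (r0 * R)" using RR nn by (intro mult_left_mono) auto
      also have "\<dots> = q2 * R" by (simp only: q2_def mult_ac)
      also have "\<dots> \<le> q * R" using qn R by (intro mult_right_mono) (auto simp: q_def)
      finally show "sqrt CD * (K0 * R)\<^sup>2 * H \<le> q * R" .
      have "2 * (Cf * (K0 * R)\<^sup>2) * K = (2 * Cf * K * K0\<^sup>2) * (R * R)" by (simp only: power2_eq_square mult_ac)
      also have "\<dots> \<le> (2 * Cf * K * K0\<^sup>2) * (r0 * R)" using RR nn K by (intro mult_left_mono) auto
      also have "\<dots> = q3 * R" by (simp only: q3_def mult_ac)
      also have "\<dots> \<le> q * R" using qn R by (intro mult_right_mono) (auto simp: q_def)
      finally show "2 * (Cf * (K0 * R)\<^sup>2) * K \<le> q * R" .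
    qed
    have main: "wnorm_sq m (\<lambda>\<xi>. w \<tau> \<xi> - w_app b c d \<tau> \<xi>) \<le> ennreal ((11 * q * exp (- \<nu> * \<tau>) * R)\<^sup>2)" if t: "0 \<le> \<tau>" for \<tau>
    proof -
      note [measurable] = w_measurable[OF t]
      have comp: "(\<integral>\<^sup>+\<xi>. ennreal ((\<rho> \<xi> powr m * \<bar>w \<tau> \<xi> $ i - approx i \<tau> \<xi>\<bar>)\<^sup>2) \<partial>lborel) \<le> ennreal (40 * (q * R * exp (- \<nu> * \<tau>))\<^sup>2)" for i
      proof (rule component_bound[OF \<nu> Cf C2 CL CD H K sym(1) t _ qR])
        show "AE \<xi> in lborel. (\<forall>j. set_integrable lborel {0..\<tau>} (duhamel w i j \<tau> \<xi>)) \<and>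
          w \<tau> \<xi> $ i = exp_Lambda \<tau> (\<lambda>\<eta>. w 0 \<eta> $ i) \<xi> + (\<Sum>j\<in>UNIV. LBINT s:{0..\<tau>}. duhamel w i j \<tau> \<xi> s)"
          using mild t unfolding mild_solution_def by blast
      qed
      have "wnorm_sq m (\<lambda>\<xi>. w \<tau> \<xi> - w_app b c d \<tau> \<xi>)
        = (\<Sum>i\<in>UNIV. \<integral>\<^sup>+\<xi>. ennreal ((\<rho> \<xi> powr m * \<bar>(w \<tau> \<xi> - w_app b c d \<tau> \<xi>) $ i\<bar>)\<^sup>2) \<partial>lborel)"
      proof (rule wnorm_sq_components)
        show "(\<lambda>\<xi>. (w \<tau> \<xi> - w_app b c d \<tau> \<xi>) $ i) \<in> borel_measurable borel" for i
          unfolding vector_minus_component app by measurable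
      qed
      also have "\<dots> \<le> (\<Sum>i\<in>(UNIV::3 set). ennreal (40 * (q * R * exp (- \<nu> * \<tau>))\<^sup>2))"
        unfolding vector_minus_component app by (intro sum_mono comp)
      also have "\<dots> = ennreal (\<Sum>i\<in>(UNIV::3 set). 40 * (q * R * exp (- \<nu> * \<tau>))\<^sup>2)"
        by (rule sum_ennreal) simp
      also have "\<dots> \<le> ennreal ((11 * q * exp (- \<nu> * \<tau>) * R)\<^sup>2)"
      proof (rule ennreal_leI)
        have "(\<Sum>i\<in>(UNIV::3 set). 40 * (q * R * exp (- \<nu> * \<tau>))\<^sup>2) = 120 * (q * R * exp (- \<nu> * \<tau>))\<^sup>2"
          by (simp add: sum_3)
        \<comment> \<open>three components at \<open>40\<close> each, and \<open>121 = 11\<^sup>2\<close>\<close>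
        also have "\<dots> \<le> 121 * (q * R * exp (- \<nu> * \<tau>))\<^sup>2" by (intro mult_right_mono) auto
        also have "\<dots> = (11 * q * exp (- \<nu> * \<tau>) * R)\<^sup>2" by (simp add: power_mult_distrib mult_ac)
        finally show "(\<Sum>i\<in>(UNIV::3 set). 40 * (q * R * exp (- \<nu> * \<tau>))\<^sup>2) \<le> (11 * q * exp (- \<nu> * \<tau>) * R)\<^sup>2" .
      qed
      finally show ?thesis .
    qed
    \<comment> \<open>the coefficients were computed from \<open>w\<close>; any other solution agrees with it almost everywhere\<close>
    have "wnorm m (\<lambda>\<xi>. w' \<tau> \<xi> - w_app b c d \<tau> \<xi>) \<le> 11 * q * exp (- \<nu> * \<tau>) * wnorm m w0"
      if w': "solution_from m w0 w'" and t: "0 \<le> \<tau>" for w' \<tau>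
    proof (rule wnorm_le)
      have "AE \<xi> in lborel. w' \<tau> \<xi> = w \<tau> \<xi>" using uniq[OF w'] t by blast
      then have "wnorm_sq m (\<lambda>\<xi>. w' \<tau> \<xi> - w_app b c d \<tau> \<xi>) = wnorm_sq m (\<lambda>\<xi>. w \<tau> \<xi> - w_app b c d \<tau> \<xi>)"
        by (intro wnorm_sq_cong_AE) auto
      then show "wnorm_sq m (\<lambda>\<xi>. w' \<tau> \<xi> - w_app b c d \<tau> \<xi>) \<le> ennreal ((11 * q * exp (- \<nu> * \<tau>) * wnorm m w0)\<^sup>2)"
        using main[OF t] by (simp add: R_def)
      show "0 \<le> 11 * q * exp (- \<nu> * \<tau>) * wnorm m w0" using qn by (simp add: q_def wnorm_nonneg)
    qed
    then show ?thesis by blast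
  qed
  moreover have "0 < 11 * q" using qn by (simp add: q_def)
  ultimately show ?thesis by blast
qed

end
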